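(* Assume that $p>2$. Let $\mathfrak{g}=\mathfrak{sl}(n,k)$ endowed with the representation of $\operatorname{SL}(n,\mathcal{O})$ obtained by composing the projection of $\operatorname{SL}(n,\mathcal{O})$ on $\operatorname{SL}(n,k)$ with the adjoint representation. Let $\mathfrak{g}^{[p^s]}$, $s>0$, denote the $s$-th Frobenius twist of the representation $\mathfrak{g}$. Then the sequence of restricted Lie algebras $\mathfrak{wsl}(n,\mathcal{O})=\boldsymbol{\gamma}_0\supseteq\boldsymbol{\gamma}_1\supseteq\cdots\supseteq\boldsymbol{\gamma}_j\supseteq\cdots$ is an exhaustive decreasing filtration of $\mathfrak{wsl}(n,\mathcal{O})$ by ideals and a basis of neighborhoods of $0$ in a separated complete topology on $\mathfrak{wsl}(n,\mathcal{O})$. Furthermore: 1. The associated graded of $\mathfrak{wsl}(n,\mathcal{O})$ in this filtration, as a representation of $\operatorname{SL}(n,\mathcal{O})$, is $\mathfrak{g}\oplus\coprod_{j\ge1}\mathfrak{g}^{[p^j]}$. 2. $[\mathfrak{wsl}(n,\mathcal{O}),\boldsymbol{\gamma}_j]=(0)$ for all $j\ge1$. 3. $\mathfrak{g}_0\simeq\mathfrak{g}$ as an unrestricted Lie algebra and as a representation. 4. The $T_k$-weight of $\mathfrak{h}$ and of the $Y_{i,j}$ is $0$. 5. The $T_k$-weight of $X_\alpha^{j}$ is $p^j\alpha$.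
   Context: Let $p$ be a prime, $k$ the algebraic closure of $\mathbb{F}_p$, $\mathcal{O}=W(k)$, $n\ge 2$. $\operatorname{SL}(n,\mathcal{O})=\varprojlim_m\operatorname{SL}(n,\mathcal{O}/p^m\mathcal{O})$ is viewed as a proalgebraic $k$-group (each $\mathcal{O}/p^m\mathcal{O}$ being the $k$-ring scheme of length-$m$ Witt vectors). For a (pro)algebraic $k$-group $G$, $\mathfrak{L}(G)$ is its restricted Lie algebra over $k$ (inverse limit in the proalgebraic case), with $p$-th power $x\mapsto x^{[p]}$. Put $\mathfrak{wsl}(n,\mathcal{O})=\mathfrak{L}(\operatorname{SL}(n,\mathcal{O}))$. For $j\ge0$ let $\Gamma_j\subseteq\operatorname{SL}(n,\mathcal{O})$ be the group of matrices congruent to $I_n$ modulo $p^j$ (so $\Gamma_0=\operatorname{SL}(n,\mathcal{O})$) and $\boldsymbol{\gamma}_j=\mathfrak{L}(\Gamma_j)$. $\operatorname{SL}(n,\mathcal{O})$ acts on $\mathfrak{wsl}(n,\mathcal{O})$ by the adjoint representation. The $\nu$-th Frobenius twist $V^{[p^\nu]}$ of a representation $V$ is the representation on $V$ whose matrices have as entries the $p^\nu$-th powers of the entries of the matrices of the given representation. $T(\mathcal{O})$ is the group of diagonal matrices in $\operatorname{SL}(n,\mathcal{O})$, $A_1=p\mathcal{O}$ is the additive proalgebraic group of Witt vectors congruent to $0$ mod $p$, and $T(\mathcal{O})=T_k\times A_1^{n-1}$, where $T_k$ is the split $(n-1)$-dimensional $k$-torus of diagonal matrices with multiplicative (Teichmüller)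 representatives as entries (the $A_1$ factors arising via the $p$-adic logarithm on units congruent to $1$ mod $p$). $\mathfrak{h}=\mathfrak{L}(T_k)$, and $\mathfrak{L}(A_1^{n-1})=\prod_{1\le i\le n-1,\,j>0}kY_{i,j}$ with $Y_{i,j}^{[p]}=Y_{i,j+1}$. Let $\Phi$ be the root system of $\operatorname{SL}(n)$ and $U_\alpha$ the root subgroup scheme of $\alpha\in\Phi$. $X_\alpha$ spans the unique $T_k$-stable complement (a line, of weight $\alpha$) of $(\mathfrak{L}(U_\alpha(\mathcal{O})))^{[p]}$ in $\mathfrak{L}(U_\alpha(\mathcal{O}))$, normalized so as to map to the standard root vector of $\mathfrak{sl}(n,k)$; $X_\alpha^{j}=X_\alpha^{[p^j]}$, and $\mathfrak{L}(U_\alpha(\mathcal{O}))=\prod_{j\ge0}kX_\alpha^{j}$. Finally $\mathfrak{g}_0=\mathfrak{h}\oplus\coprod_{\alpha\in\Phi}kX_\alpha\subseteq\mathfrak{wsl}(n,\mathcal{O})$, a (not necessarily restricted) Lie subalgebra mapping isomorphically onto $\mathfrak{sl}(n,k)$ under the map induced by $\mathcal{O}\to k$.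
   Formalization: In 3, 𝔤_0 with 𝔥 = 𝔏(T_k) is not closed under the bracket, so there 𝔥 is replaced by the span of the brackets [X_α, X_{-α}]; for the original 𝔤_0 only a T_k-equivariant linear isomorphism onto 𝔰𝔩(n,k) is shown. *)

theory Defs
  imports "HOL-Analysis.Analysis" "HOL-Algebra.Algebraic_Closure_Type" "HOL-Library.Poly_Mapping"
    "HOL-Library.Function_Algebras" "Berlekamp_Zassenhaus.Finite_Field"
begin

section \<open>Witt vectors\<close>

type_synonym wpoly = "(nat \<times> nat \<Rightarrow>\<^sub>0 nat) \<Rightarrow>\<^sub>0 int"

definition wvar :: "nat \<Rightarrow> nat \<Rightarrow> wpoly" where
  "wvar c i = Poly_Mapping.single (Poly_Mapping.single (c, i) 1) 1"

definition mon_eval :: "(nat \<Rightarrow> nat \<Rightarrow> 'a::comm_ring_1) \<Rightarrow> (nat \<times> nat \<Rightarrow>\<^sub>0 nat) \<Rightarrow> 'a" where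
  "mon_eval x m = (\<Prod>(c, i)\<in>Poly_Mapping.keys m. x c i ^ Poly_Mapping.lookup m (c, i))"

definition weval :: "(nat \<Rightarrow> nat \<Rightarrow> 'a::comm_ring_1) \<Rightarrow> wpoly \<Rightarrow> 'a" where
  "weval x P = (\<Sum>m\<in>Poly_Mapping.keys P. of_int (Poly_Mapping.lookup P m) * mon_eval x m)"

text \<open>The \<open>n\<close>-th Witt polynomial (ghost component), and the integral polynomials that
  express the ring operations on Witt vectors.  The variable \<open>wvar c i\<close> stands for the
  \<open>i\<close>-th component of the \<open>c\<close>-th argument.  That the descriptions below are well defined is
  \<open>dwork\<close>, used in \<open>ghost_wadd_poly\<close> etc.\<close>

definition ghost :: "nat \<Rightarrow> nat \<Rightarrow> (nat \<Rightarrow> 'a::comm_semiring_1) \<Rightarrow> 'a" where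
  "ghost p n a = (\<Sum>i\<le>n. of_nat p ^ i * a i ^ (p ^ (n - i)))"

definition wadd_poly :: "nat \<Rightarrow> nat \<Rightarrow> wpoly" where
  "wadd_poly p = (THE S. \<forall>n. ghost p n S = ghost p n (wvar 0) + ghost p n (wvar 1))"

definition wmult_poly :: "nat \<Rightarrow> nat \<Rightarrow> wpoly" where
  "wmult_poly p = (THE S. \<forall>n. ghost p n S = ghost p n (wvar 0) * ghost p n (wvar 1))"

definition wneg_poly :: "nat \<Rightarrow> nat \<Rightarrow> wpoly" where
  "wneg_poly p = (THE S. \<forall>n. ghost p n S = - ghost p n (wvar 0))"

subsection \<open>Evaluation is a ring homomorphism\<close>

lemma mon_eval_superset:
  assumes "finite S" "Poly_Mapping.keys m \<subseteq> S"
  shows "mon_eval x m = (\<Prod>(c, i)\<in>S. x c i ^ Poly_Mapping.lookup m (c, i))"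
  unfolding mon_eval_def using assms
  by (intro prod.mono_neutral_left) (auto simp: in_keys_iff)

lemma mon_eval_0 [simp]: "mon_eval x 0 = 1"
  by (simp add: mon_eval_def)

lemma mon_eval_add: "mon_eval x (m + n) = mon_eval x m * mon_eval x n"
proof -
  let ?S = "Poly_Mapping.keys m \<union> Poly_Mapping.keys n"
  have "mon_eval x (m + n) = (\<Prod>(c, i)\<in>?S. x c i ^ Poly_Mapping.lookup (m + n) (c, i))"
    by (intro mon_eval_superset) (auto dest: subsetD[OF Poly_Mapping.keys_add])
  also have "\<dots> = (\<Prod>(c, i)\<in>?S. x c i ^ Poly_Mapping.lookup m (c, i)) *
      (\<Prod>(c, i)\<in>?S. x c i ^ Poly_Mapping.lookup n (c, i))"
    by (simp add: lookup_add power_add prod.distrib case_prod_unfold)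
  also have "\<dots> = mon_eval x m * mon_eval x n"
    by (subst (1 2) mon_eval_superset[of ?S]) auto
  finally show ?thesis .
qed

lemma weval_superset:
  assumes "finite S" "Poly_Mapping.keys P \<subseteq> S"
  shows "weval x P = (\<Sum>m\<in>S. of_int (Poly_Mapping.lookup P m) * mon_eval x m)"
  unfolding weval_def using assms
  by (intro sum.mono_neutral_left) (auto simp: in_keys_iff)

lemma weval_0 [simp]: "weval x 0 = 0"
  by (simp add: weval_def)

lemma weval_add: "weval x (P + Q) = weval x P + weval x Q"
proof -
  let ?S = "Poly_Mapping.keys P \<union> Poly_Mapping.keys Q"
  have "weval x (P + Q) = (\<Sum>m\<in>?S. of_int (Poly_Mapping.lookup (P + Q) m) * mon_eval x m)"
    by (intro weval_superset) (auto dest: subsetD[OF Poly_Mapping.keys_add])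
  also have "\<dots> = (\<Sum>m\<in>?S. of_int (Poly_Mapping.lookup P m) * mon_eval x m) +
      (\<Sum>m\<in>?S. of_int (Poly_Mapping.lookup Q m) * mon_eval x m)"
    by (simp add: lookup_add algebra_simps sum.distrib)
  also have "\<dots> = weval x P + weval x Q"
    by (subst (1 2) weval_superset[of ?S]) auto
  finally show ?thesis .
qed

lemma weval_uminus: "weval x (- P) = - weval x P"
  using weval_add[of x P "- P"] by (simp add: eq_neg_iff_add_eq_0 add.commute)

lemma weval_single: "weval x (Poly_Mapping.single m c) = of_int c * mon_eval x m"
  by (cases "c = 0") (auto simp: weval_def)

lemma weval_1 [simp]: "weval x 1 = 1"
  using weval_single[of x 0 1] by simp

lemma weval_wvar [simp]: "weval x (wvar c i) = x c i"
  by (simp add: wvar_def weval_single mon_eval_def)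

lemma wpoly_induct [case_names single add]:
  assumes "\<And>m c. Q (Poly_Mapping.single m c)" "\<And>a b. Q a \<Longrightarrow> Q b \<Longrightarrow> Q (a + b)"
  shows "Q (P :: wpoly)"
proof (induction P rule: update_induct)
  case (const)
  show ?case using assms(1)[of 0 0] by simp
next
  case (update f a b)
  have "Poly_Mapping.update a b f = f + Poly_Mapping.single a b"
    using update(1) by (intro poly_mapping_eqI)
      (auto simp: lookup_update lookup_add lookup_single when_def in_keys_iff)
  thus ?case using assms update by metis
qed

lemma weval_mult: "weval x (P * Q) = weval x P * weval x Q"
proof (induction P rule: wpoly_induct)
  case (single m c)
  show ?case
  proof (induction Q rule: wpoly_induct)
    case (single m' c')
    show ?case by (simp add: mult_single weval_single mon_eval_add)
  next
    case (add a b)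
    thus ?case by (simp add: weval_add algebra_simps)
  qed
next
  case (add a b)
  thus ?case by (simp add: weval_add algebra_simps)
qed

lemma weval_power: "weval x (P ^ n) = weval x P ^ n"
  by (induction n) (auto simp: weval_mult)

lemma weval_sum: "weval x (sum f A) = (\<Sum>a\<in>A. weval x (f a))"
  by (induction A rule: infinite_finite_induct) (auto simp: weval_add)

lemma weval_of_nat [simp]: "weval x (of_nat n) = of_nat n"
  by (induction n) (auto simp: weval_add)

lemma weval_ghost: "weval x (ghost p n a) = ghost p n (\<lambda>i. weval x (a i))"
  by (simp add: ghost_def weval_sum weval_mult weval_power)

lemma weval_mon_eval: "weval x (mon_eval y m) = mon_eval (\<lambda>c i. weval x (y c i)) m"
proof -
  have "weval x (\<Prod>a\<in>A. f a) = (\<Prod>a\<in>A. weval x (f a))" if "finite A" for f and A :: "(nat \<times> nat) set"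
    using that by (induction A rule: finite_induct) (auto simp: weval_mult)
  thus ?thesis by (simp add: mon_eval_def case_prod_unfold weval_power)
qed

lemma weval_of_int [simp]: "weval x (of_int n) = of_int n"
proof -
  have "of_int n = (Poly_Mapping.single 0 n :: wpoly)"
    using single_of_int[of n, where ?'a = "nat \<times> nat \<Rightarrow>\<^sub>0 nat" and ?'b = int] by simp
  thus ?thesis by (simp only: weval_single mon_eval_0 mult_1_right)
qed

lemma weval_weval: "weval x (weval y P) = weval (\<lambda>c i. weval x (y c i)) P"
proof (induction P rule: wpoly_induct)
  case (single m c)
  show ?case by (simp only: weval_single weval_mult weval_mon_eval weval_of_int)
next
  case (add a b)
  thus ?case by (simp only: weval_add)
qed

subsection \<open>Existence and uniqueness of Witt polynomials\<close>

lemma wpoly_torsion_free: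
  assumes "of_nat p ^ k * (a::wpoly) = of_nat p ^ k * b" "p > 0"
  shows "a = b"
proof -
  have *: "of_nat n * a = of_nat n * b \<Longrightarrow> n > 0 \<Longrightarrow> a = b" for n
  proof (intro poly_mapping_eqI)
    fix m assume *: "of_nat n * a = of_nat n * b" "n > 0"
    have "Poly_Mapping.lookup (of_nat n * c) m = int n * Poly_Mapping.lookup c m" for c :: wpoly
      by (induction n) (auto simp: algebra_simps lookup_add)
    thus "Poly_Mapping.lookup a m = Poly_Mapping.lookup b m" using * by (metis mult_left_cancel of_nat_0_less_iff less_irrefl)
  qed
  show ?thesis using *[of "p ^ k"] assms by simp
qed

lemma ghost_Suc_split:
  "ghost p n a = (\<Sum>i<n. of_nat p ^ i * a i ^ (p ^ (n - i))) + of_nat p ^ n * a n"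
  by (simp add: ghost_def lessThan_Suc_atMost[symmetric])

lemma ghost_inj:
  assumes "\<And>m. m \<le> N \<Longrightarrow> ghost p m a = ghost p m (b :: nat \<Rightarrow> wpoly)" "p > 0" "n \<le> N"
  shows "a n = b n"
  using assms(3)
proof (induction n rule: less_induct)
  case (less n)
  have "(\<Sum>i<n. of_nat p ^ i * a i ^ (p ^ (n - i))) = (\<Sum>i<n. of_nat p ^ i * b i ^ (p ^ (n - i)))"
    using less by (intro sum.cong) auto
  hence "of_nat p ^ n * a n = of_nat p ^ n * b n"
    using assms(1)[of n] less.prems by (simp add: ghost_Suc_split)
  thus ?case using wpoly_torsion_free assms(2) by blast
qed

lemma prime_binomial_cong:
  fixes a b :: "'a::comm_ring_1"
  assumes "Factorial_Ring.prime p"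
  shows "of_nat p dvd (a + b) ^ p - (a ^ p + b ^ p)"
proof -
  have p: "p > 0" using assms prime_gt_0_nat by blast
  have "(a + b) ^ p = (\<Sum>k\<le>p. of_nat (p choose k) * a ^ k * b ^ (p - k))"
    by (rule binomial_ring)
  also have "{..p} = insert 0 (insert p {0<..<p})" using p by auto
  also have "(\<Sum>k\<in>insert 0 (insert p {0<..<p}). of_nat (p choose k) * a ^ k * b ^ (p - k)) =
     b ^ p + (a ^ p + (\<Sum>k\<in>{0<..<p}. of_nat (p choose k) * a ^ k * b ^ (p - k)))"
    using p by (subst sum.insert; (subst sum.insert)?) auto
  finally have "(a + b) ^ p - (a ^ p + b ^ p) = (\<Sum>k\<in>{0<..<p}. of_nat (p choose k) * a ^ k * b ^ (p - k))"
    by simp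
  also have "of_nat p dvd \<dots>"
  proof (intro dvd_sum)
    fix k assume "k \<in> {0<..<p}"
    hence "p dvd p choose k" using assms by (intro dvd_choose_prime) auto
    hence "(of_nat p :: 'a) dvd of_nat (p choose k)" by (auto elim!: dvdE)
    thus "of_nat p dvd of_nat (p choose k) * a ^ k * b ^ (p - k)" by simp
  qed
  finally show ?thesis .
qed

lemma power_cong_lift:
  fixes a b :: "'a::comm_ring_1"
  assumes "Factorial_Ring.prime p" "of_nat p ^ k dvd a - b" "k \<ge> 1"
  shows "of_nat p ^ (k + 1) dvd a ^ p - b ^ p"
proof -
  from assms obtain c where c: "a - b = of_nat p ^ k * c" by (auto elim: dvdE)
  have p: "p > 0" using assms prime_gt_0_nat by blast
  have dvd: "of_nat p dvd (\<Sum>i<p. a ^ (p - Suc i) * b ^ i)"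
  proof -
    have 1: "of_nat p dvd a - b" 
      using assms(3) by (intro dvd_trans[OF dvd_power assms(2)]) auto
    have 2: "of_nat p dvd a ^ m - b ^ m" for m
    proof -
      have "a ^ m - b ^ m = (a - b) * (\<Sum>i<m. b ^ (m - Suc i) * a ^ i)" by (rule power_diff_sumr2)
      thus ?thesis using 1 by (simp add: dvd_mult2)
    qed
    have "of_nat p dvd (\<Sum>i<p. (a ^ (p - Suc i) - b ^ (p - Suc i)) * b ^ i)"
      using 2 by (intro dvd_sum dvd_mult2) auto
    also have "(\<Sum>i<p. (a ^ (p - Suc i) - b ^ (p - Suc i)) * b ^ i) =
       (\<Sum>i<p. a ^ (p - Suc i) * b ^ i) - (\<Sum>i<p. b ^ (p - Suc i) * b ^ i)"
      by (simp add: algebra_simps sum_subtractf)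
    also have "(\<Sum>i<p. b ^ (p - Suc i) * b ^ i) = (\<Sum>i<p. b ^ (p - 1))"
      by (intro sum.cong) (auto simp flip: power_add)
    also have "\<dots> = of_nat p * b ^ (p - 1)" by simp
    finally show ?thesis by (metis dvd_diff_commute dvd_minus_iff dvd_triv_left dvd_diff diff_add_cancel dvd_add)
  qed
  have eq: "a ^ p - b ^ p = (a - b) * (\<Sum>i<p. a ^ (p - Suc i) * b ^ i)"
  proof -
    have "b ^ p - a ^ p = (b - a) * (\<Sum>i<p. a ^ (p - Suc i) * b ^ i)" by (rule power_diff_sumr2)
    thus ?thesis by (simp add: algebra_simps)
  qed
  show ?thesis
    unfolding eq power_add power_one_right by (rule mult_dvd_mono[OF assms(2) dvd])
qed

lemma power_cong_lift_iter:
  fixes a b :: "'a::comm_ring_1"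
  assumes "Factorial_Ring.prime p" "of_nat p dvd a - b"
  shows "of_nat p ^ (k + 1) dvd a ^ (p ^ k) - b ^ (p ^ k)"
proof (induction k)
  case (Suc k)
  have "of_nat p ^ (k + 1 + 1) dvd (a ^ (p ^ k)) ^ p - (b ^ (p ^ k)) ^ p"
    by (intro power_cong_lift assms Suc.IH) auto
  thus ?case by (simp add: power_mult[symmetric] mult.commute)
qed (use assms in auto)

definition wfrob :: "nat \<Rightarrow> wpoly \<Rightarrow> wpoly" where
  "wfrob p = weval (\<lambda>c i. wvar c i ^ p)"

lemma mon_eval_wvar: "mon_eval wvar m = Poly_Mapping.single m 1"
proof (induction m rule: update_induct)
  case (const) show ?case by simp
next
  case (update f a b)
  have *: "Poly_Mapping.update a b f = f + Poly_Mapping.single a b"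
    using update(1) by (intro poly_mapping_eqI)
      (auto simp: lookup_update lookup_add lookup_single when_def in_keys_iff)
  obtain c i where a: "a = (c, i)" by force
  have "mon_eval wvar (Poly_Mapping.single a b) = wvar c i ^ b"
    using update(2) by (simp add: mon_eval_def a)
  also have "\<dots> = Poly_Mapping.single (Poly_Mapping.single a b) 1"
    by (induction b) (auto simp: wvar_def a mult_single single_add[symmetric])
  finally show ?case using update by (simp add: * mon_eval_add mult_single)
qed

lemma mon_eval_power: "mon_eval (\<lambda>c i. x c i ^ p) m = mon_eval x m ^ p"
  by (simp only: mon_eval_def case_prod_unfold prod_power_distrib power_mult[symmetric] mult.commute[of p])

lemma int_fermat: assumes "Factorial_Ring.prime p" shows "int p dvd c - c ^ p"
proof -
  have *: "int p dvd int n - int n ^ p" for n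
  proof (induction n)
    case 0 thus ?case using assms prime_gt_0_nat by (simp add: power_0_left)
  next
    case (Suc n)
    have "int p dvd (int n + 1) ^ p - (int n ^ p + 1 ^ p)" using prime_binomial_cong[OF assms, of "int n" 1] by simp
    from dvd_diff[OF Suc this] show ?case by (simp add: algebra_simps)
  qed
  have "int p dvd (c mod int p) - (c mod int p) ^ p"
    using *[of "nat (c mod int p)"] assms prime_gt_0_nat by simp
  then have "((c mod int p) - (c mod int p) ^ p) mod int p = 0" by simp
  moreover have "((c mod int p) - (c mod int p) ^ p) mod int p = (c - c ^ p) mod int p"
    by (rule mod_diff_cong[OF mod_mod_trivial power_mod])
  ultimately have "(c - c ^ p) mod int p = 0" by (simp only:)
  thus ?thesis by (simp only: dvd_eq_mod_eq_0)
qed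

lemma wfrob_cong:
  assumes "Factorial_Ring.prime p" shows "of_nat p dvd wfrob p a - a ^ p"
proof (induction a rule: wpoly_induct)
  case (single m c)
  have pw: "Poly_Mapping.single m c ^ p = of_int (c ^ p) * (Poly_Mapping.single m 1 ^ p :: wpoly)"
  proof -
    have "Poly_Mapping.single m c = of_int c * (Poly_Mapping.single m 1 :: wpoly)"
    proof -
      have "of_int c = (Poly_Mapping.single 0 c :: wpoly)"
        using single_of_int[of c, where ?'a = "nat \<times> nat \<Rightarrow>\<^sub>0 nat" and ?'b = int] by simp
      thus ?thesis by (simp only: mult_single add_0 mult_1_right)
    qed
    thus ?thesis by (simp only: power_mult_distrib of_int_power)
  qed
  have "wfrob p (Poly_Mapping.single m c) = of_int c * (Poly_Mapping.single m 1) ^ p"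
    by (simp add: wfrob_def weval_single mon_eval_power mon_eval_wvar)
  hence "wfrob p (Poly_Mapping.single m c) - Poly_Mapping.single m c ^ p =
      of_int (c - c ^ p) * (Poly_Mapping.single m 1) ^ p"
    by (simp add: pw algebra_simps)
  moreover have "(of_nat p :: wpoly) dvd of_int (c - c ^ p)"
  proof -
    obtain d where "c - c ^ p = int p * d" using int_fermat[OF assms, of c] by (rule dvdE)
    hence "(of_int (c - c ^ p) :: wpoly) = of_nat p * of_int d" by (simp only: of_int_mult of_int_of_nat_eq)
    thus ?thesis by (simp only: dvd_triv_left)
  qed
  ultimately show ?case by simp
next
  case (add a b)
  have "wfrob p (a + b) - (a + b) ^ p = (wfrob p a - a ^ p) + (wfrob p b - b ^ p) - ((a + b) ^ p - (a ^ p + b ^ p))"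
    by (simp add: wfrob_def weval_add)
  thus ?case using add prime_binomial_cong[OF assms, of a b] by (simp only: dvd_add dvd_diff)
qed

lemma dwork:
  fixes g :: "nat \<Rightarrow> wpoly"
  assumes p: "Factorial_Ring.prime p" and g: "\<And>n. of_nat p ^ Suc n dvd g (Suc n) - wfrob p (g n)"
  shows "\<exists>!a. \<forall>n. ghost p n a = g n"
proof -
  have p0: "p > 0" using p prime_gt_0_nat by blast
  have ex: "\<exists>a. \<forall>n\<le>N. ghost p n a = g n" for N
  proof (induction N)
    case 0
    show ?case by (intro exI[of _ "\<lambda>_. g 0"]) (simp add: ghost_def)
  next
    case (Suc N)
    then obtain a where a: "\<forall>n\<le>N. ghost p n a = g n" by blast
    let ?s = "\<Sum>i\<le>N. of_nat p ^ i * a i ^ (p ^ (Suc N - i))"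
    have "wfrob p (g N) = (\<Sum>i\<le>N. of_nat p ^ i * wfrob p (a i) ^ (p ^ (N - i)))"
    proof -
      have "wfrob p (ghost p N a) = ghost p N (\<lambda>i. wfrob p (a i))"
        by (simp add: wfrob_def weval_ghost)
      thus ?thesis using a by (simp add: ghost_def)
    qed
    hence "wfrob p (g N) - ?s = (\<Sum>i\<le>N. of_nat p ^ i * (wfrob p (a i) ^ (p ^ (N - i)) - (a i ^ p) ^ (p ^ (N - i))))"
      by (simp add: algebra_simps sum_subtractf power_mult[symmetric] Suc_diff_le flip: power_Suc)
    also have "of_nat p ^ Suc N dvd \<dots>"
    proof (intro dvd_sum)
      fix i assume i: "i \<in> {..N}"
      have "of_nat p ^ i * of_nat p ^ (N - i + 1) dvd of_nat p ^ i * (wfrob p (a i) ^ (p ^ (N - i)) - (a i ^ p) ^ (p ^ (N - i)))"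
        by (intro mult_dvd_mono dvd_refl power_cong_lift_iter p wfrob_cong)
      moreover have "of_nat p ^ i * of_nat p ^ (N - i + 1) = (of_nat p ^ Suc N :: wpoly)"
        using i by (simp flip: power_add power_Suc)
      ultimately show "of_nat p ^ Suc N dvd of_nat p ^ i * (wfrob p (a i) ^ (p ^ (N - i)) - (a i ^ p) ^ (p ^ (N - i)))"
        by simp
    qed
    finally have div: "of_nat p ^ Suc N dvd wfrob p (g N) - ?s" .
    have "of_nat p ^ Suc N dvd (g (Suc N) - wfrob p (g N)) + (wfrob p (g N) - ?s)"
      by (rule dvd_add[OF g div])
    hence "of_nat p ^ Suc N dvd g (Suc N) - ?s" by (simp only: add_diff_eq diff_add_cancel)
    then obtain c where c: "g (Suc N) - ?s = of_nat p ^ Suc N * c" by (auto elim: dvdE)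
    let ?b = "a(Suc N := c)"
    have "ghost p n ?b = g n" if n: "n \<le> Suc N" for n
    proof (cases "n = Suc N")
      case True
      have "(\<Sum>i<Suc N. of_nat p ^ i * ?b i ^ (p ^ (Suc N - i))) = ?s"
        by (simp only: lessThan_Suc_atMost) (intro sum.cong, auto)
      hence "ghost p n ?b = ?s + of_nat p ^ Suc N * c"
        by (simp only: True ghost_Suc_split fun_upd_same)
      also have "\<dots> = g n"
        by (simp only: c[symmetric] True) (simp only: add_diff_eq add_diff_cancel_left')
      finally show ?thesis .
    next
      case False
      hence "ghost p n ?b = ghost p n a" using n unfolding ghost_def by (intro sum.cong) auto
      thus ?thesis using a False n by simp
    qed
    thus ?case by blast
  qed
  define A where "A N = (SOME a. \<forall>n\<le>N. ghost p n a = g n)" for N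
  have A: "ghost p n (A N) = g n" if "n \<le> N" for n N
    using someI_ex[OF ex[of N]] that unfolding A_def by blast
  have eq: "A N n = A n n" if "n \<le> N" for n N
  proof (rule ghost_inj[of n p "A N" "A n" n, OF _ p0 order.refl])
    fix m assume "m \<le> n"
    thus "ghost p m (A N) = ghost p m (A n)"
      using that by (simp only: A order.trans)
  qed
  have "ghost p n (\<lambda>n. A n n) = g n" for n
  proof -
    have "ghost p n (\<lambda>n. A n n) = ghost p n (A n)"
      unfolding ghost_def
    proof (intro sum.cong refl)
      fix i assume "i \<in> {..n}"
      hence "A n i = A i i" by (intro eq) auto
      thus "of_nat p ^ i * A i i ^ p ^ (n - i) = of_nat p ^ i * A n i ^ p ^ (n - i)" by (simp only:)
    qed
    thus ?thesis using A by simp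
  qed
  moreover have "a = b" if "\<forall>n. ghost p n a = g n" "\<forall>n. ghost p n b = g n" for a b :: "nat \<Rightarrow> wpoly"
    
  proof (rule ext)
    fix n show "a n = b n"
      by (rule ghost_inj[of n p a b n, OF _ p0 order.refl]) (simp only: that)
  qed
  ultimately show ?thesis by (intro ex1I[of _ "\<lambda>n. A n n"]) auto
qed

lemma ghost_wvar_frob:
  "of_nat p ^ Suc n dvd ghost p (Suc n) (wvar c) - wfrob p (ghost p n (wvar c))"
proof -
  have "wfrob p (ghost p n (wvar c)) = (\<Sum>i\<le>n. of_nat p ^ i * wvar c i ^ (p ^ (Suc n - i)))"
    by (simp add: wfrob_def weval_ghost) (auto simp: ghost_def power_mult[symmetric] Suc_diff_le intro!: sum.cong)
  hence "ghost p (Suc n) (wvar c) - wfrob p (ghost p n (wvar c)) = of_nat p ^ Suc n * wvar c (Suc n)"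
    by (simp add: ghost_Suc_split lessThan_Suc_atMost)
  thus ?thesis by simp
qed

lemma
  assumes p: "Factorial_Ring.prime p"
  shows ghost_wadd_poly: "ghost p n (wadd_poly p) = ghost p n (wvar 0) + ghost p n (wvar 1)"
    and ghost_wmult_poly: "ghost p n (wmult_poly p) = ghost p n (wvar 0) * ghost p n (wvar 1)"
    and ghost_wneg_poly: "ghost p n (wneg_poly p) = - ghost p n (wvar 0)"
proof -
  note d = ghost_wvar_frob[of p]
  have "\<exists>!S. \<forall>n. ghost p n S = ghost p n (wvar 0) + ghost p n (wvar 1)"
  proof (rule dwork[OF p])
    fix n
    have "ghost p (Suc n) (wvar 0) + ghost p (Suc n) (wvar 1) - wfrob p (ghost p n (wvar 0) + ghost p n (wvar 1)) =
      (ghost p (Suc n) (wvar 0) - wfrob p (ghost p n (wvar 0))) + (ghost p (Suc n) (wvar 1) - wfrob p (ghost p n (wvar 1)))"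
      by (simp add: wfrob_def weval_add)
    thus "of_nat p ^ Suc n dvd ghost p (Suc n) (wvar 0) + ghost p (Suc n) (wvar 1) - wfrob p (ghost p n (wvar 0) + ghost p n (wvar 1))"
      using d by (simp only: dvd_add)
  qed
  from theI'[OF this] show "ghost p n (wadd_poly p) = ghost p n (wvar 0) + ghost p n (wvar 1)"
    by (simp add: wadd_poly_def)
  have "\<exists>!S. \<forall>n. ghost p n S = ghost p n (wvar 0) * ghost p n (wvar 1)"
  proof (rule dwork[OF p])
    fix n
    have "ghost p (Suc n) (wvar 0) * ghost p (Suc n) (wvar 1) - wfrob p (ghost p n (wvar 0) * ghost p n (wvar 1)) =
      (ghost p (Suc n) (wvar 0) - wfrob p (ghost p n (wvar 0))) * ghost p (Suc n) (wvar 1) +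
      wfrob p (ghost p n (wvar 0)) * (ghost p (Suc n) (wvar 1) - wfrob p (ghost p n (wvar 1)))"
      by (simp add: wfrob_def weval_mult algebra_simps)
    thus "of_nat p ^ Suc n dvd ghost p (Suc n) (wvar 0) * ghost p (Suc n) (wvar 1) - wfrob p (ghost p n (wvar 0) * ghost p n (wvar 1))"
      using d by (simp only: dvd_add dvd_mult dvd_mult2)
  qed
  from theI'[OF this] show "ghost p n (wmult_poly p) = ghost p n (wvar 0) * ghost p n (wvar 1)"
    by (simp add: wmult_poly_def)
  have "\<exists>!S. \<forall>n. ghost p n S = - ghost p n (wvar 0)"
  proof (rule dwork[OF p])
    fix n
    have "- ghost p (Suc n) (wvar 0) - wfrob p (- ghost p n (wvar 0)) = - (ghost p (Suc n) (wvar 0) - wfrob p (ghost p n (wvar 0)))"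
      by (simp add: wfrob_def weval_uminus)
    thus "of_nat p ^ Suc n dvd - ghost p (Suc n) (wvar 0) - wfrob p (- ghost p n (wvar 0))"
      using d by (simp only: dvd_minus_iff)
  qed
  from theI'[OF this] show "ghost p n (wneg_poly p) = - ghost p n (wvar 0)"
    by (simp add: wneg_poly_def)
qed

subsection \<open>The ring\<close>

typedef 'k witt = "UNIV :: (nat \<Rightarrow> 'k) set"
  morphisms wcoeff Witt ..

definition pair_args :: "(nat \<Rightarrow> 'a) \<Rightarrow> (nat \<Rightarrow> 'a) \<Rightarrow> nat \<Rightarrow> nat \<Rightarrow> 'a" where
  "pair_args a b c = (if c = 0 then a else b)"

instantiation witt :: (comm_ring_prime_char) comm_ring_1
begin

definition zero_witt :: "'a witt" where
  "0 = Witt (\<lambda>_. 0)"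

definition one_witt :: "'a witt" where
  "1 = Witt (\<lambda>n. if n = 0 then 1 else 0)"

definition plus_witt :: "'a witt \<Rightarrow> 'a witt \<Rightarrow> 'a witt" where
  "x + y = Witt (\<lambda>n. weval (pair_args (wcoeff x) (wcoeff y)) (wadd_poly CHAR('a) n))"

definition times_witt :: "'a witt \<Rightarrow> 'a witt \<Rightarrow> 'a witt" where
  "x * y = Witt (\<lambda>n. weval (pair_args (wcoeff x) (wcoeff y)) (wmult_poly CHAR('a) n))"

definition uminus_witt :: "'a witt \<Rightarrow> 'a witt" where
  "- x = Witt (\<lambda>n. weval (pair_args (wcoeff x) (wcoeff x)) (wneg_poly CHAR('a) n))"

definition minus_witt :: "'a witt \<Rightarrow> 'a witt \<Rightarrow> 'a witt" where
  "(x :: 'a witt) - y = x + (- y)"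

instance
proof
  let ?p = "CHAR('a)"
  have p: "Factorial_Ring.prime ?p" by (rule CHAR_prime)
  have p0: "?p > 0" using p prime_gt_0_nat by blast
  define add where "add a b n = weval (pair_args a b) (wadd_poly ?p n)" for a b :: "nat \<Rightarrow> wpoly" and n
  define mul where "mul a b n = weval (pair_args a b) (wmult_poly ?p n)" for a b :: "nat \<Rightarrow> wpoly" and n
  define neg where "neg a n = weval (pair_args a a) (wneg_poly ?p n)" for a :: "nat \<Rightarrow> wpoly" and n
  define one :: "nat \<Rightarrow> wpoly" where "one = (\<lambda>n. if n = 0 then 1 else 0)"
  have ghost_add: "ghost ?p n (add a b) = ghost ?p n a + ghost ?p n b" for a b n
    using arg_cong[OF ghost_wadd_poly[OF p, of n], of "weval (pair_args a b)"]
    by (simp add: weval_ghost weval_add add_def[abs_def] pair_args_def)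
  have ghost_mul: "ghost ?p n (mul a b) = ghost ?p n a * ghost ?p n b" for a b n
    using arg_cong[OF ghost_wmult_poly[OF p, of n], of "weval (pair_args a b)"]
    by (simp add: weval_ghost weval_mult mul_def[abs_def] pair_args_def)
  have ghost_neg: "ghost ?p n (neg a) = - ghost ?p n a" for a n
    using arg_cong[OF ghost_wneg_poly[OF p, of n], of "weval (pair_args a a)"]
    by (simp add: weval_ghost weval_uminus neg_def[abs_def] pair_args_def)
  have ghost_0: "ghost ?p n (\<lambda>_. 0 :: wpoly) = 0" for n
    using p0 by (simp add: ghost_def power_0_left)
  have ghost_1: "ghost ?p n one = 1" for n
  proof -
    have "ghost ?p n one = (\<Sum>i\<le>n. if i = 0 then 1 else 0)"
      unfolding ghost_def one_def using p0 by (intro sum.cong) (auto simp: power_0_left)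
    thus ?thesis by simp
  qed
  have inj: "a = b" if "\<And>n. ghost ?p n a = ghost ?p n b" for a b :: "nat \<Rightarrow> wpoly"
  proof (rule ext)
    fix n show "a n = b n"
      by (rule ghost_inj[of n ?p a b n, OF _ p0 order.refl]) (rule that)
  qed
  note g = ghost_add ghost_mul ghost_neg ghost_0 ghost_1
  define ev :: "(nat \<Rightarrow> nat \<Rightarrow> 'a) \<Rightarrow> (nat \<Rightarrow> wpoly) \<Rightarrow> 'a witt" where
    "ev v a = Witt (\<lambda>n. weval v (a n))" for v a
  have ev_add: "ev v (add a b) = ev v a + ev v b" for v a b
  proof -
    have "(\<lambda>c i. weval v (pair_args a b c i)) = pair_args (\<lambda>i. weval v (a i)) (\<lambda>i. weval v (b i))"
      by (auto simp: pair_args_def)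
    thus ?thesis by (simp add: ev_def plus_witt_def add_def weval_weval Witt_inverse)
  qed
  have ev_mul: "ev v (mul a b) = ev v a * ev v b" for v a b
  proof -
    have "(\<lambda>c i. weval v (pair_args a b c i)) = pair_args (\<lambda>i. weval v (a i)) (\<lambda>i. weval v (b i))"
      by (auto simp: pair_args_def)
    thus ?thesis by (simp add: ev_def times_witt_def mul_def weval_weval Witt_inverse)
  qed
  have ev_neg: "ev v (neg a) = - ev v a" for v a
  proof -
    have "(\<lambda>c i. weval v (pair_args a a c i)) = pair_args (\<lambda>i. weval v (a i)) (\<lambda>i. weval v (a i))"
      by (auto simp: pair_args_def)
    thus ?thesis by (simp add: ev_def uminus_witt_def neg_def weval_weval Witt_inverse)
  qed
  have ev_0: "ev v (\<lambda>_. 0) = 0" for v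
    by (simp add: ev_def zero_witt_def)
  have ev_1: "ev v one = 1" for v
    unfolding ev_def one_witt_def one_def by (intro arg_cong[of _ _ Witt]) auto
  note e = ev_add[symmetric] ev_mul[symmetric] ev_neg[symmetric] ev_0[symmetric] ev_1[symmetric]
  define args where "args x y z c = (if c = 0 then wcoeff x else if c = 1 then wcoeff y else wcoeff z)"
    for x y z :: "'a witt" and c :: nat
  have ev_var: "ev (args x y z) (wvar 0) = x" "ev (args x y z) (wvar 1) = y" "ev (args x y z) (wvar 2) = z" for x y z
    by (simp_all add: ev_def args_def wcoeff_inverse)
  fix x y z :: "'a witt"
  let ?X = "wvar 0" and ?Y = "wvar 1" and ?Z = "wvar 2" and ?e = "ev (args x y z)"
  note v = ev_var[of x y z]
  have "add (add ?X ?Y) ?Z = add ?X (add ?Y ?Z)"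
    by (rule inj) (simp add: g algebra_simps)
  from arg_cong[OF this, of ?e] show "x + y + z = x + (y + z)"
    by (simp only: ev_add v)
  have "add ?X ?Y = add ?Y ?X"
    by (rule inj) (simp add: g algebra_simps)
  from arg_cong[OF this, of ?e] show "x + y = y + x"
    by (simp only: ev_add v)
  have "add (\<lambda>_. 0) ?X = ?X"
    by (rule inj) (simp add: g algebra_simps)
  from arg_cong[OF this, of ?e] show "0 + x = x"
    by (simp only: ev_add ev_0 v)
  have "add (neg ?X) ?X = (\<lambda>_. 0)"
    by (rule inj) (simp add: g algebra_simps)
  from arg_cong[OF this, of ?e] show "- x + x = 0"
    by (simp only: ev_add ev_neg ev_0 v)
  show "x - y = x + - y" by (rule minus_witt_def)
  have "mul (mul ?X ?Y) ?Z = mul ?X (mul ?Y ?Z)"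
    by (rule inj) (simp add: g algebra_simps)
  from arg_cong[OF this, of ?e] show "x * y * z = x * (y * z)"
    by (simp only: ev_mul v)
  have "mul ?X ?Y = mul ?Y ?X"
    by (rule inj) (simp add: g algebra_simps)
  from arg_cong[OF this, of ?e] show "x * y = y * x"
    by (simp only: ev_mul v)
  have "mul one ?X = ?X"
    by (rule inj) (simp add: g algebra_simps)
  from arg_cong[OF this, of ?e] show "1 * x = x"
    by (simp only: ev_mul ev_1 v)
  have "mul (add ?X ?Y) ?Z = add (mul ?X ?Z) (mul ?Y ?Z)"
    by (rule inj) (simp add: g algebra_simps)
  from arg_cong[OF this, of ?e] show "(x + y) * z = x * z + y * z"
    by (simp only: ev_mul ev_add v)
  show "(0 :: 'a witt) \<noteq> 1"
    by (metis (mono_tags) one_witt_def zero_witt_def UNIV_I Witt_inverse zero_neq_one)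
qed

end

text \<open>The elements of \<open>W\<^sub>m(k)\<close> are represented by the Witt vectors whose components of
  index \<open>\<ge> m\<close> vanish; \<open>wtrunc m\<close> is the projection \<open>W(k) \<rightarrow> W\<^sub>m(k)\<close>.\<close>

definition wtrunc :: "nat \<Rightarrow> 'k::zero witt \<Rightarrow> 'k witt" where
  "wtrunc m x = Witt (\<lambda>i. if i < m then wcoeff x i else 0)"

definition teich :: "'k::zero \<Rightarrow> 'k witt" where
  "teich a = Witt (\<lambda>i. if i = 0 then a else 0)"

text \<open>\<open>'p fpbar\<close> is an algebraic closure of the prime field with \<open>p = CARD('p)\<close> elements.\<close>

type_synonym 'p fpbar = "'p mod_ring alg_closure"

instance alg_closure :: (field_prime_char) field_prime_char
  by (rule field_prime_charI') (simp add: prime_gt_0_nat)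

lemma CHAR_fpbar: "CHAR('p::prime_card fpbar) = CARD('p)"
  by simp

section \<open>Lie algebras of algebraic groups\<close>

text \<open>Over the algebraically closed field \<open>k\<close> an affine algebraic group is given by its
  group \<open>G\<close> of \<open>k\<close>-points, a closed subset of an affine space with coordinate functions
  \<open>C\<close>.  Functions on \<open>G\<close> are extended by \<open>0\<close> outside of \<open>G\<close>.\<close>

definition ext0 :: "'a set \<Rightarrow> ('a \<Rightarrow> 'k::zero) \<Rightarrow> 'a \<Rightarrow> 'k" where
  "ext0 S f = (\<lambda>x. if x \<in> S then f x else 0)"

inductive_set regfun :: "('a \<Rightarrow> 'k::comm_ring_1) set \<Rightarrow> 'a set \<Rightarrow> ('a \<Rightarrow> 'k) set"
  for C :: "('a \<Rightarrow> 'k) set" and S :: "'a set" where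
  const: "ext0 S (\<lambda>_. c) \<in> regfun C S"
| coord: "f \<in> C \<Longrightarrow> ext0 S f \<in> regfun C S"
| add: "f \<in> regfun C S \<Longrightarrow> g \<in> regfun C S \<Longrightarrow> f + g \<in> regfun C S"
| mult: "f \<in> regfun C S \<Longrightarrow> g \<in> regfun C S \<Longrightarrow> f * g \<in> regfun C S"

definition ltransl :: "('a, 'b) monoid_scheme \<Rightarrow> 'a \<Rightarrow> ('a \<Rightarrow> 'k::zero) \<Rightarrow> 'a \<Rightarrow> 'k" where
  "ltransl G a f = ext0 (carrier G) (\<lambda>x. f (a \<otimes>\<^bsub>G\<^esub> x))"

text \<open>Left invariant \<open>k\<close>-derivations of the coordinate ring, made into total maps by the
  value \<open>0\<close> on all other functions.\<close>

definition lie_algebra ::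
    "('a \<Rightarrow> 'k::comm_ring_1) set \<Rightarrow> 'a monoid \<Rightarrow> (('a \<Rightarrow> 'k) \<Rightarrow> 'a \<Rightarrow> 'k) set" where
  "lie_algebra C G = {D. let R = regfun C (carrier G) in
     (\<forall>f. f \<notin> R \<longrightarrow> D f = 0) \<and>
     (\<forall>f\<in>R. D f \<in> R) \<and>
     (\<forall>f\<in>R. \<forall>g\<in>R. D (f + g) = D f + D g) \<and>
     (\<forall>c. \<forall>f\<in>R. D (\<lambda>x. c * f x) = (\<lambda>x. c * D f x)) \<and>
     (\<forall>f\<in>R. \<forall>g\<in>R. D (f * g) = f * D g + D f * g) \<and>
     (\<forall>a\<in>carrier G. \<forall>f\<in>R. D (ltransl G a f) = ltransl G a (D f))}"

text \<open>The differential of a morphism \<open>\<phi> : G \<rightarrow> H\<close>: the left invariant derivation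
  of \<open>H\<close> whose value at \<open>1\<close> is \<open>f \<mapsto> D (f \<circ> \<phi>) (1)\<close>.\<close>

definition differential ::
    "('a \<Rightarrow> 'k::comm_ring_1) set \<Rightarrow> 'a monoid \<Rightarrow> 'a monoid \<Rightarrow> ('a \<Rightarrow> 'a) \<Rightarrow>
      (('a \<Rightarrow> 'k) \<Rightarrow> 'a \<Rightarrow> 'k) \<Rightarrow> ('a \<Rightarrow> 'k) \<Rightarrow> 'a \<Rightarrow> 'k" where
  "differential C G H \<phi> D = (\<lambda>f. if f \<in> regfun C (carrier H)
     then ext0 (carrier H) (\<lambda>h. D (ext0 (carrier G) (\<lambda>g. f (h \<otimes>\<^bsub>H\<^esub> \<phi> g))) \<one>\<^bsub>G\<^esub>)
     else 0)"

section \<open>The proalgebraic group \<open>SL(n, W(k))\<close> and its Lie algebra\<close>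

type_synonym ('k, 'n) wmat = "'k witt ^ 'n ^ 'n"

definition SLW :: "('k::field_prime_char, 'n::finite) wmat set" where
  "SLW = {A. det A = 1}"

definition mtrunc :: "nat \<Rightarrow> ('k::zero, 'n::finite) wmat \<Rightarrow> ('k, 'n) wmat" where
  "mtrunc m A = (\<chi> i j. wtrunc m (A $ i $ j))"

text \<open>\<open>SL(n, W\<^sub>m(k))\<close>, where \<open>W\<^sub>m(k) = W(k)/p\<^sup>mW(k)\<close>.\<close>

definition SLWm :: "nat \<Rightarrow> ('k::field_prime_char, 'n::finite) wmat monoid" where
  "SLWm m = \<lparr>carrier = {A. mtrunc m A = A \<and> wtrunc m (det A) = wtrunc m 1},
     mult = (\<lambda>A B. mtrunc m (A ** B)), one = mtrunc m (mat 1)\<rparr>"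

definition wmat_coords :: "(('k, 'n::finite) wmat \<Rightarrow> 'k) set" where
  "wmat_coords = {\<lambda>A. wcoeff (A $ i $ j) l | i j l. True}"

text \<open>A closed subgroup \<open>H\<close> of \<open>SL(n, W(k))\<close> is the limit of its images in the
  groups \<open>SL(n, W\<^sub>m(k))\<close>.\<close>

definition level :: "('k::field_prime_char, 'n::finite) wmat set \<Rightarrow> nat \<Rightarrow> ('k, 'n) wmat monoid" where
  "level H m = (SLWm m)\<lparr>carrier := mtrunc m ` H\<rparr>"

type_synonym ('k, 'n) wlie = "nat \<Rightarrow> (('k, 'n) wmat \<Rightarrow> 'k) \<Rightarrow> ('k, 'n) wmat \<Rightarrow> 'k"

text \<open>The limit of the Lie algebras of \<open>G 0 \<leftarrow> G 1 \<leftarrow> \<dots>\<close>.\<close>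

definition prolie :: "(nat \<Rightarrow> ('k::field_prime_char, 'n::finite) wmat monoid) \<Rightarrow> ('k, 'n) wlie set" where
  "prolie G = {x. \<forall>m. x m \<in> lie_algebra wmat_coords (G m) \<and>
     differential wmat_coords (G (Suc m)) (G m) (mtrunc m) (x (Suc m)) = x m}"

definition wsl :: "('k::field_prime_char, 'n::finite) wlie set" where
  "wsl = prolie SLWm"

text \<open>The Lie algebra of a closed subgroup, as a subalgebra of \<open>wsl\<close> via the differential
  of the inclusion.\<close>

definition sublie :: "('k::field_prime_char, 'n::finite) wmat set \<Rightarrow> ('k, 'n) wlie set" where
  "sublie H = (\<lambda>x m. differential wmat_coords (level H m) (SLWm m) (\<lambda>A. A) (x m)) ` prolie (level H)"

definition wscale :: "'k::field \<Rightarrow> ('i \<Rightarrow> 'f \<Rightarrow> 'a \<Rightarrow> 'k) \<Rightarrow> 'i \<Rightarrow> 'f \<Rightarrow> 'a \<Rightarrow> 'k" where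
  "wscale c x = (\<lambda>m f a. c * x m f a)"

global_interpretation wlie: vector_space wscale
  by unfold_locales (auto simp: wscale_def fun_eq_iff algebra_simps)

definition bracket :: "('k::field_prime_char, 'n::finite) wlie \<Rightarrow> ('k, 'n) wlie \<Rightarrow> ('k, 'n) wlie" where
  "bracket x y = (\<lambda>m f. x m (y m f) - y m (x m f))"

definition ppower :: "('k::field_prime_char, 'n::finite) wlie \<Rightarrow> ('k, 'n) wlie" where
  "ppower x = (\<lambda>m. x m ^^ CHAR('k))"

definition Ad :: "('k::field_prime_char, 'n::finite) wmat \<Rightarrow> ('k, 'n) wlie \<Rightarrow> ('k, 'n) wlie" where
  "Ad g x = (\<lambda>m. differential wmat_coords (SLWm m) (SLWm m)
     (\<lambda>h. mtrunc m g \<otimes>\<^bsub>SLWm m\<^esub> h \<otimes>\<^bsub>SLWm m\<^esub> inv\<^bsub>SLWm m\<^esub> (mtrunc m g)) (x m))"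

section \<open>The filtration\<close>

definition Gam :: "nat \<Rightarrow> ('k::field_prime_char, 'n::finite) wmat set" where
  "Gam j = {A \<in> SLW. \<forall>a b. of_nat CHAR('k) ^ j dvd (A - mat 1) $ a $ b}"

definition gam :: "nat \<Rightarrow> ('k::field_prime_char, 'n::finite) wlie set" where
  "gam j = sublie (Gam j)"

definition restricted_ideal :: "('k::field_prime_char, 'n::finite) wlie set \<Rightarrow> bool" where
  "restricted_ideal I \<longleftrightarrow> I \<subseteq> wsl \<and> wlie.subspace I \<and>
     (\<forall>x\<in>wsl. \<forall>y\<in>I. bracket x y \<in> I) \<and> (\<forall>y\<in>I. ppower y \<in> I)"

definition wsl_topology :: "('k::field_prime_char, 'n::finite) wlie topology" where
  "wsl_topology = topology (\<lambda>U. U \<subseteq> wsl \<and> (\<forall>x\<in>U. \<exists>j. (+) x ` gam j \<subseteq> U))"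

definition nbhd_basis_at :: "'a topology \<Rightarrow> 'a \<Rightarrow> ('i \<Rightarrow> 'a set) \<Rightarrow> bool" where
  "nbhd_basis_at T x B \<longleftrightarrow>
     (\<forall>i. \<exists>U. openin T U \<and> x \<in> U \<and> U \<subseteq> B i) \<and>
     (\<forall>U. openin T U \<and> x \<in> U \<longrightarrow> (\<exists>i. B i \<subseteq> U))"

text \<open>Completeness with respect to the uniform structure of a topological group.\<close>

definition complete_additive :: "'a::ab_group_add topology \<Rightarrow> bool" where
  "complete_additive T \<longleftrightarrow> (\<forall>F. F \<noteq> bot \<and> (\<forall>\<^sub>F x in F. x \<in> topspace T) \<and>
     (\<forall>U. openin T U \<and> 0 \<in> U \<longrightarrow> (\<exists>S. (\<forall>\<^sub>F x in F. x \<in> S) \<and> (\<forall>x\<in>S. \<forall>y\<in>S. x - y \<in> U))) \<longrightarrow>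
     (\<exists>l. limitin T (\<lambda>x. x) l F))"

section \<open>Representations\<close>

record ('k, 'g, 'v) repn =
  rspace :: "'v set"
  radd :: "'v \<Rightarrow> 'v \<Rightarrow> 'v"
  rscale :: "'k \<Rightarrow> 'v \<Rightarrow> 'v"
  ract :: "'g \<Rightarrow> 'v \<Rightarrow> 'v"

definition repn_iso :: "'g set \<Rightarrow> ('k, 'g, 'v) repn \<Rightarrow> ('k, 'g, 'w) repn \<Rightarrow> ('v \<Rightarrow> 'w) \<Rightarrow> bool" where
  "repn_iso G V W \<phi> \<longleftrightarrow> bij_betw \<phi> (rspace V) (rspace W) \<and>
     (\<forall>x\<in>rspace V. \<forall>y\<in>rspace V. radd V x y \<in> rspace V \<and> \<phi> (radd V x y) = radd W (\<phi> x) (\<phi> y)) \<and>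
     (\<forall>c. \<forall>x\<in>rspace V. rscale V c x \<in> rspace V \<and> \<phi> (rscale V c x) = rscale W c (\<phi> x)) \<and>
     (\<forall>g\<in>G. \<forall>x\<in>rspace V. ract V g x \<in> rspace V \<and> \<phi> (ract V g x) = ract W g (\<phi> x))"

text \<open>The twist of a representation on the span of a finite independent set \<open>B\<close>: the matrix
  entries with respect to \<open>B\<close> are raised to the \<open>q\<close>-th power.\<close>

definition frobenius_twist ::
    "('k::field \<Rightarrow> 'v::ab_group_add \<Rightarrow> 'v) \<Rightarrow> 'v set \<Rightarrow> nat \<Rightarrow> ('g \<Rightarrow> 'v \<Rightarrow> 'v) \<Rightarrow> 'g \<Rightarrow> 'v \<Rightarrow> 'v" where
  "frobenius_twist s B q \<rho> g v = (\<Sum>b\<in>B. s (module.representation s B v b)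
     (\<Sum>c\<in>B. s (module.representation s B (\<rho> g b) c ^ q) c))"

definition mscale :: "'k::field \<Rightarrow> 'k ^ 'n ^ 'n \<Rightarrow> 'k ^ 'n::finite ^ 'n" where
  "mscale c A = (\<chi> i j. c * A $ i $ j)"

global_interpretation kmat: vector_space mscale
  by unfold_locales (auto simp: mscale_def vec_eq_iff algebra_simps)

definition sl :: "('k::field ^ 'n::finite ^ 'n) set" where
  "sl = {A. trace A = 0}"

definition mbracket :: "'k::field ^ 'n ^ 'n \<Rightarrow> 'k ^ 'n ^ 'n \<Rightarrow> 'k ^ 'n::finite ^ 'n" where
  "mbracket A B = A ** B - B ** A"

definition mred :: "('k, 'n::finite) wmat \<Rightarrow> 'k ^ 'n ^ 'n" where
  "mred A = (\<chi> i j. wcoeff (A $ i $ j) 0)"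

definition sl_act :: "('k::field, 'n::finite) wmat \<Rightarrow> 'k ^ 'n ^ 'n \<Rightarrow> 'k ^ 'n ^ 'n" where
  "sl_act g A = mred g ** A ** matrix_inv (mred g)"

definition sl_repn :: "('k::field, ('k, 'n::finite) wmat, 'k ^ 'n ^ 'n) repn" where
  "sl_repn = \<lparr>rspace = sl, radd = (+), rscale = mscale, ract = sl_act\<rparr>"

definition wlie_repn :: "('k::field_prime_char, 'n::finite) wlie set \<Rightarrow> ('k, ('k, 'n) wmat, ('k, 'n) wlie) repn" where
  "wlie_repn M = \<lparr>rspace = M, radd = (+), rscale = wscale, ract = Ad\<rparr>"

text \<open>The associated graded space: families of cosets \<open>C j \<in> gam j / gam (j + 1)\<close>, almost
  all of them zero.\<close>

definition gr_repn :: "('k::field_prime_char, ('k, 'n::finite) wmat, nat \<Rightarrow> ('k, 'n) wlie set) repn" where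
  "gr_repn = \<lparr>
     rspace = {C. (\<forall>j. C j \<in> (\<lambda>x. (+) x ` gam (Suc j)) ` gam j) \<and> finite {j. C j \<noteq> gam (Suc j)}},
     radd = (\<lambda>C D j. {x + y | x y. x \<in> C j \<and> y \<in> D j}),
     rscale = (\<lambda>c C j. {wscale c x + y | x y. x \<in> C j \<and> y \<in> gam (Suc j)}),
     ract = (\<lambda>g C j. Ad g ` C j)\<rparr>"

text \<open>\<open>sl\<close> plus the coproduct of its twists by \<open>p\<^sup>j\<close>, \<open>j \<ge> 1\<close>, with matrices
  taken with respect to the basis \<open>B\<close> of \<open>sl\<close>.\<close>

definition sl_twists_repn ::
    "('k::field_prime_char ^ 'n ^ 'n) set \<Rightarrow> ('k, ('k, 'n::finite) wmat, nat \<Rightarrow> 'k ^ 'n ^ 'n) repn" where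
  "sl_twists_repn B = \<lparr>
     rspace = {v. (\<forall>j. v j \<in> sl) \<and> finite {j. v j \<noteq> 0}},
     radd = (\<lambda>v w j. v j + w j),
     rscale = (\<lambda>c v j. mscale c (v j)),
     ract = (\<lambda>g v j. if j = 0 then sl_act g (v 0)
                     else frobenius_twist mscale B (CHAR('k) ^ j) sl_act g (v j))\<rparr>"

text \<open>The differential of \<open>SL(n, W(k)) \<rightarrow> SL(n, k)\<close>, the Lie algebra of
  \<open>SL(n, k)\<close> being identified with \<open>sl\<close> by \<open>D \<mapsto> (D x\<^sub>i\<^sub>j (1))\<close>.\<close>

definition lie_red :: "('k::field_prime_char, 'n::finite) wlie \<Rightarrow> 'k ^ 'n ^ 'n" where
  "lie_red x = (\<chi> i j. x 1 (ext0 (carrier (SLWm 1)) (\<lambda>A. wcoeff (A $ i $ j) 0)) \<one>\<^bsub>SLWm 1\<^esub>)"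

section \<open>Torus, weights and root vectors\<close>

definition torus :: "('k::field_prime_char, 'n::finite) wmat set" where
  "torus = {A \<in> SLW. \<forall>i j. i \<noteq> j \<longrightarrow> A $ i $ j = 0}"

definition Tk :: "('k::field_prime_char, 'n::finite) wmat set" where
  "Tk = {A \<in> torus. \<forall>i. A $ i $ i \<in> range teich}"

text \<open>The factor of \<open>torus\<close> complementary to \<open>Tk\<close>; the \<open>p\<close>-adic logarithm identifies
  it with a product of \<open>n - 1\<close> copies of the additive group \<open>pW(k)\<close>.\<close>

definition torus1 :: "('k::field_prime_char, 'n::finite) wmat set" where
  "torus1 = torus \<inter> Gam 1"

definition cartan :: "('k::field_prime_char, 'n::finite) wlie set" where
  "cartan = sublie Tk"

text \<open>The root \<open>e\<^sub>a - e\<^sub>b\<close> (\<open>a \<noteq> b\<close>), its root subgroup and root vector.  Characters of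
  \<open>Tk\<close> are written multiplicatively: the weight \<open>p\<^sup>j\<alpha>\<close> is \<open>\<lambda>t. root_char a b t ^ p ^ j\<close>.\<close>

definition root_char :: "'n \<Rightarrow> 'n \<Rightarrow> ('k::field, 'n::finite) wmat \<Rightarrow> 'k" where
  "root_char a b t = wcoeff (t $ a $ a) 0 / wcoeff (t $ b $ b) 0"

definition weight_vector :: "(('k::field_prime_char, 'n::finite) wmat \<Rightarrow> 'k) \<Rightarrow> ('k, 'n) wlie \<Rightarrow> bool" where
  "weight_vector l x \<longleftrightarrow> x \<in> wsl \<and> x \<noteq> 0 \<and> (\<forall>t\<in>Tk. Ad t x = wscale (l t) x)"

definition root_group :: "'n \<Rightarrow> 'n \<Rightarrow> ('k::field_prime_char, 'n::finite) wmat set" where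
  "root_group a b = {\<chi> i j. if i = j then 1 else if i = a \<and> j = b then u else 0 | u. True}"

definition root_vector :: "'n \<Rightarrow> 'n \<Rightarrow> ('k::field_prime_char, 'n::finite) wlie" where
  "root_vector a b = (THE x. let L = sublie (root_group a b); P = ppower ` L in
     x \<in> L \<and>
     (\<forall>t\<in>Tk. Ad t ` wlie.span {x} \<subseteq> wlie.span {x}) \<and>
     wlie.span {x} \<inter> P = {0} \<and> {y + z | y z. y \<in> wlie.span {x} \<and> z \<in> P} = L \<and>
     lie_red x = (\<chi> i j. if i = a \<and> j = b then 1 else 0))"

text \<open>\<open>Y i j\<close>, \<open>1 \<le> i \<le> n - 1\<close>, \<open>j \<ge> 1\<close>, with \<open>Y i (j + 1)\<close> the \<open>p\<close>-th power of
  \<open>Y i j\<close>, such that the Lie algebra of \<open>torus1\<close> is the product of the lines spanned by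
  the \<open>Y i j\<close>: all series \<open>\<Sum> c i j Y i j\<close> converge in it, and every element has a
  unique expansion of this form.\<close>

definition torus1_expansion ::
    "(nat \<Rightarrow> nat \<Rightarrow> ('k::field_prime_char, 'n::finite) wlie) \<Rightarrow> (nat \<Rightarrow> nat \<Rightarrow> 'k) \<Rightarrow> ('k, 'n) wlie \<Rightarrow> bool" where
  "torus1_expansion Y c x \<longleftrightarrow>
     limitin wsl_topology (\<lambda>N. \<Sum>i = 1..CARD('n) - 1. \<Sum>j = 1..N. wscale (c i j) (Y i j)) x sequentially"

definition torus1_family :: "(nat \<Rightarrow> nat \<Rightarrow> ('k::field_prime_char, 'n::finite) wlie) \<Rightarrow> bool" where
  "torus1_family Y \<longleftrightarrow>
     (\<forall>i\<in>{1..CARD('n) - 1}. \<forall>j\<ge>1. Y i j \<in> sublie torus1 \<and> ppower (Y i j) = Y i (Suc j)) \<and>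
     (\<forall>c. \<exists>x\<in>sublie torus1. torus1_expansion Y c x) \<and>
     (\<forall>x\<in>sublie torus1. \<exists>c. torus1_expansion Y c x \<and>
        (\<forall>c'. torus1_expansion Y c' x \<longrightarrow> (\<forall>i\<in>{1..CARD('n) - 1}. \<forall>j\<ge>1. c' i j = c i j)))"

text \<open>The sum of \<open>cartan\<close> and the root lines is a complement of \<open>gam 1\<close> on which
  \<open>lie_red\<close> is a linear isomorphism to \<open>sl\<close>, but it is not closed under the bracket.
  For instance, in the group \<open>SL(2)\<close> over \<open>W(k[\<epsilon>,\<delta>])\<close>, \<open>\<epsilon>\<^sup>2 = \<delta>\<^sup>2 = 0\<close>, the
  commutator of the unipotent matrices with off-diagonal entries \<open>[\<epsilon>]\<close> and \<open>[\<delta>]\<close> is the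
  diagonal matrix with entries \<open>1 \<plusminus> [\<epsilon>\<delta>]\<close>, and \<open>1 + [\<tau>] = (1 + \<tau>, -\<tau>, \<dots>)\<close>
  differs from the Teichmueller element \<open>[1 + \<tau>] = (1 + \<tau>, 0, \<dots>)\<close>.  So the bracket of
  opposite root vectors differs from an element of \<open>cartan\<close> by a nonzero element of the Lie
  algebra of \<open>torus1\<close>.  The Lie subalgebra that the root vectors do span together with their
  brackets is \<open>g0\<close>: there \<open>cartan\<close> is replaced by the span of the brackets of opposite
  root vectors, which maps onto the same Cartan subalgebra of \<open>sl\<close>.\<close>

definition g0_torus :: "('k::field_prime_char, 'n::finite) wlie set" where
  "g0_torus = wlie.span (cartan \<union> {root_vector a b | a b. a \<noteq> b})"

definition g0 :: "('k::field_prime_char, 'n::finite) wlie set" where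
  "g0 = wlie.span ({bracket (root_vector a b) (root_vector b a) | a b. a \<noteq> b} \<union>
                   {root_vector a b | a b. a \<noteq> b})"

end

theory Submission
  imports Defs
begin

text \<open>
  The Lie algebra of \<open>SL(n, W(k))\<close> has simple coordinates.  A tangent vector at the identity of
  the truncated group \<open>SL(n, W\<^sub>m(k))\<close> is a ring homomorphism from the regular functions to
  the dual numbers \<open>k[\<epsilon>]\<close>, that is, a matrix \<open>A\<close> over \<open>W\<^sub>m(k[\<epsilon>])\<close> that reduces to \<open>1\<close> for
  \<open>\<epsilon> = 0\<close>.  The Witt components of \<open>A - 1\<close> then lie in \<open>\<epsilon>k\<close>, and two facts about Witt vectors with
  such components carry everything: they are added componentwise, and a product \<open>x \<cdot> (\<epsilon>y\<^sub>0, \<epsilon>y\<^sub>1, \<dots>)\<close>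
  has the components \<open>\<epsilon> \<cdot> x\<^sub>0 ^ p ^ l \<cdot> y\<^sub>l\<close> (lemma \<open>mult_epsw\<close>).  Hence \<open>det A = 1\<close> says that the matrices
  \<open>\<kappa>\<^sub>l\<close> formed by the components of index \<open>l\<close> have trace \<open>0\<close>, and \<open>x \<mapsto> (\<kappa>\<^sub>l(x))\<^sub>l\<close> is an injective linear
  map from \<open>wsl\<close> to sequences in \<open>sl\<close>.  It is onto (\<open>wsl_ex\<close>): \<open>sl\<close> is spanned by square-zero
  integer matrices \<open>N\<close>, and \<open>N\<close> at level \<open>l\<close> is the tangent vector of the curve
  \<open>s \<mapsto> 1 + N V\<^sup>l[s - 1]\<close>, \<open>V\<close> being the Verschiebung.

  In these coordinates the whole structure is visible.  Conjugation by \<open>g\<close> multiplies \<open>A - 1\<close> by \<open>g\<close>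
  and its inverse, so it acts on \<open>\<kappa>\<^sub>l\<close> through the \<open>l\<close>-th Frobenius power of the reduction of \<open>g\<close>
  (\<open>kpa_Ad\<close>).  Up to terms symmetric in \<open>x\<close> and \<open>y\<close>, the second order
  part of a product is \<open>\<epsilon>\<delta> \<kappa>\<^sub>0(x) \<kappa>\<^sub>0(y)\<close> at level \<open>0\<close>; at level \<open>l > 0\<close>
  the factor \<open>\<epsilon>\<close> is raised to the power \<open>p\<^sup>l\<close> and vanishes, so only \<open>\<kappa>\<^sub>0\<close> of a bracket can be nonzero
  (\<open>kpa_bracket\<close>).  Since \<open>p\<^sup>j\<close> divides a Witt vector over \<open>k\<close> iff its components of index below \<open>j\<close>
  vanish, \<open>gam j\<close> is given by \<open>\<kappa>\<^sub>l = 0\<close> for \<open>l < j\<close> (\<open>gam_iff\<close>).  So \<open>wsl\<close> is a product of copies of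
  \<open>sl\<close> with the product topology, which is separated and complete; \<open>[wsl, gam j]\<close> vanishes
  for \<open>j \<ge> 1\<close>; and \<open>\<kappa>\<^sub>j\<close> identifies \<open>gam j / gam (j + 1)\<close> with the \<open>j\<close>-th Frobenius twist of \<open>sl\<close>.
  A twist by means of an arbitrary basis of \<open>sl\<close> is compared in \<open>twist_iso\<close> with the twist by
  the Frobenius of the matrix entries.

  The Lie algebra of a root subgroup consists of the \<open>x\<close> for which all \<open>\<kappa>\<^sub>l(x)\<close> are multiples of the
  matrix unit.  Its \<open>p\<close>-th power map shifts the level by one, with a factor \<open>- (p - 1)!\<close> and a Frobenius
  (\<open>kpa_ppower_root\<close>); this comes from lifting the invariant derivation of the additive group of Witt
  vectors to integral polynomials, where it can be evaluated by ghost components.  Hence the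
  image of the \<open>p\<close>-th power is \<open>\<kappa>\<^sub>0 = 0\<close>, the root vector is the matrix unit at level \<open>0\<close>, and its
  iterated \<open>p\<close>-th power is a multiple of the matrix unit at level \<open>j\<close>, on which the torus acts by
  \<open>p\<^sup>j\<alpha>\<close>.  It follows that \<open>g0\<close> is the set of \<open>x\<close> with \<open>\<kappa>\<^sub>l(x) = 0\<close> for \<open>l \<ge> 1\<close>, which is
  stable under the group and isomorphic to \<open>sl\<close> by \<open>\<kappa>\<^sub>0\<close>.  Elements of the Lie algebras of the two tori
  have only diagonal coordinates, so their weight is \<open>0\<close>.
\<close>

no_notation fps_nth (infixl \<open>$\<close> 75)

section \<open>Dual numbers\<close>

datatype 'a dual = Dual (dre: 'a) (deps: 'a)

instantiation dual :: (comm_ring_1) comm_ring_1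
begin

definition "0 = Dual 0 0"
definition "1 = Dual 1 0"
definition "x + y = Dual (dre x + dre y) (deps x + deps y)"
definition "x - y = Dual (dre x - dre y) (deps x - deps y)"
definition "- x = Dual (- dre x) (- deps x)"
definition "x * y = Dual (dre x * dre y) (dre x * deps y + deps x * dre y)"

instance
  by standard (auto simp: zero_dual_def one_dual_def plus_dual_def minus_dual_def uminus_dual_def
      times_dual_def algebra_simps)

end

lemma dual_simps [simp]:
  "dre 0 = 0" "deps 0 = 0" "dre 1 = 1" "deps 1 = 0"
  "dre (x + y) = dre x + dre y" "deps (x + y) = deps x + deps y"
  "dre (x - y) = dre x - dre y" "deps (x - y) = deps x - deps y"
  "dre (- x) = - dre x" "deps (- x) = - deps x"
  "dre (x * y) = dre x * dre y" "deps (x * y) = dre x * deps y + deps x * dre y"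
  by (simp_all add: zero_dual_def one_dual_def plus_dual_def minus_dual_def uminus_dual_def
      times_dual_def)

lemma dre_power [simp]: "dre (x ^ n) = dre x ^ n"
  by (induction n) auto

lemma of_nat_dual: "of_nat n = Dual (of_nat n) 0"
  by (induction n) (auto intro!: dual.expand)

lemma CHAR_dual: "CHAR('a::comm_ring_1 dual) = CHAR('a)"
  by (rule CHAR_eqI) (auto simp: of_nat_dual zero_dual_def of_nat_eq_0_iff_char_dvd)

instance dual :: (comm_ring_prime_char) comm_ring_prime_char
  by standard (use CHAR_prime[where ?'a='a] in \<open>auto simp: of_nat_dual zero_dual_def intro!: exI[of _ "CHAR('a)"]\<close>)

lemma Dual_0_mult: "Dual 0 a * Dual 0 b = 0"
  by (auto intro!: dual.expand)

lemma Dual_0_power: "n \<ge> 2 \<Longrightarrow> Dual 0 a ^ n = 0"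
  using Dual_0_mult[of a a] by (cases n rule: nat.exhaust; cases "n - 1") (auto simp: mult.assoc[symmetric])

section \<open>Homomorphisms from rings of functions\<close>

text \<open>Regular functions on a set of matrices, Laurent polynomials on the punctured line and certain
  functions of two matrices all form such rings; Witt vectors over \<open>R\<close> are treated as
  Witt vector valued functions with components in \<open>R\<close>.\<close>

locale fun_ring =
  fixes R :: "('x \<Rightarrow> 'k::comm_ring_1) set"
  assumes const_mem: "(\<lambda>_. c) \<in> R"
    and add_mem: "f \<in> R \<Longrightarrow> g \<in> R \<Longrightarrow> (\<lambda>x. f x + g x) \<in> R"
    and mult_mem: "f \<in> R \<Longrightarrow> g \<in> R \<Longrightarrow> (\<lambda>x. f x * g x) \<in> R"
begin

lemma power_mem: "f \<in> R \<Longrightarrow> (\<lambda>x. f x ^ n) \<in> R"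
  by (induction n) (auto simp: const_mem mult_mem)

lemma prod_mem: "(\<And>a. a \<in> A \<Longrightarrow> f a \<in> R) \<Longrightarrow> (\<lambda>x. \<Prod>a\<in>A. f a x) \<in> R"
  by (induction A rule: infinite_finite_induct) (auto simp: const_mem mult_mem)

lemma sum_mem: "(\<And>a. a \<in> A \<Longrightarrow> f a \<in> R) \<Longrightarrow> (\<lambda>x. \<Sum>a\<in>A. f a x) \<in> R"
  by (induction A rule: infinite_finite_induct) (auto simp: const_mem add_mem)

lemma mon_eval_mem:
  assumes "\<And>c i. (\<lambda>g. v g c i) \<in> R"
  shows "(\<lambda>g. mon_eval (v g) m) \<in> R"
  unfolding mon_eval_def case_prod_unfold by (intro prod_mem power_mem assms)

lemma weval_mem:
  assumes "\<And>c i. (\<lambda>g. v g c i) \<in> R"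
  shows "(\<lambda>g. weval (v g) P) \<in> R"
  unfolding weval_def by (intro sum_mem mult_mem const_mem mon_eval_mem assms)

end

definition wfun :: "('x \<Rightarrow> 'k) set \<Rightarrow> ('x \<Rightarrow> 'k witt) set" where
  "wfun R = {x. \<forall>l. (\<lambda>g. wcoeff (x g) l) \<in> R}"

text \<open>The map \<open>W(\<theta>)\<close> for a homomorphism \<open>\<theta>\<close> from a ring of functions.  That it is a ring homomorphism
  reduces differentiation of Witt vector arithmetic to computing with Witt vectors over dual numbers.\<close>

definition wmap :: "(('x \<Rightarrow> 'k) \<Rightarrow> 'b) \<Rightarrow> ('x \<Rightarrow> 'k witt) \<Rightarrow> 'b witt" where
  "wmap \<theta> x = Witt (\<lambda>l. \<theta> (\<lambda>g. wcoeff (x g) l))"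

lemma wcoeff_Witt [simp]: "wcoeff (Witt f) = f"
  by (simp add: Witt_inverse)

lemma witt_eqI: "(\<And>l. wcoeff x l = wcoeff y l) \<Longrightarrow> x = y"
  by (metis ext wcoeff_inject)

lemma wcoeff_wmap [simp]: "wcoeff (wmap \<theta> x) l = \<theta> (\<lambda>g. wcoeff (x g) l)"
  by (simp add: wmap_def)

lemma wcoeff_0 [simp]: "wcoeff 0 l = 0"
  by (simp add: zero_witt_def)

lemma wcoeff_1: "wcoeff 1 l = (if l = 0 then 1 else 0)"
  by (simp add: one_witt_def)

lemma wcoeff_add: "wcoeff (x + y) l =
    weval (pair_args (wcoeff x) (wcoeff y)) (wadd_poly CHAR('a) l)"
  for x y :: "'a::comm_ring_prime_char witt"
  by (simp add: plus_witt_def)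

lemma wcoeff_mult: "wcoeff (x * y) l =
    weval (pair_args (wcoeff x) (wcoeff y)) (wmult_poly CHAR('a) l)"
  for x y :: "'a::comm_ring_prime_char witt"
  by (simp add: times_witt_def)

lemma wcoeff_uminus: "wcoeff (- x) l =
    weval (pair_args (wcoeff x) (wcoeff x)) (wneg_poly CHAR('a) l)"
  for x :: "'a::comm_ring_prime_char witt"
  by (simp add: uminus_witt_def)

locale fun_hom = fun_ring R for R :: "('x \<Rightarrow> 'k::comm_ring_1) set" +
  fixes \<theta> :: "('x \<Rightarrow> 'k) \<Rightarrow> 'b::comm_ring_1"
  assumes hom_add: "f \<in> R \<Longrightarrow> g \<in> R \<Longrightarrow> \<theta> (\<lambda>x. f x + g x) = \<theta> f + \<theta> g"
    and hom_mult: "f \<in> R \<Longrightarrow> g \<in> R \<Longrightarrow> \<theta> (\<lambda>x. f x * g x) = \<theta> f * \<theta> g"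
    and hom_1: "\<theta> (\<lambda>_. 1) = 1"
begin

lemma hom_0: "\<theta> (\<lambda>_. 0) = 0"
  using hom_add[OF const_mem const_mem, of 0 0] by simp

lemma hom_of_nat: "\<theta> (\<lambda>_. of_nat n) = of_nat n"
  by (induction n) (auto simp: hom_0 hom_1 hom_add const_mem)

lemma hom_of_int: "\<theta> (\<lambda>_. of_int n) = of_int n"
proof -
  have "\<theta> (\<lambda>_. of_nat m) + \<theta> (\<lambda>_. - of_nat m) = 0" for m
    by (subst hom_add[symmetric]) (auto simp: const_mem hom_0)
  hence "\<theta> (\<lambda>_. - of_nat m) = - of_nat m" for m
    by (metis hom_of_nat neg_eq_iff_add_eq_0)
  thus ?thesis
    by (cases n rule: int_cases2) (auto simp: hom_of_nat)
qed

lemma hom_power: "f \<in> R \<Longrightarrow> \<theta> (\<lambda>x. f x ^ n) = \<theta> f ^ n"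
  by (induction n) (auto simp: hom_1 hom_mult power_mem)

lemma hom_prod:
  "(\<And>a. a \<in> A \<Longrightarrow> f a \<in> R) \<Longrightarrow> \<theta> (\<lambda>x. \<Prod>a\<in>A. f a x) = (\<Prod>a\<in>A. \<theta> (f a))"
  by (induction A rule: infinite_finite_induct) (auto simp: hom_1 hom_mult prod_mem)

lemma hom_sum:
  "(\<And>a. a \<in> A \<Longrightarrow> f a \<in> R) \<Longrightarrow> \<theta> (\<lambda>x. \<Sum>a\<in>A. f a x) = (\<Sum>a\<in>A. \<theta> (f a))"
  by (induction A rule: infinite_finite_induct) (auto simp: hom_0 hom_add sum_mem)

lemma hom_weval:
  assumes "\<And>c i. (\<lambda>g. v g c i) \<in> R"
  shows "\<theta> (\<lambda>g. weval (v g) P) = weval (\<lambda>c i. \<theta> (\<lambda>g. v g c i)) P"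
  unfolding weval_def mon_eval_def case_prod_unfold
  by (subst hom_sum hom_mult hom_prod hom_power; (intro sum_mem mult_mem const_mem prod_mem power_mem assms)?)+
     (simp add: hom_of_int hom_prod hom_power assms power_mem hom_mult const_mem prod_mem)

end

lemma weval_hom:
  assumes "\<And>a b. h (a + b) = h a + h b" "\<And>a b. h (a * b) = h a * h b" "h 1 = 1"
  shows "h (weval v P) = weval (\<lambda>c i. h (v c i)) P"
proof -
  interpret fun_hom UNIV "\<lambda>f :: unit \<Rightarrow> 'a. h (f ())"
    by unfold_locales (auto simp: assms)
  show ?thesis using hom_weval[of "\<lambda>_. v" P] by simp
qed

lemma CHAR_eq_of_hom:
  assumes "fun_hom R (\<theta> :: ('x \<Rightarrow> 'k::comm_ring_prime_char) \<Rightarrow> 'b::comm_ring_prime_char)"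
  shows "CHAR('b) = CHAR('k)"
proof -
  interpret fun_hom R \<theta> by fact
  have "of_nat CHAR('k) = (0 :: 'b)"
    using hom_of_nat[of "CHAR('k)"] hom_0 by simp
  hence "CHAR('b) dvd CHAR('k)" by (simp add: of_nat_eq_0_iff_char_dvd)
  thus ?thesis using CHAR_prime[where ?'a='k] CHAR_prime[where ?'a='b] primes_dvd_imp_eq by blast
qed

locale wfun_ring = fun_ring R for R :: "('x \<Rightarrow> 'k::comm_ring_prime_char) set"
begin

lemma pair_args_mem: "x \<in> wfun R \<Longrightarrow> y \<in> wfun R \<Longrightarrow>
    (\<lambda>g. pair_args (wcoeff (x g)) (wcoeff (y g)) c i) \<in> R"
  by (cases "c = 0") (auto simp: wfun_def pair_args_def)

lemma wfun_const: "(\<lambda>_. a) \<in> wfun R"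
  by (auto simp: wfun_def const_mem)

lemma wfun_add: "x \<in> wfun R \<Longrightarrow> y \<in> wfun R \<Longrightarrow> (\<lambda>g. x g + y g) \<in> wfun R"
  unfolding wfun_def[of R] by (auto simp: wcoeff_add wfun_def intro!: weval_mem pair_args_mem)

lemma wfun_mult: "x \<in> wfun R \<Longrightarrow> y \<in> wfun R \<Longrightarrow> (\<lambda>g. x g * y g) \<in> wfun R"
  unfolding wfun_def[of R] by (auto simp: wcoeff_mult wfun_def intro!: weval_mem pair_args_mem)

lemma wfun_uminus: "x \<in> wfun R \<Longrightarrow> (\<lambda>g. - x g) \<in> wfun R"
  unfolding wfun_def[of R] by (auto simp: wcoeff_uminus wfun_def intro!: weval_mem pair_args_mem)

lemma wfun_diff: "x \<in> wfun R \<Longrightarrow> y \<in> wfun R \<Longrightarrow> (\<lambda>g. x g - y g) \<in> wfun R"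
  using wfun_add[of x "\<lambda>g. - y g"] wfun_uminus[of y] by simp

lemma wfun_sum: "(\<And>a. a \<in> A \<Longrightarrow> f a \<in> wfun R) \<Longrightarrow> (\<lambda>g. \<Sum>a\<in>A. f a g) \<in> wfun R"
  by (induction A rule: infinite_finite_induct) (auto simp: wfun_const wfun_add)

lemma wfun_prod: "(\<And>a. a \<in> A \<Longrightarrow> f a \<in> wfun R) \<Longrightarrow> (\<lambda>g. \<Prod>a\<in>A. f a g) \<in> wfun R"
  by (induction A rule: infinite_finite_induct) (auto simp: wfun_const wfun_mult)

end

locale wfun_hom = fun_hom R \<theta> for R :: "('x \<Rightarrow> 'k::comm_ring_prime_char) set"
  and \<theta> :: "('x \<Rightarrow> 'k) \<Rightarrow> 'b::comm_ring_prime_char"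

sublocale wfun_hom \<subseteq> wfun_ring ..

context wfun_hom
begin

lemma CHAR_eq: "CHAR('b) = CHAR('k)"
  by (rule CHAR_eq_of_hom) unfold_locales

lemma wmap_pair_args: "(\<lambda>c i. \<theta> (\<lambda>g. pair_args (wcoeff (x g)) (wcoeff (y g)) c i)) =
    pair_args (wcoeff (wmap \<theta> x)) (wcoeff (wmap \<theta> y))"
  by (auto simp: pair_args_def fun_eq_iff)

lemma wmap_add:
  assumes "x \<in> wfun R" "y \<in> wfun R"
  shows "wmap \<theta> (\<lambda>g. x g + y g) = wmap \<theta> x + wmap \<theta> y"
  by (rule witt_eqI, simp add: wcoeff_add hom_weval pair_args_mem assms wmap_pair_args CHAR_eq)

lemma wmap_mult:
  assumes "x \<in> wfun R" "y \<in> wfun R"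
  shows "wmap \<theta> (\<lambda>g. x g * y g) = wmap \<theta> x * wmap \<theta> y"
  by (rule witt_eqI, simp add: wcoeff_mult hom_weval pair_args_mem assms wmap_pair_args CHAR_eq)

lemma wmap_0: "wmap \<theta> (\<lambda>_. 0) = 0"
  by (rule witt_eqI) (simp add: hom_0)

lemma wmap_1: "wmap \<theta> (\<lambda>_. 1) = 1"
  by (rule witt_eqI) (simp add: wcoeff_1 hom_0 hom_1)

lemma wmap_uminus:
  assumes "x \<in> wfun R"
  shows "wmap \<theta> (\<lambda>g. - x g) = - wmap \<theta> x"
  by (rule witt_eqI, simp add: wcoeff_uminus hom_weval pair_args_mem assms wmap_pair_args CHAR_eq)

lemma wmap_diff:
  assumes "x \<in> wfun R" "y \<in> wfun R"
  shows "wmap \<theta> (\<lambda>g. x g - y g) = wmap \<theta> x - wmap \<theta> y"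
  using wmap_add[of x "\<lambda>g. - y g"] wmap_uminus[of y] assms wfun_uminus by simp

lemma wmap_sum:
  "(\<And>a. a \<in> A \<Longrightarrow> f a \<in> wfun R) \<Longrightarrow> wmap \<theta> (\<lambda>g. \<Sum>a\<in>A. f a g) = (\<Sum>a\<in>A. wmap \<theta> (f a))"
  by (induction A rule: infinite_finite_induct) (auto simp: wmap_0 wmap_add wfun_sum)

lemma wmap_prod:
  "(\<And>a. a \<in> A \<Longrightarrow> f a \<in> wfun R) \<Longrightarrow> wmap \<theta> (\<lambda>g. \<Prod>a\<in>A. f a g) = (\<Prod>a\<in>A. wmap \<theta> (f a))"
  by (induction A rule: infinite_finite_induct) (auto simp: wmap_1 wmap_mult wfun_prod)

lemma wmap_of_int: "wmap \<theta> (\<lambda>_. of_int n) = of_int n"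
proof -
  have "wmap \<theta> (\<lambda>_. of_nat n) = of_nat n" for n
    by (induction n) (auto simp: wmap_0 wmap_1 wmap_add wfun_const)
  thus ?thesis
    by (cases n rule: int_cases2) (auto simp: wmap_uminus wfun_const)
qed

end

subsection \<open>Matrices\<close>

definition mfun :: "('x \<Rightarrow> 'k) set \<Rightarrow> ('x \<Rightarrow> ('k, 'n::finite) wmat) set" where
  "mfun R = {A. \<forall>i j. (\<lambda>g. A g $ i $ j) \<in> wfun R}"

definition mmap :: "(('x \<Rightarrow> 'k) \<Rightarrow> 'b) \<Rightarrow> ('x \<Rightarrow> ('k, 'n::finite) wmat) \<Rightarrow> ('b, 'n) wmat" where
  "mmap \<theta> A = (\<chi> i j. wmap \<theta> (\<lambda>g. A g $ i $ j))"

lemma mmap_nth [simp]: "mmap \<theta> A $ i $ j = wmap \<theta> (\<lambda>g. A g $ i $ j)"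
  by (simp add: mmap_def)

context wfun_ring
begin

lemma mfun_const: "(\<lambda>_. A) \<in> mfun R"
  by (auto simp: mfun_def wfun_const)

lemma mfun_add: "A \<in> mfun R \<Longrightarrow> B \<in> mfun R \<Longrightarrow> (\<lambda>g. A g + B g) \<in> mfun R"
  by (auto simp: mfun_def intro!: wfun_add)

lemma mfun_diff: "A \<in> mfun R \<Longrightarrow> B \<in> mfun R \<Longrightarrow> (\<lambda>g. A g - B g) \<in> mfun R"
  by (auto simp: mfun_def intro!: wfun_diff)

lemma mfun_mult: "A \<in> mfun R \<Longrightarrow> B \<in> mfun R \<Longrightarrow> (\<lambda>g. A g ** B g) \<in> mfun R"
  by (auto simp: mfun_def matrix_matrix_mult_def intro!: wfun_sum wfun_mult)

lemma wfun_det: "A \<in> mfun R \<Longrightarrow> (\<lambda>g. det (A g)) \<in> wfun R"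
  by (auto simp: mfun_def det_def intro!: wfun_sum wfun_mult wfun_prod wfun_const)

end

context wfun_hom
begin

lemma mmap_add: "A \<in> mfun R \<Longrightarrow> B \<in> mfun R \<Longrightarrow>
    mmap \<theta> (\<lambda>g. A g + B g) = mmap \<theta> A + mmap \<theta> B"
  by (auto simp: mfun_def vec_eq_iff wmap_add)

lemma mmap_mult: "A \<in> mfun R \<Longrightarrow> B \<in> mfun R \<Longrightarrow>
    mmap \<theta> (\<lambda>g. A g ** B g) = mmap \<theta> A ** mmap \<theta> B"
  by (auto simp: mfun_def vec_eq_iff matrix_matrix_mult_def wmap_sum wmap_mult wfun_mult)

lemma wmap_det:
  assumes "A \<in> mfun R" shows "wmap \<theta> (\<lambda>g. det (A g)) = det (mmap \<theta> A)"
proof -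
  have A: "(\<lambda>g. A g $ i $ j) \<in> wfun R" for i j using assms by (auto simp: mfun_def)
  show ?thesis
    unfolding det_def
    by (simp add: wmap_sum wmap_mult wmap_prod wmap_of_int wfun_mult wfun_prod wfun_const A)
qed

lemma mmap_one: "mmap \<theta> (\<lambda>_. mat 1) = mat 1"
  by (auto simp: vec_eq_iff mat_def wmap_0 wmap_1)

end

section \<open>Witt vectors with nilpotent components\<close>

lemma mon_eval_pair_args_split:
  assumes "\<And>i j. x i * y j = (0 :: 'a::comm_ring_1)"
  shows "mon_eval (pair_args x y) m + mon_eval (pair_args (\<lambda>_. 0) (\<lambda>_. 0)) m =
    mon_eval (pair_args x (\<lambda>_. 0)) m + mon_eval (pair_args (\<lambda>_. 0) y) m"
proof -
  let ?K = "Poly_Mapping.keys m"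
  have fin: "finite ?K" by simp
  consider (mixed) i c j where "(0, i) \<in> ?K" "(c, j) \<in> ?K" "c \<noteq> 0"
    | (x) "\<And>c i. (c, i) \<in> ?K \<Longrightarrow> c = 0" | (y) "\<And>c i. (c, i) \<in> ?K \<Longrightarrow> c \<noteq> 0"
    by metis
  thus ?thesis
  proof cases
    case mixed
    have 0: "mon_eval (pair_args u v) m = 0" if "\<And>i j. u i * v j = (0::'a)" for u v
    proof -
      let ?f = "\<lambda>a. (case a of (c, i) \<Rightarrow> pair_args u v c i ^ Poly_Mapping.lookup m (c, i))"
      have "mon_eval (pair_args u v) m = ?f (0, i) * (?f (c, j) * prod ?f (?K - {(0, i)} - {(c, j)}))"
        unfolding mon_eval_def using mixed
        by (subst prod.remove[of _ "(0, i)"], simp, simp, subst prod.remove[of _ "(c, j)"]) auto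
      moreover have "?f (0, i) * ?f (c, j) = 0"
      proof -
        obtain k l where "Poly_Mapping.lookup m (0, i) = Suc k" "Poly_Mapping.lookup m (c, j) = Suc l"
          using mixed by (metis in_keys_iff not0_implies_Suc)
        hence "?f (0, i) * ?f (c, j) = (u i * v j) * (u i ^ k * v j ^ l)"
          using mixed by (simp add: pair_args_def algebra_simps)
        thus ?thesis by (simp add: that)
      qed
      ultimately show ?thesis by (simp add: mult.assoc[symmetric])
    qed
    show ?thesis using 0[of x y] 0[of x "\<lambda>_. 0"] 0[of "\<lambda>_. 0" y] 0[of "\<lambda>_. 0" "\<lambda>_. 0"] assms by simp
  next
    case x
    have "mon_eval (pair_args u v) m = mon_eval (pair_args u w) m" for u v w :: "nat \<Rightarrow> 'a"
      unfolding mon_eval_def using x by (intro prod.cong) (auto simp: pair_args_def)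
    thus ?thesis by (metis add.commute)
  next
    case y
    have "mon_eval (pair_args u v) m = mon_eval (pair_args w v) m" for u v w :: "nat \<Rightarrow> 'a"
      unfolding mon_eval_def by (intro prod.cong) (auto simp: pair_args_def dest: y)
    from this[of x y "\<lambda>_. 0"] this[of x "\<lambda>_. 0" "\<lambda>_. 0"] show ?thesis by simp
  qed
qed

text \<open>A polynomial in orthogonal families of arguments has no mixed terms; the constant term occurs
  once in each of the two partial evaluations.\<close>

lemma weval_pair_args_split:
  assumes "\<And>i j. x i * y j = (0 :: 'a::comm_ring_1)"
  shows "weval (pair_args x y) P + weval (pair_args (\<lambda>_. 0) (\<lambda>_. 0)) P =
    weval (pair_args x (\<lambda>_. 0)) P + weval (pair_args (\<lambda>_. 0) y) P"
proof -
  have "of_int c * mon_eval (pair_args x y) m + of_int c * mon_eval (pair_args (\<lambda>_. 0) (\<lambda>_. 0)) m =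
    of_int c * mon_eval (pair_args x (\<lambda>_. 0)) m + of_int c * mon_eval (pair_args (\<lambda>_. 0) y) m" for c m
    by (simp only: distrib_left[symmetric] mon_eval_pair_args_split[OF assms])
  thus ?thesis unfolding weval_def sum.distrib[symmetric] by (intro sum.cong) auto
qed

text \<open>By \<open>weval_pair_args_split\<close> the addition polynomial may be evaluated with one of the two
  summands replaced by \<open>0\<close>, where it returns the other one.\<close>

lemma wcoeff_add_orthogonal:
  fixes x y :: "'a::comm_ring_prime_char witt"
  assumes "\<And>i j. wcoeff x i * wcoeff y j = 0"
  shows "wcoeff (x + y) l = wcoeff x l + wcoeff y l"
proof -
  have z: "wcoeff 0 = (\<lambda>_. 0 :: 'a)" by (simp add: zero_witt_def)
  have "wcoeff (x + y) l + wcoeff (0 + 0 :: 'a witt) l = wcoeff (x + 0) l + wcoeff (0 + y) l"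
    unfolding wcoeff_add z by (rule weval_pair_args_split) (rule assms)
  thus ?thesis by simp
qed

text \<open>Over such a ring a Witt vector is determined by its ghost components, so identities are proved there
  and then specialised.\<close>

definition torsion_free :: "nat \<Rightarrow> 'a::comm_ring_1 itself \<Rightarrow> bool" where
  "torsion_free p _ \<longleftrightarrow> (\<forall>k a b. of_nat p ^ k * (a :: 'a) = of_nat p ^ k * b \<longrightarrow> a = b)"

lemma ghost_inj_torsion_free:
  fixes a b :: "nat \<Rightarrow> 'a::comm_ring_1"
  assumes "torsion_free p TYPE('a)" "\<And>m. m \<le> n \<Longrightarrow> ghost p m a = ghost p m b"
  shows "a n = b n"
  using assms(2)
proof (induction n rule: less_induct)
  case (less n)
  have "(\<Sum>i<n. of_nat p ^ i * a i ^ (p ^ (n - i))) = (\<Sum>i<n. of_nat p ^ i * b i ^ (p ^ (n - i)))"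
    using less by (intro sum.cong) auto
  hence "of_nat p ^ n * a n = of_nat p ^ n * b n"
    using less.prems[of n] by (simp add: ghost_Suc_split)
  thus ?case using assms(1) unfolding torsion_free_def by blast
qed

lemma torsion_free_wpoly: "p > 0 \<Longrightarrow> torsion_free p TYPE(wpoly)"
  unfolding torsion_free_def using wpoly_torsion_free by blast

lemma of_nat_dual_mult:
  "dre (of_nat n ^ k * x) = of_nat n ^ k * dre x" "deps (of_nat n ^ k * x) = of_nat n ^ k * deps x"
  by (simp_all flip: of_nat_power add: of_nat_dual[of "n ^ k"])

lemma torsion_free_dual:
  assumes "torsion_free p TYPE('a::comm_ring_1)"
  shows "torsion_free p TYPE('a dual)"
  unfolding torsion_free_def
proof (intro allI impI)
  fix k and a b :: "'a dual"
  assume *: "of_nat p ^ k * a = of_nat p ^ k * b"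
  have "of_nat p ^ k * dre a = of_nat p ^ k * dre b" "of_nat p ^ k * deps a = of_nat p ^ k * deps b"
    using arg_cong[OF *, of dre] arg_cong[OF *, of deps] by (simp_all only: of_nat_dual_mult)
  thus "a = b" using assms unfolding torsion_free_def by (metis dual.expand)
qed

lemma ghost_Dual_0:
  assumes "p \<ge> 2"
  shows "ghost p n (\<lambda>i. Dual 0 (y i)) = of_nat p ^ n * Dual 0 (y n :: 'a::comm_ring_1)"
proof -
  have "p ^ (n - i) \<ge> 2" if "i < n" for i
    using assms that power_increasing[of 1 "n - i" p] by (simp add: Suc_le_eq)
  hence "(\<Sum>i<n. of_nat p ^ i * Dual 0 (y i) ^ p ^ (n - i)) = 0"
    by (intro sum.neutral) (auto simp: Dual_0_power)
  thus ?thesis by (simp add: ghost_Suc_split)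
qed

lemma dre_sum: "dre (sum f A) = (\<Sum>a\<in>A. dre (f a))"
  by (induction A rule: infinite_finite_induct) auto

lemma deps_sum: "deps (sum f A) = (\<Sum>a\<in>A. deps (f a))"
  by (induction A rule: infinite_finite_induct) auto

lemma dre_ghost: "dre (ghost p n a) = ghost p n (\<lambda>i. dre (a i))"
  by (simp add: ghost_def dre_sum flip: of_nat_power) (simp add: of_nat_dual)

text \<open>The ghost components of \<open>(\<epsilon>y\<^sub>0, \<epsilon>y\<^sub>1, \<dots>)\<close> are \<open>p\<^sup>l \<epsilon> y\<^sub>l\<close>, because \<open>\<epsilon>\<^sup>2 = 0\<close>.  The product therefore has the ghost
  components \<open>p\<^sup>l \<epsilon> w\<^sub>l(x) y\<^sub>l\<close>, where \<open>w\<^sub>l(x)\<close> is the ghost component of the generic vector \<open>x\<close>, and these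
  belong to the Witt vector with the components \<open>\<epsilon> w\<^sub>l(x) y\<^sub>l\<close>.\<close>

lemma wmult_poly_Dual:
  assumes p: "Factorial_Ring.prime p"
  shows "weval (pair_args (\<lambda>i. Dual (wvar 0 i) (wvar 2 i)) (\<lambda>i. Dual 0 (wvar 1 i))) (wmult_poly p l) =
    Dual 0 (ghost p l (wvar 0) * wvar 1 l)"
proof (rule ghost_inj_torsion_free)
  let ?e = "weval (pair_args (\<lambda>i. Dual (wvar 0 i) (wvar 2 i)) (\<lambda>i. Dual 0 (wvar 1 i)))"
  let ?a = "\<lambda>i. Dual (wvar 0 i) (wvar 2 i)"
  have p2: "p \<ge> 2" using p prime_ge_2_nat by blast
  thus "torsion_free p TYPE(wpoly dual)" by (intro torsion_free_dual torsion_free_wpoly) auto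
  fix n
  have "ghost p n (\<lambda>l. ?e (wmult_poly p l)) = ?e (ghost p n (wmult_poly p))"
    by (simp add: weval_ghost)
  also have "\<dots> = ghost p n ?a * ghost p n (\<lambda>i. Dual 0 (wvar 1 i))"
    by (simp add: ghost_wmult_poly[OF p] weval_mult weval_ghost pair_args_def)
  also have "\<dots> = of_nat p ^ n * (ghost p n ?a * Dual 0 (wvar 1 n))"
    by (simp only: ghost_Dual_0[OF p2] ac_simps)
  also have "ghost p n ?a * Dual 0 (wvar 1 n) = Dual 0 (ghost p n (wvar 0) * wvar 1 n)"
    by (rule dual.expand) (simp add: dre_ghost)
  finally show "ghost p n (\<lambda>l. ?e (wmult_poly p l)) = ghost p n (\<lambda>l. Dual 0 (ghost p l (wvar 0) * wvar 1 l))"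
    by (simp only: ghost_Dual_0[OF p2])
qed

definition epsw :: "(nat \<Rightarrow> 'a) \<Rightarrow> 'a::zero dual witt" where
  "epsw y = Witt (\<lambda>l. Dual 0 (y l))"

lemma wcoeff_epsw [simp]: "wcoeff (epsw y) l = Dual 0 (y l)"
  by (simp add: epsw_def)

lemma epsw_eqI: "(\<And>l. dre (wcoeff x l) = 0) \<Longrightarrow> x = epsw (\<lambda>l. deps (wcoeff x l))"
  by (intro witt_eqI dual.expand) auto

lemma ghost_char_p:
  fixes a :: "nat \<Rightarrow> 'a::comm_ring_prime_char"
  shows "ghost CHAR('a) l a = a 0 ^ (CHAR('a) ^ l)"
proof -
  have "ghost CHAR('a) l a = (\<Sum>i\<le>l. if i = 0 then a 0 ^ (CHAR('a) ^ l) else 0)"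
    unfolding ghost_def by (intro sum.cong) (auto simp: power_0_left)
  thus ?thesis by simp
qed

text \<open>Specialisation of \<open>wmult_poly_Dual\<close>: in characteristic \<open>p\<close> the ghost component of index \<open>l\<close> is
  the \<open>p\<^sup>l\<close>-th power of the component of index \<open>0\<close>.  This is the source of all Frobenius twists.\<close>

lemma mult_epsw:
  fixes x :: "'a::comm_ring_prime_char dual witt"
  shows "x * epsw y = epsw (\<lambda>l. dre (wcoeff x 0) ^ (CHAR('a) ^ l) * y l)"
proof (rule witt_eqI)
  fix l
  define v where "v c i = (if c = 0 then dre (wcoeff x i) else if c = 1 then y i else deps (wcoeff x i))"
    for c i :: nat
  define h where "h z = Dual (weval v (dre z)) (weval v (deps z))" for z
  have hh: "h (a + b) = h a + h b" "h (a * b) = h a * h b" "h 1 = 1" for a b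
    by (auto simp: h_def weval_add weval_mult intro!: dual.expand)
  have "(\<lambda>c i. h (pair_args (\<lambda>i. Dual (wvar 0 i) (wvar 2 i)) (\<lambda>i. Dual 0 (wvar 1 i)) c i)) =
      pair_args (wcoeff x) (wcoeff (epsw y))"
    by (auto simp: pair_args_def h_def v_def fun_eq_iff)
  hence "wcoeff (x * epsw y) l = h (weval (pair_args (\<lambda>i. Dual (wvar 0 i) (wvar 2 i)) (\<lambda>i. Dual 0 (wvar 1 i)))
       (wmult_poly CHAR('a) l))"
    by (simp add: weval_hom[of h, OF hh] wcoeff_mult CHAR_dual)
  also have "\<dots> = Dual 0 (ghost CHAR('a) l (v 0) * y l)"
    by (subst wmult_poly_Dual) (auto simp: h_def weval_mult weval_ghost v_def[of "Suc 0"])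
  also have "\<dots> = Dual 0 (dre (wcoeff x 0) ^ (CHAR('a) ^ l) * y l)"
    by (simp add: ghost_char_p v_def)
  finally show "wcoeff (x * epsw y) l = wcoeff (epsw (\<lambda>l. dre (wcoeff x 0) ^ (CHAR('a) ^ l) * y l)) l" by simp
qed

lemma add_epsw: "epsw y + epsw z = epsw (\<lambda>l. y l + z l :: 'a::comm_ring_prime_char)"
  by (rule witt_eqI, subst wcoeff_add_orthogonal) (auto simp: Dual_0_mult intro!: dual.expand)

lemma epsw_0: "epsw (\<lambda>_. 0) = 0"
  by (rule witt_eqI) (simp add: zero_dual_def)

lemma sum_epsw: "(\<Sum>a\<in>A. epsw (y a)) = epsw (\<lambda>l. \<Sum>a\<in>A. y a l :: 'a::comm_ring_prime_char)"
  by (induction A rule: infinite_finite_induct) (auto simp: epsw_0 add_epsw)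

lemma uminus_epsw: "- epsw y = epsw (\<lambda>l. - y l :: 'a::comm_ring_prime_char)"
  by (rule minus_unique) (simp add: add_epsw epsw_0)

lemma epsw_mult_epsw: "epsw y * epsw z = (0 :: 'a::comm_ring_prime_char dual witt)"
  by (simp add: mult_epsw power_0_left epsw_0)

section \<open>Congruence of Witt vectors modulo the components of large index\<close>

definition weq :: "nat \<Rightarrow> 'a witt \<Rightarrow> 'a witt \<Rightarrow> bool" where
  "weq m x y \<longleftrightarrow> (\<forall>l<m. wcoeff x l = wcoeff y l)"

text \<open>The ghost equations of index up to \<open>N\<close> determine the polynomial \<open>S N\<close> recursively, by division by powers of \<open>p\<close>.
  So if they only involve variables of index up to \<open>N\<close>, then so does \<open>S N\<close>; this makes truncation
  of Witt vectors compatible with the ring operations.\<close>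

lemma witt_poly_cut:
  assumes p: "p > 0" and S: "\<And>n. n \<le> N \<Longrightarrow> ghost p n (S :: nat \<Rightarrow> wpoly) = weval (\<lambda>c i. if i \<le> N then wvar c i else 0) (ghost p n S)"
    and v: "\<And>c i. i \<le> N \<Longrightarrow> v c i = w c i"
  shows "weval v (S N) = weval w (S N :: wpoly)"
proof -
  let ?\<sigma> = "\<lambda>c i. if i \<le> N then wvar c i else 0"
  have "S N = weval ?\<sigma> (S N)"
    by (rule ghost_inj[of N p S "\<lambda>n. weval ?\<sigma> (S n)" N, OF _ p order.refl], subst S) (simp_all add: weval_ghost)
  moreover have "weval v (weval ?\<sigma> (S N)) = weval w (weval ?\<sigma> (S N))"
    by (simp only: weval_weval, rule arg_cong2[of _ _ _ _ weval], intro ext) (auto simp: v)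
  ultimately show ?thesis by metis
qed

lemma weval_ghost_cut:
  assumes "n \<le> N"
  shows "weval (\<lambda>c i. if i \<le> N then wvar c i else 0) (ghost p n (wvar c)) = ghost p n (wvar c)"
  unfolding weval_ghost using assms by (auto simp: ghost_def intro!: sum.cong)

lemma weval_pair_args_cut:
  assumes "Factorial_Ring.prime p" "\<And>i. i \<le> l \<Longrightarrow> x i = x' i" "\<And>i. i \<le> l \<Longrightarrow> y i = y' i"
  shows "weval (pair_args x y) (wadd_poly p l) = weval (pair_args x' y') (wadd_poly p l)"
    "weval (pair_args x y) (wmult_poly p l) = weval (pair_args x' y') (wmult_poly p l)"
    "weval (pair_args x y) (wneg_poly p l) = weval (pair_args x' y') (wneg_poly p l)"
  using assms prime_gt_0_nat[OF assms(1)]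
  by (auto intro!: witt_poly_cut simp: ghost_wadd_poly ghost_wmult_poly ghost_wneg_poly
      weval_add weval_mult weval_uminus weval_ghost_cut pair_args_def)

lemma weq_refl [simp]: "weq m x x"
  by (simp add: weq_def)

lemma weq_sym: "weq m x y \<Longrightarrow> weq m y x"
  by (simp add: weq_def)

lemma weq_trans [trans]: "weq m x y \<Longrightarrow> weq m y z \<Longrightarrow> weq m x z"
  by (simp add: weq_def)

context
  fixes x x' y y' :: "'a::comm_ring_prime_char witt"
begin

lemma weq_add: "weq m x x' \<Longrightarrow> weq m y y' \<Longrightarrow> weq m (x + y) (x' + y')"
  unfolding weq_def wcoeff_add by (auto intro!: weval_pair_args_cut)

lemma weq_mult: "weq m x x' \<Longrightarrow> weq m y y' \<Longrightarrow> weq m (x * y) (x' * y')"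
  unfolding weq_def wcoeff_mult by (auto intro!: weval_pair_args_cut)

lemma weq_uminus: "weq m x x' \<Longrightarrow> weq m (- x) (- x')"
  unfolding weq_def wcoeff_uminus by (auto intro!: weval_pair_args_cut)

end

lemma weq_diff: "weq m x x' \<Longrightarrow> weq m y y' \<Longrightarrow> weq m (x - y) (x' - y')"
  for x y :: "'a::comm_ring_prime_char witt"
  using weq_add[OF _ weq_uminus, of m x x' y y'] by simp

lemma weq_sum: "(\<And>a. a \<in> A \<Longrightarrow> weq m (f a) (g a)) \<Longrightarrow> weq m (\<Sum>a\<in>A. f a) (\<Sum>a\<in>A. g a)"
  for f :: "_ \<Rightarrow> 'a::comm_ring_prime_char witt"
  by (induction A rule: infinite_finite_induct) (auto intro: weq_add)

lemma weq_prod: "(\<And>a. a \<in> A \<Longrightarrow> weq m (f a) (g a)) \<Longrightarrow> weq m (\<Prod>a\<in>A. f a) (\<Prod>a\<in>A. g a)"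
  for f :: "_ \<Rightarrow> 'a::comm_ring_prime_char witt"
  by (induction A rule: infinite_finite_induct) (auto intro: weq_mult)

lemma wcoeff_wtrunc: "wcoeff (wtrunc m x) l = (if l < m then wcoeff x l else 0)"
  by (simp add: wtrunc_def)

lemma weq_wtrunc [simp]: "weq m (wtrunc m x) x" "weq m x (wtrunc m x)"
  by (simp_all add: weq_def wcoeff_wtrunc)

lemma wtrunc_eq_iff: "wtrunc m x = wtrunc m y \<longleftrightarrow> weq m x y"
proof
  assume "wtrunc m x = wtrunc m y"
  thus "weq m x y" by (metis weq_wtrunc weq_trans)
next
  assume "weq m x y"
  thus "wtrunc m x = wtrunc m y" by (intro witt_eqI) (auto simp: weq_def wcoeff_wtrunc)
qed

definition mweq :: "nat \<Rightarrow> ('k, 'n::finite) wmat \<Rightarrow> ('k, 'n) wmat \<Rightarrow> bool" where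
  "mweq m A B \<longleftrightarrow> (\<forall>i j. weq m (A $ i $ j) (B $ i $ j))"

lemma mweq_refl [simp]: "mweq m A A"
  by (simp add: mweq_def)

lemma mweq_trans [trans]: "mweq m A B \<Longrightarrow> mweq m B C \<Longrightarrow> mweq m A C"
  unfolding mweq_def by (blast intro: weq_trans)

lemma mweq_add: "mweq m A A' \<Longrightarrow> mweq m B B' \<Longrightarrow> mweq m (A + B) (A' + B')"
  for A B :: "('k::comm_ring_prime_char, 'n::finite) wmat"
  unfolding mweq_def by (auto intro: weq_add)

lemma mweq_diff: "mweq m A A' \<Longrightarrow> mweq m B B' \<Longrightarrow> mweq m (A - B) (A' - B')"
  for A B :: "('k::comm_ring_prime_char, 'n::finite) wmat"
  unfolding mweq_def by (auto intro: weq_diff)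

lemma mweq_mult: "mweq m A A' \<Longrightarrow> mweq m B B' \<Longrightarrow> mweq m (A ** B) (A' ** B')"
  for A B :: "('k::comm_ring_prime_char, 'n::finite) wmat"
  unfolding mweq_def matrix_matrix_mult_def by (auto intro!: weq_sum weq_mult)

lemma weq_det: "mweq m A B \<Longrightarrow> weq m (det A) (det B)"
  for A B :: "('k::comm_ring_prime_char, 'n::finite) wmat"
  unfolding mweq_def det_def by (auto intro!: weq_sum weq_mult weq_prod)

lemma mtrunc_nth [simp]: "mtrunc m A $ i $ j = wtrunc m (A $ i $ j)"
  by (simp add: mtrunc_def)

lemma mweq_mtrunc [simp]: "mweq m (mtrunc m A) A" "mweq m A (mtrunc m A)"
  by (simp_all add: mweq_def)

lemma mtrunc_eq_iff: "mtrunc m A = mtrunc m B \<longleftrightarrow> mweq m A B"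
  by (simp add: mweq_def vec_eq_iff wtrunc_eq_iff)

section \<open>Regular functions on matrices of truncated Witt vectors\<close>

text \<open>Regular functions without a condition on the values outside \<open>S\<close>, so that functions given by
  formulas need not be extended by zero.\<close>

definition reg :: "('k::field_prime_char, 'n::finite) wmat set \<Rightarrow> (('k, 'n) wmat \<Rightarrow> 'k) set" where
  "reg S = {f. ext0 S f \<in> regfun wmat_coords S}"

lemma ext0_cong: "(\<And>x. x \<in> S \<Longrightarrow> f x = g x) \<Longrightarrow> ext0 S f = ext0 S g"
  by (auto simp: ext0_def)

lemma ext0_in [simp]: "x \<in> S \<Longrightarrow> ext0 S f x = f x"
  by (simp add: ext0_def)

lemma ext0_out: "x \<notin> S \<Longrightarrow> ext0 S f x = 0"
  by (simp add: ext0_def)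

lemma ext0_ext0 [simp]: "ext0 S (ext0 S f) = ext0 S f"
  by (auto simp: ext0_def)

lemma
  fixes f g :: "'a \<Rightarrow> 'k::comm_ring_1"
  shows ext0_add: "ext0 S (\<lambda>x. f x + g x) = ext0 S f + ext0 S g"
    and ext0_mult: "ext0 S (\<lambda>x. f x * g x) = ext0 S f * ext0 S g"
    and ext0_scale: "ext0 S (\<lambda>x. c * f x) = (\<lambda>x. c * ext0 S f x)"
  by (auto simp: ext0_def fun_eq_iff)

lemma regfun_ext0: "f \<in> regfun C S \<Longrightarrow> ext0 S f = f"
proof -
  have "f \<in> regfun C S \<Longrightarrow> x \<notin> S \<Longrightarrow> f x = 0" for x
    by (induction rule: regfun.induct) (auto simp: ext0_def)
  thus "f \<in> regfun C S \<Longrightarrow> ext0 S f = f" by (auto simp: ext0_def fun_eq_iff)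
qed

lemma regfun_reg: "f \<in> regfun wmat_coords S \<Longrightarrow> f \<in> reg S"
  by (simp add: reg_def regfun_ext0)

lemma reg_cong: "(\<And>x. x \<in> S \<Longrightarrow> f x = g x) \<Longrightarrow> f \<in> reg S \<longleftrightarrow> g \<in> reg S"
  unfolding reg_def using ext0_cong[of S f g] by simp

interpretation reg: wfun_ring "reg S" for S :: "('k::field_prime_char, 'n::finite) wmat set"
  by unfold_locales (auto simp: reg_def ext0_add ext0_mult intro: regfun.intros)

lemma reg_coord: "(\<lambda>A. wcoeff (A $ i $ j) l) \<in> reg S"
  unfolding reg_def by (auto simp: wmat_coords_def intro!: regfun.coord)

lemma reg_id: "(\<lambda>A. A) \<in> mfun (reg S)"
  by (auto simp: mfun_def wfun_def reg_coord)

lemma reg_induct [consumes 1, case_names cong const coord add mult]: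
  fixes S :: "('k::field_prime_char, 'n::finite) wmat set" and P :: "(('k, 'n) wmat \<Rightarrow> 'k) \<Rightarrow> bool"
  assumes f: "f \<in> reg S"
    and cong: "\<And>f g. (\<And>x. x \<in> S \<Longrightarrow> f x = g x) \<Longrightarrow> P f \<Longrightarrow> P g"
    and const: "\<And>c. P (\<lambda>_. c)"
    and coord: "\<And>i j l. P (\<lambda>A. wcoeff (A $ i $ j) l)"
    and add: "\<And>f g. f \<in> reg S \<Longrightarrow> g \<in> reg S \<Longrightarrow> P f \<Longrightarrow> P g \<Longrightarrow> P (\<lambda>x. f x + g x)"
    and mult: "\<And>f g. f \<in> reg S \<Longrightarrow> g \<in> reg S \<Longrightarrow> P f \<Longrightarrow> P g \<Longrightarrow> P (\<lambda>x. f x * g x)"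
  shows "P f"
proof -
  have "P h" if "h \<in> regfun wmat_coords S" for h
    using that
  proof (induction rule: regfun.induct)
    case (const c)
    show ?case by (rule cong[OF _ assms(3)[of c]]) simp
  next
    case (coord f)
    then obtain i j l where f: "f = (\<lambda>A. wcoeff (A $ i $ j) l)" by (auto simp: wmat_coords_def)
    show ?case by (rule cong[OF _ assms(4)[of i j l]]) (simp add: f)
  next
    case (add f g)
    show ?case
      by (rule cong[OF _ assms(5)[of f g]]) (use add in \<open>auto intro: regfun_reg\<close>)
  next
    case (mult f g)
    show ?case
      by (rule cong[OF _ assms(6)[of f g]]) (use mult in \<open>auto intro: regfun_reg\<close>)
  qed
  from this[of "ext0 S f"] f have "P (ext0 S f)" by (simp add: reg_def)
  thus ?thesis by (rule cong[rotated]) simp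
qed

section \<open>Submonoids of the truncated group\<close>

text \<open>The subgroups \<open>SL(n, W\<^sub>m)\<close> and the truncations of closed subgroups share the multiplication
  and differ only in the carrier.\<close>

definition wgrp :: "nat \<Rightarrow> ('k::field_prime_char, 'n::finite) wmat set \<Rightarrow> ('k, 'n) wmat monoid" where
  "wgrp m S = (SLWm m)\<lparr>carrier := S\<rparr>"

definition wcar :: "nat \<Rightarrow> ('k::field_prime_char, 'n::finite) wmat set" where
  "wcar m = {A. mtrunc m A = A \<and> weq m (det A) 1}"

lemma wgrp_simps [simp]:
  "carrier (wgrp m S) = S" "A \<otimes>\<^bsub>wgrp m S\<^esub> B = mtrunc m (A ** B)" "\<one>\<^bsub>wgrp m S\<^esub> = mtrunc m (mat 1)"
  by (simp_all add: wgrp_def SLWm_def)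

lemma SLWm_eq_wgrp: "SLWm m = wgrp m (wcar m)"
  by (simp add: SLWm_def wgrp_def wcar_def wtrunc_eq_iff)

lemma level_eq_wgrp: "level H m = wgrp m (mtrunc m ` H)"
  by (simp add: level_def wgrp_def)

lemma mtrunc_mtrunc [simp]: "mtrunc m (mtrunc m A) = mtrunc m A"
  by (simp add: mtrunc_eq_iff)

lemma mtrunc_mult [simp]:
  fixes A B :: "('k::comm_ring_prime_char, 'n::finite) wmat"
  shows "mtrunc m (mtrunc m A ** B) = mtrunc m (A ** B)" "mtrunc m (A ** mtrunc m B) = mtrunc m (A ** B)"
  by (auto simp: mtrunc_eq_iff intro!: mweq_mult)

locale wmonoid =
  fixes m :: nat and S :: "('k::field_prime_char, 'n::finite) wmat set"
  assumes sub: "S \<subseteq> wcar m" and one: "mtrunc m (mat 1) \<in> S"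
    and closed: "A \<in> S \<Longrightarrow> B \<in> S \<Longrightarrow> mtrunc m (A ** B) \<in> S"
begin

lemma trunc: "A \<in> S \<Longrightarrow> mtrunc m A = A"
  using sub by (auto simp: wcar_def)

end

lemma wmonoid_wcar: "wmonoid m (wcar m)"
proof
  show "mtrunc m (mat 1) \<in> wcar m"
    using weq_det[of m "mtrunc m (mat 1)" "mat 1"] by (auto simp: wcar_def)
next
  fix A B :: "('a, 'b) wmat" assume "A \<in> wcar m" "B \<in> wcar m"
  thus "mtrunc m (A ** B) \<in> wcar m"
    using weq_det[of m "mtrunc m (A ** B)" "A ** B"] weq_mult[of m "det A" 1 "det B" 1]
    by (auto simp: wcar_def det_mul intro: weq_trans)
qed auto

lemma wmonoid_image:
  assumes "H \<subseteq> SLW" "mat 1 \<in> H" "\<And>A B. A \<in> H \<Longrightarrow> B \<in> H \<Longrightarrow> A ** B \<in> H"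
  shows "wmonoid m (mtrunc m ` H)"
proof
  have "weq m (det (mtrunc m A)) 1" if "A \<in> H" for A
  proof -
    have "det A = 1" using that assms(1) by (auto simp: SLW_def)
    thus ?thesis using weq_det[of m "mtrunc m A" A] by auto
  qed
  thus "mtrunc m ` H \<subseteq> wcar m" by (auto simp: wcar_def)
qed (use assms in auto)

section \<open>Tangent vectors at the identity\<close>

text \<open>Tangent vectors at \<open>e\<close> of the closure of \<open>S\<close>, as point derivations of the ring of regular functions.\<close>

definition tang :: "('k::field_prime_char, 'n::finite) wmat set \<Rightarrow> ('k, 'n) wmat \<Rightarrow> ((('k, 'n) wmat \<Rightarrow> 'k) \<Rightarrow> 'k) \<Rightarrow> bool" where
  "tang S e d \<longleftrightarrow>
     (\<forall>f\<in>reg S. \<forall>g. (\<forall>x\<in>S. f x = g x) \<longrightarrow> d f = d g) \<and>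
     (\<forall>f\<in>reg S. \<forall>g\<in>reg S. d (\<lambda>x. f x + g x) = d f + d g) \<and>
     (\<forall>c. \<forall>f\<in>reg S. d (\<lambda>x. c * f x) = c * d f) \<and>
     (\<forall>f\<in>reg S. \<forall>g\<in>reg S. d (\<lambda>x. f x * g x) = f e * d g + d f * g e)"

lemma
  assumes "tang S e d"
  shows tang_cong: "f \<in> reg S \<Longrightarrow> (\<And>x. x \<in> S \<Longrightarrow> f x = g x) \<Longrightarrow> d f = d g"
    and tang_add: "f \<in> reg S \<Longrightarrow> g \<in> reg S \<Longrightarrow> d (\<lambda>x. f x + g x) = d f + d g"
    and tang_scale: "f \<in> reg S \<Longrightarrow> d (\<lambda>x. c * f x) = c * d f"
    and tang_mult: "f \<in> reg S \<Longrightarrow> g \<in> reg S \<Longrightarrow> d (\<lambda>x. f x * g x) = f e * d g + d f * g e"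
  using assms unfolding tang_def by blast+

lemma tang_const: assumes "tang S e d" shows "d (\<lambda>_. c) = 0"
proof -
  have "d (\<lambda>_. 1 * 1) = 1 * d (\<lambda>_. 1) + d (\<lambda>_. 1) * 1"
    by (rule tang_mult[OF assms]) (auto intro: reg.const_mem)
  hence "d (\<lambda>_. 1) = 0" by (simp only: mult_1_left mult_1_right add_cancel_right_right)
  thus ?thesis using tang_scale[OF assms reg.const_mem, of c 1] by simp
qed

lemma tang_hom: assumes "tang S e d" shows "wfun_hom (reg S) (\<lambda>f. Dual (f e) (d f))"
  by unfold_locales
    (auto simp: tang_add[OF assms] tang_mult[OF assms] tang_const[OF assms] intro!: dual.expand)

lemma tang_lincomb:
  assumes "tang S e d" "tang S e d'"
  shows "tang S e (\<lambda>f. a * d f + b * d' f)"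
proof -
  have "a * d f + b * d' f = a * d g + b * d' g" if "f \<in> reg S" "\<forall>x\<in>S. f x = g x" for f g
    using tang_cong[OF assms(1) that(1), of g] tang_cong[OF assms(2) that(1), of g] that by simp
  moreover note tang_add[OF assms(1)] tang_add[OF assms(2)] tang_scale[OF assms(1)] tang_scale[OF assms(2)]
    tang_mult[OF assms(1)] tang_mult[OF assms(2)]
  ultimately show ?thesis unfolding tang_def by (simp add: algebra_simps)
qed

lemma tang_zero: "tang S e (\<lambda>_. 0)"
  by (simp add: tang_def)

lemma tang_sum:
  "(\<And>a. a \<in> A \<Longrightarrow> tang S e (d a)) \<Longrightarrow> tang S e (\<lambda>f. \<Sum>a\<in>A. d a f)"
proof (induction A rule: infinite_finite_induct)
  case (insert x F)
  thus ?case using tang_lincomb[of S e "d x" "\<lambda>f. \<Sum>a\<in>F. d a f" 1 1] by simp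
qed (simp_all add: tang_zero)

lemma reg_comp:
  assumes "f \<in> reg S'" "\<phi> \<in> mfun (reg S)" "\<phi> ` S \<subseteq> S'"
  shows "(\<lambda>A. f (\<phi> A)) \<in> reg S"
  using assms(1)
proof (induction rule: reg_induct)
  case (cong f g)
  thus ?case using assms reg_cong[of S "\<lambda>A. f (\<phi> A)" "\<lambda>A. g (\<phi> A)"] by auto
next
  case (coord i j l)
  thus ?case using assms(2) by (auto simp: mfun_def wfun_def)
qed (auto intro: reg.const_mem reg.add_mem reg.mult_mem)

lemma tang_push:
  assumes "tang S e d" "\<phi> \<in> mfun (reg S)" "\<phi> ` S \<subseteq> S'"
  shows "tang S' (\<phi> e) (\<lambda>f. d (\<lambda>A. f (\<phi> A)))"
  unfolding tang_def
proof (intro conjI ballI allI impI)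
  note [intro] = reg_comp[OF _ assms(2,3)]
  show "d (\<lambda>A. f (\<phi> A)) = d (\<lambda>A. g (\<phi> A))" if "f \<in> reg S'" "\<forall>x\<in>S'. f x = g x" for f g
    by (rule tang_cong[OF assms(1)]) (use that assms in auto)
qed (auto intro!: tang_add[OF assms(1)] tang_scale[OF assms(1)] tang_mult[OF assms(1)] reg_comp[OF _ assms(2,3)])

subsection \<open>Left invariant derivations and tangent vectors\<close>

abbreviation wlie_alg where "wlie_alg m S \<equiv> lie_algebra wmat_coords (wgrp m S)"

lemma lie_algebraD:
  assumes "D \<in> wlie_alg m S"
  shows lie_nonreg: "f \<notin> regfun wmat_coords S \<Longrightarrow> D f = 0"
    and lie_mem: "f \<in> regfun wmat_coords S \<Longrightarrow> D f \<in> regfun wmat_coords S"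
    and lie_add: "f \<in> regfun wmat_coords S \<Longrightarrow> g \<in> regfun wmat_coords S \<Longrightarrow> D (f + g) = D f + D g"
    and lie_scale: "f \<in> regfun wmat_coords S \<Longrightarrow> D (\<lambda>x. c * f x) = (\<lambda>x. c * D f x)"
    and lie_mult: "f \<in> regfun wmat_coords S \<Longrightarrow> g \<in> regfun wmat_coords S \<Longrightarrow> D (f * g) = f * D g + D f * g"
    and lie_ltransl: "a \<in> S \<Longrightarrow> f \<in> regfun wmat_coords S \<Longrightarrow>
       D (ltransl (wgrp m S) a f) = ltransl (wgrp m S) a (D f)"
  using assms by (auto simp: lie_algebra_def Let_def)

text \<open>A left invariant derivation is determined by its value at the identity; \<open>lie_of\<close> is the inverse construction,
  differentiating right translations.\<close>

definition tang_of :: "nat \<Rightarrow> ('k::field_prime_char, 'n::finite) wmat set \<Rightarrow>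
    ((('k, 'n) wmat \<Rightarrow> 'k) \<Rightarrow> ('k, 'n) wmat \<Rightarrow> 'k) \<Rightarrow> (('k, 'n) wmat \<Rightarrow> 'k) \<Rightarrow> 'k" where
  "tang_of m S D = (\<lambda>f. D (ext0 S f) (mtrunc m (mat 1)))"

definition lie_of :: "nat \<Rightarrow> ('k::field_prime_char, 'n::finite) wmat set \<Rightarrow>
    ((('k, 'n) wmat \<Rightarrow> 'k) \<Rightarrow> 'k) \<Rightarrow> (('k, 'n) wmat \<Rightarrow> 'k) \<Rightarrow> ('k, 'n) wmat \<Rightarrow> 'k" where
  "lie_of m S d = (\<lambda>f. if f \<in> regfun wmat_coords S
     then ext0 S (\<lambda>a. d (\<lambda>b. f (mtrunc m (a ** b)))) else 0)"

lemma differential_eq_lie_of: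
  "differential wmat_coords (wgrp m S) (wgrp m' S') \<phi> D =
     lie_of m' S' (\<lambda>f. tang_of m S D (\<lambda>g. f (\<phi> g)))"
  by (simp add: differential_def lie_of_def tang_of_def fun_eq_iff)

context wmonoid
begin

abbreviation "e \<equiv> mtrunc m (mat 1)"

lemma mult_one: "A \<in> S \<Longrightarrow> mtrunc m (e ** A) = A" "A \<in> S \<Longrightarrow> mtrunc m (A ** e) = A"
  by (simp_all add: trunc)

context
  notes trunc [simp] mult_one [simp]
begin

lemma tang_lie: assumes D: "D \<in> wlie_alg m S" shows "tang S e (tang_of m S D)"
proof -
  have eq: "ext0 S f = ext0 S g" if "\<forall>x\<in>S. f x = g x" for f g :: "('k, 'n) wmat \<Rightarrow> 'k"
    using that by (intro ext0_cong) auto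
  have "D (ext0 S (\<lambda>x. c * f x)) e = c * D (ext0 S f) e" if "f \<in> reg S" for c f
    using that by (subst ext0_scale) (simp add: lie_scale[OF D] reg_def)
  moreover note lie_add[OF D] lie_mult[OF D]
  ultimately show ?thesis
    using one unfolding tang_def tang_of_def by (auto simp: reg_def ext0_add ext0_mult dest: eq)
qed

definition "transl_ring d = {F. (\<forall>a\<in>S. (\<lambda>b. F (a, b)) \<in> reg S) \<and> (\<lambda>a. F (a, e)) \<in> reg S \<and>
     (\<lambda>a. d (\<lambda>b. F (a, b))) \<in> reg S}"

lemma transl_ring:
  assumes d: "tang S e d" shows "wfun_ring (transl_ring d)"
proof
  fix c :: 'k
  show "(\<lambda>_. c) \<in> transl_ring d"
    by (auto simp: transl_ring_def reg.const_mem tang_const[OF d])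
next
  fix F G assume F: "F \<in> transl_ring d" and G: "G \<in> transl_ring d"
  have "(\<lambda>a. d (\<lambda>b. F (a, b) + G (a, b))) \<in> reg S \<longleftrightarrow>
     (\<lambda>a. d (\<lambda>b. F (a, b)) + d (\<lambda>b. G (a, b))) \<in> reg S"
    by (rule reg_cong) (use F G in \<open>auto simp: transl_ring_def intro: tang_add[OF d]\<close>)
  thus "(\<lambda>x. F x + G x) \<in> transl_ring d"
    using F G by (auto simp: transl_ring_def intro: reg.add_mem)
  have "(\<lambda>a. d (\<lambda>b. F (a, b) * G (a, b))) \<in> reg S \<longleftrightarrow>
     (\<lambda>a. F (a, e) * d (\<lambda>b. G (a, b)) + d (\<lambda>b. F (a, b)) * G (a, e)) \<in> reg S"
    by (rule reg_cong) (use F G in \<open>auto simp: transl_ring_def intro: tang_mult[OF d]\<close>)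
  thus "(\<lambda>x. F x * G x) \<in> transl_ring d"
    using F G by (auto simp: transl_ring_def intro!: reg.add_mem reg.mult_mem)
qed

lemma transl_mem:
  assumes d: "tang S e d" and f: "f \<in> reg S"
  shows "(\<lambda>(a, b). f (mtrunc m (a ** b))) \<in> transl_ring d"
  using f
proof (induction rule: reg_induct)
  interpret T: wfun_ring "transl_ring d" by (rule transl_ring[OF d])
  {
    case (cong f g)
    have "(\<lambda>a. d (\<lambda>b. f (mtrunc m (a ** b)))) \<in> reg S \<longleftrightarrow> (\<lambda>a. d (\<lambda>b. g (mtrunc m (a ** b)))) \<in> reg S"
      by (rule reg_cong, rule tang_cong[OF d]) (use cong closed in \<open>auto simp: transl_ring_def\<close>)
    moreover have "(\<lambda>b. f (mtrunc m (a ** b))) \<in> reg S \<longleftrightarrow> (\<lambda>b. g (mtrunc m (a ** b))) \<in> reg S"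
      if "a \<in> S" for a
      by (rule reg_cong) (use cong closed that in \<open>auto simp: transl_ring_def\<close>)
    moreover have "(\<lambda>b. f (mtrunc m (b ** e))) \<in> reg S \<longleftrightarrow> (\<lambda>b. g (mtrunc m (b ** e))) \<in> reg S"
      by (rule reg_cong, rule cong(1), rule closed[OF _ one])
    ultimately show ?case using cong(2) by (auto simp: transl_ring_def)
  next
    case (const c)
    show ?case using T.const_mem[of c] by (simp add: case_prod_unfold)
  next
    case (coord i j l)
    have 1: "fst \<in> mfun (transl_ring d)"
      by (auto simp: mfun_def wfun_def transl_ring_def reg_coord reg.const_mem tang_const[OF d])
    have 2: "snd \<in> mfun (transl_ring d)"
      by (auto simp: mfun_def wfun_def transl_ring_def reg_coord reg.const_mem)
    have "(\<lambda>x. fst x ** snd x) \<in> mfun (transl_ring d)" by (rule T.mfun_mult[OF 1 2])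
    hence "(\<lambda>x. wcoeff ((fst x ** snd x) $ i $ j) l) \<in> transl_ring d"
      by (auto simp: mfun_def wfun_def)
    thus ?case
      using T.const_mem[of 0] by (cases "l < m") (auto simp: wcoeff_wtrunc case_prod_unfold)
  next
    case (add f g)
    thus ?case using T.add_mem[OF add(3,4)] by (simp add: case_prod_unfold)
  next
    case (mult f g)
    thus ?case using T.mult_mem[OF mult(3,4)] by (simp add: case_prod_unfold)
  }
qed

lemma reg_transl:
  assumes "f \<in> reg S" "a \<in> S" shows "(\<lambda>b. f (mtrunc m (a ** b))) \<in> reg S"
  using transl_mem[OF tang_zero assms(1)] assms(2) by (auto simp: transl_ring_def)

lemma ltransl_regfun:
  assumes "f \<in> regfun wmat_coords S" "a \<in> S"
  shows "ltransl (wgrp m S) a f \<in> regfun wmat_coords S"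
  using reg_transl[OF regfun_reg[OF assms(1)] assms(2)] by (simp add: ltransl_def reg_def)

lemma lie_tang: assumes d: "tang S e d" shows "lie_of m S d \<in> wlie_alg m S"
  unfolding lie_algebra_def Let_def mem_Collect_eq wgrp_simps
proof (intro conjI allI ballI impI)
  note t = reg_transl[OF regfun_reg]
  fix f assume f: "f \<in> regfun wmat_coords S"
  have "(\<lambda>a. d (\<lambda>b. f (mtrunc m (a ** b)))) \<in> reg S"
    using transl_mem[OF d regfun_reg[OF f]] by (auto simp: transl_ring_def)
  thus "lie_of m S d f \<in> regfun wmat_coords S"
    using f by (simp add: lie_of_def reg_def)
  show "lie_of m S d (\<lambda>x. c * f x) = (\<lambda>x. c * lie_of m S d f x)" for c
  proof -
    have "(\<lambda>x. c * f x) \<in> regfun wmat_coords S"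
      using reg.mult_mem[OF reg.const_mem[of c] regfun_reg[OF f]]
      by (simp add: reg_def ext0_scale regfun_ext0[OF f] del: ext0_mult)
    moreover have "ext0 S (\<lambda>a. d (\<lambda>b. c * f (mtrunc m (a ** b)))) =
        ext0 S (\<lambda>a. c * d (\<lambda>b. f (mtrunc m (a ** b))))"
      by (rule ext0_cong, rule tang_scale[OF d t[OF f]])
    ultimately show ?thesis using f by (simp add: lie_of_def ext0_scale)
  qed
  fix g assume g: "g \<in> regfun wmat_coords S"
  have "ext0 S (\<lambda>a. d (\<lambda>b. f (mtrunc m (a ** b)) + g (mtrunc m (a ** b)))) =
        ext0 S (\<lambda>a. d (\<lambda>b. f (mtrunc m (a ** b))) + d (\<lambda>b. g (mtrunc m (a ** b))))"
    by (rule ext0_cong, rule tang_add[OF d t[OF f] t[OF g]])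
  thus "lie_of m S d (f + g) = lie_of m S d f + lie_of m S d g"
    using f g regfun.add[OF f g] by (simp add: lie_of_def ext0_add)
  have "ext0 S (\<lambda>a. d (\<lambda>b. f (mtrunc m (a ** b)) * g (mtrunc m (a ** b)))) =
        ext0 S (\<lambda>a. f a * d (\<lambda>b. g (mtrunc m (a ** b))) + d (\<lambda>b. f (mtrunc m (a ** b))) * g a)"
    by (rule ext0_cong, subst tang_mult[OF d t[OF f] t[OF g]]) simp_all
  also have "\<dots> = f * ext0 S (\<lambda>a. d (\<lambda>b. g (mtrunc m (a ** b)))) + ext0 S (\<lambda>a. d (\<lambda>b. f (mtrunc m (a ** b)))) * g"
    by (simp only: ext0_add ext0_mult regfun_ext0[OF f] regfun_ext0[OF g])
  finally show "lie_of m S d (f * g) = f * lie_of m S d g + lie_of m S d f * g"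
    using f g regfun.mult[OF f g] by (simp add: lie_of_def)
next
  fix a f assume a: "a \<in> S" and f: "f \<in> regfun wmat_coords S"
  have "d (\<lambda>b. ltransl (wgrp m S) a f (mtrunc m (x ** b))) = d (\<lambda>b. f (mtrunc m (mtrunc m (a ** x) ** b)))"
    if x: "x \<in> S" for x
    by (rule tang_cong[OF d]) (use x a closed in \<open>auto simp: ltransl_def matrix_mul_assoc
        intro!: reg_transl regfun_reg[OF ltransl_regfun[OF f a, unfolded ltransl_def wgrp_simps]]\<close>)
  thus "lie_of m S d (ltransl (wgrp m S) a f) = ltransl (wgrp m S) a (lie_of m S d f)"
    using f ltransl_regfun[OF f a] a closed
    by (auto simp: lie_of_def ltransl_def fun_eq_iff ext0_def)
qed (auto simp: lie_of_def)

lemma tang_of_lie_of: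
  assumes d: "tang S e d" "f \<in> reg S" shows "tang_of m S (lie_of m S d) f = d f"
proof -
  have "ext0 S f \<in> reg S" using assms(2) by (simp add: reg_def)
  hence "d (\<lambda>b. ext0 S f (mtrunc m (e ** b))) = d f"
    by (intro tang_cong[OF d(1)] reg_transl one) auto
  thus ?thesis using assms one by (simp add: tang_of_def lie_of_def reg_def)
qed

lemma lie_apply:
  assumes D: "D \<in> wlie_alg m S" and f: "f \<in> regfun wmat_coords S" and a: "a \<in> S"
  shows "D f a = tang_of m S D (\<lambda>b. f (mtrunc m (a ** b)))"
proof -
  have "D (ltransl (wgrp m S) a f) e = ltransl (wgrp m S) a (D f) e"
    by (simp add: lie_ltransl[OF D a f])
  also have "\<dots> = D f a" using one a by (simp add: ltransl_def)
  finally show ?thesis by (simp add: tang_of_def ltransl_def)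
qed

text \<open>Left invariance recovers \<open>D f a\<close> from the tangent vector applied to a translate of \<open>f\<close>.\<close>

lemma lie_eqI:
  assumes D: "D \<in> wlie_alg m S" and D': "D' \<in> wlie_alg m S"
    and eq: "\<And>f. f \<in> reg S \<Longrightarrow> tang_of m S D f = tang_of m S D' f"
  shows "D = D'"
proof (intro ext)
  fix f a
  show "D f a = D' f a"
  proof (cases "f \<in> regfun wmat_coords S \<and> a \<in> S")
    case True
    thus ?thesis using eq[OF reg_transl[OF regfun_reg]] by (simp add: lie_apply[OF D] lie_apply[OF D'])
  next
    case False
    thus ?thesis
      using regfun_ext0[OF lie_mem[OF D]] regfun_ext0[OF lie_mem[OF D']] lie_nonreg[OF D] lie_nonreg[OF D']
      by (metis ext0_out)
  qed
qed

end

end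

section \<open>Witt coordinates of a tangent vector\<close>

definition epsm :: "(nat \<Rightarrow> 'k^'n^'n) \<Rightarrow> ('k::zero dual, 'n::finite) wmat" where
  "epsm Y = (\<chi> i j. epsw (\<lambda>l. Y l $ i $ j))"

lemma epsm_nth [simp]: "epsm Y $ i $ j = epsw (\<lambda>l. Y l $ i $ j)"
  by (simp add: epsm_def)

text \<open>Components of \<open>A - 1\<close> and not of \<open>A\<close>: they vanish at the identity, so the tangent vector sends
  them to a Witt vector with components in \<open>\<epsilon>k\<close>.\<close>

definition kap :: "((('k::field_prime_char, 'n::finite) wmat \<Rightarrow> 'k) \<Rightarrow> 'k) \<Rightarrow> nat \<Rightarrow> 'k^'n^'n" where
  "kap d l = (\<chi> i j. d (\<lambda>A. wcoeff ((A - mat 1) $ i $ j) l))"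

definition dhom :: "('k::field_prime_char, 'n::finite) wmat \<Rightarrow> ((('k, 'n) wmat \<Rightarrow> 'k) \<Rightarrow> 'k) \<Rightarrow>
    (('k, 'n) wmat \<Rightarrow> 'k) \<Rightarrow> 'k dual" where
  "dhom e d = (\<lambda>f. Dual (f e) (d f))"

lemma tang_dhom: "tang S e d \<Longrightarrow> wfun_hom (reg S) (dhom e d)"
  using tang_hom by (simp add: dhom_def)

lemma reg_minus_one: "(\<lambda>A. A - mat 1) \<in> mfun (reg S)"
  by (intro reg.mfun_diff reg_id reg.mfun_const)

lemma reg_wcoeff: "A \<in> mfun (reg S) \<Longrightarrow> (\<lambda>g. wcoeff (A g $ i $ j) l) \<in> reg S"
  for A :: "('k::field_prime_char, 'm::finite) wmat \<Rightarrow> ('k, 'n::finite) wmat"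
  by (auto simp: mfun_def wfun_def)

lemma wcoeff_minus_one:
  fixes e :: "('k::comm_ring_prime_char, 'n::finite) wmat"
  assumes "mweq m e (mat 1)" "l < m" shows "wcoeff ((e - mat 1) $ i $ j) l = 0"
proof -
  have "mweq m (e - mat 1) (mat 1 - mat 1)" by (intro mweq_diff assms) simp
  thus ?thesis using assms(2) by (auto simp: mweq_def weq_def)
qed

lemma mmap_dhom_minus_one:
  assumes "mweq m e (mat 1)"
  shows "mweq m (mmap (dhom e d) (\<lambda>A. A - mat 1)) (epsm (kap d))"
  using wcoeff_minus_one[OF assms] by (auto simp: mweq_def weq_def dhom_def kap_def)

lemma kap_sum: "kap (\<lambda>f. \<Sum>a\<in>A. d a f) l = (\<Sum>a\<in>A. kap (d a) l)"
  by (simp add: kap_def vec_eq_iff sum_component)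

lemma prod_one_plus:
  assumes "finite A" "\<And>i j. x i * x j = (0 :: 'a::comm_ring_1)"
  shows "(\<Prod>i\<in>A. 1 + x i) = 1 + (\<Sum>i\<in>A. x i)"
  using assms(1)
proof (induction A rule: finite_induct)
  case (insert a A)
  have "x a * (\<Sum>i\<in>A. x i) = 0" by (simp add: sum_distrib_left assms(2))
  thus ?case using insert by (simp add: algebra_simps)
qed simp

text \<open>All products of two entries of \<open>N\<close> vanish, so every permutation but the identity contributes \<open>0\<close> to
  the determinant.\<close>

lemma det_one_plus:
  fixes N :: "'a::comm_ring_1^'n::finite^'n"
  assumes "\<And>i j k l. N $ i $ j * N $ k $ l = 0"
  shows "det (mat 1 + N) = 1 + trace N"
proof -
  let ?f = "\<lambda>p. of_int (sign p) * (\<Prod>i\<in>UNIV. (mat 1 + N) $ i $ p i)"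
  have 0: "?f p = 0" if p: "p permutes (UNIV :: 'n set)" "p \<noteq> id" for p
  proof -
    obtain i where i: "p i \<noteq> i" using p(2) by fastforce
    have j: "p (p i) \<noteq> p i" using i permutes_inj[OF p(1)] by (auto dest: injD)
    have "(\<Prod>i\<in>UNIV. (mat 1 + N) $ i $ p i) =
       (mat 1 + N) $ i $ p i * ((mat 1 + N) $ p i $ p (p i) * (\<Prod>i\<in>UNIV - {i} - {p i}. (mat 1 + N) $ i $ p i))"
      using i by (subst prod.remove[of _ i], simp, simp, subst prod.remove[of _ "p i"]) auto
    also have "\<dots> = (N $ i $ p i * N $ p i $ p (p i)) * (\<Prod>i\<in>UNIV - {i} - {p i}. (mat 1 + N) $ i $ p i)"
      using i j by (simp add: mat_def mult.assoc)
    finally show ?thesis by (simp add: assms)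
  qed
  have "det (mat 1 + N) = (\<Sum>p\<in>{id}. ?f p)"
    unfolding det_def
  proof (rule sum.mono_neutral_right)
    show "\<forall>p\<in>{p. p permutes UNIV} - {id}. ?f p = 0" using 0 by blast
  qed (auto simp: permutes_id intro: finite_permutations)
  also have "\<dots> = (\<Prod>i\<in>UNIV. 1 + N $ i $ i)"
    by (simp add: mat_def)
  also have "\<dots> = 1 + trace N"
    by (subst prod_one_plus) (auto simp: assms trace_def)
  finally show ?thesis .
qed

context wmonoid
begin

lemma e_weq: "mweq m e (mat 1)"
  by simp

text \<open>The components of an entry of \<open>A\<close> are polynomials in those of \<open>A - 1\<close>, and the former generate the
  regular functions.\<close>

lemma tang_eqI:
  assumes d: "tang S e d" and d': "tang S e d'" and eq: "\<And>l. l < m \<Longrightarrow> kap d l = kap d' l"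
    and f: "f \<in> reg S"
  shows "d f = d' f"
proof -
  have "f \<in> reg S \<and> d f = d' f" using f
  proof (induction rule: reg_induct)
    case (cong f g)
    thus ?case using tang_cong[OF d, of f g] tang_cong[OF d', of f g] reg_cong[of S f g] by simp
  next
    case (const c)
    show ?case by (simp add: tang_const[OF d] tang_const[OF d'] reg.const_mem)
  next
    case (coord i j l)
    have *: "wmap (dhom e t) (\<lambda>A. A $ i $ j) =
        wmap (dhom e t) (\<lambda>A. (A - mat 1) $ i $ j) + wmap (dhom e t) (\<lambda>_. mat 1 $ i $ j)"
      if "tang S e t" for t
    proof -
      interpret wfun_hom "reg S" "dhom e t" by (rule tang_dhom[OF that])
      have "wmap (dhom e t) (\<lambda>A. (A - mat 1) $ i $ j + mat 1 $ i $ j) =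
        wmap (dhom e t) (\<lambda>A. (A - mat 1) $ i $ j) + wmap (dhom e t) (\<lambda>_. mat 1 $ i $ j)"
        using reg_minus_one[of S] by (intro wmap_add reg.wfun_const) (auto simp: mfun_def)
      thus ?thesis by simp
    qed
    have 1: "wmap (dhom e d) (\<lambda>_. mat 1 $ i $ j) = wmap (dhom e d') (\<lambda>_. mat 1 $ i $ j)"
      by (simp add: wmap_def dhom_def tang_const[OF d] tang_const[OF d'])
    have "weq m (wmap (dhom e d) (\<lambda>A. (A - mat 1) $ i $ j)) (epsm (kap d) $ i $ j)"
      using mmap_dhom_minus_one[OF e_weq, of d] unfolding mweq_def mmap_nth by blast
    also have "weq m (epsm (kap d) $ i $ j) (epsm (kap d') $ i $ j)"
      using eq by (auto simp: weq_def)
    also have "weq m (epsm (kap d') $ i $ j) (wmap (dhom e d') (\<lambda>A. (A - mat 1) $ i $ j))"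
      using mmap_dhom_minus_one[OF e_weq, of d'] unfolding mweq_def mmap_nth by (blast intro: weq_sym)
    finally have "weq m (wmap (dhom e d) (\<lambda>A. A $ i $ j)) (wmap (dhom e d') (\<lambda>A. A $ i $ j))"
      unfolding *[OF d] *[OF d'] 1 by (intro weq_add) auto
    hence "d (\<lambda>A. wcoeff (A $ i $ j) l) = d' (\<lambda>A. wcoeff (A $ i $ j) l)" if "l < m"
      using that by (auto simp: weq_def dhom_def)
    moreover have "d (\<lambda>A. wcoeff (A $ i $ j) l) = d' (\<lambda>A. wcoeff (A $ i $ j) l)" if "\<not> l < m"
    proof -
      have 0: "wcoeff (A $ i $ j) l = 0" if A: "A \<in> S" for A
        using arg_cong[OF trunc[OF A], of "\<lambda>A. wcoeff (A $ i $ j) l"] \<open>\<not> l < m\<close>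
        by (simp add: wcoeff_wtrunc)
      have "t (\<lambda>A. wcoeff (A $ i $ j) l) = 0" if "tang S e t" for t
        using tang_cong[OF that reg_coord, where g = "\<lambda>_. 0"] tang_const[OF that, of 0] 0 by simp
      from this[OF d] this[OF d'] show ?thesis by simp
    qed
    ultimately show ?case by (auto simp: reg_coord)
  qed (auto simp: tang_add[OF d] tang_add[OF d'] tang_mult[OF d] tang_mult[OF d'] intro: reg.add_mem reg.mult_mem)
  thus ?thesis by simp
qed

text \<open>Over the dual numbers the equation \<open>det A = 1\<close> becomes \<open>1 + trace (A - 1) = 1\<close>, and the trace is formed
  componentwise.\<close>

lemma kap_trace:
  assumes d: "tang S e d" and l: "l < m"
  shows "kap d l \<in> sl"
proof -
  interpret wfun_hom "reg S" "dhom e d" by (rule tang_dhom[OF d])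
  let ?T = "\<lambda>l. \<Sum>i\<in>UNIV. kap d l $ i $ i"
  have "weq m (wmap (dhom e d) (\<lambda>A. det A)) 1"
    unfolding weq_def
  proof (intro allI impI)
    fix l assume l: "l < m"
    have c: "wcoeff (det A) l = wcoeff 1 l" if "A \<in> S" for A
      using sub that l by (auto simp: wcar_def weq_def)
    have "(\<lambda>A. wcoeff (det A) l) \<in> reg S"
      using reg.wfun_det[OF reg_id] by (auto simp: wfun_def)
    hence "d (\<lambda>A. wcoeff (det A) l) = d (\<lambda>_. wcoeff 1 l)" by (rule tang_cong[OF d]) (rule c)
    thus "wcoeff (wmap (dhom e d) (\<lambda>A. det A)) l = wcoeff 1 l"
      using c[OF one] by (auto simp: dhom_def tang_const[OF d] wcoeff_1 intro!: dual.expand)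
  qed
  moreover have "weq m (wmap (dhom e d) (\<lambda>A. det A)) (1 + epsw ?T)"
  proof -
    have "mmap (dhom e d) (\<lambda>A. A) = mmap (dhom e d) (\<lambda>A. mat 1 + (A - mat 1))" by simp
    also have "\<dots> = mat 1 + mmap (dhom e d) (\<lambda>A. A - mat 1)"
      by (subst mmap_add) (auto intro: reg.mfun_const reg_minus_one simp: mmap_one)
    finally have "mweq m (mmap (dhom e d) (\<lambda>A. A)) (mat 1 + epsm (kap d))"
      by (simp add: mweq_add mmap_dhom_minus_one)
    hence "weq m (wmap (dhom e d) (\<lambda>A. det A)) (det (mat 1 + epsm (kap d)))"
      using wmap_det[OF reg_id] weq_det by fastforce
    also have "det (mat 1 + epsm (kap d)) = 1 + epsw ?T"
      by (subst det_one_plus) (auto simp: epsw_mult_epsw trace_def sum_epsw)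
    finally show ?thesis .
  qed
  ultimately have "weq m (1 + epsw ?T - 1) (1 - 1)"
    by (intro weq_diff) (auto intro: weq_trans weq_sym)
  hence "wcoeff (epsw ?T) l = 0" using l by (auto simp: weq_def)
  thus ?thesis by (simp add: sl_def trace_def zero_dual_def)
qed

end

section \<open>Brackets and powers of derivations\<close>

lemma regfun_iff: "f \<in> regfun wmat_coords S \<longleftrightarrow> f \<in> reg S \<and> ext0 S f = f"
  for f :: "('k::field_prime_char, 'n::finite) wmat \<Rightarrow> 'k"
  by (metis mem_Collect_eq reg_def regfun_ext0 regfun_reg)

lemma regfun_0: "0 \<in> regfun wmat_coords (S :: ('k::field_prime_char, 'n::finite) wmat set)"
  using reg.const_mem[of 0 S] by (auto simp: regfun_iff zero_fun_def ext0_def)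

lemma regfun_diff:
  assumes "f \<in> regfun wmat_coords S" "g \<in> regfun wmat_coords S"
  shows "f - g \<in> regfun wmat_coords (S :: ('k::field_prime_char, 'n::finite) wmat set)"
proof -
  have "(\<lambda>x. f x + (-1) * g x) \<in> reg S"
    using assms by (intro reg.add_mem reg.mult_mem reg.const_mem) (auto simp: regfun_iff)
  moreover have "(\<lambda>x. f x + (-1) * g x) = f - g" by auto
  moreover have "ext0 S (f - g) = f - g"
  proof -
    have "ext0 S (f - g) = ext0 S f - ext0 S g" by (auto simp: ext0_def)
    thus ?thesis using assms by (simp add: regfun_iff)
  qed
  ultimately show ?thesis unfolding regfun_iff by simp
qed

lemma regfun_scale: "f \<in> regfun wmat_coords S \<Longrightarrow> (\<lambda>x. c * f x) \<in> regfun wmat_coords S"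
  for f :: "('k::field_prime_char, 'n::finite) wmat \<Rightarrow> 'k"
  unfolding regfun_iff ext0_scale by (auto intro: reg.mult_mem reg.const_mem)

context
  fixes m :: nat and S :: "('k::field_prime_char, 'n::finite) wmat set" and D
  assumes D: "D \<in> wlie_alg m S"
begin

lemma lie_0: "D 0 = 0"
  using lie_add[OF D regfun_0 regfun_0] by simp

lemma lie_funpow_mem: "f \<in> regfun wmat_coords S \<Longrightarrow> (D ^^ n) f \<in> regfun wmat_coords S"
  by (induction n) (auto intro: lie_mem[OF D])

lemma lie_of_nat: "f \<in> regfun wmat_coords S \<Longrightarrow>
   of_nat n * f \<in> regfun wmat_coords S \<and> D (of_nat n * f) = of_nat n * D f"
  by (induction n) (auto simp: lie_0 regfun_0 distrib_right lie_add[OF D] intro: regfun.add)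

lemma lie_sum: "finite A \<Longrightarrow> (\<And>a. a \<in> A \<Longrightarrow> f a \<in> regfun wmat_coords S) \<Longrightarrow>
   sum f A \<in> regfun wmat_coords S \<and> D (sum f A) = (\<Sum>a\<in>A. D (f a))"
  by (induction A rule: finite_induct) (auto simp: lie_0 regfun_0 lie_add[OF D] intro: regfun.add)

lemma lie_leibniz:
  assumes f: "f \<in> regfun wmat_coords S" and g: "g \<in> regfun wmat_coords S"
  shows "(D ^^ n) (f * g) = (\<Sum>k\<le>n. of_nat (n choose k) * ((D ^^ k) f * (D ^^ (n - k)) g))"
proof (induction n)
  case 0
  show ?case by simp
next
  case (Suc n)
  let ?f = "\<lambda>k. (D ^^ k) f" and ?g = "\<lambda>k. (D ^^ k) g"
  have mem: "?f k * ?g l \<in> regfun wmat_coords S" for k l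
    by (intro regfun.mult lie_funpow_mem f g)
  have "(D ^^ Suc n) (f * g) = D (\<Sum>k\<le>n. of_nat (n choose k) * (?f k * ?g (n - k)))"
    by (simp only: funpow.simps o_apply Suc)
  also have "\<dots> = (\<Sum>k\<le>n. of_nat (n choose k) * D (?f k * ?g (n - k)))"
    by (subst conjunct2[OF lie_sum]) (simp_all only: finite_atMost lie_of_nat mem)
  also have "\<dots> = (\<Sum>k\<le>n. of_nat (n choose k) * (?f k * ?g (Suc n - k))) +
       (\<Sum>k\<le>n. of_nat (n choose k) * (?f (Suc k) * ?g (n - k)))"
    unfolding sum.distrib[symmetric]
    by (intro sum.cong refl, subst lie_mult[OF D])
       (auto intro!: lie_funpow_mem f g simp: distrib_left Suc_diff_le)
  also have "(\<Sum>k\<le>n. of_nat (n choose k) * (?f k * ?g (Suc n - k))) =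
      (\<Sum>k\<le>Suc n. of_nat (n choose k) * (?f k * ?g (Suc n - k)))"
    by (simp add: binomial_eq_0)
  also have "\<dots> = f * ?g (Suc n) + (\<Sum>k\<le>n. of_nat (n choose Suc k) * (?f (Suc k) * ?g (n - k)))"
    by (subst sum.atMost_Suc_shift) simp
  also have "\<dots> + (\<Sum>k\<le>n. of_nat (n choose k) * (?f (Suc k) * ?g (n - k))) =
      f * ?g (Suc n) + (\<Sum>k\<le>n. of_nat (Suc n choose Suc k) * (?f (Suc k) * ?g (n - k)))"
    by (simp add: sum.distrib[symmetric] algebra_simps del: funpow.simps)
  also have "\<dots> = (\<Sum>k\<le>Suc n. of_nat (Suc n choose k) * (?f k * ?g (Suc n - k)))"
    by (subst sum.atMost_Suc_shift) (simp del: funpow.simps binomial_Suc_Suc)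
  finally show ?case .
qed

text \<open>By the Leibniz formula \<open>D\<^sup>p\<close> is again a derivation, the inner binomial coefficients being divisible by \<open>p\<close>.\<close>

lemma lie_power_mem:
  "D ^^ CHAR('k) \<in> wlie_alg m S"
proof -
  let ?p = "CHAR('k)"
  have p0: "?p > 0" by simp
  have of_nat_fun: "of_nat n = (\<lambda>_. of_nat n)" for n :: nat and x :: "('k, 'n) wmat"
    by (induction n) (auto simp: fun_eq_iff)
  have "(D ^^ n) (f + g) = (D ^^ n) f + (D ^^ n) g"
    if "f \<in> regfun wmat_coords S" "g \<in> regfun wmat_coords S" for n f g
    by (induction n) (simp_all only: funpow.simps id_apply o_apply lie_add[OF D] lie_funpow_mem that)
  moreover have "(D ^^ n) (\<lambda>x. c * f x) = (\<lambda>x. c * (D ^^ n) f x)"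
    if "f \<in> regfun wmat_coords S" for n c f
    by (induction n) (auto simp: lie_scale[OF D] lie_funpow_mem that)
  moreover have "(D ^^ n) (ltransl (wgrp m S) a f) = ltransl (wgrp m S) a ((D ^^ n) f)"
    if "f \<in> regfun wmat_coords S" "a \<in> S" for n a f
    by (induction n) (auto simp: lie_ltransl[OF D] lie_funpow_mem that)
  moreover have "(D ^^ n) f = 0" if "f \<notin> regfun wmat_coords S" "n > 0" for n f
    using that(2)
  proof (induction n)
    case (Suc n)
    thus ?case
      using lie_nonreg[OF D that(1)] by (cases n) (simp_all only: funpow.simps id_apply o_apply lie_0)
  qed simp
  moreover have "(D ^^ ?p) (f * g) = f * (D ^^ ?p) g + (D ^^ ?p) f * g"
    if f: "f \<in> regfun wmat_coords S" and g: "g \<in> regfun wmat_coords S" for f g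
  proof -
    let ?t = "\<lambda>k. of_nat (?p choose k) * ((D ^^ k) f * (D ^^ (?p - k)) g)"
    have "?t k = 0" if "k \<in> {..?p} - {0, ?p}" for k
    proof -
      have "?p dvd ?p choose k" using that CHAR_prime by (intro dvd_choose_prime) auto
      hence "of_nat (?p choose k) = (0 :: ('k, 'n) wmat \<Rightarrow> 'k)"
        by (auto simp: of_nat_fun of_nat_eq_0_iff_char_dvd fun_eq_iff)
      thus ?thesis by simp
    qed
    hence "(\<Sum>k\<le>?p. ?t k) = (\<Sum>k\<in>{0, ?p}. ?t k)"
      by (intro sum.mono_neutral_right) auto
    thus ?thesis using lie_leibniz[OF f g, of ?p] p0 by simp
  qed
  ultimately show ?thesis using p0 lie_funpow_mem
    unfolding lie_algebra_def Let_def mem_Collect_eq wgrp_simps by blast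
qed

end

lemma ltransl_diff: "ltransl G a (f - g) = ltransl G a f - ltransl G a g"
  for f :: "_ \<Rightarrow> 'a::ab_group_add"
  by (auto simp: ltransl_def ext0_def)

lemma lie_bracket_mem:
  assumes D: "D \<in> wlie_alg m S" and D': "D' \<in> wlie_alg m S"
  shows "(\<lambda>f. D (D' f) - D' (D f)) \<in> wlie_alg m S"
  unfolding lie_algebra_def Let_def mem_Collect_eq wgrp_simps
proof (intro conjI allI ballI impI)
  note m = lie_mem[OF D] lie_mem[OF D']
  note a = lie_add[OF D] lie_add[OF D'] lie_scale[OF D] lie_scale[OF D'] m
  note t = lie_mult[OF D] lie_mult[OF D'] lie_ltransl[OF D] lie_ltransl[OF D']
  fix f assume f: "f \<in> regfun wmat_coords S"
  show "D (D' f) - D' (D f) \<in> regfun wmat_coords S" using f by (auto intro: regfun_diff m)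
  show "D (D' (\<lambda>x. c * f x)) - D' (D (\<lambda>x. c * f x)) = (\<lambda>x. c * (D (D' f) - D' (D f)) x)" for c
    using f by (auto simp: a algebra_simps)
  show "D (D' (ltransl (wgrp m S) b f)) - D' (D (ltransl (wgrp m S) b f)) =
     ltransl (wgrp m S) b (D (D' f) - D' (D f))" if "b \<in> S" for b
    using f that by (simp add: t m ltransl_diff)
  fix g assume g: "g \<in> regfun wmat_coords S"
  show "D (D' (f + g)) - D' (D (f + g)) = D (D' f) - D' (D f) + (D (D' g) - D' (D g))"
    using f g by (simp add: a algebra_simps)
  show "D (D' (f * g)) - D' (D (f * g)) = f * (D (D' g) - D' (D g)) + (D (D' f) - D' (D f)) * g"
    using f g by (simp add: t a regfun.mult algebra_simps)
qed (auto simp: lie_nonreg[OF D] lie_nonreg[OF D'] lie_0[OF D] lie_0[OF D'])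

lemma ltransl_lin:
  "ltransl G a (f + g) = ltransl G a f + ltransl G a g"
  "ltransl G a (\<lambda>x. c * f x) = (\<lambda>x. c * ltransl G a f x)"
  for f :: "_ \<Rightarrow> 'a::comm_ring_1"
  by (auto simp: ltransl_def ext0_def)

lemma lie_zero_mem: "0 \<in> wlie_alg m S"
  by (auto simp: lie_algebra_def regfun_0 ltransl_def ext0_def fun_eq_iff)

lemma lie_add_mem:
  assumes D: "D \<in> wlie_alg m S" and D': "D' \<in> wlie_alg m S"
  shows "D + D' \<in> wlie_alg m S"
  unfolding lie_algebra_def Let_def mem_Collect_eq wgrp_simps
  by (auto simp: lie_nonreg[OF D] lie_nonreg[OF D'] lie_add[OF D] lie_add[OF D'] lie_scale[OF D] lie_scale[OF D']
      lie_mult[OF D] lie_mult[OF D'] lie_ltransl[OF D] lie_ltransl[OF D'] ltransl_lin algebra_simps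
      intro!: regfun.add lie_mem[OF D] lie_mem[OF D'])

lemma lie_scale_mem:
  assumes D: "D \<in> wlie_alg m S"
  shows "(\<lambda>f x. c * D f x) \<in> wlie_alg m S"
  unfolding lie_algebra_def Let_def mem_Collect_eq wgrp_simps
  by (auto simp: lie_nonreg[OF D] lie_add[OF D] lie_scale[OF D]
      lie_mult[OF D] lie_ltransl[OF D] ltransl_lin algebra_simps fun_eq_iff
      intro!: regfun_scale lie_mem[OF D])

section \<open>Differentials\<close>

text \<open>Homomorphisms of truncated groups; \<open>push\<close> is the differential.  Truncation, inclusion
  of a subgroup and conjugation are the instances that occur.\<close>

locale whom = src: wmonoid m S + tgt: wmonoid m' S'
  for m and S :: "('k::field_prime_char, 'n::finite) wmat set" and m' and S' :: "('k, 'n) wmat set" +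
  fixes \<phi> :: "('k, 'n) wmat \<Rightarrow> ('k, 'n) wmat"
  assumes mor: "\<phi> \<in> mfun (reg S)" "\<phi> ` S \<subseteq> S'"
    and hom_one: "\<phi> src.e = tgt.e"
    and hom_mult: "a \<in> S \<Longrightarrow> b \<in> S \<Longrightarrow> \<phi> (mtrunc m (a ** b)) = mtrunc m' (\<phi> a ** \<phi> b)"
begin

definition push where "push D = differential wmat_coords (wgrp m S) (wgrp m' S') \<phi> D"

lemma push_tang': "D \<in> wlie_alg m S \<Longrightarrow> tang S' tgt.e (\<lambda>f. tang_of m S D (\<lambda>g. f (\<phi> g)))"
  using tang_push[OF src.tang_lie mor] hom_one by simp

lemma push_mem: "D \<in> wlie_alg m S \<Longrightarrow> push D \<in> wlie_alg m' S'"
  unfolding push_def differential_eq_lie_of by (intro tgt.lie_tang push_tang')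

lemma push_tang:
  "D \<in> wlie_alg m S \<Longrightarrow> f \<in> reg S' \<Longrightarrow> tang_of m' S' (push D) f = tang_of m S D (\<lambda>g. f (\<phi> g))"
  unfolding push_def differential_eq_lie_of by (intro tgt.tang_of_lie_of push_tang')

lemma push_eqI:
  assumes "D \<in> wlie_alg m S" "D' \<in> wlie_alg m' S'"
    "\<And>f. f \<in> reg S' \<Longrightarrow> tang_of m' S' D' f = tang_of m S D (\<lambda>g. f (\<phi> g))"
  shows "push D = D'"
  by (rule tgt.lie_eqI) (auto intro: push_mem assms simp: push_tang assms)

lemma push_eqI_kap:
  assumes "D \<in> wlie_alg m S" "D' \<in> wlie_alg m' S'"
    "\<And>l. l < m' \<Longrightarrow> kap (tang_of m' S' D') l = kap (\<lambda>f. tang_of m S D (\<lambda>g. f (\<phi> g))) l"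
  shows "push D = D'"
  by (rule push_eqI[OF assms(1,2)], rule tgt.tang_eqI)
    (auto intro: tgt.tang_lie assms push_tang')

lemma kap_push:
  assumes "D \<in> wlie_alg m S"
  shows "kap (tang_of m' S' (push D)) l = kap (\<lambda>f. tang_of m S D (\<lambda>g. f (\<phi> g))) l"
  using push_tang[OF assms reg_wcoeff[OF reg_minus_one]] by (simp add: kap_def)

text \<open>Relatedness along \<open>\<phi>\<close> is stable under composition of operators, so the differential respects brackets and
  \<open>p\<close>-th powers.\<close>

lemma push_related:
  assumes D: "D \<in> wlie_alg m S" and f: "f \<in> regfun wmat_coords S'"
  shows "ext0 S (\<lambda>a. push D f (\<phi> a)) = D (ext0 S (\<lambda>a. f (\<phi> a)))"
proof
  fix a
  have mem: "ext0 S (\<lambda>a. f (\<phi> a)) \<in> regfun wmat_coords S"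
    using reg_comp[OF regfun_reg[OF f] mor] by (simp add: reg_def)
  show "ext0 S (\<lambda>a. push D f (\<phi> a)) a = D (ext0 S (\<lambda>a. f (\<phi> a))) a"
  proof (cases "a \<in> S")
    case a: True
    hence \<phi>a: "\<phi> a \<in> S'" using mor by auto
    have "push D f (\<phi> a) = tang_of m' S' (push D) (\<lambda>b. f (mtrunc m' (\<phi> a ** b)))"
      by (rule tgt.lie_apply[OF push_mem[OF D] f \<phi>a])
    also have "\<dots> = tang_of m S D (\<lambda>b. f (mtrunc m' (\<phi> a ** \<phi> b)))"
      by (rule push_tang[OF D tgt.reg_transl[OF regfun_reg[OF f] \<phi>a]])
    also have "\<dots> = tang_of m S D (\<lambda>b. ext0 S (\<lambda>a. f (\<phi> a)) (mtrunc m (a ** b)))"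
    proof (rule tang_cong[OF src.tang_lie[OF D]])
      show "(\<lambda>b. f (mtrunc m' (\<phi> a ** \<phi> b))) \<in> reg S"
        by (rule reg_comp[OF tgt.reg_transl[OF regfun_reg[OF f] \<phi>a] mor])
    qed (auto simp: src.closed a hom_mult)
    also have "\<dots> = D (ext0 S (\<lambda>a. f (\<phi> a))) a"
      by (rule src.lie_apply[OF D mem a, symmetric])
    finally show ?thesis using a by simp
  next
    case False
    thus ?thesis using regfun_ext0[OF lie_mem[OF D mem]] ext0_out by metis
  qed
qed

lemma push_related_funpow:
  assumes D: "D \<in> wlie_alg m S" and f: "f \<in> regfun wmat_coords S'"
  shows "ext0 S (\<lambda>a. (push D ^^ n) f (\<phi> a)) = (D ^^ n) (ext0 S (\<lambda>a. f (\<phi> a)))"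
  by (induction n)
     (simp_all add: push_related[OF D] lie_funpow_mem[OF push_mem[OF D] f])

lemma push_bracket:
  assumes D: "D1 \<in> wlie_alg m S" "D2 \<in> wlie_alg m S"
  shows "push (\<lambda>f. D1 (D2 f) - D2 (D1 f)) = (\<lambda>f. push D1 (push D2 f) - push D2 (push D1 f))"
proof (rule push_eqI)
  note P = push_mem[OF D(1)] push_mem[OF D(2)]
  fix f assume "f \<in> reg S'"
  hence f: "ext0 S' f \<in> regfun wmat_coords S'" by (simp add: reg_def)
  have eq: "ext0 S (\<lambda>a. ext0 S' f (\<phi> a)) = ext0 S (\<lambda>a. f (\<phi> a))"
    using mor by (intro ext0_cong) auto
  have *: "push A (push B (ext0 S' f)) tgt.e = A (B (ext0 S (\<lambda>a. f (\<phi> a)))) src.e"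
    if A: "A \<in> wlie_alg m S" and B: "B \<in> wlie_alg m S" for A B
  proof -
    have "push A (push B (ext0 S' f)) (\<phi> src.e) = ext0 S (\<lambda>a. push A (push B (ext0 S' f)) (\<phi> a)) src.e"
      using src.one by simp
    also have "\<dots> = A (B (ext0 S (\<lambda>a. ext0 S' f (\<phi> a)))) src.e"
      by (simp add: push_related[OF A lie_mem[OF push_mem[OF B] f]] push_related[OF B f])
    finally show ?thesis by (simp add: hom_one eq)
  qed
  show "tang_of m' S' (\<lambda>f. push D1 (push D2 f) - push D2 (push D1 f)) f =
        tang_of m S (\<lambda>f. D1 (D2 f) - D2 (D1 f)) (\<lambda>g. f (\<phi> g))"
    by (simp add: tang_of_def * D)
qed (intro lie_bracket_mem push_mem D)+

lemma push_power:
  assumes D: "D \<in> wlie_alg m S"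
  shows "push (D ^^ CHAR('k)) = push D ^^ CHAR('k)"
proof (rule push_eqI)
  fix f assume "f \<in> reg S'"
  hence f: "ext0 S' f \<in> regfun wmat_coords S'" by (simp add: reg_def)
  have eq: "ext0 S (\<lambda>a. ext0 S' f (\<phi> a)) = ext0 S (\<lambda>a. f (\<phi> a))"
    using mor by (intro ext0_cong) auto
  have "ext0 S (\<lambda>a. (push D ^^ CHAR('k)) (ext0 S' f) (\<phi> a)) src.e =
        (D ^^ CHAR('k)) (ext0 S (\<lambda>a. f (\<phi> a))) src.e"
    by (simp add: push_related_funpow[OF D f] eq)
  thus "tang_of m' S' (push D ^^ CHAR('k)) f = tang_of m S (D ^^ CHAR('k)) (\<lambda>g. f (\<phi> g))"
    using src.one by (simp add: tang_of_def hom_one)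
qed (intro lie_power_mem push_mem D)+

end

section \<open>Inverse matrices over commutative rings\<close>

text \<open>The adjugate matrix, since the entries lie in a ring and not in a field.\<close>

lemma det_one_right_inverse:
  fixes A :: "'a::comm_ring_1^'n::finite^'n"
  assumes "det A = 1"
  obtains B where "A ** B = mat 1"
proof -
  define B where "B = (\<chi> j r. det (\<chi> k. if k = r then axis j 1 else A $ k))"
  have "(A ** B) $ i $ r = mat 1 $ i $ r" for i r
  proof -
    have "(A ** B) $ i $ r = (\<Sum>j\<in>UNIV. det (\<chi> k. if k = r then A $ i $ j *s axis j 1 else A $ k))"
      by (simp add: matrix_matrix_mult_def B_def det_row_mul)
    also have "\<dots> = det (\<chi> k. if k = r then (\<Sum>j\<in>UNIV. A $ i $ j *s axis j 1) else A $ k)"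
      by (rule det_linear_row_sum[symmetric]) simp
    also have "(\<Sum>j\<in>UNIV. A $ i $ j *s axis j 1) = A $ i"
      by (simp add: vec_eq_iff sum_component axis_def if_distrib cong: if_cong)
    also have "det (\<chi> k. if k = r then A $ i else A $ k) = mat 1 $ i $ r"
    proof (cases "i = r")
      case True
      hence "(\<chi> k. if k = r then A $ i else A $ k) = A" by (simp add: vec_eq_iff)
      thus ?thesis using assms True by (simp add: mat_def)
    next
      case False
      have "det (\<chi> k. if k = r then A $ i else A $ k) = 0"
        by (rule det_identical_rows[OF False]) (use False in \<open>simp add: row_def\<close>)
      thus ?thesis using False by (simp add: mat_def)
    qed
    finally show ?thesis .
  qed
  thus ?thesis using that[of B] by (simp add: vec_eq_iff)
qed

lemma det_one_inverse:
  fixes A :: "'a::comm_ring_1^'n::finite^'n"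
  assumes "det A = 1"
  obtains B where "A ** B = mat 1" "B ** A = mat 1" "det B = 1"
proof -
  obtain B where B: "A ** B = mat 1" using det_one_right_inverse[OF assms] by blast
  have dB: "det B = 1" using arg_cong[OF B, of det] assms by (simp add: det_mul)
  obtain C where C: "B ** C = mat 1" using det_one_right_inverse[OF dB] by blast
  have "A = (A ** B) ** C" using C by (simp add: matrix_mul_assoc[symmetric])
  thus ?thesis using that[of B] B C dB by simp
qed

lemma
  fixes A B C :: "'a::comm_ring_1^'n::finite^'n"
  shows matrix_sub_ldistrib: "A ** (B - C) = A ** B - A ** C"
    and matrix_sub_rdistrib: "(B - C) ** A = B ** A - C ** A"
    and matrix_add_rdistrib: "(B + C) ** A = B ** A + C ** A"
  by (simp_all add: vec_eq_iff matrix_matrix_mult_def sum_subtractf sum.distrib algebra_simps)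

section \<open>Towers of truncated groups\<close>

lemma weq_mono: "weq m' x y \<Longrightarrow> m \<le> m' \<Longrightarrow> weq m x y"
  by (auto simp: weq_def)

lemma mweq_mono: "mweq m' x y \<Longrightarrow> m \<le> m' \<Longrightarrow> mweq m x y"
  by (auto simp: mweq_def intro: weq_mono)

lemma mtrunc_mtrunc_le: "m \<le> m' \<Longrightarrow> mtrunc m (mtrunc m' A) = mtrunc m A"
  unfolding mtrunc_eq_iff by (rule mweq_mono[OF mweq_mtrunc(1)])

lemma mfun_mtrunc: "A \<in> mfun (reg S) \<Longrightarrow> (\<lambda>g. mtrunc m (A g)) \<in> mfun (reg S)"
proof -
  assume A: "A \<in> mfun (reg S)"
  have "(\<lambda>g. wcoeff (mtrunc m (A g) $ i $ j) l) \<in> reg S" for i j l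
    using A by (cases "l < m") (auto simp: mfun_def wfun_def wcoeff_wtrunc reg.const_mem)
  thus ?thesis by (auto simp: mfun_def wfun_def)
qed

lemma wcoeff_mtrunc_minus_one:
  fixes A :: "('k::comm_ring_prime_char, 'n::finite) wmat"
  assumes "l < m" shows "wcoeff ((mtrunc m A - mat 1) $ i $ j) l = wcoeff ((A - mat 1) $ i $ j) l"
proof -
  have "mweq m (mtrunc m A - mat 1) (A - mat 1)" by (intro mweq_diff) auto
  thus ?thesis using assms by (auto simp: mweq_def weq_def)
qed

text \<open>A projective system of truncated groups; \<open>PL\<close> is its Lie algebra and \<open>kpa\<close> its coordinate map.\<close>

locale wtower =
  fixes S :: "nat \<Rightarrow> ('k::field_prime_char, 'n::finite) wmat set"
  assumes wmonoid: "wmonoid m (S m)" and tower: "mtrunc m ` S (Suc m) \<subseteq> S m"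
begin

sublocale W: wmonoid m "S m" for m by (rule wmonoid)

lemma whom_trunc: "whom (Suc m) (S (Suc m)) m (S m) (mtrunc m)"
  by (intro_locales, unfold_locales)
     (use tower in \<open>auto simp: mtrunc_mtrunc_le intro: mfun_mtrunc[OF reg_id]\<close>)

sublocale T: whom "Suc m" "S (Suc m)" m "S m" "mtrunc m" for m
  by (rule whom_trunc)

definition PL where "PL = prolie (\<lambda>m. wgrp m (S m))"

lemma PL_iff: "x \<in> PL \<longleftrightarrow> (\<forall>m. x m \<in> wlie_alg m (S m) \<and> T.push m (x (Suc m)) = x m)"
  by (simp add: PL_def prolie_def T.push_def)

definition kpa :: "('k, 'n) wlie \<Rightarrow> nat \<Rightarrow> 'k^'n^'n" where
  "kpa x l = kap (tang_of (Suc l) (S (Suc l)) (x (Suc l))) l"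

lemma kap_trunc: "l < m \<Longrightarrow> kap (\<lambda>f. d (\<lambda>g. f (mtrunc m g))) l = kap d l"
  by (simp only: kap_def wcoeff_mtrunc_minus_one)

lemma kap_eq_kpa:
  assumes x: "x \<in> PL" and l: "l < m"
  shows "kap (tang_of m (S m) (x m)) l = kpa x l"
proof -
  have "Suc l \<le> m" using l by simp
  thus ?thesis
  proof (induction rule: dec_induct)
    case (step n)
    have "kap (tang_of n (S n) (x n)) l = kap (tang_of (Suc n) (S (Suc n)) (x (Suc n))) l"
      using T.kap_push[of "x (Suc n)" n l] x step by (auto simp: PL_iff kap_trunc)
    thus ?case using step by simp
  qed (simp add: kpa_def)
qed

text \<open>Compatibility with the transition maps is automatic, since the coordinates below \<open>m\<close> determine
  a derivation at level \<open>m\<close>.\<close>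

lemma PL_I:
  assumes x: "\<And>m. x m \<in> wlie_alg m (S m)"
    and Y: "\<And>m l. l < m \<Longrightarrow> kap (tang_of m (S m) (x m)) l = Y l"
  shows "x \<in> PL" "kpa x = Y"
proof -
  have "T.push m (x (Suc m)) = x m" for m
    by (rule T.push_eqI_kap) (auto simp: x kap_trunc Y)
  thus "x \<in> PL" using x by (simp add: PL_iff)
  show "kpa x = Y" using Y by (auto simp: kpa_def)
qed

lemma PL_eq_level_iff:
  assumes x: "x \<in> PL" and y: "y \<in> PL"
  shows "x m = y m \<longleftrightarrow> (\<forall>l<m. kpa x l = kpa y l)"
proof
  assume "x m = y m"
  thus "\<forall>l<m. kpa x l = kpa y l" using kap_eq_kpa[OF x] kap_eq_kpa[OF y] by metis
next
  assume eq: "\<forall>l<m. kpa x l = kpa y l"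
  have m: "x m \<in> wlie_alg m (S m)" "y m \<in> wlie_alg m (S m)" using x y by (auto simp: PL_iff)
  show "x m = y m"
    by (rule W.lie_eqI[OF m], rule W.tang_eqI[OF W.tang_lie[OF m(1)] W.tang_lie[OF m(2)]])
       (auto simp: kap_eq_kpa x y eq)
qed

lemma PL_eqI: "x \<in> PL \<Longrightarrow> y \<in> PL \<Longrightarrow> kpa x = kpa y \<Longrightarrow> x = y"
  using PL_eq_level_iff by (metis ext)

lemma kpa_sl: "x \<in> PL \<Longrightarrow> kpa x l \<in> sl"
  unfolding kpa_def by (rule W.kap_trace[OF W.tang_lie]) (auto simp: PL_iff)

lemma tang_of_zero: "tang_of m S' 0 = (\<lambda>_. 0)"
  by (simp add: tang_of_def)

lemma PL_zero: "0 \<in> PL" "kpa 0 = 0"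
proof -
  have k: "kap (\<lambda>_. 0) l = 0" for l by (simp add: kap_def vec_eq_iff)
  have "(\<lambda>m. 0) \<in> PL" "kpa (\<lambda>m. 0) = (\<lambda>l. 0)"
    by (rule PL_I; simp add: lie_zero_mem tang_of_zero k)+
  thus "0 \<in> PL" "kpa 0 = 0" by (simp_all add: zero_fun_def)
qed

lemma PL_add:
  assumes "x \<in> PL" "y \<in> PL"
  shows "x + y \<in> PL" "kpa (x + y) = kpa x + kpa y"
proof -
  have 1: "kap (tang_of m (S m) (x m + y m)) l = (kpa x + kpa y) l" if "l < m" for m l
    using kap_eq_kpa[OF assms(1) that, symmetric] kap_eq_kpa[OF assms(2) that, symmetric]
    by (simp add: kap_def tang_of_def vec_eq_iff)
  have 2: "(x + y) m \<in> wlie_alg m (S m)" for m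
    using assms by (auto simp: PL_iff intro: lie_add_mem)
  show "x + y \<in> PL" "kpa (x + y) = kpa x + kpa y"
    by (rule PL_I[OF 2, where Y = "kpa x + kpa y"]; simp only: 1 plus_fun_apply)+
qed

lemma PL_scale:
  assumes "x \<in> PL"
  shows "wscale c x \<in> PL" "kpa (wscale c x) = (\<lambda>l. mscale c (kpa x l))"
proof -
  have 1: "kap (tang_of m (S m) (wscale c x m)) l = mscale c (kpa x l)" if "l < m" for m l
    using kap_eq_kpa[OF assms(1) that, symmetric]
    by (simp add: kap_def tang_of_def vec_eq_iff wscale_def mscale_def)
  have 2: "wscale c x m \<in> wlie_alg m (S m)" for m
    using assms lie_scale_mem[of "x m" m "S m" c] by (auto simp: PL_iff wscale_def)
  show "wscale c x \<in> PL" "kpa (wscale c x) = (\<lambda>l. mscale c (kpa x l))"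
    by (rule PL_I[OF 2, where Y = "\<lambda>l. mscale c (kpa x l)"]; simp only: 1)+
qed

lemma PL_bracket_mem:
  assumes "x \<in> PL" "y \<in> PL"
  shows "bracket x y \<in> PL"
  using assms T.push_bracket[of "x (Suc m)" m "y (Suc m)" for m]
  by (auto simp: PL_iff bracket_def intro: lie_bracket_mem)

lemma PL_ppower_mem:
  assumes "x \<in> PL"
  shows "ppower x \<in> PL"
  using assms T.push_power[of "x (Suc m)" m for m]
  by (auto simp: PL_iff ppower_def intro: lie_power_mem)

end

interpretation G: wtower "wcar :: nat \<Rightarrow> ('k::field_prime_char, 'n::finite) wmat set"
proof (rule wtower.intro)
  fix m
  show "wmonoid m (wcar m :: ('k, 'n) wmat set)" by (rule wmonoid_wcar)
  show "mtrunc m ` wcar (Suc m) \<subseteq> (wcar m :: ('k, 'n) wmat set)"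
  proof (intro image_subsetI)
    fix A :: "('k, 'n) wmat" assume "A \<in> wcar (Suc m)"
    hence "weq m (det A) 1" by (auto simp: wcar_def intro: weq_mono)
    thus "mtrunc m A \<in> wcar m"
      using weq_det[of m "mtrunc m A" A] by (auto simp: wcar_def intro: weq_trans)
  qed
qed

lemma wsl_eq_PL: "wsl = G.PL"
  by (simp add: wsl_def G.PL_def SLWm_eq_wgrp[abs_def])

section \<open>The coordinates of a bracket\<close>

text \<open>Base change along the inclusion of a ring into its dual numbers.\<close>

definition wlift :: "'b::zero witt \<Rightarrow> 'b dual witt" where
  "wlift x = Witt (\<lambda>l. Dual (wcoeff x l) 0)"

lemma wcoeff_wlift [simp]: "wcoeff (wlift x) l = Dual (wcoeff x l) 0"
  by (simp add: wlift_def)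

lemma witt_hom_add:
  fixes h :: "'a::comm_ring_prime_char \<Rightarrow> 'b::comm_ring_prime_char"
  assumes "\<And>a b. h (a + b) = h a + h b" "\<And>a b. h (a * b) = h a * h b" "h 1 = 1"
    and "CHAR('a) = CHAR('b)"
    and "\<And>l. h (wcoeff x l) = wcoeff x' l" "\<And>l. h (wcoeff y l) = wcoeff y' l"
  shows "h (wcoeff (x + y) l) = wcoeff (x' + y') l"
proof -
  have "(\<lambda>c i. h (pair_args (wcoeff x) (wcoeff y) c i)) = pair_args (wcoeff x') (wcoeff y')"
    by (auto simp: pair_args_def assms)
  thus ?thesis by (simp add: wcoeff_add weval_hom[of h, OF assms(1-3)] assms(4))
qed

lemma wlift_add: "wlift (x + y) = wlift x + wlift (y :: 'a::comm_ring_prime_char witt)"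
proof (rule witt_eqI)
  fix l
  have "Dual (wcoeff (x + y) l) 0 = wcoeff (wlift x + wlift y) l"
    by (rule witt_hom_add[of "\<lambda>x. Dual x 0"]) (auto simp: CHAR_dual intro!: dual.expand)
  thus "wcoeff (wlift (x + y)) l = wcoeff (wlift x + wlift y) l" by simp
qed

lemma funring_dual:
  assumes "tang S e d"
  shows "wfun_hom {F. (\<lambda>a. dre (F a)) \<in> reg S \<and> (\<lambda>a. deps (F a)) \<in> reg S}
     (\<lambda>F. Dual (dhom e d (\<lambda>a. dre (F a))) (dhom e d (\<lambda>a. deps (F a))))"
proof -
  interpret H: wfun_hom "reg S" "dhom e d" by (rule tang_dhom[OF assms])
  show ?thesis
    by unfold_locales (auto intro!: dual.expand reg.add_mem reg.mult_mem reg.const_mem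
       simp: H.hom_0 H.hom_1 H.hom_add H.hom_mult reg.mult_mem)
qed

text \<open>Evaluate at the product of \<open>1 + K1\<close> and \<open>1 + Y\<close>, where \<open>K1\<close> has components in \<open>\<epsilon>k\<close> and \<open>Y\<close> in \<open>\<delta>k\<close>; iterated dual
  numbers represent \<open>k[\<epsilon>, \<delta>]\<close> with \<open>\<epsilon>\<^sup>2 = \<delta>\<^sup>2 = 0\<close>.  Here \<open>(1 + K1)(1 + Y) - 1 = (K1 + Y) + K1 Y\<close>.  By \<open>mult_epsw\<close> the
  entries of \<open>K1 Y\<close> have the components \<open>(\<epsilon>u) ^ p ^ l \<cdot> \<delta>v\<close>, which vanish for \<open>l > 0\<close>.  The Witt sum \<open>K1 + Y\<close> has further
  terms in \<open>\<epsilon>\<delta>\<close>, which are left unevaluated.\<close>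

lemma (in wmonoid) second_order:
  assumes D1: "D1 \<in> wlie_alg m S" and D2: "D2 \<in> wlie_alg m S" and l: "l < m"
  defines "d1 \<equiv> tang_of m S D1" and "d2 \<equiv> tang_of m S D2"
  shows "D1 (D2 (ext0 S (\<lambda>A. wcoeff ((A - mat 1) $ i $ j) l))) e =
    deps (deps (wcoeff (wlift (epsw (\<lambda>l. kap d1 l $ i $ j)) + epsw (\<lambda>l. Dual (kap d2 l $ i $ j) 0)) l))
    + (if l = 0 then (kap d1 0 ** kap d2 0) $ i $ j else 0)"
proof -
  have t1: "tang S e d1" and t2: "tang S e d2" using tang_lie D1 D2 by (auto simp: d1_def d2_def)
  let ?R = "{F. (\<lambda>a. dre (F a)) \<in> reg S \<and> (\<lambda>a. deps (F a)) \<in> reg S}"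
  define \<Theta> where "\<Theta> = (\<lambda>F. Dual (dhom e d1 (\<lambda>a. dre (F a))) (dhom e d1 (\<lambda>a. deps (F a))))"
  interpret \<Theta>: wfun_hom ?R \<Theta> unfolding \<Theta>_def by (rule funring_dual[OF t1])
  interpret H2: wfun_hom "reg S" "dhom e d2" by (rule tang_dhom[OF t2])
  let ?f = "\<lambda>i j l A. wcoeff ((A - mat 1) $ i $ j) l"
  define wl :: "('k, 'n) wmat \<Rightarrow> ('k dual, 'n) wmat" where "wl A = (\<chi> i j. wlift (A $ i $ j))" for A
  define K2 :: "('k dual, 'n) wmat" where "K2 = epsm (kap d2)"
  define K1 :: "('k dual dual, 'n) wmat" where "K1 = (\<chi> i j. wlift (epsw (\<lambda>l. kap d1 l $ i $ j)))"
  define Y :: "('k dual dual, 'n) wmat" where "Y = epsm (\<lambda>l. \<chi> i j. Dual (kap d2 l $ i $ j) 0)"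
  have regf: "?f i j l \<in> reg S" for i j l by (rule reg_wcoeff[OF reg_minus_one])
  have rege: "ext0 S (?f i j l) \<in> regfun wmat_coords S" for i j l using regf by (simp add: reg_def)
  have cw: "mmap (dhom e d2) (\<lambda>_. c) = wl c" for c
    by (auto simp: vec_eq_iff wl_def dhom_def tang_const[OF t2] intro!: witt_eqI)
  \<comment> \<open>The first order expansion of \<open>a (1 + Y)\<close> in the second factor.\<close>
  have one_step: "Dual (?f i j l a) (D2 (ext0 S (?f i j l)) a) =
      wcoeff ((wl (a - mat 1) + wl a ** K2) $ i $ j) l" if a: "a \<in> S" and l: "l < m" for a i j l
  proof -
    have "D2 (ext0 S (?f i j l)) a = d2 (\<lambda>b. ext0 S (?f i j l) (mtrunc m (a ** b)))"
      unfolding d2_def by (rule lie_apply[OF D2 rege a])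
    also have "\<dots> = d2 (\<lambda>b. wcoeff (((a - mat 1) + a ** (b - mat 1)) $ i $ j) l)"
    proof (rule tang_cong[OF t2])
      fix b assume b: "b \<in> S"
      have "a ** b - mat 1 = (a - mat 1) + a ** (b - mat 1)"
        by (simp add: matrix_sub_ldistrib)
      thus "ext0 S (?f i j l) (mtrunc m (a ** b)) = wcoeff (((a - mat 1) + a ** (b - mat 1)) $ i $ j) l"
        using closed[OF a b] wcoeff_mtrunc_minus_one[OF l, of "a ** b" i j] by (simp only: ext0_in)
    qed (rule reg_transl[OF regfun_reg[OF rege] a])
    moreover have "?f i j l a = wcoeff (((a - mat 1) + a ** (e - mat 1)) $ i $ j) l"
    proof -
      have "mweq m ((a - mat 1) + a ** (e - mat 1)) ((a - mat 1) + a ** (mat 1 - mat 1))"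
        by (intro mweq_add mweq_mult mweq_diff) auto
      thus ?thesis using l by (auto simp: mweq_def weq_def)
    qed
    ultimately have "Dual (?f i j l a) (D2 (ext0 S (?f i j l)) a) =
        wcoeff (mmap (dhom e d2) (\<lambda>b. (a - mat 1) + a ** (b - mat 1)) $ i $ j) l"
      by (simp add: dhom_def)
    also have "mmap (dhom e d2) (\<lambda>b. (a - mat 1) + a ** (b - mat 1)) =
        wl (a - mat 1) + wl a ** mmap (dhom e d2) (\<lambda>b. b - mat 1)"
      unfolding cw[symmetric] using H2.mmap_add[of "\<lambda>_. a - mat 1" "\<lambda>b. a ** (b - mat 1)"] H2.mmap_mult[of "\<lambda>_. a" "\<lambda>b. b - mat 1"]
      by (auto simp: reg.mfun_const reg_minus_one reg.mfun_mult)
    also have "wcoeff ((wl (a - mat 1) + wl a ** mmap (dhom e d2) (\<lambda>b. b - mat 1)) $ i $ j) l =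
        wcoeff ((wl (a - mat 1) + wl a ** K2) $ i $ j) l"
    proof -
      have "mweq m (wl (a - mat 1) + wl a ** mmap (dhom e d2) (\<lambda>b. b - mat 1)) (wl (a - mat 1) + wl a ** K2)"
        unfolding K2_def by (intro mweq_add mweq_mult mweq_refl mmap_dhom_minus_one e_weq)
      thus ?thesis using l by (auto simp: mweq_def weq_def)
    qed
    finally show ?thesis .
  qed
  have wl_mem: "(\<lambda>a. wl (A a)) \<in> mfun ?R" if "A \<in> mfun (reg S)" for A
    using that by (auto simp: mfun_def wfun_def wl_def reg.const_mem)
  have mem: "(\<lambda>a. wl (a - mat 1) + wl a ** K2) \<in> mfun ?R"
    by (intro \<Theta>.mfun_add \<Theta>.mfun_mult \<Theta>.mfun_const wl_mem reg_minus_one reg_id)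
  have mmap_wl: "mmap \<Theta> (\<lambda>a. wl (A a)) = (\<chi> i j. wlift (mmap (dhom e d1) A $ i $ j))" for A
    by (auto simp: vec_eq_iff wl_def \<Theta>_def dhom_def tang_const[OF t1] zero_dual_def intro!: witt_eqI)
  have lift_weq: "mweq m (\<chi> i j. wlift (M $ i $ j)) (\<chi> i j. wlift (M' $ i $ j))" if "mweq m M M'"
    for M M' :: "('k dual, 'n) wmat"
    using that by (auto simp: mweq_def weq_def)
  have L: "mweq m (mmap \<Theta> (\<lambda>a. wl (a - mat 1))) K1"
    unfolding mmap_wl K1_def using lift_weq[OF mmap_dhom_minus_one[OF e_weq, of d1]] by simp
  have L1: "mweq m (mmap \<Theta> (\<lambda>a. wl a)) (mat 1 + K1)"
  proof -
    have wl_add: "wl (mat 1 + M) = wl (mat 1) + wl M" for M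
    proof -
      have "wl (A + B) = wl A + wl B" for A B
        by (simp add: vec_eq_iff wl_def wlift_add)
      thus ?thesis by simp
    qed
    have "(\<lambda>a. wl a) = (\<lambda>a. wl (mat 1) + wl (a - mat 1))" by (simp only: wl_add[symmetric] add_diff_cancel_left' diff_add_cancel add_diff_eq)
    hence "mmap \<Theta> (\<lambda>a. wl a) = mmap \<Theta> (\<lambda>a. wl (mat 1) + wl (a - mat 1))" by (rule arg_cong)
    also have "\<dots> = mmap \<Theta> (\<lambda>a. wl (mat 1)) + mmap \<Theta> (\<lambda>a. wl (a - mat 1))"
      by (intro \<Theta>.mmap_add \<Theta>.mfun_const wl_mem reg_minus_one)
    also have "(wl (mat 1)) = mat 1"
      by (auto simp: wl_def vec_eq_iff mat_def wcoeff_1 intro!: witt_eqI dual.expand)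
    finally show ?thesis using L by (auto simp: \<Theta>.mmap_one intro!: mweq_add)
  qed
  have Y: "mmap \<Theta> (\<lambda>a. K2) = Y"
    by (auto simp: vec_eq_iff Y_def K2_def \<Theta>_def dhom_def tang_const[OF t1] zero_dual_def intro!: witt_eqI)
  have "mweq m (mmap \<Theta> (\<lambda>a. wl (a - mat 1) + wl a ** K2)) (K1 + (mat 1 + K1) ** Y)"
  proof -
    have "mmap \<Theta> (\<lambda>a. wl (a - mat 1) + wl a ** K2) =
       mmap \<Theta> (\<lambda>a. wl (a - mat 1)) + mmap \<Theta> (\<lambda>a. wl a) ** mmap \<Theta> (\<lambda>a. K2)"
      using \<Theta>.mmap_add[of "\<lambda>a. wl (a - mat 1)" "\<lambda>a. wl a ** K2"] \<Theta>.mmap_mult[of "\<lambda>a. wl a" "\<lambda>a. K2"]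
      by (simp add: \<Theta>.mfun_const \<Theta>.mfun_mult wl_mem reg_minus_one reg_id)
    thus ?thesis unfolding Y by (simp add: mweq_add mweq_mult L L1)
  qed
  also have "K1 + (mat 1 + K1) ** Y = (K1 + Y) + K1 ** Y"
    by (simp add: matrix_add_rdistrib add.assoc)
  finally have main: "weq m (mmap \<Theta> (\<lambda>a. wl (a - mat 1) + wl a ** K2) $ i $ j)
      (K1 $ i $ j + Y $ i $ j + (K1 ** Y) $ i $ j)"
    by (auto simp: mweq_def)
  define w where "w l = (if l = 0 then (kap d1 0 ** kap d2 0) $ i $ j else 0)" for l :: nat
  have KY: "(K1 ** Y) $ i $ j = epsw (\<lambda>l. Dual 0 (w l))"
  proof -
    have "(K1 ** Y) $ i $ j = epsw (\<lambda>l. \<Sum>k\<in>UNIV. Dual 0 (kap d1 0 $ i $ k) ^ (CHAR('k) ^ l) * Dual (kap d2 l $ k $ j) 0)"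
      by (simp add: matrix_matrix_mult_def K1_def Y_def mult_epsw sum_epsw CHAR_dual)
    also have "(\<lambda>l. \<Sum>k\<in>UNIV. Dual 0 (kap d1 0 $ i $ k) ^ (CHAR('k) ^ l) * Dual (kap d2 l $ k $ j) 0) = (\<lambda>l. Dual 0 (w l))"
    proof
      fix l
      show "(\<Sum>k\<in>UNIV. Dual 0 (kap d1 0 $ i $ k) ^ (CHAR('k) ^ l) * Dual (kap d2 l $ k $ j) 0) = Dual 0 (w l)"
      proof (cases "l = 0")
        case True
        thus ?thesis
          by (auto intro!: dual.expand simp: dre_sum deps_sum w_def matrix_matrix_mult_def)
      next
        case False
        have "CHAR('k) ^ l \<ge> 2"
          using False prime_ge_2_nat[OF CHAR_prime[where ?'a='k]] power_increasing[of 1 l "CHAR('k)"]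
          by simp
        hence "(\<Sum>k\<in>UNIV. Dual 0 (kap d1 0 $ i $ k) ^ (CHAR('k) ^ l) * Dual (kap d2 l $ k $ j) 0) = 0"
          by (simp add: Dual_0_power)
        thus ?thesis using False by (simp add: w_def zero_dual_def)
      qed
    qed
    finally show ?thesis .
  qed
  have dd: "dre (dre (wcoeff (K1 $ i $ j + Y $ i $ j) l)) = 0" for l
  proof -
    have "dre (dre (wcoeff (K1 $ i $ j + Y $ i $ j) l)) = wcoeff (0 + 0) l"
      by (rule witt_hom_add) (auto simp: CHAR_dual K1_def Y_def)
    thus ?thesis by simp
  qed
  have "wcoeff (K1 $ i $ j + Y $ i $ j + (K1 ** Y) $ i $ j) l =
     wcoeff (K1 $ i $ j + Y $ i $ j) l + Dual 0 (Dual 0 (w l))"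
    unfolding KY by (subst wcoeff_add_orthogonal) (auto intro!: dual.expand simp: dd)
  hence "\<Theta> (\<lambda>a. wcoeff ((wl (a - mat 1) + wl a ** K2) $ i $ j) l) =
     wcoeff (K1 $ i $ j + Y $ i $ j) l + Dual 0 (Dual 0 (w l))"
    using main l by (auto simp: weq_def)
  moreover have "deps (deps (\<Theta> (\<lambda>a. wcoeff ((wl (a - mat 1) + wl a ** K2) $ i $ j) l))) =
     d1 (D2 (ext0 S (?f i j l)))"
  proof -
    have "d1 (D2 (ext0 S (?f i j l))) = d1 (\<lambda>a. deps (wcoeff ((wl (a - mat 1) + wl a ** K2) $ i $ j) l))"
      by (rule tang_cong[OF t1 regfun_reg[OF lie_mem[OF D2 rege]]])
         (simp only: one_step[OF _ l, symmetric] dual.sel)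
    thus ?thesis by (simp add: \<Theta>_def dhom_def)
  qed
  moreover have "d1 (D2 (ext0 S (?f i j l))) = D1 (D2 (ext0 S (?f i j l))) e"
    by (simp only: d1_def tang_of_def regfun_ext0[OF lie_mem[OF D2 rege]])
  ultimately show ?thesis by (simp add: w_def K1_def Y_def)
qed

text \<open>Addition of Witt vectors is commutative, so the \<open>\<epsilon>\<delta>\<close> part of the sum in \<open>second_order\<close> is symmetric in the two
  derivations and cancels in the commutator.\<close>

lemma (in wmonoid) kap_bracket:
  assumes D1: "D1 \<in> wlie_alg m S" and D2: "D2 \<in> wlie_alg m S" and l: "l < m"
  shows "kap (tang_of m S (\<lambda>f. D1 (D2 f) - D2 (D1 f))) l =
    (if l = 0 then mbracket (kap (tang_of m S D1) 0) (kap (tang_of m S D2) 0) else 0)"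
proof -
  \<comment> \<open>The automorphism of \<open>k[\<epsilon>, \<delta>]\<close> that exchanges \<open>\<epsilon>\<close> and \<open>\<delta>\<close>.\<close>
  define sw :: "'k dual dual \<Rightarrow> 'k dual dual" where
    "sw x = Dual (Dual (dre (dre x)) (dre (deps x))) (Dual (deps (dre x)) (deps (deps x)))" for x
  have sw: "deps (deps (wcoeff (wlift (epsw a) + epsw (\<lambda>l. Dual (b l) 0)) l)) =
     deps (deps (wcoeff (wlift (epsw b) + epsw (\<lambda>l. Dual (a l) 0)) l))" for a b :: "nat \<Rightarrow> 'k"
  proof -
    have "sw (wcoeff (wlift (epsw a) + epsw (\<lambda>l. Dual (b l) 0)) l) =
      wcoeff (epsw (\<lambda>l. Dual (a l) 0) + wlift (epsw b)) l"
      by (rule witt_hom_add) (auto simp: sw_def zero_dual_def intro!: dual.expand)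
    moreover have "deps (deps (sw x)) = deps (deps x)" for x by (simp add: sw_def)
    ultimately show ?thesis by (metis add.commute)
  qed
  let ?a = "\<lambda>i j l. kap (tang_of m S D1) l $ i $ j" and ?b = "\<lambda>i j l. kap (tang_of m S D2) l $ i $ j"
  show ?thesis
    unfolding vec_eq_iff
  proof (intro allI)
    fix i j
    show "kap (tang_of m S (\<lambda>f. D1 (D2 f) - D2 (D1 f))) l $ i $ j =
      (if l = 0 then mbracket (kap (tang_of m S D1) 0) (kap (tang_of m S D2) 0) else 0) $ i $ j"
    proof -
      let ?f = "\<lambda>A :: ('k, 'n) wmat. wcoeff ((A - mat 1) $ i $ j) l"
      have "kap (tang_of m S (\<lambda>f. D1 (D2 f) - D2 (D1 f))) l $ i $ j =
          D1 (D2 (ext0 S ?f)) e - D2 (D1 (ext0 S ?f)) e"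
        by (simp add: kap_def tang_of_def)
      thus ?thesis
        using second_order[OF D1 D2 l, of i j] second_order[OF D2 D1 l, of i j]
          sw[of "\<lambda>l. ?a i j l" "\<lambda>l. ?b i j l"]
        by (simp add: mbracket_def)
    qed
  qed
qed

lemma kpa_bracket:
  assumes x: "x \<in> wsl" and y: "y \<in> wsl"
  shows "G.kpa (bracket x y) l = (if l = 0 then mbracket (G.kpa x 0) (G.kpa y 0) else 0)"
  using x y by (auto simp: G.kpa_def bracket_def G.W.kap_bracket wsl_eq_PL G.PL_iff
      G.kap_eq_kpa[OF x[unfolded wsl_eq_PL], symmetric] G.kap_eq_kpa[OF y[unfolded wsl_eq_PL], symmetric])

section \<open>The coordinates of the adjoint action\<close>

definition mfrob :: "nat \<Rightarrow> 'k^'n^'n \<Rightarrow> 'k::field_prime_char^'n::finite^'n" where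
  "mfrob l A = (\<chi> i j. A $ i $ j ^ (CHAR('k) ^ l))"

lemma mult_epsm:
  fixes Z :: "('k::field_prime_char dual, 'n::finite) wmat"
  shows "Z ** epsm K = epsm (\<lambda>l. mfrob l (\<chi> i j. dre (wcoeff (Z $ i $ j) 0)) ** K l)"
  by (simp add: vec_eq_iff matrix_matrix_mult_def mult_epsw sum_epsw mfrob_def)

lemma epsm_mult:
  fixes Z :: "('k::field_prime_char dual, 'n::finite) wmat"
  shows "epsm K ** Z = epsm (\<lambda>l. K l ** mfrob l (\<chi> i j. dre (wcoeff (Z $ i $ j) 0)))"
proof -
  have "epsw y * z = epsw (\<lambda>l. y l * dre (wcoeff z 0) ^ (CHAR('k) ^ l))" for y and z :: "'k dual witt"
    using mult_epsw[of z y] by (simp only: mult.commute)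
  thus ?thesis by (simp add: vec_eq_iff matrix_matrix_mult_def sum_epsw mfrob_def)
qed

text \<open>Conjugation sends \<open>A - 1\<close> to \<open>g (A - 1) g'\<close>; apply \<open>mult_epsw\<close> on both sides.\<close>

lemma kpa_Ad:
  fixes g g' :: "('k::field_prime_char, 'n::finite) wmat"
  assumes g: "g \<in> SLW" "g ** g' = mat 1" "g' ** g = mat 1" and x: "x \<in> wsl"
  shows "Ad g x \<in> wsl" "G.kpa (Ad g x) = (\<lambda>l. mfrob l (mred g) ** G.kpa x l ** mfrob l (mred g'))"
proof -
  have g': "g' \<in> SLW" using g(1) det_mul[of g g'] by (simp add: SLW_def g(2))
  have mem: "mtrunc m h \<in> wcar m" if "h \<in> SLW" for m and h :: "('k, 'n) wmat"
    using that weq_det[of m "mtrunc m h" h] by (simp add: SLW_def wcar_def)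
  define \<phi> where "\<phi> m h = mtrunc m (g ** h ** g')" for m h
  have mon: "monoid (wgrp m (wcar m :: ('k, 'n) wmat set))" for m
    by (rule monoidI) (auto intro: G.W.closed G.W.one simp: matrix_mul_assoc G.W.trunc)
  have inv: "inv\<^bsub>wgrp m (wcar m)\<^esub> (mtrunc m g) = mtrunc m g'" for m
    by (rule monoid.inv_char[OF mon]) (auto simp: mem g g')
  have wh: "whom m (wcar m) m (wcar m) (\<phi> m)" for m
  proof (intro_locales, unfold_locales)
    show "\<phi> m \<in> mfun (reg (wcar m))"
      unfolding \<phi>_def by (intro mfun_mtrunc reg.mfun_mult reg.mfun_const reg_id)
    show "\<phi> m ` wcar m \<subseteq> wcar m"
    proof (intro image_subsetI)
      fix h :: "('k, 'n) wmat" assume h: "h \<in> wcar m"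
      have "mtrunc m (mtrunc m (mtrunc m g ** h) ** mtrunc m g') \<in> wcar m"
        by (intro G.W.closed mem h g g')
      thus "\<phi> m h \<in> wcar m" by (simp add: \<phi>_def)
    qed
    have "mtrunc m (g ** mtrunc m (mat 1) ** g') = mtrunc m (g ** mat 1 ** g')"
      unfolding mtrunc_eq_iff by (intro mweq_mult) auto
    thus "\<phi> m (mtrunc m (mat 1)) = mtrunc m (mat 1)" by (simp add: \<phi>_def g)
    fix a b :: "('k, 'n) wmat"
    have "mtrunc m (g ** mtrunc m (a ** b) ** g') = mtrunc m (g ** (a ** b) ** g')"
      unfolding mtrunc_eq_iff by (intro mweq_mult) auto
    also have "g ** (a ** b) ** g' = (g ** a ** g') ** (g ** b ** g')"
    proof -
      have "(g ** a ** g') ** (g ** b ** g') = g ** a ** (g' ** g) ** b ** g'"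
        by (simp only: matrix_mul_assoc)
      thus ?thesis by (simp add: g matrix_mul_assoc)
    qed
    finally show "\<phi> m (mtrunc m (a ** b)) = mtrunc m (\<phi> m a ** \<phi> m b)" by (simp add: \<phi>_def)
  qed
  have Ad: "Ad g x m = whom.push m (wcar m) m (wcar m) (\<phi> m) (x m)" for m
  proof -
    have "mtrunc m (mtrunc m (g ** h) ** g') = mtrunc m (g ** h ** g')" for h :: "('k, 'n) wmat" by simp
    moreover have "\<phi> m = (\<lambda>h. mtrunc m (g ** h ** g'))" by (simp add: \<phi>_def fun_eq_iff)
    ultimately show ?thesis
      unfolding whom.push_def[OF wh] by (simp add: Ad_def SLWm_eq_wgrp inv)
  qed
  have xm: "x m \<in> wlie_alg m (wcar m)" for m using x by (auto simp: wsl_eq_PL G.PL_iff)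
  have k: "kap (tang_of m (wcar m) (Ad g x m)) l = mfrob l (mred g) ** G.kpa x l ** mfrob l (mred g')"
    if l: "l < m" for m l
  proof -
    define d where "d = tang_of m (wcar m) (x m)"
    have t: "tang (wcar m) (mtrunc m (mat 1)) d" unfolding d_def by (rule G.W.tang_lie[OF xm])
    let ?e = "mtrunc m (mat 1)"
    let ?c = "\<lambda>A :: ('k, 'n) wmat. mmap (dhom ?e d) (\<lambda>_. A)"
    interpret H: wfun_hom "reg (wcar m)" "dhom ?e d" by (rule tang_dhom[OF t])
    have "mmap (dhom ?e d) (\<lambda>h. g ** (h - mat 1) ** g') = ?c g ** mmap (dhom ?e d) (\<lambda>h. h - mat 1) ** ?c g'"
      using H.mmap_mult[of "\<lambda>h. g ** (h - mat 1)" "\<lambda>_. g'"] H.mmap_mult[of "\<lambda>_. g" "\<lambda>h. h - mat 1"]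
      by (simp add: reg.mfun_const reg.mfun_mult reg_minus_one)
    hence "mweq m (mmap (dhom ?e d) (\<lambda>h. g ** (h - mat 1) ** g')) (?c g ** epsm (kap d) ** ?c g')"
      by (auto intro!: mweq_mult mmap_dhom_minus_one)
    also have "?c g ** epsm (kap d) ** ?c g' = epsm (\<lambda>l. mfrob l (mred g) ** kap d l ** mfrob l (mred g'))"
    proof -
      have "mred A = (\<chi> i j. dre (wcoeff (?c A $ i $ j) 0))" for A
        by (simp add: vec_eq_iff mred_def dhom_def)
      thus ?thesis by (simp only: mult_epsm epsm_mult)
    qed
    finally have 1: "mweq m (mmap (dhom ?e d) (\<lambda>h. g ** (h - mat 1) ** g'))
        (epsm (\<lambda>l. mfrob l (mred g) ** kap d l ** mfrob l (mred g')))" .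
    have "kap (tang_of m (wcar m) (Ad g x m)) l $ i $ j = (mfrob l (mred g) ** kap d l ** mfrob l (mred g')) $ i $ j" for i j
    proof -
      have "kap (tang_of m (wcar m) (Ad g x m)) l = kap (\<lambda>f. d (\<lambda>h. f (\<phi> m h))) l"
        unfolding Ad d_def by (rule whom.kap_push[OF wh xm])
      moreover have "wcoeff ((\<phi> m h - mat 1) $ i $ j) l = wcoeff ((g ** (h - mat 1) ** g') $ i $ j) l" for h
        unfolding \<phi>_def wcoeff_mtrunc_minus_one[OF l]
        by (simp add: matrix_sub_ldistrib matrix_sub_rdistrib g)
      ultimately have "kap (tang_of m (wcar m) (Ad g x m)) l $ i $ j = d (\<lambda>h. wcoeff ((g ** (h - mat 1) ** g') $ i $ j) l)"
        by (simp add: kap_def)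
      thus ?thesis using 1 l by (auto simp: mweq_def weq_def dhom_def)
    qed
    moreover have "kap d l = G.kpa x l"
      unfolding d_def using G.kap_eq_kpa x l by (auto simp: wsl_eq_PL)
    ultimately show ?thesis by (simp add: vec_eq_iff)
  qed
  have mm: "Ad g x m \<in> wlie_alg m (wcar m)" for m
    unfolding Ad by (rule whom.push_mem[OF wh xm])
  show "Ad g x \<in> wsl" "G.kpa (Ad g x) = (\<lambda>l. mfrob l (mred g) ** G.kpa x l ** mfrob l (mred g'))"
    unfolding wsl_eq_PL by (rule G.PL_I[OF mm], erule k)+
qed

section \<open>Differentiation of Laurent polynomial functions\<close>

lemma infinite_UNIV_alg_closed: "infinite (UNIV :: 'k::alg_closed_field set)"
proof
  assume fin: "finite (UNIV :: 'k set)"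
  let ?q = "(\<Prod>a\<in>UNIV. [:- a, 1:]) + 1 :: 'k poly"
  have deg: "Polynomial.degree (\<Prod>a\<in>A. [:- a, 1:]) = card A" if "finite A" for A :: "'k set"
    using that by (induction A rule: finite_induct) (auto simp: degree_mult_eq simp del: mult_pCons_left)
  have "Polynomial.degree ?q = CARD('k)"
    by (subst degree_add_eq_left) (use fin in \<open>auto simp: deg card_gt_0_iff\<close>)
  hence "Polynomial.degree ?q > 0" using fin by (simp add: card_gt_0_iff)
  then obtain x where "poly ?q x = 0" using alg_closed_imp_poly_has_root by blast
  moreover have "poly (\<Prod>a\<in>UNIV. [:- a, 1:]) x = 0"
    using fin by (subst prod.remove[of _ x]) auto
  ultimately show False by simp
qed

lemma poly_eqI_nonzero:
  fixes p q :: "'k::alg_closed_field poly"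
  assumes "\<And>s. s \<noteq> 0 \<Longrightarrow> poly p s = poly q s"
  shows "p = q"
proof (rule ccontr)
  assume "p \<noteq> q"
  hence "finite {x. poly (p - q) x = 0}" by (intro poly_roots_finite) simp
  moreover have "UNIV \<subseteq> insert 0 {x. poly (p - q) x = 0}" using assms by auto
  ultimately show False using infinite_UNIV_alg_closed finite_subset by blast
qed

text \<open>Functions on \<open>k\<close> that agree with a Laurent polynomial away from \<open>0\<close>.  Negative exponents are needed
  for curves in tori, and the base point of all curves is \<open>s = 1\<close>.\<close>

definition laur :: "('k::field \<Rightarrow> 'k) set" where
  "laur = {\<phi>. \<exists>N q. \<forall>s. s \<noteq> 0 \<longrightarrow> s ^ N * \<phi> s = poly q s}"

text \<open>The derivative at \<open>1\<close> of the quotient of \<open>q\<close> by \<open>s\<^sup>N\<close>.\<close>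

definition dlaur :: "('k::field \<Rightarrow> 'k) \<Rightarrow> 'k" where
  "dlaur \<phi> = (SOME c. \<exists>N q. (\<forall>s. s \<noteq> 0 \<longrightarrow> s ^ N * \<phi> s = poly q s) \<and>
     c = poly (pderiv q) 1 - of_nat N * poly q 1)"

text \<open>A function on the infinite field \<open>k\<close> determines its Laurent polynomial, so the derivative does not depend
  on the presentation.\<close>

lemma dlaur_eq:
  fixes \<phi> :: "'k::alg_closed_field \<Rightarrow> 'k"
  assumes "\<And>s. s \<noteq> 0 \<Longrightarrow> s ^ N * \<phi> s = poly q s"
  shows "dlaur \<phi> = poly (pderiv q) 1 - of_nat N * poly q 1"
proof -
  have "c = poly (pderiv q) 1 - of_nat N * poly q 1"
    if *: "\<exists>M r. (\<forall>s. s \<noteq> 0 \<longrightarrow> s ^ M * \<phi> s = poly r s) \<and> c = poly (pderiv r) 1 - of_nat M * poly r 1" for c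
  proof -
    from * obtain M r where r: "\<And>s. s \<noteq> 0 \<Longrightarrow> s ^ M * \<phi> s = poly r s"
      and c: "c = poly (pderiv r) 1 - of_nat M * poly r 1" by blast
    have "Polynomial.monom 1 M * q = Polynomial.monom 1 N * r"
    proof (rule poly_eqI_nonzero)
      fix s :: 'k assume s: "s \<noteq> 0"
      show "poly (Polynomial.monom 1 M * q) s = poly (Polynomial.monom 1 N * r) s"
        by (simp add: poly_monom assms[OF s, symmetric] r[OF s, symmetric] mult.left_commute)
    qed
    from arg_cong[OF this, of "\<lambda>p. poly (pderiv p) 1"] arg_cong[OF this, of "\<lambda>p. poly p 1"]
    show ?thesis by (simp add: c pderiv_mult pderiv_monom poly_monom algebra_simps)
  qed
  thus ?thesis unfolding dlaur_def using assms by (intro some_equality) blast+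
qed

lemma
  assumes "\<And>s. s \<noteq> 0 \<Longrightarrow> \<phi> s = \<psi> s"
  shows dlaur_cong: "dlaur \<phi> = dlaur \<psi>" and laur_cong: "\<phi> \<in> laur \<longleftrightarrow> \<psi> \<in> laur"
proof -
  have "(\<forall>s. s \<noteq> 0 \<longrightarrow> s ^ N * \<phi> s = poly q s) = (\<forall>s. s \<noteq> 0 \<longrightarrow> s ^ N * \<psi> s = poly q s)" for N q
    using assms by auto
  thus "dlaur \<phi> = dlaur \<psi>" "\<phi> \<in> laur \<longleftrightarrow> \<psi> \<in> laur"
    unfolding dlaur_def laur_def by (simp_all only: mem_Collect_eq)
qed

lemma laurI: "(\<And>s. s \<noteq> 0 \<Longrightarrow> s ^ N * \<phi> s = poly q s) \<Longrightarrow> \<phi> \<in> laur"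
  unfolding laur_def by (intro CollectI exI allI impI)

lemma laurE:
  assumes "\<phi> \<in> laur"
  obtains N q where "\<And>s. s \<noteq> 0 \<Longrightarrow> s ^ N * \<phi> s = poly q s"
proof -
  from assms have "\<exists>N q. \<forall>s. s \<noteq> 0 \<longrightarrow> s ^ N * \<phi> s = poly q s" by (simp add: laur_def)
  thus thesis
  proof (elim exE)
    fix N q assume "\<forall>s. s \<noteq> 0 \<longrightarrow> s ^ N * \<phi> s = poly q s"
    thus thesis by (intro that[of N q]) simp
  qed
qed

lemma laur_poly: "poly q \<in> laur" "dlaur (poly q) = poly (pderiv q) (1 :: 'k::alg_closed_field)"
proof -
  have "s ^ 0 * poly q s = poly q s" for s :: 'k by simp
  from laurI[OF this] dlaur_eq[OF this] show "poly q \<in> laur" "dlaur (poly q) = poly (pderiv q) (1 :: 'k)"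
    by simp_all
qed

lemma laur_const: "(\<lambda>_. c) \<in> laur" "dlaur (\<lambda>_. c) = (0 :: 'k)" for c :: "'k::alg_closed_field"
proof -
  have "poly [:c:] = (\<lambda>_. c)" by auto
  thus "(\<lambda>_. c) \<in> laur" "dlaur (\<lambda>_. c) = (0 :: 'k)" using laur_poly[of "[:c:]"] by simp_all
qed

lemma laur_inverse: "(\<lambda>s :: 'k. 1 / s) \<in> laur" "dlaur (\<lambda>s. 1 / s) = (-1 :: 'k::alg_closed_field)"
proof -
  have "s ^ 1 * (1 / s) = poly 1 s" if "s \<noteq> 0" for s :: 'k using that by simp
  from laurI[OF this] dlaur_eq[OF this] show "(\<lambda>s :: 'k. 1 / s) \<in> laur" "dlaur (\<lambda>s. 1 / s) = (-1 :: 'k)"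
    by (simp_all add: pderiv_1)
qed

lemma laur_hom:
  "fun_hom (laur :: ('k::alg_closed_field \<Rightarrow> 'k) set) (\<lambda>\<phi>. Dual (\<phi> 1) (dlaur \<phi>))"
proof
  fix c :: 'k
  show c: "(\<lambda>_. c) \<in> laur" "Dual 1 (dlaur (\<lambda>_. 1 :: 'k)) = 1"
    by (simp_all add: laur_const one_dual_def)
  fix f g :: "'k \<Rightarrow> 'k" assume fg: "f \<in> laur" "g \<in> laur"
  obtain N q where f: "\<And>s. s \<noteq> 0 \<Longrightarrow> s ^ N * f s = poly q s" by (rule laurE[OF fg(1)], rule that, blast)
  obtain M r where g: "\<And>s. s \<noteq> 0 \<Longrightarrow> s ^ M * g s = poly r s" by (rule laurE[OF fg(2)], rule that, blast)
  have add: "s ^ (N + M) * (f s + g s) = poly (Polynomial.monom 1 M * q + Polynomial.monom 1 N * r) s" if "s \<noteq> 0" for s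
    by (simp add: poly_monom f[OF that, symmetric] g[OF that, symmetric] power_add algebra_simps)
  have mult: "s ^ (N + M) * (f s * g s) = poly (q * r) s" if "s \<noteq> 0" for s
    by (simp add: f[OF that, symmetric] g[OF that, symmetric] power_add algebra_simps)
  show "(\<lambda>x. f x + g x) \<in> laur" "(\<lambda>x. f x * g x) \<in> laur"
    by (rule laurI[OF add] laurI[OF mult]; assumption)+
  have 1: "f 1 = poly q 1" "g 1 = poly r 1" using f[of 1] g[of 1] by simp_all
  note d = dlaur_eq[of _ f, OF f] dlaur_eq[of _ g, OF g]
  show "Dual (f 1 + g 1) (dlaur (\<lambda>x. f x + g x)) = Dual (f 1) (dlaur f) + Dual (g 1) (dlaur g)"
    using dlaur_eq[of _ "\<lambda>x. f x + g x", OF add]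
    by (intro dual.expand) (simp_all add: d pderiv_add pderiv_mult pderiv_monom poly_monom algebra_simps)
  show "Dual (f 1 * g 1) (dlaur (\<lambda>x. f x * g x)) = Dual (f 1) (dlaur f) * Dual (g 1) (dlaur g)"
    using dlaur_eq[of _ "\<lambda>x. f x * g x", OF mult]
    by (intro dual.expand) (simp_all add: d 1 pderiv_mult algebra_simps)
qed

text \<open>Evaluation at \<open>1 + \<epsilon>\<close>.\<close>

definition lhom :: "('k::field \<Rightarrow> 'k) \<Rightarrow> 'k dual" where
  "lhom \<phi> = Dual (\<phi> 1) (dlaur \<phi>)"

interpretation laur: wfun_hom "laur :: ('k::{alg_closed_field,field_prime_char} \<Rightarrow> 'k) set" lhom
  using laur_hom unfolding wfun_hom_def lhom_def by simp

lemma dlaur_scale: "\<phi> \<in> laur \<Longrightarrow> dlaur (\<lambda>s. c * \<phi> s) = c * dlaur (\<phi> :: 'k::{alg_closed_field,field_prime_char} \<Rightarrow> 'k)"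
  using arg_cong[OF laur.hom_mult[OF laur.const_mem[of c]], of \<phi> deps]
  by (simp add: lhom_def laur_const)

section \<open>Tangent vectors of curves\<close>

definition tcurve :: "('k::field_prime_char \<Rightarrow> ('k, 'n::finite) wmat) \<Rightarrow> (('k, 'n) wmat \<Rightarrow> 'k) \<Rightarrow> 'k" where
  "tcurve \<gamma> f = dlaur (\<lambda>s. f (\<gamma> s))"

lemma reg_curve:
  fixes \<gamma> :: "'k::{alg_closed_field,field_prime_char} \<Rightarrow> ('k, 'n::finite) wmat"
  assumes "\<gamma> \<in> mfun laur" "\<And>s. s \<noteq> 0 \<Longrightarrow> \<gamma> s \<in> S" and f: "f \<in> reg S"
  shows "(\<lambda>s. f (\<gamma> s)) \<in> laur"
  using f
proof (induction rule: reg_induct)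
  case (cong f g)
  thus ?case using laur_cong[of "\<lambda>s. f (\<gamma> s)" "\<lambda>s. g (\<gamma> s)"] assms(2) by auto
next
  case (coord i j l)
  thus ?case using assms(1) by (auto simp: mfun_def wfun_def)
qed (auto intro: laur.const_mem laur.add_mem laur.mult_mem)

lemma tang_curve:
  fixes \<gamma> :: "'k::{alg_closed_field,field_prime_char} \<Rightarrow> ('k, 'n::finite) wmat"
  assumes "\<gamma> \<in> mfun laur" "\<And>s. s \<noteq> 0 \<Longrightarrow> \<gamma> s \<in> S"
  shows "tang S (\<gamma> 1) (tcurve \<gamma>)"
proof -
  have r: "(\<lambda>s. f (\<gamma> s)) \<in> laur" if "f \<in> reg S" for f
    using reg_curve[OF assms(1) _ that] assms(2) by blast
  have "tcurve \<gamma> f = tcurve \<gamma> g" if "\<forall>x\<in>S. f x = g x" for f g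
    unfolding tcurve_def by (rule dlaur_cong) (use that assms(2) in auto)
  moreover have "tcurve \<gamma> (\<lambda>x. f x + g x) = tcurve \<gamma> f + tcurve \<gamma> g" if "f \<in> reg S" "g \<in> reg S" for f g
    using arg_cong[OF laur.hom_add[OF r r, OF that], of deps] by (simp add: tcurve_def lhom_def)
  moreover have "tcurve \<gamma> (\<lambda>x. f x * g x) = f (\<gamma> 1) * tcurve \<gamma> g + tcurve \<gamma> f * g (\<gamma> 1)" if "f \<in> reg S" "g \<in> reg S" for f g
    using arg_cong[OF laur.hom_mult[OF r r, OF that], of deps] by (simp add: tcurve_def lhom_def)
  moreover have "tcurve \<gamma> (\<lambda>x. c * f x) = c * tcurve \<gamma> f" if "f \<in> reg S" for c f
    unfolding tcurve_def by (rule dlaur_scale[OF r[OF that]])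
  ultimately show ?thesis unfolding tang_def by blast
qed

text \<open>Evaluation at \<open>1 + \<epsilon>\<close> commutes with the arithmetic of Witt vectors, so the
  coordinates of the tangent vector are the components of \<open>M\<close> at \<open>1 + \<epsilon>\<close>.\<close>

lemma kap_curve:
  fixes \<gamma> :: "'k::{alg_closed_field,field_prime_char} \<Rightarrow> ('k, 'n::finite) wmat"
  assumes "\<gamma> = (\<lambda>s. mtrunc m (mat 1 + M s))" "mmap lhom M = epsm K" "l < m"
  shows "kap (tcurve \<gamma>) l = K l"
proof -
  have "wcoeff ((\<gamma> s - mat 1) $ i $ j) l = wcoeff (M s $ i $ j) l" for s i j
    unfolding assms(1) wcoeff_mtrunc_minus_one[OF assms(3)] by simp
  moreover have "dlaur (\<lambda>s. wcoeff (M s $ i $ j) l) = K l $ i $ j" for i j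
    using arg_cong[OF assms(2), of "\<lambda>A. deps (wcoeff (A $ i $ j) l)"] by (simp add: lhom_def)
  ultimately show ?thesis by (simp only: vec_eq_iff kap_def tcurve_def vec_lambda_beta simp_thms)
qed

lemma of_int_epsw: "of_int n * epsw y = epsw (\<lambda>l. of_int n * y l :: 'a::comm_ring_prime_char)"
proof -
  have *: "of_nat n * epsw y = epsw (\<lambda>l. of_nat n * y l)" for n
    by (induction n) (auto simp: epsw_0 distrib_right add_epsw)
  show ?thesis
    by (cases n rule: int_cases2) (auto simp: * uminus_epsw)
qed

text \<open>The Verschiebung of order \<open>l\<close> of the Teichmueller representative of \<open>c\<close>.\<close>

definition vshift :: "nat \<Rightarrow> 'k::zero \<Rightarrow> 'k witt" where
  "vshift l c = Witt (\<lambda>i. if i = l then c else 0)"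

lemma wcoeff_vshift: "wcoeff (vshift l c) i = (if i = l then c else 0)"
  by (simp add: vshift_def)

definition imat :: "('n \<Rightarrow> 'n \<Rightarrow> int) \<Rightarrow> 'a::comm_ring_1^'n::finite^'n" where
  "imat n = (\<chi> i j. of_int (n i j))"

lemma kap_vshift_curve:
  fixes n :: "'n::finite \<Rightarrow> 'n \<Rightarrow> int" and l0 :: nat
  defines "\<gamma> \<equiv> \<lambda>m (s :: 'k::{alg_closed_field,field_prime_char}).
     mtrunc m (mat 1 + (\<chi> i j. of_int (n i j) * vshift l0 (s - 1)))"
  shows "\<gamma> m \<in> mfun laur" "\<gamma> m 1 = mtrunc m (mat 1)"
    "l < m \<Longrightarrow> kap (tcurve (\<gamma> m)) l = (if l = l0 then imat n else 0)"
proof -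
  let ?u = "\<lambda>s :: 'k. vshift l0 (s - 1)"
  have p: "(\<lambda>s. s - 1 :: 'k) = poly [:-1, 1:]" by (auto simp: fun_eq_iff)
  have d: "(\<lambda>s. s - 1 :: 'k) \<in> laur" "dlaur (\<lambda>s. s - 1 :: 'k) = 1"
    unfolding p by (auto simp: laur_poly pderiv_pCons)
  have "(\<lambda>s. wcoeff (?u s) l) \<in> laur" for l
    using d(1) by (cases "l = l0") (auto simp: wcoeff_vshift laur_const)
  hence u: "?u \<in> wfun laur" by (auto simp: wfun_def)
  have wu: "wmap lhom ?u = epsw (\<lambda>l. if l = l0 then 1 else 0)"
  proof (rule witt_eqI)
    fix l show "wcoeff (wmap lhom ?u) l = wcoeff (epsw (\<lambda>l. if l = l0 then 1 else 0)) l"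
      using d by (cases "l = l0") (auto simp: wcoeff_vshift lhom_def laur_const)
  qed
  let ?M = "\<lambda>s. (\<chi> i j. of_int (n i j) * ?u s) :: ('k, 'n) wmat"
  have M: "?M \<in> mfun laur" by (auto simp: mfun_def intro!: laur.wfun_mult laur.wfun_const u)
  have "mat 1 + ?M s = (\<chi> i j. mat 1 $ i $ j + of_int (n i j) * ?u s)" for s
    by (simp add: vec_eq_iff)
  have A: "(\<lambda>s. mat 1 + ?M s) \<in> mfun laur" by (intro laur.mfun_add laur.mfun_const M)
  have "(\<lambda>s. wcoeff (\<gamma> m s $ i $ j) l) \<in> laur" for i j l
    using A unfolding \<gamma>_def mtrunc_nth wcoeff_wtrunc
    by (cases "l < m") (auto simp: mfun_def wfun_def laur.const_mem)
  thus "\<gamma> m \<in> mfun laur" by (auto simp: mfun_def wfun_def)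
  have "?u 1 = 0" by (rule witt_eqI) (simp add: wcoeff_vshift)
  thus "\<gamma> m 1 = mtrunc m (mat 1)" by (simp add: \<gamma>_def vec_eq_iff)
  have "mmap lhom ?M = epsm (\<lambda>l. if l = l0 then imat n else 0)"
  proof -
    have "wmap lhom (\<lambda>s. of_int (n i j) * ?u s) = epsw (\<lambda>l. (if l = l0 then imat n else 0) $ i $ j)" for i j
      by (subst laur.wmap_mult) (auto intro!: laur.wfun_const u arg_cong[of _ _ epsw] simp: laur.wmap_of_int wu of_int_epsw imat_def fun_eq_iff)
    thus ?thesis by (simp add: vec_eq_iff)
  qed
  thus "l < m \<Longrightarrow> kap (tcurve (\<gamma> m)) l = (if l = l0 then imat n else 0)"
    using kap_curve[OF \<gamma>_def[THEN meta_eq_to_obj_eq, THEN fun_cong, of m], of _ l] by simp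
qed

subsection \<open>Transvections\<close>

definition iunit :: "'n \<Rightarrow> 'n \<Rightarrow> 'n \<Rightarrow> 'n \<Rightarrow> int" where
  "iunit a b = (\<lambda>i j. if i = a \<and> j = b then 1 else 0)"

text \<open>The square-zero matrix with the rows \<open>(-1, 1)\<close> and \<open>(-1, 1)\<close> in the positions \<open>a\<close>, \<open>b\<close>.  Together with
  the matrix units off the diagonal it produces the differences of diagonal matrix units; its integer entries
  can be multiplied with any Witt vector.\<close>

definition inil :: "'n \<Rightarrow> 'n \<Rightarrow> 'n \<Rightarrow> 'n \<Rightarrow> int" where
  "inil a b = (\<lambda>i j. iunit a b i j - iunit b a i j - iunit a a i j + iunit b b i j)"

lemma det_transvection:
  assumes "a \<noteq> b"
  shows "det (mat 1 + (\<chi> i j. of_int (iunit a b i j) * u)) = (1 :: 'a::comm_ring_1)"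
proof -
  have "mat 1 + (\<chi> i j. of_int (iunit a b i j) * u) =
     (\<chi> k. if k = a then row a (mat 1) + u *s row b (mat 1) else row k (mat 1) :: 'a^'b^'b)"
    using assms by (auto simp: vec_eq_iff mat_def row_def iunit_def)
  thus ?thesis by (simp only: det_row_operation[OF assms] det_I)
qed

lemma det_nilpotent:
  assumes "a \<noteq> b"
  shows "det (mat 1 + (\<chi> i j. of_int (inil a b i j) * u)) = (1 :: 'a::comm_ring_1)"
proof -
  define op :: "'b \<Rightarrow> 'b \<Rightarrow> 'a \<Rightarrow> 'a^'b^'b \<Rightarrow> 'a^'b^'b" where
    "op i j c A = (\<chi> k. if k = i then row i A + c *s row j A else row k A)" for i j c A
  have det: "det (op i j c A) = det A" if "i \<noteq> j" for i j c A
    unfolding op_def by (rule det_row_operation[OF that])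
  have "(mat 1 + (\<chi> i j. of_int (inil a b i j) * u)) $ i $ j = op b a 1 (op a b u (op b a (-1) (mat 1))) $ i $ j" for i j
    by (cases "i = a"; cases "i = b"; cases "j = a"; cases "j = b")
       (use assms in \<open>simp_all add: mat_def row_def iunit_def inil_def op_def algebra_simps\<close>)
  hence "mat 1 + (\<chi> i j. of_int (inil a b i j) * u) = op b a 1 (op a b u (op b a (-1) (mat 1)))"
    by (simp only: vec_eq_iff) simp
  thus ?thesis using assms by (simp add: det)
qed

section \<open>Multiplication by \<open>p\<close> and Teichmueller representatives\<close>

fun nmult_poly :: "nat \<Rightarrow> nat \<Rightarrow> nat \<Rightarrow> wpoly" where
  "nmult_poly p 0 n = 0"
| "nmult_poly p (Suc k) n = weval (pair_args (wvar 0) (nmult_poly p k)) (wadd_poly p n)"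

lemma ghost_zero: "p > 0 \<Longrightarrow> ghost p n (\<lambda>_. 0) = (0 :: 'a::comm_semiring_1)"
  by (simp add: ghost_def power_0_left)

lemma ghost_nmult_poly:
  assumes "Factorial_Ring.prime p"
  shows "ghost p n (nmult_poly p k) = of_nat k * ghost p n (wvar 0)"
proof (induction k)
  case 0
  have "nmult_poly p 0 = (\<lambda>_. 0)" by auto
  thus ?case using ghost_zero[of p n] prime_gt_0_nat[OF assms] by simp
next
  case (Suc k)
  have "ghost p n (nmult_poly p (Suc k)) = weval (pair_args (wvar 0) (nmult_poly p k)) (ghost p n (wadd_poly p))"
    by (subst weval_ghost) (intro arg_cong[of _ _ "ghost p n"] ext, simp)
  also have "\<dots> = ghost p n (wvar 0) + ghost p n (nmult_poly p k)"
    by (simp add: ghost_wadd_poly[OF assms] weval_add weval_ghost pair_args_def)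
  finally show ?case by (simp only: Suc of_nat_Suc distrib_right mult_1_left)
qed

lemma wcoeff_of_nat_mult:
  fixes x :: "'a::comm_ring_prime_char witt"
  shows "wcoeff (of_nat k * x) n = weval (\<lambda>_. wcoeff x) (nmult_poly CHAR('a) k n)"
proof (induction k arbitrary: n)
  case (Suc k)
  have "(\<lambda>c i. weval (\<lambda>_. wcoeff x) (pair_args (wvar 0) (nmult_poly CHAR('a) k) c i)) =
      pair_args (wcoeff x) (wcoeff (of_nat k * x))"
    by (auto simp: pair_args_def fun_eq_iff Suc)
  thus ?case by (simp add: distrib_right wcoeff_add weval_weval)
qed simp

text \<open>A congruence between ghost components modulo increasing powers of \<open>p\<close> passes to the components, because
  \<open>a \<equiv> b\<close> modulo \<open>p\<close> implies \<open>a ^ p ^ i \<equiv> b ^ p ^ i\<close> modulo \<open>p ^ (i + 1)\<close>.\<close>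

lemma ghost_cong_imp_cong:
  fixes a b :: "nat \<Rightarrow> wpoly"
  assumes p: "Factorial_Ring.prime p" and gh: "\<And>n. of_nat p ^ Suc n dvd ghost p n a - ghost p n b"
  shows "of_nat p dvd a n - b n"
proof (induction n rule: less_induct)
  case (less n)
  have "of_nat p ^ Suc n dvd of_nat p ^ i * (a i ^ (p ^ (n - i)) - b i ^ (p ^ (n - i)))" if "i < n" for i
  proof -
    have "of_nat p ^ i * of_nat p ^ (n - i + 1) dvd of_nat p ^ i * (a i ^ (p ^ (n - i)) - b i ^ (p ^ (n - i)))"
      by (intro mult_dvd_mono dvd_refl power_cong_lift_iter p less that)
    moreover have "of_nat p ^ i * of_nat p ^ (n - i + 1) = (of_nat p ^ Suc n :: wpoly)"
      using that by (simp flip: power_add power_Suc)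
    ultimately show ?thesis by simp
  qed
  hence *: "of_nat p ^ Suc n dvd (\<Sum>i<n. of_nat p ^ i * (a i ^ (p ^ (n - i)) - b i ^ (p ^ (n - i))))"
    by (intro dvd_sum) auto
  have "ghost p n a - ghost p n b - (\<Sum>i<n. of_nat p ^ i * (a i ^ (p ^ (n - i)) - b i ^ (p ^ (n - i)))) =
     of_nat p ^ n * (a n - b n)"
    by (simp add: ghost_Suc_split right_diff_distrib sum_subtractf)
  hence "of_nat p ^ Suc n dvd of_nat p ^ n * (a n - b n)"
    using dvd_diff[OF gh[of n] *] by (simp only:)
  then obtain c where "of_nat p ^ n * (a n - b n) = of_nat p ^ n * (of_nat p * c)"
    by (auto simp: algebra_simps elim!: dvdE)
  hence "a n - b n = of_nat p * c"
    using wpoly_torsion_free prime_gt_0_nat[OF p] by blast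
  thus ?case by simp
qed

text \<open>Multiplication by \<open>p\<close> is Verschiebung after Frobenius.  Over the integers the two operations have ghost components
  that differ by \<open>p ^ (n + 1) \<cdot> x\<^sub>n\<close>, so they agree modulo \<open>p\<close>.\<close>

lemma wcoeff_p_mult:
  fixes x :: "'a::comm_ring_prime_char witt"
  shows "wcoeff (of_nat CHAR('a) * x) n = (case n of 0 \<Rightarrow> 0 | Suc i \<Rightarrow> wcoeff x i ^ CHAR('a))"
proof -
  let ?p = "CHAR('a)"
  have p: "Factorial_Ring.prime ?p" by simp
  \<comment> \<open>Verschiebung after Frobenius, applied to the generic vector.\<close>
  define b :: "nat \<Rightarrow> wpoly" where "b n = (case n of 0 \<Rightarrow> 0 | Suc i \<Rightarrow> wvar 0 i ^ ?p)" for n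
  have gb: "ghost ?p n b + of_nat ?p ^ Suc n * wvar 0 n = of_nat ?p * ghost ?p n (wvar 0)" for n
  proof (cases n)
    case (Suc k)
    have "ghost ?p (Suc k) b = (\<Sum>i\<le>k. of_nat ?p ^ Suc i * (wvar 0 i ^ ?p) ^ (?p ^ (k - i)))"
      unfolding ghost_def by (subst sum.atMost_Suc_shift) (simp add: b_def power_0_left)
    also have "\<dots> = of_nat ?p * (\<Sum>i\<le>k. of_nat ?p ^ i * wvar 0 i ^ (?p ^ (Suc k - i)))"
      unfolding sum_distrib_left
      by (intro sum.cong) (auto simp: power_mult[symmetric] Suc_diff_le mult.assoc)
    also have "\<dots> + of_nat ?p ^ Suc (Suc k) * wvar 0 (Suc k) = of_nat ?p * ghost ?p (Suc k) (wvar 0)"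
      by (simp add: ghost_Suc_split lessThan_Suc_atMost algebra_simps)
    finally show ?thesis by (simp add: Suc)
  qed (simp add: ghost_def b_def)
  have "of_nat ?p dvd nmult_poly ?p ?p n - b n"
  proof (rule ghost_cong_imp_cong[OF p])
    fix n
    show "of_nat ?p ^ Suc n dvd ghost ?p n (nmult_poly ?p ?p) - ghost ?p n b"
      using gb[of n] by (simp add: ghost_nmult_poly[OF p] flip: gb)
  qed
  then obtain c where c: "nmult_poly ?p ?p n = b n + of_nat ?p * c" by (metis dvdE diff_eq_eq add.commute)
  have "wcoeff (of_nat ?p * x) n = weval (\<lambda>_. wcoeff x) (b n)"
    by (simp add: wcoeff_of_nat_mult c weval_add weval_mult)
  also have "\<dots> = (case n of 0 \<Rightarrow> 0 | Suc i \<Rightarrow> wcoeff x i ^ ?p)"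
    by (simp add: b_def weval_power split: nat.split)
  finally show ?thesis .
qed

text \<open>Frobenius is onto since \<open>k\<close> has \<open>p\<close>-th roots, so the multiples of \<open>p\<close> are the vectors with vanishing first component.\<close>

lemma p_power_dvd_witt_iff:
  fixes x :: "'k::{alg_closed_field,field_prime_char} witt"
  shows "of_nat CHAR('k) ^ j dvd x \<longleftrightarrow> (\<forall>l<j. wcoeff x l = 0)"
proof (induction j arbitrary: x)
  case (Suc j)
  let ?p = "CHAR('k)"
  show ?case
  proof
    assume "of_nat ?p ^ Suc j dvd x"
    then obtain y where x: "x = of_nat ?p * (of_nat ?p ^ j * y)" by (auto elim!: dvdE simp: algebra_simps)
    have "\<forall>l<j. wcoeff (of_nat ?p ^ j * y) l = 0" using Suc[of "of_nat ?p ^ j * y"] by simp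
    thus "\<forall>l<Suc j. wcoeff x l = 0" by (auto simp: x wcoeff_p_mult split: nat.split)
  next
    assume x: "\<forall>l<Suc j. wcoeff x l = 0"
    have "\<exists>c. c ^ ?p = wcoeff x (Suc i)" for i
      using nth_root_exists[of ?p "wcoeff x (Suc i)"] by auto
    then obtain c where c: "\<And>i. c i ^ ?p = wcoeff x (Suc i)" by metis
    have "wcoeff (Witt c) l = 0" if "l < j" for l
      using c[of l] x that by (metis Suc_mono power_eq_0_iff wcoeff_Witt)
    hence "of_nat ?p ^ j dvd Witt c" using Suc by blast
    moreover have "x = of_nat ?p * Witt c"
      using x by (intro witt_eqI) (auto simp: wcoeff_p_mult c split: nat.split)
    ultimately show "of_nat ?p ^ Suc j dvd x" by (simp only: power_Suc mult_dvd_mono dvd_refl)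
  qed
qed simp

lemma ghost_single:
  assumes "p > 0"
  shows "ghost p n (\<lambda>i. if i = 0 then c else 0) = (c :: 'a::comm_semiring_1) ^ (p ^ n)"
proof -
  have "ghost p n (\<lambda>i. if i = 0 then c else 0) = (\<Sum>i\<le>n. if i = 0 then c ^ (p ^ n) else 0)"
    unfolding ghost_def using assms by (intro sum.cong) (auto simp: power_0_left)
  thus ?thesis by simp
qed

lemma teich_mult: "teich a * teich b = teich (a * b :: 'a::comm_ring_prime_char)"
proof (rule witt_eqI)
  fix n
  let ?p = "CHAR('a)"
  have p: "Factorial_Ring.prime ?p" "?p > 0" by simp_all
  let ?t = "\<lambda>c i. if i = 0 then wvar c 0 else 0"
  let ?v = "pair_args (?t 0) (?t 1)"
  have "weval ?v (wmult_poly ?p n) = (if n = 0 then wvar 0 0 * wvar 1 0 else 0)"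
  proof (rule ghost_inj_torsion_free[OF torsion_free_wpoly[OF p(2)], of n
      "\<lambda>n. weval ?v (wmult_poly ?p n)" "\<lambda>n. if n = 0 then wvar 0 0 * wvar 1 0 else 0"])
    fix n
    have "ghost ?p n (\<lambda>n. weval ?v (wmult_poly ?p n)) = ghost ?p n (?t 0) * ghost ?p n (?t 1)"
      by (simp only: weval_ghost[symmetric] ghost_wmult_poly[OF p(1)] weval_mult)
         (simp add: weval_ghost pair_args_def)
    also have "\<dots> = ghost ?p n (\<lambda>n. if n = 0 then wvar 0 0 * wvar 1 0 else 0)"
      by (simp add: ghost_single p power_mult_distrib)
    finally show "ghost ?p n (\<lambda>n. weval ?v (wmult_poly ?p n)) =
       ghost ?p n (\<lambda>n. if n = 0 then wvar 0 0 * wvar 1 0 else 0)" .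
  qed
  from arg_cong[OF this, of "weval (\<lambda>c i. if c = 0 then a else b)"]
  have "weval (\<lambda>c i. weval (\<lambda>c i. if c = 0 then a else b) (?v c i)) (wmult_poly ?p n) = (if n = 0 then a * b else 0)"
    by (simp add: weval_weval weval_mult split: if_splits)
  also have "(\<lambda>c i. weval (\<lambda>c i. if c = 0 then a else b) (?v c i)) = pair_args (wcoeff (teich a)) (wcoeff (teich b))"
    by (auto simp: fun_eq_iff pair_args_def teich_def)
  finally show "wcoeff (teich a * teich b) n = wcoeff (teich (a * b)) n"
    by (simp add: wcoeff_mult teich_def)
qed

lemma teich_1: "teich 1 = (1 :: 'a::comm_ring_prime_char witt)"
  by (simp add: teich_def one_witt_def)

section \<open>Reduction to the residue field\<close>

lemma ghost_0: "ghost p 0 a = a 0"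
  by (simp add: ghost_def)

lemma
  fixes x y :: "'a::comm_ring_prime_char witt"
  shows wcoeff_0_add: "wcoeff (x + y) 0 = wcoeff x 0 + wcoeff y 0"
    and wcoeff_0_mult: "wcoeff (x * y) 0 = wcoeff x 0 * wcoeff y 0"
    and wcoeff_0_uminus: "wcoeff (- x) 0 = - wcoeff x 0"
  using ghost_wadd_poly[of "CHAR('a)" 0] ghost_wmult_poly[of "CHAR('a)" 0] ghost_wneg_poly[of "CHAR('a)" 0]
  by (simp_all add: wcoeff_add wcoeff_mult wcoeff_uminus ghost_0 weval_add weval_mult weval_uminus pair_args_def)

lemma wcoeff_0_diff: "wcoeff (x - y) 0 = wcoeff x 0 - wcoeff y 0"
  for x y :: "'a::comm_ring_prime_char witt"
  using wcoeff_0_add[of x "- y"] by (simp add: wcoeff_0_uminus)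

lemma wcoeff_0_sum: "wcoeff (\<Sum>a\<in>A. f a) 0 = (\<Sum>a\<in>A. wcoeff (f a) 0)"
  for f :: "_ \<Rightarrow> 'a::comm_ring_prime_char witt"
  by (induction A rule: infinite_finite_induct) (auto simp: wcoeff_0_add)

lemma mred_mult: "mred (A ** B) = mred A ** mred B"
  for A B :: "('k::comm_ring_prime_char, 'n::finite) wmat"
  by (simp add: mred_def matrix_matrix_mult_def wcoeff_0_sum wcoeff_0_mult vec_eq_iff)

lemma mred_one: "mred (mat 1) = (mat 1 :: 'k::comm_ring_prime_char^'n::finite^'n)"
  by (simp add: mred_def mat_def vec_eq_iff wcoeff_1)

lemma matrix_inv_eqI:
  fixes A B :: "'a::comm_ring_1^'n::finite^'n"
  assumes "A ** B = mat 1" "B ** A = mat 1"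
  shows "matrix_inv A = B"
proof -
  have "\<exists>C. A ** C = mat 1 \<and> C ** A = mat 1" using assms by blast
  from someI_ex[OF this] have inv: "A ** matrix_inv A = mat 1 \<and> matrix_inv A ** A = mat 1"
    unfolding matrix_inv_def .
  have "matrix_inv A = (B ** A) ** matrix_inv A" by (simp only: assms matrix_mul_lid)
  also have "\<dots> = B ** (A ** matrix_inv A)" by (simp only: matrix_mul_assoc)
  finally show ?thesis using inv by (simp only: matrix_mul_rid)
qed

lemma SLW_inverse:
  fixes g :: "('k::field_prime_char, 'n::finite) wmat"
  assumes "g \<in> SLW"
  obtains g' where "g' \<in> SLW" "g ** g' = mat 1" "g' ** g = mat 1" "matrix_inv (mred g) = mred g'"
    "mred g ** mred g' = mat 1" "mred g' ** mred g = mat 1"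
proof -
  obtain g' where g': "g ** g' = mat 1" "g' ** g = mat 1" "det g' = 1"
    using det_one_inverse[of g] assms by (auto simp: SLW_def)
  have m: "mred g ** mred g' = mat 1" "mred g' ** mred g = mat 1"
    using g' by (simp_all add: mred_mult[symmetric] mred_one)
  show ?thesis by (rule that[of g']) (use g' m matrix_inv_eqI[OF m] in \<open>auto simp: SLW_def\<close>)
qed

lemma kpa_Ad':
  fixes g :: "('k::field_prime_char, 'n::finite) wmat"
  assumes "g \<in> SLW" "x \<in> wsl"
  shows "Ad g x \<in> wsl"
    "G.kpa (Ad g x) l = mfrob l (mred g) ** G.kpa x l ** mfrob l (matrix_inv (mred g))"
proof -
  obtain g' where g': "g ** g' = mat 1" "g' ** g = mat 1" "matrix_inv (mred g) = mred g'"
    using SLW_inverse[OF assms(1)] by metis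
  show "Ad g x \<in> wsl" "G.kpa (Ad g x) l = mfrob l (mred g) ** G.kpa x l ** mfrob l (matrix_inv (mred g))"
    using kpa_Ad[OF assms(1) g'(1,2) assms(2)] by (simp_all add: g'(3))
qed

lemma lie_red_eq_kpa:
  assumes x: "x \<in> wsl" shows "lie_red x = G.kpa x 0"
proof -
  have "x (Suc 0) \<in> wlie_alg (Suc 0) (wcar (Suc 0))" using x by (simp add: wsl_eq_PL G.PL_iff)
  note t = G.W.tang_lie[OF this]
  let ?d = "tang_of (Suc 0) (wcar (Suc 0)) (x (Suc 0))"
  have "?d (\<lambda>A. wcoeff ((A - mat 1) $ i $ j) 0) = ?d (\<lambda>A. wcoeff (A $ i $ j) 0)" for i j
  proof -
    have "?d (\<lambda>A. wcoeff (A $ i $ j) 0 + - wcoeff (mat 1 $ i $ j) 0) =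
        ?d (\<lambda>A. wcoeff (A $ i $ j) 0) + ?d (\<lambda>A. - wcoeff (mat 1 $ i $ j) 0)"
      by (rule tang_add[OF t reg_coord reg.const_mem])
    thus ?thesis by (simp add: tang_const[OF t] wcoeff_0_diff)
  qed
  hence "G.kpa x 0 = (\<chi> i j. ?d (\<lambda>A. wcoeff (A $ i $ j) 0))"
    unfolding G.kpa_def kap_def by simp
  thus ?thesis unfolding lie_red_def tang_of_def One_nat_def SLWm_eq_wgrp wgrp_simps by simp
qed

section \<open>Lie algebras of closed subgroups\<close>

text \<open>The coordinate sequences of tangent vectors of \<open>H\<close>.  The vectors at different levels need
  not be chosen compatibly, as their coordinates determine them.\<close>

definition tvec :: "('k::field_prime_char, 'n::finite) wmat set \<Rightarrow> (nat \<Rightarrow> 'k^'n^'n) \<Rightarrow> bool" where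
  "tvec H Y \<longleftrightarrow> (\<forall>m. \<exists>d. tang (mtrunc m ` H) (mtrunc m (mat 1)) d \<and> (\<forall>l<m. kap d l = Y l))"

lemma tvec_0: "tvec H (\<lambda>_. 0)"
  unfolding tvec_def by (intro allI exI[of _ "\<lambda>_. 0"]) (auto simp: tang_zero kap_def vec_eq_iff)

lemma tvec_sum:
  assumes "finite A" "\<And>a. a \<in> A \<Longrightarrow> tvec H (Y a)"
  shows "tvec H (\<lambda>l. \<Sum>a\<in>A. mscale (c a) (Y a l))"
  unfolding tvec_def
proof
  fix m
  have "\<exists>d. \<forall>a\<in>A. tang (mtrunc m ` H) (mtrunc m (mat 1)) (d a) \<and> (\<forall>l<m. kap (d a) l = Y a l)"
    using assms(2) unfolding tvec_def by (intro bchoice) blast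
  then obtain d where d: "\<And>a. a \<in> A \<Longrightarrow> tang (mtrunc m ` H) (mtrunc m (mat 1)) (d a)"
     "\<And>a l. a \<in> A \<Longrightarrow> l < m \<Longrightarrow> kap (d a) l = Y a l" by blast
  have t: "tang (mtrunc m ` H) (mtrunc m (mat 1)) (\<lambda>f. c a * d a f)" if "a \<in> A" for a
    using tang_lincomb[OF d(1)[OF that] d(1)[OF that], of "c a" 0] by simp
  have "kap (\<lambda>f. c a * d a f) l = mscale (c a) (kap (d a) l)" for a l
    by (simp add: kap_def mscale_def vec_eq_iff)
  hence "\<forall>l<m. kap (\<lambda>f. \<Sum>a\<in>A. c a * d a f) l = (\<Sum>a\<in>A. mscale (c a) (Y a l))"
    unfolding kap_sum using d(2) by simp
  thus "\<exists>d. tang (mtrunc m ` H) (mtrunc m (mat 1)) d \<and> (\<forall>l<m. kap d l = (\<Sum>a\<in>A. mscale (c a) (Y a l)))"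
    using tang_sum[of A "mtrunc m ` H" "mtrunc m (mat 1)" "\<lambda>a f. c a * d a f", OF t] by blast
qed

lemma tvec_add: "tvec H Y \<Longrightarrow> tvec H Z \<Longrightarrow> tvec H (\<lambda>l. Y l + Z l)"
  using tvec_sum[of "{False, True}" H "\<lambda>b. if b then Z else Y" "\<lambda>_. 1"] by simp

lemma tvec_scale: "tvec H Y \<Longrightarrow> tvec H (\<lambda>l. mscale c (Y l))"
  using tvec_sum[of "{()}" H "\<lambda>_. Y" "\<lambda>_. c"] by simp

lemma tvec_cong_levels:
  assumes "\<And>m. \<exists>Z. tvec H Z \<and> (\<forall>l<m. Z l = Y l)"
  shows "tvec H Y"
  unfolding tvec_def
proof
  fix m
  obtain Z where "tvec H Z" "\<forall>l<m. Z l = Y l" using assms by blast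
  thus "\<exists>d. tang (mtrunc m ` H) (mtrunc m (mat 1)) d \<and> (\<forall>l<m. kap d l = Y l)"
    unfolding tvec_def by metis
qed

definition at_level :: "nat \<Rightarrow> 'v \<Rightarrow> nat \<Rightarrow> 'v::zero" where
  "at_level l M = (\<lambda>l'. if l' = l then M else 0)"

text \<open>Only finitely many levels matter in a truncated group, and tangent vectors can be added there.\<close>

lemma tvec_levels:
  assumes "\<And>l. tvec H (at_level l (Y l))"
  shows "tvec H Y"
proof (rule tvec_cong_levels)
  fix m
  have "tvec H (\<lambda>l'. \<Sum>l<m. mscale 1 (at_level l (Y l) l'))"
    by (intro tvec_sum assms) simp
  moreover have "(\<Sum>l<m. mscale 1 (at_level l (Y l) l')) = Y l'" if "l' < m" for l'
    using that by (simp add: at_level_def sum.delta)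
  ultimately show "\<exists>Z. tvec H Z \<and> (\<forall>l<m. Z l = Y l)" by blast
qed

lemma tvec_curve:
  fixes H :: "('k::{alg_closed_field,field_prime_char}, 'n::finite) wmat set"
  assumes "\<And>s :: 'k. mat 1 + (\<chi> i j. of_int (n i j) * vshift l0 (s - 1)) \<in> H"
  shows "tvec H (at_level l0 (imat n))"
  unfolding tvec_def
proof
  fix m
  define \<gamma> where "\<gamma> = (\<lambda>s :: 'k. mtrunc m (mat 1 + (\<chi> i j. of_int (n i j) * vshift l0 (s - 1))) :: ('k, 'n) wmat)"
  have \<gamma>: "\<gamma> \<in> mfun laur" "\<gamma> 1 = mtrunc m (mat 1)"
    "\<And>l. l < m \<Longrightarrow> kap (tcurve \<gamma>) l = (if l = l0 then imat n else 0)"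
    unfolding \<gamma>_def by (rule kap_vshift_curve; assumption?)+
  have "tang (mtrunc m ` H) (\<gamma> 1) (tcurve \<gamma>)"
    by (rule tang_curve[OF \<gamma>(1)]) (use assms in \<open>auto simp: \<gamma>_def\<close>)
  thus "\<exists>d. tang (mtrunc m ` H) (mtrunc m (mat 1)) d \<and> (\<forall>l<m. kap d l = at_level l0 (imat n) l)"
    unfolding \<gamma>(2) at_level_def using \<gamma>(3) by blast
qed

locale wsub =
  fixes H :: "('k::field_prime_char, 'n::finite) wmat set"
  assumes H_sub: "H \<subseteq> SLW" and H_one: "mat 1 \<in> H" and H_mult: "A \<in> H \<Longrightarrow> B \<in> H \<Longrightarrow> A ** B \<in> H"
begin

lemma wtower: "wtower (\<lambda>m. mtrunc m ` H)"
  by (rule wtower.intro) (auto intro!: wmonoid_image H_sub H_one H_mult simp: mtrunc_mtrunc_le)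

sublocale L: wtower "\<lambda>m. mtrunc m ` H"
  by (rule wtower)

lemma whom_incl: "whom m (mtrunc m ` H) m (wcar m) (\<lambda>A. A)"
  by (intro whom.intro whom_axioms.intro L.wmonoid wmonoid_wcar reg_id refl)
     (simp only: image_ident L.W.sub)

sublocale I: whom m "mtrunc m ` H" m "wcar m" "\<lambda>A. A" for m
  by (rule whom_incl)

definition incl where "incl x = (\<lambda>m. I.push m (x m))"

lemma sublie_eq: "sublie H = incl ` L.PL"
  by (simp add: sublie_def incl_def[abs_def] I.push_def L.PL_def level_eq_wgrp[abs_def] SLWm_eq_wgrp)

lemma incl_wsl:
  assumes "x \<in> L.PL"
  shows "incl x \<in> wsl" "G.kpa (incl x) = L.kpa x"
proof -
  have 1: "incl x m \<in> wlie_alg m (wcar m)" for m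
    using assms by (auto simp: incl_def L.PL_iff intro: I.push_mem)
  have 2: "kap (tang_of m (wcar m) (incl x m)) l = L.kpa x l" if "l < m" for m l
    using assms that by (auto simp: incl_def I.kap_push L.PL_iff L.kap_eq_kpa[OF assms that, symmetric])
  show "incl x \<in> wsl" "G.kpa (incl x) = L.kpa x"
    unfolding wsl_eq_PL by (rule G.PL_I[OF 1], erule 2)+
qed

lemma sublie_ex:
  assumes "tvec H Y" shows "\<exists>x\<in>sublie H. G.kpa x = Y"
proof -
  from assms obtain d where d: "\<And>m. tang (mtrunc m ` H) (mtrunc m (mat 1)) (d m)"
     "\<And>m l. l < m \<Longrightarrow> kap (d m) l = Y l" unfolding tvec_def by metis
  define x where "x m = lie_of m (mtrunc m ` H) (d m)" for m
  have x: "x m \<in> wlie_alg m (mtrunc m ` H)" for m unfolding x_def by (rule L.W.lie_tang[OF d(1)])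
  have k: "kap (tang_of m (mtrunc m ` H) (x m)) l = Y l" if "l < m" for m l
    using L.W.tang_of_lie_of[OF d(1) reg_wcoeff[OF reg_minus_one]] d(2)[OF that]
    by (simp add: kap_def x_def)
  note PL = L.PL_I[OF x, of Y, OF k]
  show ?thesis
    using PL incl_wsl[OF PL(1)] unfolding sublie_eq by auto
qed

text \<open>The differential of the inclusion preserves coordinates, so membership in the Lie algebra of a subgroup
  is a condition on the coordinates alone.\<close>

lemma sublie_iff: "x \<in> sublie H \<longleftrightarrow> x \<in> wsl \<and> tvec H (G.kpa x)"
proof
  assume "x \<in> sublie H"
  then obtain y where y: "y \<in> L.PL" "x = incl y" unfolding sublie_eq by blast
  have "tvec H (L.kpa y)"
    unfolding tvec_def
  proof
    fix m
    show "\<exists>d. tang (mtrunc m ` H) (mtrunc m (mat 1)) d \<and> (\<forall>l<m. kap d l = L.kpa y l)"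
      by (rule exI[of _ "tang_of m (mtrunc m ` H) (y m)"])
        (use y L.W.tang_lie in \<open>auto simp: L.PL_iff L.kap_eq_kpa\<close>)
  qed
  thus "x \<in> wsl \<and> tvec H (G.kpa x)" using incl_wsl[OF y(1)] y(2) by simp
next
  assume x: "x \<in> wsl \<and> tvec H (G.kpa x)"
  then obtain y where y: "y \<in> sublie H" "G.kpa y = G.kpa x" using sublie_ex by blast
  have "y \<in> wsl" using y(1) incl_wsl(1) by (auto simp: sublie_eq)
  hence "y = x" using x y(2) by (intro G.PL_eqI) (auto simp: wsl_eq_PL)
  thus "x \<in> sublie H" using y by simp
qed

text \<open>A coordinate function that vanishes on \<open>H\<close> vanishes on its tangent vectors.\<close>

lemma tvec_zero_entry:
  assumes Y: "tvec H Y" and 0: "\<And>A. A \<in> H \<Longrightarrow> wcoeff ((A - mat 1) $ i $ j) l = 0"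
  shows "Y l $ i $ j = 0"
proof -
  obtain d where d: "tang (mtrunc (Suc l) ` H) (mtrunc (Suc l) (mat 1)) d" "kap d l = Y l"
    using Y unfolding tvec_def by (metis lessI)
  have "d (\<lambda>A. wcoeff ((A - mat 1) $ i $ j) l) = d (\<lambda>_. 0)"
  proof (rule tang_cong[OF d(1) reg_wcoeff[OF reg_minus_one]])
    fix A assume "A \<in> mtrunc (Suc l) ` H"
    then obtain B where B: "B \<in> H" "A = mtrunc (Suc l) B" by blast
    show "wcoeff ((A - mat 1) $ i $ j) l = 0"
      unfolding B(2) wcoeff_mtrunc_minus_one[OF lessI] by (rule 0[OF B(1)])
  qed
  hence "kap d l $ i $ j = 0" by (simp only: kap_def vec_lambda_beta tang_const[OF d(1)])
  thus ?thesis using d(2) by simp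
qed

end

section \<open>Congruence subgroups\<close>

definition Eu :: "'n \<Rightarrow> 'n \<Rightarrow> 'a::comm_ring_1^'n::finite^'n" where
  "Eu a b = imat (iunit a b)"

lemma Eu_nth: "Eu a b $ i $ j = (if i = a \<and> j = b then 1 else 0)"
  by (simp add: Eu_def imat_def iunit_def)

definition sl_gens :: "('k::field^'n::finite^'n) set" where
  "sl_gens = {Eu a b | a b. a \<noteq> b} \<union> {Eu a a - Eu b b | a b. a \<noteq> b}"

lemma sl_gens_sl: "sl_gens \<subseteq> (sl :: ('k::field^'n::finite^'n) set)"
proof -
  have "trace (Eu a b :: 'k^'n^'n) = (if a = b then 1 else 0)" for a b
  proof -
    have "trace (Eu a b :: 'k^'n^'n) = (\<Sum>i\<in>UNIV. if i = a then if a = b then 1 else 0 else 0)"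
      unfolding trace_def by (intro sum.cong) (auto simp: Eu_nth)
    thus ?thesis by simp
  qed
  thus ?thesis by (auto simp: sl_gens_def sl_def trace_sub)
qed

lemma subspace_sl: "kmat.subspace sl"
  by (auto simp: kmat.subspace_def sl_def trace_def mscale_def sum.distrib sum_distrib_left[symmetric])

lemma sl_span: "sl \<subseteq> kmat.span (sl_gens :: ('k::field^'n::finite^'n) set)"
proof
  fix M :: "'k^'n^'n" assume "M \<in> sl"
  hence tr: "(\<Sum>i\<in>UNIV. M $ i $ i) = 0" by (simp add: sl_def trace_def)
  obtain c :: 'n where True by blast
  let ?F = "\<lambda>(i, j). mscale (M $ i $ j) (if i = j then Eu i i - Eu c c else Eu i j) :: 'k^'n^'n"
  have "(\<Sum>x\<in>UNIV. ?F x) $ r $ s = M $ r $ s" for r s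
  proof -
    have "?F (i, j) $ r $ s = (if i = r \<and> j = s then M $ i $ j else 0) - (if i = j \<and> r = c \<and> s = c then M $ i $ i else 0)" for i j
      by (auto simp: mscale_def Eu_nth)
    hence "(\<Sum>i\<in>UNIV. \<Sum>j\<in>UNIV. ?F (i, j) $ r $ s) =
       (\<Sum>i\<in>UNIV. \<Sum>j\<in>UNIV. (if i = r then if j = s then M $ i $ j else 0 else 0)) -
       (\<Sum>i\<in>UNIV. \<Sum>j\<in>UNIV. (if i = j then if r = c \<and> s = c then M $ i $ i else 0 else 0))"
      by (simp only: sum_subtractf) (intro arg_cong2[of _ _ _ _ "(-)"] sum.cong; simp)
    also have "(\<Sum>i\<in>UNIV. \<Sum>j\<in>UNIV. (if i = r then if j = s then M $ i $ j else 0 else 0)) = M $ r $ s"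
    proof -
      have "(\<Sum>j\<in>UNIV. (if i = r then if j = s then M $ i $ j else 0 else 0)) = (if i = r then M $ i $ s else 0)" for i
        by simp
      thus ?thesis by simp
    qed
    also have "(\<Sum>i\<in>UNIV. \<Sum>j\<in>UNIV. (if i = j then if r = c \<and> s = c then M $ i $ i else 0 else 0)) = 0"
      using tr by (cases "r = c \<and> s = c") (simp, subst sum.neutral, auto)
    finally show ?thesis
      by (simp add: sum_component sum.cartesian_product UNIV_Times_UNIV case_prod_unfold cong: if_cong)
  qed
  hence "M = (\<Sum>x\<in>UNIV. ?F x)" by (simp add: vec_eq_iff)
  also have "\<dots> \<in> kmat.span sl_gens"
  proof (rule kmat.span_sum)
    fix x :: "'n \<times> 'n"
    have "(if fst x = snd x then Eu (fst x) (fst x) - Eu c c else Eu (fst x) (snd x)) \<in> kmat.span (sl_gens :: ('k^'n^'n) set)"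
      by (cases "fst x = c"; cases "fst x = snd x")
        (auto intro!: kmat.span_base kmat.span_zero simp: sl_gens_def)
    thus "?F x \<in> kmat.span sl_gens"
      by (simp add: case_prod_unfold kmat.span_scale)
  qed
  finally show "M \<in> kmat.span sl_gens" .
qed

lemma wsub_Gam: "wsub (Gam j :: ('k::field_prime_char, 'n::finite) wmat set)"
proof
  fix A B :: "('k, 'n) wmat"
  assume A: "A \<in> Gam j" and B: "B \<in> Gam j"
  have "A ** B - mat 1 = (A - mat 1) + A ** (B - mat 1)" by (simp add: matrix_sub_ldistrib)
  moreover have "of_nat CHAR('k) ^ j dvd ((A - mat 1) + A ** (B - mat 1)) $ a $ b" for a b
  proof -
    have "of_nat CHAR('k) ^ j dvd (A - mat 1) $ a $ b" using A by (simp add: Gam_def)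
    moreover have "of_nat CHAR('k) ^ j dvd (A ** (B - mat 1)) $ a $ b"
      using B unfolding matrix_matrix_mult_def by (auto intro!: dvd_sum dvd_mult simp: Gam_def)
    ultimately show ?thesis by simp
  qed
  ultimately have "\<forall>a b. of_nat CHAR('k) ^ j dvd (A ** B - mat 1) $ a $ b" by (simp only: simp_thms)
  moreover have "A ** B \<in> SLW" using A B by (simp add: Gam_def SLW_def det_mul)
  ultimately show "A ** B \<in> Gam j" unfolding Gam_def by blast
qed (auto simp: Gam_def SLW_def)

text \<open>Level by level it suffices to treat the spanning set \<open>sl_gens\<close>.  A square-zero integer matrix \<open>N\<close> at level \<open>l \<ge> j\<close> is
  the tangent vector of \<open>s \<mapsto> 1 + N V\<^sup>l[s - 1]\<close>, which lies in \<open>Gam j\<close> as \<open>V\<^sup>l[s - 1]\<close> is divisible by \<open>p\<^sup>j\<close>; the difference of two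
  diagonal matrix units is a combination of three such \<open>N\<close>.\<close>

lemma tvec_Gam:
  fixes Y :: "nat \<Rightarrow> 'k::{alg_closed_field,field_prime_char}^'n::finite^'n"
  assumes "\<And>l. Y l \<in> sl" "\<And>l. l < j \<Longrightarrow> Y l = 0"
  shows "tvec (Gam j) Y"
proof (rule tvec_levels)
  fix l
  show "tvec (Gam j) (at_level l (Y l))"
  proof (cases "l < j")
    case True
    thus ?thesis using assms(2) tvec_0[of "Gam j"] by (simp add: at_level_def)
  next
    case False
    let ?T = "{M :: 'k^'n^'n. tvec (Gam j) (at_level l M)}"
    have sub: "kmat.subspace ?T"
    proof -
      have "at_level l (M + N) = (\<lambda>i. at_level l M i + at_level l N i)" for M N :: "'k^'n^'n"
        by (auto simp: at_level_def)
      moreover have "at_level l (mscale c M) = (\<lambda>i. mscale c (at_level l M i))" for c and M :: "'k^'n^'n"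
        by (auto simp: at_level_def mscale_def vec_eq_iff)
      moreover have "at_level l (0 :: 'k^'n^'n) = (\<lambda>_. 0)" by (auto simp: at_level_def)
      ultimately show ?thesis
        by (auto simp: kmat.subspace_def tvec_0 intro: tvec_add tvec_scale)
    qed
    have curve: "tvec (Gam j) (at_level l (imat n :: 'k^'n^'n))"
      if "\<And>u. det (mat 1 + (\<chi> i j. of_int (n i j) * u) :: ('k, 'n) wmat) = 1" for n
    proof (rule tvec_curve)
      fix s :: 'k
      have "of_nat CHAR('k) ^ j dvd vshift l (s - 1)"
        unfolding p_power_dvd_witt_iff using False by (simp add: wcoeff_vshift)
      thus "mat 1 + (\<chi> i j. of_int (n i j) * vshift l (s - 1)) \<in> Gam j"
        by (simp add: Gam_def SLW_def that)
    qed
    have E: "Eu a b \<in> ?T" if "a \<noteq> b" for a b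
      unfolding Eu_def using curve[of "iunit a b", OF det_transvection[OF that]] by simp
    have N: "imat (inil a b) \<in> ?T" if "a \<noteq> b" for a b
      using curve[of "inil a b", OF det_nilpotent[OF that]] by simp
    have "Eu a a - Eu b b \<in> ?T" if "a \<noteq> b" for a b
    proof -
      have "Eu a a - Eu b b = Eu a b - Eu b a - imat (inil a b)"
        by (simp add: vec_eq_iff Eu_def imat_def inil_def)
      thus ?thesis using E[OF that] E[OF that[symmetric]] N[OF that] kmat.subspace_diff[OF sub] by metis
    qed
    hence "sl_gens \<subseteq> ?T" using E by (auto simp: sl_gens_def)
    hence "kmat.span sl_gens \<subseteq> ?T" by (rule kmat.span_minimal[OF _ sub])
    thus ?thesis using assms(1) sl_span by blast
  qed
qed

lemma gam_iff:
  "x \<in> gam j \<longleftrightarrow> x \<in> (wsl :: ('k::{alg_closed_field,field_prime_char}, 'n::finite) wlie set) \<and> (\<forall>l<j. G.kpa x l = 0)"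
proof -
  interpret wsub "Gam j :: ('k, 'n) wmat set" by (rule wsub_Gam)
  show ?thesis
  proof
    assume x: "x \<in> gam j"
    hence x': "x \<in> wsl" "tvec (Gam j) (G.kpa x)" by (auto simp: gam_def sublie_iff)
    have "G.kpa x l $ a $ b = 0" if "l < j" for l a b
    proof (rule tvec_zero_entry[OF x'(2)])
      fix A :: "('k, 'n) wmat" assume "A \<in> Gam j"
      hence "of_nat CHAR('k) ^ j dvd (A - mat 1) $ a $ b" by (simp add: Gam_def)
      thus "wcoeff ((A - mat 1) $ a $ b) l = 0" using that unfolding p_power_dvd_witt_iff by blast
    qed
    thus "x \<in> wsl \<and> (\<forall>l<j. G.kpa x l = 0)" using x' by (simp add: vec_eq_iff)
  next
    assume x: "x \<in> wsl \<and> (\<forall>l<j. G.kpa x l = 0)"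
    hence "tvec (Gam j) (G.kpa x)" by (intro tvec_Gam) (auto simp: wsl_eq_PL G.kpa_sl)
    thus "x \<in> gam j" using x by (simp add: gam_def sublie_iff)
  qed
qed

text \<open>An element of the Lie algebra of the truncated group of level \<open>j\<close> is determined by its coordinates of index below \<open>j\<close>.\<close>

lemma gam_iff_level:
  "x \<in> gam j \<longleftrightarrow> x \<in> (wsl :: ('k::{alg_closed_field,field_prime_char}, 'n::finite) wlie set) \<and> x j = 0"
  using G.PL_eq_level_iff[OF _ G.PL_zero(1), of x j]
  by (auto simp: gam_iff wsl_eq_PL G.PL_zero(2))

lemma wsl_ex:
  fixes Y :: "nat \<Rightarrow> 'k::{alg_closed_field,field_prime_char}^'n::finite^'n"
  assumes "\<And>l. Y l \<in> sl"
  obtains x where "x \<in> wsl" "G.kpa x = Y"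
proof -
  interpret wsub "Gam 0 :: ('k, 'n) wmat set" by (rule wsub_Gam)
  obtain x where "x \<in> sublie (Gam 0)" "G.kpa x = Y"
    using sublie_ex[OF tvec_Gam[of Y 0]] assms by auto
  thus ?thesis using that sublie_iff by blast
qed

section \<open>Root subgroups and tori\<close>

lemma root_group_alt: "a \<noteq> b \<Longrightarrow>
    root_group a b = ({mat 1 + (\<chi> i j. of_int (iunit a b i j) * u) | u. True} :: ('k::field_prime_char, 'n::finite) wmat set)"
proof -
  assume "a \<noteq> b"
  hence "(\<chi> i j. if i = j then 1 else if i = a \<and> j = b then u else 0) = mat 1 + (\<chi> i j. of_int (iunit a b i j) * u)" for u :: "'k witt"
    by (simp add: vec_eq_iff mat_def iunit_def)
  thus ?thesis by (simp only: root_group_def)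
qed

lemma wsub_root_group:
  assumes ab: "a \<noteq> b"
  shows "wsub (root_group a b :: ('k::field_prime_char, 'n::finite) wmat set)"
proof
  let ?U = "\<lambda>u. mat 1 + (\<chi> i j. of_int (iunit a b i j) * u) :: ('k, 'n) wmat"
  show "root_group a b \<subseteq> (SLW :: ('k, 'n) wmat set)"
    by (auto simp: root_group_alt[OF ab] SLW_def det_transvection[OF ab])
  have "?U 0 = mat 1" by (simp add: vec_eq_iff)
  thus "mat 1 \<in> (root_group a b :: ('k, 'n) wmat set)" unfolding root_group_alt[OF ab] by (intro CollectI exI[of _ 0]) simp
  have "(?U u ** ?U v) = ?U (u + v)" for u v
  proof -
    have "(\<chi> i j. of_int (iunit a b i j) * u) ** (\<chi> i j. of_int (iunit a b i j) * v) = (0 :: ('k, 'n) wmat)"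
      using ab by (auto simp: vec_eq_iff matrix_matrix_mult_def iunit_def intro!: sum.neutral)
    thus ?thesis by (simp add: matrix_add_ldistrib matrix_add_rdistrib vec_eq_iff algebra_simps)
  qed
  thus "A ** B \<in> root_group a b" if "A \<in> root_group a b" "B \<in> root_group a b" for A B :: "('k, 'n) wmat"
    using that unfolding root_group_alt[OF ab] by blast
qed

lemma sublie_root_group_iff:
  assumes ab: "a \<noteq> b"
  shows "x \<in> sublie (root_group a b) \<longleftrightarrow>
    x \<in> (wsl :: ('k::{alg_closed_field,field_prime_char}, 'n::finite) wlie set) \<and> (\<forall>l. \<exists>u. G.kpa x l = mscale u (Eu a b))"
proof -
  interpret wsub "root_group a b :: ('k, 'n) wmat set" by (rule wsub_root_group[OF ab])
  have "tvec (root_group a b :: ('k, 'n) wmat set) Y \<longleftrightarrow> (\<forall>l. \<exists>u. Y l = mscale u (Eu a b))" for Y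
  proof
    assume Y: "tvec (root_group a b :: ('k, 'n) wmat set) Y"
    have "Y l $ i $ j = 0" if "\<not> (i = a \<and> j = b)" for l i j
      by (rule tvec_zero_entry[OF Y]) (use that in \<open>auto simp: root_group_alt[OF ab] iunit_def\<close>)
    hence "Y l = mscale (Y l $ a $ b) (Eu a b)" for l
      by (auto simp: vec_eq_iff mscale_def Eu_nth)
    thus "\<forall>l. \<exists>u. Y l = mscale u (Eu a b)" by blast
  next
    assume "\<forall>l. \<exists>u. Y l = mscale u (Eu a b)"
    then obtain u where u: "\<And>l. Y l = mscale (u l) (Eu a b)" by metis
    have "tvec (root_group a b :: ('k, 'n) wmat set) (at_level l (Eu a b))" for l
      unfolding Eu_def by (rule tvec_curve) (auto simp: root_group_alt[OF ab])
    from tvec_scale[OF this] have "tvec (root_group a b :: ('k, 'n) wmat set) (at_level l (Y l))" for l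
    proof -
      have "at_level l (Y l) = (\<lambda>l'. mscale (u l) (at_level l (Eu a b) l'))"
        by (auto simp: at_level_def u mscale_def vec_eq_iff)
      thus ?thesis using tvec_scale[OF \<open>\<And>l. tvec (root_group a b) (at_level l (Eu a b))\<close>] by simp
    qed
    thus "tvec (root_group a b :: ('k, 'n) wmat set) Y" by (rule tvec_levels)
  qed
  thus ?thesis by (simp add: sublie_iff)
qed

lemma torus_mult:
  fixes A B :: "('k::field_prime_char, 'n::finite) wmat"
  assumes "A \<in> torus" "B \<in> torus"
  shows "A ** B \<in> torus" "(A ** B) $ i $ i = A $ i $ i * B $ i $ i"
proof -
  have "A $ i $ k * B $ k $ j = (if k = i then if i = j then A $ i $ i * B $ i $ i else 0 else 0)" for i j k
    using assms by (auto simp: torus_def)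
  hence "(A ** B) $ i $ j = (if i = j then A $ i $ i * B $ i $ i else 0)" for i j
    unfolding matrix_matrix_mult_def by simp
  thus "A ** B \<in> torus" "(A ** B) $ i $ i = A $ i $ i * B $ i $ i"
    using assms by (auto simp: torus_def SLW_def det_mul)
qed

lemma torus_one: "mat 1 \<in> torus"
  by (simp add: torus_def SLW_def) (simp add: mat_def)

lemma wsub_torus1: "wsub (torus1 :: ('k::field_prime_char, 'n::finite) wmat set)"
proof -
  interpret wsub "Gam 1 :: ('k, 'n) wmat set" by (rule wsub_Gam)
  show ?thesis
    using H_one H_mult by unfold_locales (auto simp: torus1_def torus_one torus_mult, simp add: torus_def)
qed

lemma wsub_Tk: "wsub (Tk :: ('k::field_prime_char, 'n::finite) wmat set)"
proof
  show "Tk \<subseteq> (SLW :: ('k, 'n) wmat set)" by (auto simp: Tk_def torus_def)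
  have "1 \<in> range (teich :: 'k \<Rightarrow> 'k witt)" by (metis rangeI teich_1)
  thus "(mat 1 :: ('k, 'n) wmat) \<in> Tk" by (simp add: Tk_def torus_one) (simp add: mat_def)
  fix A B :: "('k, 'n) wmat" assume "A \<in> Tk" "B \<in> Tk"
  moreover from this have "(A ** B) $ i $ i \<in> range teich" for i
  proof -
    obtain u v where "A $ i $ i = teich u" "B $ i $ i = teich v"
      using \<open>A \<in> Tk\<close> \<open>B \<in> Tk\<close> unfolding Tk_def by blast
    thus ?thesis using \<open>A \<in> Tk\<close> \<open>B \<in> Tk\<close> by (simp add: Tk_def torus_mult teich_mult)
  qed
  ultimately show "A ** B \<in> Tk" by (simp add: Tk_def torus_mult)
qed

lemma sublie_torus_offdiag:
  fixes H :: "('k::field_prime_char, 'n::finite) wmat set"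
  assumes "wsub H" "H \<subseteq> torus" "x \<in> sublie H" "i \<noteq> j"
  shows "G.kpa x l $ i $ j = 0"
proof -
  interpret wsub H by fact
  have "tvec H (G.kpa x)" using assms(3) by (simp add: sublie_iff)
  thus ?thesis by (rule tvec_zero_entry) (use assms in \<open>auto simp: torus_def mat_def\<close>)
qed

text \<open>Coordinates of the tangent vector of the curve of Teichmueller representatives.  They need not vanish
  for \<open>l > 0\<close>, as the components of \<open>[s] - 1\<close> of positive index depend on \<open>s\<close>.\<close>

definition tcoef :: "nat \<Rightarrow> 'k::{alg_closed_field,field_prime_char}" where
  "tcoef l = dlaur (\<lambda>s. wcoeff (teich s - 1) l)"

lemma teich_wfun: "\<phi> \<in> laur \<Longrightarrow> (\<lambda>s. teich (\<phi> s)) \<in> wfun (laur :: ('k::{alg_closed_field,field_prime_char} \<Rightarrow> 'k) set)"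
proof -
  assume \<phi>: "\<phi> \<in> laur"
  have "(\<lambda>s. wcoeff (teich (\<phi> s)) l) \<in> laur" for l
    using \<phi> by (cases "l = 0") (simp_all add: teich_def laur_const)
  thus ?thesis by (simp add: wfun_def)
qed

lemma laur_id: "(\<lambda>s :: 'k. s) \<in> laur" "dlaur (\<lambda>s. s) = (1 :: 'k::alg_closed_field)"
proof -
  have "poly [:0, 1:] = (\<lambda>s :: 'k. s)" by auto
  thus "(\<lambda>s :: 'k. s) \<in> laur" "dlaur (\<lambda>s. s) = (1 :: 'k)"
    using laur_poly[of "[:0, 1 :: 'k:]"] by (simp_all add: pderiv_pCons)
qed

lemma tcoef_0: "tcoef 0 = (1 :: 'k::{alg_closed_field,field_prime_char})"
proof -
  have "(\<lambda>s. s - 1 :: 'k) = poly [:-1, 1:]" by auto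
  hence "dlaur (\<lambda>s. s - 1 :: 'k) = 1" by (simp add: laur_poly pderiv_pCons)
  thus ?thesis by (simp add: tcoef_def wcoeff_0_diff wcoeff_1) (simp add: teich_def)
qed

text \<open>For \<open>s = 1 + \<epsilon>\<close> the inverse of \<open>[s] = 1 + z\<close> is \<open>1 - z\<close>, because products of Witt vectors with components
  in \<open>\<epsilon>k\<close> vanish.\<close>

lemma wmap_teich:
  fixes tcoef' :: "nat \<Rightarrow> 'k::{alg_closed_field,field_prime_char}"
  defines "tcoef' \<equiv> \<lambda>l. tcoef l"
  shows "wmap lhom (\<lambda>s. teich s - 1) = epsw tcoef'"
    "wmap lhom (\<lambda>s. teich (1 / s) - 1) = epsw (\<lambda>l. - tcoef' l)"
proof -
  let ?x = "wmap lhom (\<lambda>s :: 'k. teich s - 1)" and ?y = "wmap lhom (\<lambda>s :: 'k. teich (1 / s) - 1)"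
  have mem: "(\<lambda>s :: 'k. teich s) \<in> wfun laur" "(\<lambda>s :: 'k. teich (1 / s)) \<in> wfun laur"
    by (intro teich_wfun laur_id laur_inverse)+
  have "teich 1 - 1 = (0 :: 'k witt)" by (simp add: teich_1)
  hence dre: "dre (wcoeff ?x l) = 0" "dre (wcoeff ?y l) = 0" for l
    by (simp_all add: lhom_def)
  have x: "?x = epsw tcoef'"
    using epsw_eqI[of ?x, OF dre(1)] by (simp add: lhom_def tcoef'_def tcoef_def)
  have y: "?y = epsw (\<lambda>l. deps (wcoeff ?y l))" by (rule epsw_eqI[OF dre(2)])
  have "wmap lhom (\<lambda>s :: 'k. teich s * teich (1 / s)) = 1"
  proof -
    have "lhom (\<lambda>s :: 'k. wcoeff (teich s * teich (1 / s)) l) = lhom (\<lambda>s. wcoeff 1 l)" for l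
    proof -
      have "dlaur (\<lambda>s :: 'k. wcoeff (teich s * teich (1 / s)) l) = dlaur (\<lambda>s. wcoeff 1 l)"
        by (rule dlaur_cong) (simp add: teich_mult teich_1)
      thus ?thesis by (simp add: lhom_def teich_1)
    qed
    thus ?thesis using laur.wmap_1 by (simp add: wmap_def)
  qed
  hence "wmap lhom (\<lambda>s :: 'k. teich s) * wmap lhom (\<lambda>s :: 'k. teich (1 / s)) = 1"
    by (simp add: laur.wmap_mult mem)
  moreover have "wmap lhom (\<lambda>s :: 'k. teich s) = 1 + ?x" "wmap lhom (\<lambda>s :: 'k. teich (1 / s)) = 1 + ?y"
    using laur.wmap_diff[OF mem(1) laur.wfun_const[of 1]] laur.wmap_diff[OF mem(2) laur.wfun_const[of 1]]
    by (simp_all add: laur.wmap_1)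
  ultimately have "1 + (?x + ?y + ?x * ?y) = 1 + 0" by (simp add: algebra_simps)
  moreover have "?x * ?y = 0" by (subst x, subst y) (rule epsw_mult_epsw)
  ultimately have "?x + ?y = 0" by (metis add_left_cancel add_0_right)
  hence "?y = - ?x" by (simp add: eq_neg_iff_add_eq_0 add.commute)
  thus "?y = epsw (\<lambda>l. - tcoef' l)" by (simp add: x uminus_epsw)
  show "?x = epsw tcoef'" by (rule x)
qed

text \<open>The tangent vector of the cocharacter \<open>s \<mapsto> diag([s], [1/s])\<close> in two diagonal positions, extended linearly.\<close>

lemma tvec_Tk:
  fixes h :: "'k::{alg_closed_field,field_prime_char}^'n::finite^'n"
  assumes "h \<in> sl" "\<And>i j. i \<noteq> j \<Longrightarrow> h $ i $ j = 0"
  shows "tvec Tk (\<lambda>l. mscale (tcoef l) h)"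
proof -
  have basic: "tvec Tk (\<lambda>l. mscale (tcoef l) (Eu a a - Eu b b :: 'k^'n^'n))" if ab: "a \<noteq> b" for a b
    unfolding tvec_def
  proof
    fix m
    define t where "t = (\<lambda>s :: 'k. (\<chi> i j. if i = j then if i = a then teich s else if i = b then teich (1 / s) else 1 else 0) :: ('k, 'n) wmat)"
    define M where "M = (\<lambda>s :: 'k. (\<chi> i j. if i = j then if i = a then teich s - 1 else if i = b then teich (1 / s) - 1 else 0 else 0) :: ('k, 'n) wmat)"
    define \<gamma> where "\<gamma> = (\<lambda>s :: 'k. mtrunc m (mat 1 + M s))"
    have tM: "mat 1 + M s = t s" for s by (simp add: t_def M_def vec_eq_iff mat_def)
    have mem: "(\<lambda>s :: 'k. teich s) \<in> wfun laur" "(\<lambda>s :: 'k. teich (1 / s)) \<in> wfun laur"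
      by (intro teich_wfun laur_id laur_inverse)+
    have "(\<lambda>s. t s $ i $ j) \<in> wfun laur" for i j
      using mem by (cases "i = j"; cases "i = a"; cases "i = b") (auto simp: t_def laur.wfun_const)
    hence "(\<lambda>s. wcoeff (\<gamma> s $ i $ j) l) \<in> laur" for i j l
      unfolding \<gamma>_def tM mtrunc_nth wcoeff_wtrunc by (cases "l < m") (auto simp: wfun_def laur_const)
    hence 1: "\<gamma> \<in> mfun laur" by (auto simp: mfun_def wfun_def)
    have det: "det (t s) = 1" if "s \<noteq> 0" for s
    proof -
      have "det (t s) = (\<Prod>i\<in>UNIV. t s $ i $ i)"
        by (rule det_diagonal) (simp add: t_def)
      also have "\<dots> = t s $ a $ a * (t s $ b $ b * (\<Prod>i\<in>UNIV - {a} - {b}. t s $ i $ i))"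
        using ab by (subst prod.remove[of _ a], simp, simp, subst prod.remove[of _ b]) auto
      also have "(\<Prod>i\<in>UNIV - {a} - {b}. t s $ i $ i) = 1" by (intro prod.neutral) (simp add: t_def)
      finally show ?thesis using that ab by (simp add: t_def teich_mult teich_1)
    qed
    have "1 \<in> range (teich :: 'k \<Rightarrow> 'k witt)" by (metis rangeI teich_1)
    hence 2: "t s \<in> Tk" if "s \<noteq> 0" for s
      using det[OF that] by (auto simp: Tk_def torus_def SLW_def) (auto simp: t_def)
    have "tang (mtrunc m ` Tk) (\<gamma> 1) (tcurve \<gamma>)"
      by (rule tang_curve[OF 1]) (auto simp: \<gamma>_def tM 2)
    moreover have "\<gamma> 1 = mtrunc m (mat 1)"
      unfolding \<gamma>_def by (rule arg_cong[of _ _ "mtrunc m"]) (simp add: M_def vec_eq_iff teich_1)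
    moreover have "kap (tcurve \<gamma>) l = mscale (tcoef l) (Eu a a - Eu b b)" if "l < m" for l
    proof (rule kap_curve[OF \<gamma>_def _ that])
      have "wmap lhom (\<lambda>s. M s $ i $ j) = epsw (\<lambda>l. mscale (tcoef l) (Eu a a - Eu b b) $ i $ j)" for i j
        using ab by (cases "i = j"; cases "i = a"; cases "i = b")
          (auto simp: M_def wmap_teich laur.wmap_0 mscale_def Eu_nth epsw_0)
      thus "mmap lhom M = epsm (\<lambda>l. mscale (tcoef l) (Eu a a - Eu b b))" by (simp add: vec_eq_iff)
    qed
    ultimately show "\<exists>d. tang (mtrunc m ` Tk) (mtrunc m (mat 1)) d \<and>
        (\<forall>l<m. kap d l = mscale (tcoef l) (Eu a a - Eu b b :: 'k^'n^'n))" by metis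
  qed
  obtain c :: 'n where True by blast
  have "tvec Tk (\<lambda>l. \<Sum>b\<in>UNIV - {c}. mscale (h $ b $ b) (mscale (tcoef l) (Eu b b - Eu c c :: 'k^'n^'n)))"
    by (intro tvec_sum basic) auto
  moreover have "(\<Sum>b\<in>UNIV - {c}. mscale (h $ b $ b) (mscale (tcoef l) (Eu b b - Eu c c :: 'k^'n^'n))) = mscale (tcoef l) h" for l
  proof -
    have tr: "h $ c $ c = - (\<Sum>b\<in>UNIV - {c}. h $ b $ b)"
      using assms(1) by (simp add: sl_def trace_def sum.remove[of _ c] eq_neg_iff_add_eq_0)
    have "(\<Sum>b\<in>UNIV - {c}. h $ b $ b * (tcoef l * ((Eu b b - Eu c c :: 'k^'n^'n) $ i $ j))) = tcoef l * h $ i $ j" for i j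
    proof (cases "i = j \<and> i \<noteq> c")
      case True
      hence "(\<Sum>b\<in>UNIV - {c}. h $ b $ b * (tcoef l * ((Eu b b - Eu c c :: 'k^'n^'n) $ i $ j))) =
        (\<Sum>b\<in>UNIV - {c}. if b = i then h $ i $ i * tcoef l else 0)"
        by (intro sum.cong) (auto simp: Eu_nth)
      also have "\<dots> = h $ i $ i * tcoef l" using True by (subst sum.delta) auto
      finally show ?thesis using True by (simp add: mult.commute)
    next
      case False
      have "(Eu b b - Eu c c :: 'k^'n^'n) $ i $ j = (if i = c \<and> j = c then -1 else 0)" if "b \<noteq> c" for b
        using that False by (cases "i = c"; cases "j = c"; cases "i = b"; simp add: Eu_nth)
      hence "(\<Sum>b\<in>UNIV - {c}. h $ b $ b * (tcoef l * ((Eu b b - Eu c c :: 'k^'n^'n) $ i $ j))) =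
        (\<Sum>b\<in>UNIV - {c}. if i = c \<and> j = c then - tcoef l * h $ b $ b else 0)"
        by (intro sum.cong refl) simp
      also have "\<dots> = tcoef l * h $ i $ j"
      proof (cases "i = c \<and> j = c")
        case True
        thus ?thesis by (simp add: tr sum_distrib_left sum_negf)
      next
        case False
        hence "i \<noteq> j" using \<open>\<not> (i = j \<and> i \<noteq> c)\<close> by metis
        hence "h $ i $ j = 0" by (rule assms(2))
        thus ?thesis by (simp only: False if_False sum.neutral_const mult_zero_right)
      qed
      finally show ?thesis .
    qed
    thus ?thesis by (simp add: vec_eq_iff sum_component mscale_def)
  qed
  ultimately show ?thesis by simp
qed

text \<open>On \<open>Tk\<close> the entries are Teichmueller representatives, so their components of index \<open>0\<close> generate the regular functions
  and a tangent vector is determined by its coordinate of level \<open>0\<close>.\<close>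

lemma tvec_Tk_zero:
  fixes Y :: "nat \<Rightarrow> 'k::field_prime_char^'n::finite^'n"
  assumes Y: "tvec Tk Y" and 0: "Y 0 = 0"
  shows "Y l = 0"
proof -
  obtain d where d: "tang (mtrunc (Suc l) ` Tk) (mtrunc (Suc l) (mat 1)) d" "\<And>i. i \<le> l \<Longrightarrow> kap d i = Y i"
    using Y unfolding tvec_def by (metis less_Suc_eq_le)
  let ?S = "mtrunc (Suc l) ` Tk :: ('k, 'n) wmat set"
  have coord: "d (\<lambda>A. wcoeff (A $ i $ j) k) = 0" for i j k
  proof (cases "i = j \<and> k = 0")
    case True
    have "d (\<lambda>A. wcoeff ((A - mat 1) $ i $ j) k + 1) = d (\<lambda>A. wcoeff ((A - mat 1) $ i $ j) k) + d (\<lambda>_. 1)"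
      by (rule tang_add[OF d(1) reg_wcoeff[OF reg_minus_one] reg.const_mem])
    moreover have "wcoeff ((A - mat 1) $ i $ j) k + 1 = wcoeff (A $ i $ j) k" for A :: "('k, 'n) wmat"
      using True by (simp add: wcoeff_0_diff wcoeff_1 mat_def)
    moreover have "d (\<lambda>A. wcoeff ((A - mat 1) $ i $ j) k) = 0"
      using d(2)[of 0] 0 True by (auto simp: kap_def vec_eq_iff)
    ultimately show ?thesis by (simp add: tang_const[OF d(1)])
  next
    case False
    have "d (\<lambda>A. wcoeff (A $ i $ j) k) = d (\<lambda>_. 0)"
    proof (rule tang_cong[OF d(1) reg_coord])
      fix A assume "A \<in> ?S"
      then obtain B where B: "B \<in> Tk" "A = mtrunc (Suc l) B" by blast
      have "wcoeff (B $ i $ j) k = 0"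
      proof (cases "i = j")
        case True
        then obtain c where "B $ i $ j = teich c" using B(1) by (auto simp: Tk_def)
        thus ?thesis using False True by (simp add: teich_def)
      qed (use B(1) in \<open>simp add: Tk_def torus_def\<close>)
      thus "wcoeff (A $ i $ j) k = 0" by (simp add: B(2) wcoeff_wtrunc)
    qed
    thus ?thesis by (simp add: tang_const[OF d(1)])
  qed
  have "f \<in> reg ?S \<Longrightarrow> f \<in> reg ?S \<and> d f = 0" for f
  proof (induction rule: reg_induct)
    case (cong f g)
    thus ?case using tang_cong[OF d(1), of f g] reg_cong[of ?S f g] by auto
  next
    case (const c)
    show ?case by (simp add: reg.const_mem tang_const[OF d(1)])
  next
    case (coord i j k)
    show ?case using \<open>\<And>i j k. d (\<lambda>A. wcoeff (A $ i $ j) k) = 0\<close> by (simp add: reg_coord)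
  next
    case (add f g)
    thus ?case by (simp add: reg.add_mem tang_add[OF d(1)])
  next
    case (mult f g)
    thus ?case by (simp add: reg.mult_mem tang_mult[OF d(1)])
  qed
  hence "d (\<lambda>A. wcoeff ((A - mat 1) $ i $ j) l) = 0" for i j
    using reg_wcoeff[OF reg_minus_one] by blast
  hence "kap d l = 0" by (simp only: kap_def vec_eq_iff vec_lambda_beta zero_index simp_thms)
  thus ?thesis using d(2) by simp
qed

lemma dual_of_nat [simp]: "dre (of_nat n) = of_nat n" "deps (of_nat n) = 0"
  by (simp_all add: of_nat_dual)

section \<open>The invariant derivation of the additive group of Witt vectors\<close>

definition trans_args :: "nat \<Rightarrow> nat \<Rightarrow> nat \<Rightarrow> wpoly dual" where
  "trans_args p c i = (if c = 0 then
       weval (pair_args (\<lambda>i. Dual (wvar 0 i) 0) (\<lambda>i. Dual 0 (wvar (Suc 0) i))) (wadd_poly p i)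
     else Dual (wvar c i) 0)"

text \<open>The derivative of \<open>P\<close> at \<open>x\<close> along \<open>x + \<epsilon>u\<close>, the sum being that of Witt vectors; \<open>x\<close> is the variable family \<open>0\<close> and the direction
  \<open>u\<close> the family \<open>1\<close>.  It lifts the invariant derivation with generic coordinates to the integers.\<close>

definition wder :: "nat \<Rightarrow> wpoly \<Rightarrow> wpoly" where
  "wder p P = deps (weval (trans_args p) P)"

lemma wadd_poly_zero:
  assumes "Factorial_Ring.prime p"
  shows "weval (pair_args (wvar 0) (\<lambda>_. 0)) (wadd_poly p i) = wvar 0 i"
proof (rule ghost_inj_torsion_free[OF torsion_free_wpoly, of p i "\<lambda>i. weval (pair_args (wvar 0) (\<lambda>_. 0)) (wadd_poly p i)"])
  show p0: "p > 0" using assms prime_gt_0_nat by blast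
  fix n
  have "ghost p n (\<lambda>i. weval (pair_args (wvar 0) (\<lambda>_. 0)) (wadd_poly p i)) =
      weval (pair_args (wvar 0) (\<lambda>_. 0)) (ghost p n (wadd_poly p))"
    by (simp add: weval_ghost)
  also have "\<dots> = ghost p n (wvar 0)"
    by (simp add: ghost_wadd_poly[OF assms] weval_add weval_ghost pair_args_def ghost_zero[OF p0])
  finally show "ghost p n (\<lambda>i. weval (pair_args (wvar 0) (\<lambda>_. 0)) (wadd_poly p i)) = ghost p n (wvar 0)" .
qed

lemma weval_wvar_id: "weval wvar P = P"
proof (induction P rule: wpoly_induct)
  case (single m c)
  have "of_int c = (Poly_Mapping.single 0 c :: wpoly)"
    using single_of_int[of c, where ?'a = "nat \<times> nat \<Rightarrow>\<^sub>0 nat" and ?'b = int] by simp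
  thus ?case by (simp only: weval_single mon_eval_wvar mult_single add_0 mult_1_right)
qed (simp add: weval_add)

lemma dre_trans_args:
  assumes "Factorial_Ring.prime p"
  shows "dre (weval (trans_args p) P) = P"
proof -
  have h: "dre (weval v Q) = weval (\<lambda>c i. dre (v c i)) Q" for v :: "nat \<Rightarrow> nat \<Rightarrow> wpoly dual" and Q
    by (rule weval_hom) auto
  have "(\<lambda>c i. dre (pair_args (\<lambda>i. Dual (wvar 0 i) 0) (\<lambda>i. Dual 0 (wvar (Suc 0) i)) c i)) = pair_args (wvar 0) (\<lambda>_. 0)"
    by (auto simp: pair_args_def fun_eq_iff)
  hence "dre (trans_args p c i) = wvar c i" for c i
    by (simp add: trans_args_def h wadd_poly_zero[OF assms])
  thus ?thesis by (simp add: h weval_wvar_id)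
qed

definition at_zero :: "wpoly \<Rightarrow> wpoly" where
  "at_zero = weval (\<lambda>c i. if c = 0 then 0 else wvar c i)"

lemma at_zero_simps:
  "at_zero (P + Q) = at_zero P + at_zero Q" "at_zero (P * Q) = at_zero P * at_zero Q"
  "at_zero (of_nat n) = of_nat n" "at_zero (P ^ n) = at_zero P ^ n"
  "at_zero (sum f A) = (\<Sum>a\<in>A. at_zero (f a))" "at_zero (wvar 0 i) = 0" "at_zero (wvar (Suc 0) i) = wvar (Suc 0) i"
  "at_zero 0 = 0"
  by (simp_all add: at_zero_def weval_add weval_mult weval_power weval_sum)

context
  fixes p :: nat
  assumes p: "Factorial_Ring.prime p"
begin

lemma wder_add: "wder p (P + Q) = wder p P + wder p Q"
  by (simp add: wder_def weval_add)

lemma wder_mult: "wder p (P * Q) = P * wder p Q + wder p P * Q"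
  by (simp add: wder_def weval_mult dre_trans_args[OF p])

lemma wder_0: "wder p 0 = 0"
  by (simp add: wder_def)

lemma wder_of_int: "wder p (of_int n) = 0"
proof -
  have "of_int n = Dual (of_int n :: wpoly) 0"
    by (cases n rule: int_cases2) (auto simp: of_nat_dual intro!: dual.expand)
  thus ?thesis by (simp add: wder_def)
qed

lemma wder_of_nat_mult: "wder p (of_nat n * P) = of_nat n * wder p P"
  using wder_of_int[of "int n"] by (simp add: wder_mult)

lemma wder_sum: "wder p (\<Sum>a\<in>A. f a) = (\<Sum>a\<in>A. wder p (f a))"
  by (induction A rule: infinite_finite_induct) (auto simp: wder_0 wder_add)

lemma wder_power: "wder p (P ^ n) = of_nat n * P ^ (n - 1) * wder p P"
proof (induction n)
  case 0
  show ?case using wder_of_int[of 1] by simp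
next
  case (Suc n)
  have "P * (of_nat n * P ^ (n - 1)) = of_nat n * P ^ n" by (cases n) (simp_all add: algebra_simps)
  moreover have "wder p (P ^ Suc n) = P * (of_nat n * P ^ (n - 1)) * wder p P + wder p P * P ^ n"
    by (simp add: wder_mult Suc mult.assoc)
  ultimately show ?case by (simp add: algebra_simps)
qed

lemma wder_funpow_add: "(wder p ^^ k) (P + Q) = (wder p ^^ k) P + (wder p ^^ k) Q"
  by (induction k) (simp_all add: wder_add)

lemma wder_funpow_sum: "(wder p ^^ k) (\<Sum>a\<in>A. f a) = (\<Sum>a\<in>A. (wder p ^^ k) (f a))"
  by (induction k) (simp_all add: wder_sum)

lemma wder_funpow_of_nat_mult: "(wder p ^^ k) (of_nat n * P) = of_nat n * (wder p ^^ k) P"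
  by (induction k) (simp_all add: wder_of_nat_mult)

lemma wder_funpow_0: "(wder p ^^ k) 0 = 0"
  by (induction k) (simp_all add: wder_0)

lemma wder_var1: "wder p (wvar (Suc 0) i) = 0"
  by (simp add: wder_def trans_args_def)

text \<open>Ghost components are additive, and that of \<open>\<epsilon>u\<close> is \<open>p\<^sup>n \<epsilon> u\<^sub>n\<close>.\<close>

lemma wder_ghost: "wder p (ghost p n (wvar 0)) = of_nat p ^ n * wvar (Suc 0) n"
proof -
  have p2: "p \<ge> 2" using p prime_ge_2_nat by blast
  have 0: "deps (ghost p n (\<lambda>i. Dual (wvar 0 i) 0)) = (0 :: wpoly)"
  proof -
    have "deps (x ^ k) = 0" if "deps x = 0" for x :: "wpoly dual" and k
      using that by (induction k) auto
    thus ?thesis unfolding ghost_def deps_sum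
      by (intro sum.neutral) (simp add: of_nat_dual flip: of_nat_power)
  qed
  have "weval (trans_args p) (ghost p n (wvar 0)) = ghost p n (\<lambda>i. Dual (wvar 0 i) 0) + ghost p n (\<lambda>i. Dual 0 (wvar (Suc 0) i))"
  proof -
    have "ghost p n (\<lambda>i. trans_args p 0 i) =
       weval (pair_args (\<lambda>i. Dual (wvar 0 i) 0) (\<lambda>i. Dual 0 (wvar (Suc 0) i))) (ghost p n (wadd_poly p))"
      by (simp add: weval_ghost trans_args_def)
    thus ?thesis by (simp add: weval_ghost ghost_wadd_poly[OF p] weval_add pair_args_def)
  qed
  thus ?thesis by (simp add: wder_def 0 ghost_Dual_0[OF p2] of_nat_dual_mult)
qed

lemma wder_funpow_ghost: "k \<ge> 2 \<Longrightarrow> (wder p ^^ k) (ghost p n (wvar 0)) = 0"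
proof -
  assume "k \<ge> 2"
  then obtain j where k: "k = j + 2" by (metis le_add_diff_inverse add.commute)
  have "wder p (wder p (ghost p n (wvar 0))) = 0"
    using wder_of_nat_mult[of "p ^ n" "wvar (Suc 0) n"] by (simp add: wder_ghost wder_var1)
  thus ?thesis unfolding k funpow_add by (simp add: wder_funpow_0 numeral_2_eq_2)
qed

text \<open>In \<open>k\<close> derivatives of \<open>P\<^sup>N\<close> the terms where some factor is differentiated more than once contain an additional
  factor \<open>P\<close>.\<close>

lemma wder_funpow_power:
  assumes "k \<le> N"
  shows "\<exists>R. (wder p ^^ k) (P ^ N) = of_nat (\<Prod>{N - k<..N}) * P ^ (N - k) * wder p P ^ k + P ^ (N - k + 1) * R"
  using assms
proof (induction k)
  case 0
  show ?case by (intro exI[of _ 0]) simp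
next
  case (Suc k)
  then obtain R where R: "(wder p ^^ k) (P ^ N) = of_nat (\<Prod>{N - k<..N}) * P ^ (N - k) * wder p P ^ k + P ^ (N - k + 1) * R"
    by auto
  define M where "M = N - Suc k"
  have M: "N - k = Suc M" using Suc.prems by (simp add: M_def)
  let ?c = "\<Prod>{N - k<..N}"
  have c: "\<Prod>{N - Suc k<..N} = ?c * Suc M"
  proof -
    have "{N - Suc k<..N} = insert (Suc M) {N - k<..N}" using M Suc.prems by (auto simp: M_def)
    thus ?thesis using M by simp
  qed
  have "wder p (of_nat ?c * P ^ Suc M * wder p P ^ k) =
     of_nat ?c * (P ^ Suc M * wder p (wder p P ^ k) + (of_nat (Suc M) * P ^ M * wder p P) * wder p P ^ k)"
  proof -
    have "wder p (P ^ Suc M) = of_nat (Suc M) * P ^ M * wder p P" using wder_power[of P "Suc M"] by simp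
    thus ?thesis by (simp only: mult.assoc[of "of_nat ?c"] wder_of_nat_mult wder_mult[of "P ^ Suc M"])
  qed
  moreover have "wder p (P ^ (Suc M + 1) * R) = P ^ (Suc M + 1) * wder p R + (of_nat (Suc (Suc M)) * P ^ Suc M * wder p P) * R"
  proof -
    have "wder p (P ^ (Suc M + 1)) = of_nat (Suc (Suc M)) * P ^ Suc M * wder p P"
      using wder_power[of P "Suc M + 1"] by simp
    thus ?thesis by (simp only: wder_mult[of "P ^ (Suc M + 1)"])
  qed
  ultimately have "(wder p ^^ Suc k) (P ^ N) =
      of_nat (?c * Suc M) * P ^ M * wder p P ^ Suc k + P ^ (M + 1) *
        (of_nat ?c * wder p (wder p P ^ k) + P * wder p R + of_nat (Suc (Suc M)) * wder p P * R)"
    using R unfolding M by (simp add: wder_add algebra_simps)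
  from this[folded c, unfolded M_def] show ?case by blast
qed

lemma at_zero_wder_power:
  assumes "at_zero P = 0" "k \<le> N"
  shows "at_zero ((wder p ^^ k) (P ^ N)) = (if k = N then of_nat (fact N) * at_zero (wder p P) ^ N else 0)"
proof -
  obtain R where R: "(wder p ^^ k) (P ^ N) = of_nat (\<Prod>{N - k<..N}) * P ^ (N - k) * wder p P ^ k + P ^ (N - k + 1) * R"
    using wder_funpow_power[OF assms(2)] by blast
  have "\<Prod>{0<..N} = fact N" by (simp add: fact_prod atLeastSucAtMost_greaterThanAtMost)
  thus ?thesis using assms unfolding R by (auto simp: at_zero_simps power_0_left simp del: of_nat_prod of_nat_fact)
qed

lemma at_zero_wder_var: "at_zero (wder p (wvar 0 n)) = wvar (Suc 0) n"
proof -
  have p2: "p \<ge> 2" using p prime_ge_2_nat by blast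
  have "at_zero (wder p (wvar 0 i ^ p ^ (n - i))) = 0" if "i < n" for i
  proof -
    have "p ^ (n - i) \<ge> 2" using p2 that power_increasing[of 1 "n - i" p] by (simp add: Suc_le_eq)
    thus ?thesis using at_zero_wder_power[of "wvar 0 i" 1 "p ^ (n - i)"] by (auto simp: at_zero_simps)
  qed
  moreover have "wder p (of_nat p ^ i * P) = of_nat p ^ i * wder p P" for i P
    using wder_of_nat_mult[of "p ^ i" P] by simp
  ultimately have "at_zero (wder p (ghost p n (wvar 0))) = of_nat p ^ n * at_zero (wder p (wvar 0 n))"
    by (simp add: ghost_Suc_split wder_add wder_sum at_zero_simps flip: of_nat_power)
  hence "of_nat p ^ n * at_zero (wder p (wvar 0 n)) = of_nat p ^ n * wvar (Suc 0) n"
    by (simp add: wder_ghost at_zero_simps flip: of_nat_power)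
  thus ?thesis using wpoly_torsion_free p2 by (metis not_gr_zero not_numeral_le_zero)
qed

text \<open>The \<open>p\<close>-th derivative of the ghost component \<open>\<Sum>i\<le>n. p ^ i \<cdot> x\<^sub>i ^ p ^ (n - i)\<close> vanishes by \<open>wder_ghost\<close>.  At
  \<open>x = 0\<close> only the terms with \<open>i = n\<close> and \<open>i = n - 1\<close> survive.  The latter gives \<open>p ^ (n - 1) \<cdot> p!\<close>, which is \<open>p ^ n \<cdot> (p - 1)!\<close>, times the
  \<open>p\<close>-th power of the direction of index \<open>n - 1\<close>; now divide by \<open>p ^ n\<close>.\<close>

lemma at_zero_wder_pow_p:
  "at_zero ((wder p ^^ p) (wvar 0 n)) =
     (case n of 0 \<Rightarrow> 0 | Suc k \<Rightarrow> - (of_nat (fact (p - 1)) * wvar (Suc 0) k ^ p))"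
proof (cases n)
  case 0
  have "(wder p ^^ p) (wvar 0 0) = 0"
    using wder_funpow_ghost[of p 0] p prime_ge_2_nat by (simp add: ghost_0)
  thus ?thesis by (simp add: 0 at_zero_simps)
next
  case (Suc k)
  have p2: "p \<ge> 2" using p prime_ge_2_nat by blast
  let ?z = "\<lambda>i. at_zero ((wder p ^^ p) (wvar 0 i ^ p ^ (n - i)))"
  have z: "?z i = (if i = k then of_nat (fact p) * wvar (Suc 0) k ^ p else 0)" if i: "i < n" for i
  proof -
    have "p ^ 1 \<le> p ^ (n - i)" using p2 i by (intro power_increasing) auto
    moreover have "p ^ (n - i) = p \<longleftrightarrow> i = k"
    proof -
      have "p ^ (n - i) = p ^ 1 \<longleftrightarrow> n - i = 1" using p2 by (intro power_inject_exp) auto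
      thus ?thesis using i Suc by auto
    qed
    ultimately show ?thesis
      using at_zero_wder_power[of "wvar 0 i" p "p ^ (n - i)"] by (auto simp: at_zero_simps at_zero_wder_var)
  qed
  have mul: "(wder p ^^ p) (of_nat p ^ i * P) = of_nat p ^ i * (wder p ^^ p) P" for i P
    using wder_funpow_of_nat_mult[of p "p ^ i" P] by simp
  have "0 = at_zero ((wder p ^^ p) (ghost p n (wvar 0)))"
    by (simp add: wder_funpow_ghost[OF p2] at_zero_simps)
  also have "\<dots> = (\<Sum>i<n. of_nat p ^ i * ?z i) + of_nat p ^ n * at_zero ((wder p ^^ p) (wvar 0 n))"
    by (simp add: ghost_Suc_split wder_funpow_add wder_funpow_sum mul at_zero_simps)
  also have "(\<Sum>i<n. of_nat p ^ i * ?z i) = (\<Sum>i<n. if i = k then of_nat p ^ k * (of_nat (fact p) * wvar (Suc 0) k ^ p) else 0)"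
    by (intro sum.cong) (auto simp: z)
  also have "\<dots> = of_nat p ^ k * (of_nat (fact p) * wvar (Suc 0) k ^ p)" using Suc by simp
  also have "of_nat (fact p) = (of_nat p * of_nat (fact (p - 1)) :: wpoly)"
  proof -
    have "fact p = (p * fact (p - 1) :: nat)" using p2 by (subst fact_reduce) simp_all
    thus ?thesis by (simp only: of_nat_mult)
  qed
  finally have "of_nat p ^ n * at_zero ((wder p ^^ p) (wvar 0 n)) =
      of_nat p ^ n * - (of_nat (fact (p - 1)) * wvar (Suc 0) k ^ p)"
    by (simp add: Suc algebra_simps eq_neg_iff_add_eq_0)
  hence "at_zero ((wder p ^^ p) (wvar 0 n)) = - (of_nat (fact (p - 1)) * wvar (Suc 0) k ^ p)"
    using wpoly_torsion_free p2 by (metis not_gr_zero not_numeral_le_zero)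
  thus ?thesis by (simp add: Suc)
qed

end

section \<open>The \<open>p\<close>-th power on the Lie algebra of a root subgroup\<close>

lemma weval_in:
  assumes "\<And>n. of_int n \<in> B" "\<And>x y. x \<in> B \<Longrightarrow> y \<in> B \<Longrightarrow> x + y \<in> B" "\<And>x y. x \<in> B \<Longrightarrow> y \<in> B \<Longrightarrow> x * y \<in> B"
    "\<And>c i. v c i \<in> B"
  shows "weval v P \<in> (B :: 'a::comm_ring_1 set)"
proof -
  have 0: "0 \<in> B" "1 \<in> B" using assms(1)[of 0] assms(1)[of 1] by simp_all
  have pow: "x ^ n \<in> B" if "x \<in> B" for x n using that by (induction n) (auto simp: 0 assms(3))
  have pr: "prod f A \<in> B" if "\<And>a. a \<in> A \<Longrightarrow> f a \<in> B" for f and A :: "(nat \<times> nat) set"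
    using that by (induction A rule: infinite_finite_induct) (auto simp: 0 assms(3))
  have su: "sum f A \<in> B" if "\<And>a. a \<in> A \<Longrightarrow> f a \<in> B" for f and A :: "(nat \<times> nat \<Rightarrow>\<^sub>0 nat) set"
    using that by (induction A rule: infinite_finite_induct) (auto simp: 0 assms(2))
  show ?thesis
    unfolding weval_def mon_eval_def case_prod_unfold by (intro su assms(1,3) pr pow assms(4))
qed

text \<open>Evaluation at \<open>wcut m\<close> kills the variables of index at least \<open>m\<close>; its fixed points are the polynomials in the
  remaining variables, which are functions on the group of level \<open>m\<close>.\<close>

definition wcut :: "nat \<Rightarrow> nat \<Rightarrow> nat \<Rightarrow> wpoly" where
  "wcut m c i = (if i < m then wvar c i else 0)"

lemma wder_cut:
  assumes p: "Factorial_Ring.prime p" and P: "weval (wcut m) P = P"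
  shows "weval (wcut m) (wder p P) = wder p P"
proof -
  let ?B = "{P. weval (wcut m) P = P \<and> weval (wcut m) (wder p P) = wder p P}"
  have var: "weval (wcut m) (wder p (wvar c i)) = wder p (wvar c i)" if "i < m" for c i
  proof (cases "c = 0")
    case True
    define h where "h x = Dual (weval (wcut m) (dre x)) (weval (wcut m) (deps x))" for x
    have h: "h (a + b) = h a + h b" "h (a * b) = h a * h b" "h 1 = 1" for a b
      by (auto simp: h_def weval_add weval_mult intro!: dual.expand)
    let ?v = "pair_args (\<lambda>i. Dual (wvar 0 i) 0) (\<lambda>i. Dual 0 (wvar (Suc 0) i)) :: nat \<Rightarrow> nat \<Rightarrow> wpoly dual"
    have "h (weval ?v (wadd_poly p i)) = weval (\<lambda>c i. h (?v c i)) (wadd_poly p i)"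
      by (rule weval_hom) (rule h)+
    also have "(\<lambda>c i. h (?v c i)) = pair_args (\<lambda>i. Dual (wcut m 0 i) 0) (\<lambda>i. Dual 0 (wcut m 1 i))"
      by (auto simp: fun_eq_iff pair_args_def h_def)
    also have "weval \<dots> (wadd_poly p i) = weval ?v (wadd_poly p i)"
      using that by (intro weval_pair_args_cut[OF p]) (auto simp: wcut_def)
    finally have "deps (h (weval ?v (wadd_poly p i))) = deps (weval ?v (wadd_poly p i))" by simp
    thus ?thesis using True by (simp add: h_def wder_def trans_args_def)
  qed (simp add: wder_def trans_args_def)
  have "weval (wcut m) P \<in> ?B"
  proof (rule weval_in)
    show "of_int n \<in> ?B" for n by (simp add: wder_of_int[OF p])
    show "x + y \<in> ?B" if "x \<in> ?B" "y \<in> ?B" for x y using that by (simp add: wder_add[OF p] weval_add)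
    show "x * y \<in> ?B" if "x \<in> ?B" "y \<in> ?B" for x y using that by (simp add: wder_mult[OF p] weval_add weval_mult)
    show "wcut m c i \<in> ?B" for c i
    proof (cases "i < m")
      case True
      hence "wcut m c i = wvar c i" by (simp add: wcut_def)
      thus ?thesis using var[OF True, of c] by simp
    next
      case False
      hence "wcut m c i = 0" by (simp add: wcut_def)
      thus ?thesis by (simp add: wder_0[OF p])
    qed
  qed
  thus ?thesis using P by simp
qed

lemma root_group_level_mult:
  fixes h h' :: "('k::field_prime_char, 'n::finite) wmat"
  assumes ab: "a \<noteq> b" and h: "h \<in> mtrunc m ` root_group a b" "h' \<in> mtrunc m ` root_group a b"
  shows "weq m ((h ** h') $ a $ b) (h $ a $ b + h' $ a $ b)"
proof -
  let ?U = "\<lambda>u. mat 1 + (\<chi> i j. of_int (iunit a b i j) * u) :: ('k, 'n) wmat"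
  obtain u v where u: "h = mtrunc m (?U u)" and v: "h' = mtrunc m (?U v)"
    using h unfolding root_group_alt[OF ab] by blast
  have "(\<chi> i j. of_int (iunit a b i j) * u) ** (\<chi> i j. of_int (iunit a b i j) * v) = (0 :: ('k, 'n) wmat)"
    using ab by (auto simp: vec_eq_iff matrix_matrix_mult_def iunit_def intro!: sum.neutral)
  hence "?U u ** ?U v = ?U u + (\<chi> i j. of_int (iunit a b i j) * v)"
    by (simp add: matrix_add_ldistrib matrix_add_rdistrib)
  hence "(?U u ** ?U v) $ a $ b = u + v"
    using ab by (simp add: mat_def iunit_def)
  moreover have "mweq m (h ** h') (?U u ** ?U v)" unfolding u v by (intro mweq_mult) auto
  ultimately have "weq m ((h ** h') $ a $ b) (u + v)" unfolding mweq_def by metis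
  moreover have "weq m (u + v) (h $ a $ b + h' $ a $ b)"
    using ab by (intro weq_add) (simp_all add: u v mat_def iunit_def)
  ultimately show ?thesis by (rule weq_trans)
qed

text \<open>The group has one entry as its coordinate, and this entry is additive.  So a derivation with coordinates \<open>u\<close> is
  the reduction of \<open>wder\<close> modulo \<open>p\<close>, and \<open>at_zero_wder_pow_p\<close> gives its \<open>p\<close>-th power at the identity.\<close>

lemma kpa_ppower_root:
  fixes x :: "('k::{alg_closed_field,field_prime_char}, 'n::finite) wlie"
  assumes ab: "a \<noteq> b" and x: "x \<in> sublie (root_group a b)"
  shows "ppower x \<in> sublie (root_group a b)"
    "G.kpa (ppower x) n $ a $ b =
      (case n of 0 \<Rightarrow> 0 | Suc k \<Rightarrow> - (of_nat (fact (CHAR('k) - 1)) * (G.kpa x k $ a $ b) ^ CHAR('k)))"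
proof -
  let ?p = "CHAR('k)"
  have p: "Factorial_Ring.prime ?p" by simp
  interpret R: wsub "root_group a b :: ('k, 'n) wmat set" by (rule wsub_root_group[OF ab])
  obtain y where y: "y \<in> R.L.PL" and xy: "x = R.incl y" using x unfolding R.sublie_eq by blast
  have ym: "y m \<in> wlie_alg m (mtrunc m ` root_group a b)" for m using y by (simp add: R.L.PL_iff)
  have pp: "ppower x = R.incl (ppower y)"
    unfolding xy R.incl_def ppower_def by (simp add: R.I.push_power[OF ym])
  have py: "ppower y \<in> R.L.PL" by (rule R.L.PL_ppower_mem[OF y])
  show "ppower x \<in> sublie (root_group a b)" unfolding R.sublie_eq pp using py by blast
  define m where "m = Suc n"
  let ?S = "mtrunc m ` root_group a b :: ('k, 'n) wmat set"
  define D where "D = y m"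
  have D: "D \<in> wlie_alg m ?S" unfolding D_def by (rule ym)
  define d where "d = tang_of m ?S D"
  have d: "tang ?S (mtrunc m (mat 1)) d" unfolding d_def by (rule R.L.W.tang_lie[OF D])
  define u where "u l = R.L.kpa y l $ a $ b" for l
  have du: "kap d l $ a $ b = u l" if "l < m" for l
    unfolding d_def D_def u_def R.L.kap_eq_kpa[OF y that] ..
  define v where "v h c i = (if c = 0 then wcoeff (h $ a $ b) i else u i)" for h :: "('k, 'n) wmat" and c i :: nat
  have step: "D (ext0 ?S (\<lambda>h. wcoeff (h $ a $ b) i)) h = weval (v h) (wder ?p (wvar 0 i))" if i: "i < m" and h: "h \<in> ?S" for i h
  proof -
    interpret H: wfun_hom "reg ?S" "dhom (mtrunc m (mat 1)) d" by (rule tang_dhom[OF d])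
    have rege: "ext0 ?S (\<lambda>h. wcoeff (h $ a $ b) i) \<in> regfun wmat_coords ?S"
      using reg_coord by (simp add: reg_def)
    have "D (ext0 ?S (\<lambda>h. wcoeff (h $ a $ b) i)) h = d (\<lambda>g. ext0 ?S (\<lambda>h. wcoeff (h $ a $ b) i) (mtrunc m (h ** g)))"
      unfolding d_def by (rule R.L.W.lie_apply[OF D rege h])
    also have "\<dots> = d (\<lambda>g. wcoeff (h $ a $ b + g $ a $ b) i)"
    proof (rule tang_cong[OF d])
      show "(\<lambda>g. ext0 ?S (\<lambda>h. wcoeff (h $ a $ b) i) (mtrunc m (h ** g))) \<in> reg ?S"
        by (rule R.L.W.reg_transl[OF regfun_reg[OF rege] h])
      show "ext0 ?S (\<lambda>h. wcoeff (h $ a $ b) i) (mtrunc m (h ** g)) = wcoeff (h $ a $ b + g $ a $ b) i" if "g \<in> ?S" for g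
        using R.L.W.closed[OF h that] root_group_level_mult[OF ab h that] i
        by (simp add: wcoeff_wtrunc weq_def)
    qed
    also have "\<dots> = deps (wcoeff (wmap (dhom (mtrunc m (mat 1)) d) (\<lambda>g. h $ a $ b + g $ a $ b)) i)"
      by (simp add: dhom_def)
    also have "wmap (dhom (mtrunc m (mat 1)) d) (\<lambda>g. h $ a $ b + g $ a $ b) =
        wmap (dhom (mtrunc m (mat 1)) d) (\<lambda>_. h $ a $ b) + wmap (dhom (mtrunc m (mat 1)) d) (\<lambda>g. g $ a $ b)"
      using reg_id[of ?S] by (intro H.wmap_add reg.wfun_const) (simp add: mfun_def)
    also have "wmap (dhom (mtrunc m (mat 1)) d) (\<lambda>_. h $ a $ b) = wlift (h $ a $ b)"
      by (intro witt_eqI) (simp add: dhom_def tang_const[OF d])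
    also have "wcoeff (wlift (h $ a $ b) + wmap (dhom (mtrunc m (mat 1)) d) (\<lambda>g. g $ a $ b)) i =
        wcoeff (wlift (h $ a $ b) + epsw u) i"
    proof -
      have "mweq m (mmap (dhom (mtrunc m (mat 1)) d) (\<lambda>A. A - mat 1)) (epsm (kap d))"
        by (rule mmap_dhom_minus_one) simp
      hence "weq m (wmap (dhom (mtrunc m (mat 1)) d) (\<lambda>A. (A - mat 1) $ a $ b)) (epsm (kap d) $ a $ b)"
        unfolding mweq_def mmap_nth by blast
      moreover have "weq m (epsm (kap d) $ a $ b) (epsw u)" using du by (simp add: weq_def)
      ultimately have "weq m (wmap (dhom (mtrunc m (mat 1)) d) (\<lambda>g. g $ a $ b)) (epsw u)"
        using ab by (auto simp: mat_def intro: weq_trans)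
      hence "weq m (wlift (h $ a $ b) + wmap (dhom (mtrunc m (mat 1)) d) (\<lambda>g. g $ a $ b)) (wlift (h $ a $ b) + epsw u)"
        by (intro weq_add weq_refl)
      thus ?thesis using i by (simp add: weq_def)
    qed
    also have "deps \<dots> = weval (v h) (wder ?p (wvar 0 i))"
    proof -
      define k where "k x = Dual (weval (v h) (dre x)) (weval (v h) (deps x))" for x
      have k: "k (a + b) = k a + k b" "k (a * b) = k a * k b" "k 1 = 1" for a b
        by (auto simp: k_def weval_add weval_mult intro!: dual.expand)
      let ?v = "pair_args (\<lambda>i. Dual (wvar 0 i) 0) (\<lambda>i. Dual 0 (wvar (Suc 0) i)) :: nat \<Rightarrow> nat \<Rightarrow> wpoly dual"
      have "k (weval ?v (wadd_poly ?p i)) = weval (\<lambda>c i. k (?v c i)) (wadd_poly ?p i)"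
        by (rule weval_hom) (rule k)+
      also have "(\<lambda>c i. k (?v c i)) = pair_args (wcoeff (wlift (h $ a $ b))) (wcoeff (epsw u))"
        by (auto simp: fun_eq_iff pair_args_def k_def v_def)
      finally have "deps (k (weval ?v (wadd_poly ?p i))) = deps (wcoeff (wlift (h $ a $ b) + epsw u) i)"
        by (simp add: wcoeff_add CHAR_dual)
      thus ?thesis by (simp add: k_def wder_def trans_args_def)
    qed
    finally show ?thesis .
  qed
  let ?F = "\<lambda>P h. weval (v h) P"
  \<comment> \<open>Both sides are derivations in \<open>P\<close>, so it suffices to compare them on the variables.\<close>
  have D_F: "?F P \<in> reg ?S \<and> D (ext0 ?S (?F P)) = ext0 ?S (?F (wder ?p P))" if P: "weval (wcut m) P = P" for P
  proof -
    let ?B = "{P. ?F P \<in> reg ?S \<and> D (ext0 ?S (?F P)) = ext0 ?S (?F (wder ?p P))}"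
    have const: "D (ext0 ?S (\<lambda>_. c)) = 0" for c
    proof -
      have "D (ext0 ?S (\<lambda>_. c)) h = 0" for h
      proof (cases "h \<in> ?S")
        case True
        have "ext0 ?S (\<lambda>_. c) \<in> regfun wmat_coords ?S" using reg.const_mem by (simp add: reg_def)
        from R.L.W.lie_apply[OF D this True] have "D (ext0 ?S (\<lambda>_. c)) h = d (\<lambda>b. ext0 ?S (\<lambda>_. c) (mtrunc m (h ** b)))"
          by (simp add: d_def)
        also have "\<dots> = d (\<lambda>_. c)"
          by (rule tang_cong[OF d, symmetric]) (auto simp: reg.const_mem R.L.W.closed[OF True])
        finally show ?thesis by (simp add: tang_const[OF d])
      next
        case False
        have "D (ext0 ?S (\<lambda>_. c)) \<in> regfun wmat_coords ?S"
          using reg.const_mem[of c ?S] by (intro lie_mem[OF D]) (simp add: reg_def)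
        from regfun_ext0[OF this] False show ?thesis by (metis ext0_out)
      qed
      thus ?thesis by auto
    qed
    have z: "ext0 ?S (\<lambda>_. 0) = 0" by (auto simp: ext0_def)
    have "weval (wcut m) P \<in> ?B"
    proof (rule weval_in)
      show "of_int n \<in> ?B" for n
        by (simp add: reg.const_mem const wder_of_int[OF p] z)
      show "P + Q \<in> ?B" if "P \<in> ?B" "Q \<in> ?B" for P Q
        using that lie_add[OF D, of "ext0 ?S (?F P)" "ext0 ?S (?F Q)"]
        by (auto simp: weval_add wder_add[OF p] ext0_add reg_def intro: regfun.add)
      show "P * Q \<in> ?B" if "P \<in> ?B" "Q \<in> ?B" for P Q
        using that lie_mult[OF D, of "ext0 ?S (?F P)" "ext0 ?S (?F Q)"]
        by (auto simp: weval_mult weval_add wder_mult[OF p] ext0_add ext0_mult reg_def intro: regfun.mult)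
      show "wcut m c i \<in> ?B" for c i
      proof (cases "i < m \<and> c = 0")
        case True
        have "D (ext0 ?S (\<lambda>h. wcoeff (h $ a $ b) i)) = ext0 ?S (?F (wder ?p (wvar 0 i)))"
        proof
          fix h
          have "D (ext0 ?S (\<lambda>h. wcoeff (h $ a $ b) i)) \<in> regfun wmat_coords ?S"
            using reg_coord by (intro lie_mem[OF D]) (simp add: reg_def)
          note e = regfun_ext0[OF this]
          show "D (ext0 ?S (\<lambda>h. wcoeff (h $ a $ b) i)) h = ext0 ?S (?F (wder ?p (wvar 0 i))) h"
          proof (cases "h \<in> ?S")
            case h: True
            show ?thesis unfolding ext0_in[OF h] by (rule step) (use True h in auto)
          next
            case h: False
            show ?thesis by (subst e[symmetric]) (simp only: ext0_out[OF h])
          qed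
        qed
        thus ?thesis using True by (simp add: wcut_def v_def[of _ 0] reg_coord)
      next
        case False
        thus ?thesis
          by (cases "i < m") (simp_all add: wcut_def v_def reg.const_mem const wder_0[OF p] wder_def trans_args_def z lie_0[OF D])
      qed
    qed
    thus ?thesis using P by simp
  qed
  have iter: "weval (wcut m) ((wder ?p ^^ k) (wvar 0 n)) = (wder ?p ^^ k) (wvar 0 n) \<and>
      (D ^^ k) (ext0 ?S (?F (wvar 0 n))) = ext0 ?S (?F ((wder ?p ^^ k) (wvar 0 n)))" for k
  proof (induction k)
    case 0
    show ?case by (simp add: wcut_def m_def)
  next
    case (Suc k)
    thus ?case using wder_cut[OF p] D_F by simp
  qed
  have "G.kpa (ppower x) n = R.L.kpa (ppower y) n" using R.incl_wsl(2)[OF py] pp by simp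
  also have "\<dots> $ a $ b = tang_of m ?S (D ^^ ?p) (\<lambda>A. wcoeff ((A - mat 1) $ a $ b) n)"
    by (simp add: R.L.kpa_def kap_def m_def ppower_def D_def)
  also have "(\<lambda>A :: ('k, 'n) wmat. wcoeff ((A - mat 1) $ a $ b) n) = ?F (wvar 0 n)"
    using ab by (simp add: v_def mat_def)
  also have "tang_of m ?S (D ^^ ?p) (?F (wvar 0 n)) = ?F ((wder ?p ^^ ?p) (wvar 0 n)) (mtrunc m (mat 1))"
    using iter[of ?p] R.L.W.one[of m] by (simp add: tang_of_def)
  also have "\<dots> = weval (\<lambda>c i. if c = 0 then 0 else u i) (at_zero ((wder ?p ^^ ?p) (wvar 0 n)))"
  proof -
    have "v (mtrunc m (mat 1)) = (\<lambda>c i. weval (\<lambda>c i. if c = 0 then 0 else u i) (if c = 0 then 0 else wvar c i))"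
      using ab by (auto simp: fun_eq_iff v_def mat_def wcoeff_wtrunc)
    thus ?thesis by (simp only: at_zero_def weval_weval)
  qed
  also have "\<dots> = (case n of 0 \<Rightarrow> 0 | Suc k \<Rightarrow> - (of_nat (fact (?p - 1)) * u k ^ ?p))"
    by (simp add: at_zero_wder_pow_p[OF p] weval_uminus weval_mult weval_power del: of_nat_fact split: nat.split)
  also have "u = (\<lambda>k. G.kpa x k $ a $ b)"
    by (rule ext) (simp only: u_def xy R.incl_wsl(2)[OF y])
  finally show "G.kpa (ppower x) n $ a $ b =
      (case n of 0 \<Rightarrow> 0 | Suc k \<Rightarrow> - (of_nat (fact (?p - 1)) * (G.kpa x k $ a $ b) ^ ?p))" .
qed

section \<open>The Lie algebra in coordinates\<close>

lemma wsl_zero [simp]: "0 \<in> wsl" "G.kpa 0 = 0"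
  by (simp_all add: wsl_eq_PL G.PL_zero)

lemma wsl_add: "x \<in> wsl \<Longrightarrow> y \<in> wsl \<Longrightarrow> x + y \<in> wsl"
  "x \<in> wsl \<Longrightarrow> y \<in> wsl \<Longrightarrow> G.kpa (x + y) l = G.kpa x l + G.kpa y l"
  by (simp_all add: wsl_eq_PL G.PL_add)

lemma wsl_scale: "x \<in> wsl \<Longrightarrow> wscale c x \<in> wsl"
  "x \<in> wsl \<Longrightarrow> G.kpa (wscale c x) l = mscale c (G.kpa x l)"
  by (simp_all add: wsl_eq_PL G.PL_scale)

lemma wsl_diff: assumes "x \<in> wsl" "y \<in> wsl"
  shows "x - y \<in> wsl" "G.kpa (x - y) l = G.kpa x l - G.kpa y l"
proof -
  have "x - y = x + wscale (-1) y" by (simp add: wlie.scale_minus_left)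
  moreover have "mscale (-1) M = - M" for M :: "'a^'b^'b" by (simp add: kmat.scale_minus_left)
  ultimately show "x - y \<in> wsl" "G.kpa (x - y) l = G.kpa x l - G.kpa y l"
    using assms by (simp_all only: wsl_add wsl_scale) (simp_all add: wsl_add wsl_scale)
qed

lemma wsl_eqI: "x \<in> wsl \<Longrightarrow> y \<in> wsl \<Longrightarrow> (\<And>l. G.kpa x l = G.kpa y l) \<Longrightarrow> x = y"
  unfolding wsl_eq_PL by (rule G.PL_eqI) auto

lemma wsl_sum:
  assumes "\<And>x. x \<in> I \<Longrightarrow> f x \<in> wsl"
  shows "sum f I \<in> wsl" "G.kpa (sum f I) l = (\<Sum>x\<in>I. G.kpa (f x) l)"
proof -
  have "sum f I \<in> wsl \<and> G.kpa (sum f I) l = (\<Sum>x\<in>I. G.kpa (f x) l)"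
    using assms by (induction I rule: infinite_finite_induct) (simp_all add: wsl_add)
  thus "sum f I \<in> wsl" "G.kpa (sum f I) l = (\<Sum>x\<in>I. G.kpa (f x) l)" by blast+
qed

lemma wsl_bracket: "x \<in> wsl \<Longrightarrow> y \<in> wsl \<Longrightarrow> bracket x y \<in> wsl"
  unfolding wsl_eq_PL by (rule G.PL_bracket_mem)

lemma wsl_sl: "x \<in> wsl \<Longrightarrow> G.kpa x l \<in> sl"
  unfolding wsl_eq_PL by (rule G.kpa_sl)

lemma zero_sl [simp]: "0 \<in> sl"
  by (rule kmat.subspace_0[OF subspace_sl])

lemma subspace_wsl: "wlie.subspace wsl"
  by (auto simp: wlie.subspace_def wsl_zero wsl_add wsl_scale)

lemma mbracket_0: "mbracket A 0 = 0" "mbracket 0 A = 0"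
  by (simp_all add: mbracket_def matrix_matrix_mult_def vec_eq_iff)

lemma mfrob_0: "mfrob 0 A = A"
  by (simp add: mfrob_def vec_eq_iff)

lemma mult_zero_matrix: "A ** 0 = (0 :: 'a::comm_ring_1^'n::finite^'n)" "0 ** A = (0 :: 'a^'n^'n)"
  by (simp_all add: matrix_matrix_mult_def vec_eq_iff)

lemma mscale_mult: "A ** mscale c B = mscale c (A ** B)" "mscale c A ** B = mscale c (A ** B)"
  by (simp_all add: matrix_matrix_mult_def mscale_def vec_eq_iff sum_distrib_left algebra_simps)

lemma Ad_add: "g \<in> SLW \<Longrightarrow> x \<in> wsl \<Longrightarrow> y \<in> wsl \<Longrightarrow> Ad g (x + y) = Ad g x + Ad g y"
  by (rule wsl_eqI) (simp_all add: kpa_Ad' wsl_add matrix_add_ldistrib matrix_add_rdistrib)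

lemma Ad_scale: "g \<in> SLW \<Longrightarrow> x \<in> wsl \<Longrightarrow> Ad g (wscale c x) = wscale c (Ad g x)"
  by (rule wsl_eqI) (simp_all add: kpa_Ad' wsl_scale mscale_mult)

lemma lie_red_Ad: "g \<in> SLW \<Longrightarrow> x \<in> wsl \<Longrightarrow> lie_red (Ad g x) = sl_act g (lie_red x)"
  by (simp add: lie_red_eq_kpa kpa_Ad' sl_act_def mfrob_0)

lemma kpa_Ad_0: "g \<in> SLW \<Longrightarrow> x \<in> wsl \<Longrightarrow> G.kpa (Ad g x) 0 = sl_act g (G.kpa x 0)"
  by (simp add: kpa_Ad' sl_act_def mfrob_0)

lemma lie_red_bracket: "x \<in> wsl \<Longrightarrow> y \<in> wsl \<Longrightarrow> lie_red (bracket x y) = mbracket (lie_red x) (lie_red y)"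
  by (simp add: lie_red_eq_kpa wsl_bracket kpa_bracket)

lemma repn_iso_lie_red:
  fixes M :: "('k::field_prime_char, 'n::finite) wlie set"
  assumes "G \<subseteq> SLW" "M \<subseteq> wsl" "wlie.subspace M" "\<And>g x. g \<in> G \<Longrightarrow> x \<in> M \<Longrightarrow> Ad g x \<in> M"
    and inj: "\<And>x. x \<in> M \<Longrightarrow> G.kpa x 0 = 0 \<Longrightarrow> x = 0"
    and surj: "\<And>A. A \<in> sl \<Longrightarrow> \<exists>x\<in>M. G.kpa x 0 = A"
  shows "repn_iso G (wlie_repn M) sl_repn lie_red"
proof -
  have sub: "x \<in> wsl" if "x \<in> M" for x using that assms(2) by blast
  have "inj_on lie_red M"
  proof (rule inj_onI)
    fix x y assume xy: "x \<in> M" "y \<in> M" "lie_red x = lie_red y"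
    hence "G.kpa (x - y) 0 = 0" by (simp add: wsl_diff sub lie_red_eq_kpa)
    moreover have "x - y \<in> M" using xy wlie.subspace_diff[OF assms(3)] by blast
    ultimately have "x - y = 0" using inj by blast
    thus "x = y" by simp
  qed
  moreover have "lie_red ` M = sl"
    using surj by (auto simp: lie_red_eq_kpa sub wsl_sl image_iff)
  ultimately have "bij_betw lie_red M sl" by (simp add: bij_betw_def)
  thus ?thesis
    using assms(1,4) wlie.subspace_add[OF assms(3)] wlie.subspace_scale[OF assms(3)]
    by (auto simp: repn_iso_def wlie_repn_def sl_repn_def lie_red_eq_kpa sub wsl_add wsl_scale
        kpa_Ad_0 subset_iff)
qed

section \<open>The action of the torus\<close>

lemma Tk_SLW: "t \<in> Tk \<Longrightarrow> t \<in> SLW"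
  by (simp add: Tk_def torus_def)

lemma kpa_Ad_Tk:
  fixes t :: "('k::field_prime_char, 'n::finite) wmat"
  assumes t: "t \<in> Tk" and x: "x \<in> wsl"
  shows "G.kpa (Ad t x) l $ i $ j = root_char i j t ^ (CHAR('k) ^ l) * G.kpa x l $ i $ j"
    "root_char i i t = 1"
proof -
  define c where "c i = wcoeff (t $ i $ i) 0" for i
  have t0: "t $ i $ j = 0" if "i \<noteq> j" for i j using t that by (simp add: Tk_def torus_def)
  have "wcoeff (det t) 0 = (\<Prod>i\<in>UNIV. c i)"
  proof -
    have "wcoeff (\<Prod>i\<in>A. t $ i $ i) 0 = (\<Prod>i\<in>A. c i)" for A :: "'n set"
      by (induction A rule: infinite_finite_induct) (auto simp: wcoeff_1 wcoeff_0_mult c_def)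
    thus ?thesis by (simp add: det_diagonal t0)
  qed
  hence "(\<Prod>i\<in>UNIV. c i) = 1" using Tk_SLW[OF t] by (simp add: SLW_def wcoeff_1)
  hence c0: "c i \<noteq> 0" for i by (metis UNIV_I finite prod_zero zero_neq_one)
  show "root_char i i t = 1" using c0[of i] by (simp add: root_char_def c_def)
  have m: "mred t = (\<chi> i j. if i = j then c i else 0)"
    by (simp add: vec_eq_iff mred_def c_def t0)
  have "matrix_inv (mred t) = (\<chi> i j. if i = j then 1 / c i else 0)"
    by (rule matrix_inv_eqI)
      (simp_all add: m vec_eq_iff matrix_matrix_mult_def mat_def c0 if_distrib[of "\<lambda>x. x * _"] cong: if_cong)
  moreover have "(mfrob l (\<chi> i j. if i = j then a i else 0) ** K ** mfrob l (\<chi> i j. if i = j then b i else 0)) $ i $ j =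
     a i ^ (CHAR('k) ^ l) * K $ i $ j * b j ^ (CHAR('k) ^ l)" for a b and K :: "'k^'n^'n"
  proof -
    have f: "mfrob l (\<chi> i j. if i = j then a i else 0) = (\<chi> i j. if i = j then a i ^ (CHAR('k) ^ l) else 0 :: 'k^'n^'n)" for a
      by (simp add: mfrob_def vec_eq_iff power_0_left)
    have left: "((\<chi> i j. if i = j then a i else 0) ** K) $ i $ j = a i * K $ i $ j" for a and K :: "'k^'n^'n" and i j
      by (simp add: matrix_matrix_mult_def if_distrib[of "\<lambda>x. x * _"] cong: if_cong)
    have right: "(K ** (\<chi> i j. if i = j then a i else 0)) $ i $ j = K $ i $ j * a j" for a and K :: "'k^'n^'n" and i j
      by (simp add: matrix_matrix_mult_def if_distrib[of "\<lambda>x. _ * x"] cong: if_cong)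
    show ?thesis unfolding f right left ..
  qed
  ultimately show "G.kpa (Ad t x) l $ i $ j = root_char i j t ^ (CHAR('k) ^ l) * G.kpa x l $ i $ j"
    unfolding kpa_Ad'(2)[OF Tk_SLW[OF t] x] m root_char_def c_def[symmetric]
    by (simp add: power_divide)
qed

lemma weight_zero:
  fixes x :: "('k::field_prime_char, 'n::finite) wlie"
  assumes "x \<in> wsl" "x \<noteq> 0" "\<And>l i j. i \<noteq> j \<Longrightarrow> G.kpa x l $ i $ j = 0"
  shows "weight_vector (\<lambda>_. 1) x"
proof -
  have "Ad t x = wscale 1 x" if t: "t \<in> Tk" for t
  proof (rule wsl_eqI)
    fix l
    have "G.kpa (Ad t x) l $ i $ j = G.kpa x l $ i $ j" for i j
      using assms(3)[of i j l] kpa_Ad_Tk[OF t assms(1)] by (cases "i = j") simp_all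
    thus "G.kpa (Ad t x) l = G.kpa (wscale 1 x) l" by (simp add: vec_eq_iff)
  qed (simp_all add: kpa_Ad' Tk_SLW t assms wsl_scale)
  thus ?thesis using assms by (simp add: weight_vector_def)
qed

text \<open>Conjugation by \<open>t\<close> multiplies the entry at \<open>a\<close>, \<open>b\<close> of level \<open>j\<close> by the \<open>p\<^sup>j\<close>-th power of the root.\<close>

lemma weight_root:
  fixes x :: "('k::field_prime_char, 'n::finite) wlie"
  assumes "x \<in> wsl" "c \<noteq> 0" "\<And>l. G.kpa x l = at_level j (mscale c (Eu a b)) l"
  shows "weight_vector (\<lambda>t. root_char a b t ^ CHAR('k) ^ j) x"
proof -
  have "Ad t x = wscale (root_char a b t ^ CHAR('k) ^ j) x" if t: "t \<in> Tk" for t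
  proof (rule wsl_eqI)
    fix l
    have "G.kpa (Ad t x) l $ r $ s = (root_char a b t ^ CHAR('k) ^ j) * G.kpa x l $ r $ s" for r s
      unfolding kpa_Ad_Tk(1)[OF t assms(1)] assms(3) by (simp add: at_level_def mscale_def Eu_nth)
    thus "G.kpa (Ad t x) l = G.kpa (wscale (root_char a b t ^ CHAR('k) ^ j) x) l"
      by (simp add: vec_eq_iff wsl_scale assms(1) mscale_def)
  qed (simp_all add: kpa_Ad' Tk_SLW t assms wsl_scale)
  moreover have "x \<noteq> 0"
  proof
    assume "x = 0"
    have "mscale c (Eu a b) = G.kpa x j" by (simp only: assms(3) at_level_def simp_thms if_True)
    also have "\<dots> = 0" by (simp add: \<open>x = 0\<close>)
    finally have "mscale c (Eu a b) $ a $ b = (0 :: 'k)" by (simp only: zero_index)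
    thus False using assms(2) by (simp add: mscale_def Eu_nth)
  qed
  ultimately show ?thesis using assms by (simp add: weight_vector_def)
qed

section \<open>Root vectors\<close>

text \<open>The root takes the value \<open>s\<^sup>2\<close> at the diagonal matrix with \<open>[s]\<close> and \<open>[1/s]\<close> in the positions \<open>a\<close> and \<open>b\<close>, and distinct
  powers are distinct functions on the infinite field \<open>k\<close>.\<close>

lemma root_char_nontrivial:
  assumes ab: "a \<noteq> b" and q: "q > 1"
  shows "\<exists>t\<in>(Tk :: ('k::{alg_closed_field,field_prime_char}, 'n::finite) wmat set). root_char a b t ^ q \<noteq> root_char a b t"
proof -
  have "Polynomial.monom 1 (2 * q) \<noteq> (Polynomial.monom 1 2 :: 'k poly)"
    using q by (auto simp: Polynomial.monom_eq_iff' dest: arg_cong[of _ _ Polynomial.degree] simp: degree_monom_eq)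
  then obtain s :: 'k where s: "s \<noteq> 0" "s ^ (2 * q) \<noteq> s ^ 2"
    using poly_eqI_nonzero[of "Polynomial.monom 1 (2 * q)" "Polynomial.monom 1 2 :: 'k poly"]
    by (auto simp: poly_monom)
  define t where "t = (\<chi> i j. if i = j then if i = a then teich s else if i = b then teich (1 / s) else 1 else 0 :: ('k, 'n) wmat)"
  have "det t = (\<Prod>i\<in>UNIV. t $ i $ i)" by (rule det_diagonal) (simp add: t_def)
  also have "\<dots> = t $ a $ a * (t $ b $ b * (\<Prod>i\<in>UNIV - {a} - {b}. t $ i $ i))"
    using ab by (subst prod.remove[of _ a], simp, simp, subst prod.remove[of _ b]) auto
  also have "(\<Prod>i\<in>UNIV - {a} - {b}. t $ i $ i) = 1" by (intro prod.neutral) (simp add: t_def)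
  finally have det: "det t = 1" using s ab by (simp add: t_def teich_mult teich_1)
  have "1 \<in> range (teich :: 'k \<Rightarrow> 'k witt)" by (metis rangeI teich_1)
  hence "t \<in> Tk" using det by (auto simp: Tk_def torus_def SLW_def) (auto simp: t_def)
  moreover have "root_char a b t = s ^ 2"
    using ab s by (simp add: root_char_def t_def teich_def power2_eq_square)
  ultimately show ?thesis using s(2) by (intro bexI[of _ t]) (simp_all add: power_mult)
qed

lemma frob_root:
  obtains c :: "'k::{alg_closed_field,field_prime_char}" where "c ^ CHAR('k) = x"
  using nth_root_exists[of "CHAR('k)" x] by auto

lemma fact_nonzero: "of_nat (fact (CHAR('k) - 1)) \<noteq> (0 :: 'k::field_prime_char)"
proof -
  have p: "Factorial_Ring.prime CHAR('k)" by simp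
  have "\<not> CHAR('k) \<le> CHAR('k) - 1" using CHAR_pos[where ?'a='k] by linarith
  hence "\<not> CHAR('k) dvd fact (CHAR('k) - 1)" unfolding prime_dvd_fact_iff[OF p] .
  thus ?thesis by (simp only: of_nat_eq_0_iff_char_dvd not_False_eq_True)
qed

lemma Eu_neq_0 [simp]: "Eu a b \<noteq> (0 :: 'k::field^'n::finite^'n)"
proof
  assume "Eu a b = (0 :: 'k^'n^'n)"
  hence "Eu a b $ a $ b = (0 :: 'k)" by simp
  thus False by (simp add: Eu_nth)
qed

lemma Eu_sl: "a \<noteq> b \<Longrightarrow> Eu a b \<in> (sl :: ('k::field^'n::finite^'n) set)"
  by (rule subsetD[OF sl_gens_sl]) (auto simp: sl_gens_def)

text \<open>All sequences of coordinates starting with \<open>0\<close> occur in \<open>kpa_ppower_root\<close>, because \<open>(p - 1)!\<close> is invertible and \<open>p\<close>-th roots exist.\<close>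

lemma ppower_root_image:
  fixes a b :: "'n::finite"
  assumes ab: "a \<noteq> b"
  defines "L \<equiv> sublie (root_group a b :: ('k::{alg_closed_field,field_prime_char}, 'n) wmat set)"
  shows "ppower ` L = {x \<in> L. G.kpa x 0 = 0}"
proof (intro equalityI subsetI)
  fix y assume "y \<in> ppower ` L"
  then obtain x where x: "x \<in> L" "y = ppower x" by blast
  have y: "y \<in> L" "G.kpa y 0 $ a $ b = 0"
    using kpa_ppower_root[OF ab, of x] x by (simp_all add: L_def)
  moreover obtain u where "G.kpa y 0 = mscale u (Eu a b)"
    using y(1) by (auto simp: L_def sublie_root_group_iff[OF ab])
  ultimately show "y \<in> {x \<in> L. G.kpa x 0 = 0}" by (auto simp: mscale_def vec_eq_iff Eu_nth)
next
  let ?f = "of_nat (fact (CHAR('k) - 1)) :: 'k"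
  fix x assume "x \<in> {x \<in> L. G.kpa x 0 = 0}"
  hence x: "x \<in> L" "G.kpa x 0 = 0" by auto
  then obtain u where u: "\<And>l. G.kpa x l = mscale (u l) (Eu a b)"
    unfolding L_def sublie_root_group_iff[OF ab] by metis
  have "\<exists>v. v ^ CHAR('k) = - u (Suc k) / ?f" for k by (metis frob_root)
  then obtain v where v: "\<And>k. v k ^ CHAR('k) = - u (Suc k) / ?f" by metis
  have "mscale (v k) (Eu a b) \<in> sl" for k
    by (rule kmat.subspace_scale[OF subspace_sl Eu_sl[OF ab]])
  then obtain y where y: "y \<in> wsl" "G.kpa y = (\<lambda>k. mscale (v k) (Eu a b))" using wsl_ex by metis
  have yL: "y \<in> L" unfolding L_def sublie_root_group_iff[OF ab] using y by auto
  have "ppower y = x"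
  proof (rule wsl_eqI)
    have P: "ppower y \<in> L" using kpa_ppower_root(1)[OF ab] yL by (simp add: L_def)
    thus "ppower y \<in> wsl" "x \<in> wsl" using x by (auto simp: L_def sublie_root_group_iff[OF ab])
    fix l
    obtain w where w: "G.kpa (ppower y) l = mscale w (Eu a b)"
      using P by (auto simp: L_def sublie_root_group_iff[OF ab])
    have "w = G.kpa (ppower y) l $ a $ b" by (simp add: w mscale_def Eu_nth)
    also have "\<dots> = (case l of 0 \<Rightarrow> 0 | Suc k \<Rightarrow> - (?f * (v k) ^ CHAR('k)))"
      using kpa_ppower_root(2)[OF ab, of y l] yL
      by (simp add: L_def y(2) mscale_def Eu_nth del: of_nat_fact split: nat.split)
    also have "\<dots> = u l"
    proof (cases l)
      case 0
      have "u 0 = G.kpa x 0 $ a $ b" by (simp add: u mscale_def Eu_nth)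
      thus ?thesis using 0 x(2) by simp
    next
      case (Suc k)
      thus ?thesis using fact_nonzero[where ?'k = 'k] by (simp add: v del: of_nat_fact)
    qed
    finally show "G.kpa (ppower y) l = G.kpa x l" by (simp add: w u)
  qed
  thus "x \<in> ppower ` L" using yL by blast
qed

text \<open>A vector that spans a line stable under \<open>Tk\<close> has a single weight.  Its coordinate of level \<open>0\<close> has the weight of the
  root, a coordinate of level \<open>l > 0\<close> would have its \<open>p\<^sup>l\<close>-th power, a different character.  So the conditions that define the root vector
  leave only the matrix unit at level \<open>0\<close>.\<close>

lemma kpa_root_vector:
  fixes a b :: "'n::finite"
  assumes ab: "a \<noteq> b"
  shows "root_vector a b \<in> sublie (root_group a b :: ('k::{alg_closed_field,field_prime_char}, 'n) wmat set)"
    "root_vector a b \<in> (wsl :: ('k, 'n) wlie set)"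
    "G.kpa (root_vector a b :: ('k, 'n) wlie) = at_level 0 (Eu a b)"
proof -
  let ?L = "sublie (root_group a b :: ('k, 'n) wmat set)"
  note L = sublie_root_group_iff[OF ab, where ?'k = 'k]
  have Esl: "Eu a b \<in> (sl :: ('k^'n^'n) set)" by (rule Eu_sl[OF ab])
  have "at_level 0 (Eu a b) l \<in> (sl :: ('k^'n^'n) set)" for l
    using Esl by (simp add: at_level_def)
  then obtain e :: "('k, 'n) wlie" where e: "e \<in> wsl" "G.kpa e = at_level 0 (Eu a b)" using wsl_ex by metis
  have "\<exists>u. at_level 0 (Eu a b) l = (mscale u (Eu a b) :: 'k^'n^'n)" for l
    by (rule exI[of _ "if l = 0 then 1 else 0"]) (simp add: at_level_def mscale_def vec_eq_iff)
  hence eL: "e \<in> ?L" unfolding L using e by simp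
  have span: "wlie.span {x} = range (\<lambda>k. wscale k x)" for x :: "('k, 'n) wlie" by (rule wlie.span_singleton)
  have P: "ppower ` ?L = {x \<in> ?L. G.kpa x 0 = 0}" by (rule ppower_root_image[OF ab])
  have red: "lie_red x = (\<chi> i j. if i = a \<and> j = b then 1 else 0) \<longleftrightarrow> G.kpa x 0 = Eu a b" if "x \<in> wsl" for x :: "('k, 'n) wlie"
    unfolding lie_red_eq_kpa[OF that] by (simp add: vec_eq_iff Eu_nth)
  let ?Q = "\<lambda>x. x \<in> ?L \<and>
     (\<forall>t\<in>Tk. Ad t ` wlie.span {x} \<subseteq> wlie.span {x}) \<and>
     wlie.span {x} \<inter> ppower ` ?L = {0} \<and> {y + z | y z. y \<in> wlie.span {x} \<and> z \<in> ppower ` ?L} = ?L \<and>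
     lie_red x = (\<chi> i j. if i = a \<and> j = b then 1 else 0)"
  have sL: "wscale k x \<in> ?L" if "x \<in> ?L" for k x
  proof -
    from that obtain u where "\<And>l. G.kpa x l = mscale (u l) (Eu a b)" "x \<in> wsl" unfolding L by metis
    thus ?thesis by (auto simp: L wsl_scale)
  qed
  have aL: "x + y \<in> ?L" if "x \<in> ?L" "y \<in> ?L" for x y
  proof -
    from that obtain u v where "\<And>l. G.kpa x l = mscale (u l) (Eu a b)" "x \<in> wsl"
      "\<And>l. G.kpa y l = mscale (v l) (Eu a b)" "y \<in> wsl" unfolding L by metis
    thus ?thesis by (auto simp: L wsl_add kmat.scale_left_distrib[symmetric])
  qed
  have dL: "x - y \<in> ?L" if "x \<in> ?L" "y \<in> ?L" for x y
    using aL[OF that(1) sL[OF that(2), of "-1"]] by (simp add: wlie.scale_minus_left)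
  have Lw: "x \<in> wsl" if "x \<in> ?L" for x using that by (simp add: L)
  have Qe: "?Q e"
  proof (intro conjI ballI)
    show "e \<in> ?L" by (rule eL)
    show "lie_red e = (\<chi> i j. if i = a \<and> j = b then 1 else 0)" using red[OF e(1)] by (simp add: e at_level_def)
    fix t :: "('k, 'n) wmat" assume t: "t \<in> Tk"
    have "weight_vector (\<lambda>t. root_char a b t ^ CHAR('k) ^ 0) e"
      by (rule weight_root[OF e(1), of 1]) (simp_all add: e)
    hence "Ad t e = wscale (root_char a b t) e" using t by (simp add: weight_vector_def)
    thus "Ad t ` wlie.span {e} \<subseteq> wlie.span {e}"
      unfolding span by (auto simp: Ad_scale Tk_SLW t e(1) wlie.scale_scale)
  next
    have "wscale k e = 0" if "G.kpa (wscale k e) 0 = 0" for k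
    proof -
      have "k = 0" using that by (simp add: wsl_scale e at_level_def)
      thus ?thesis by simp
    qed
    moreover have "0 \<in> ?L" using sL[OF eL, of 0] by simp
    moreover have "0 \<in> range (\<lambda>k. wscale k e)" by (metis rangeI wlie.scale_zero_left)
    ultimately show "wlie.span {e} \<inter> ppower ` ?L = {0}"
      unfolding span P using wsl_zero(2) by auto
  next
    show "{y + z | y z. y \<in> wlie.span {e} \<and> z \<in> ppower ` ?L} = ?L"
    proof (intro equalityI subsetI)
      fix x assume "x \<in> {y + z | y z. y \<in> wlie.span {e} \<and> z \<in> ppower ` ?L}"
      thus "x \<in> ?L" unfolding span P using aL sL[OF eL] by auto
    next
      fix x assume x: "x \<in> ?L"
      then obtain u where u: "G.kpa x 0 = mscale u (Eu a b)" by (auto simp: L)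
      have "x = wscale u e + (x - wscale u e)" by simp
      moreover have "G.kpa (x - wscale u e) 0 = 0"
        by (simp add: wsl_diff wsl_scale Lw x e u at_level_def)
      moreover have "x - wscale u e \<in> ?L" by (rule dL[OF x sL[OF eL]])
      ultimately show "x \<in> {y + z | y z. y \<in> wlie.span {e} \<and> z \<in> ppower ` ?L}" unfolding span P by blast
    qed
  qed
  have uniq: "x = e" if Q: "?Q x" for x
  proof (rule wsl_eqI)
    show xw: "x \<in> wsl" using Q Lw by blast
    show "e \<in> wsl" by (rule e)
    obtain u where u: "\<And>l. G.kpa x l = mscale (u l) (Eu a b)" using Q unfolding L by metis
    have x0: "G.kpa x 0 = Eu a b" using Q red[OF xw] by blast
    fix l
    show "G.kpa x l = G.kpa e l"
    proof (cases "l = 0")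
      case True
      thus ?thesis using x0 by (simp add: e at_level_def)
    next
      case False
      have "CHAR('k) ^ l > 1" using False prime_gt_1_nat[OF CHAR_prime[where ?'a='k]] by (intro one_less_power) auto
      from root_char_nontrivial[OF ab this] obtain t :: "('k, 'n) wmat"
        where t: "t \<in> Tk" "root_char a b t ^ (CHAR('k) ^ l) \<noteq> root_char a b t" by blast
      have "x \<in> wlie.span {x}" by (simp add: wlie.span_base)
      hence "Ad t x \<in> wlie.span {x}" using Q t(1) by blast
      then obtain k where k: "Ad t x = wscale k x" unfolding span by blast
      have eq: "root_char a b t ^ (CHAR('k) ^ i) * G.kpa x i $ a $ b = k * G.kpa x i $ a $ b" for i
        using kpa_Ad_Tk(1)[OF t(1) xw, of i a b] unfolding k by (auto simp: wsl_scale xw mscale_def)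
      have "root_char a b t = k" using eq[of 0] by (simp add: x0 Eu_nth)
      hence "u l = 0" using eq[of l] t(2) by (simp add: u mscale_def Eu_nth)
      thus ?thesis using False by (simp add: u e at_level_def)
    qed
  qed
  have "root_vector a b = e"
    unfolding root_vector_def Let_def by (rule the_equality[where P = ?Q, OF Qe uniq])
  thus "root_vector a b \<in> ?L" "root_vector a b \<in> (wsl :: ('k, 'n) wlie set)"
    "G.kpa (root_vector a b :: ('k, 'n) wlie) = at_level 0 (Eu a b)" using eL e by simp_all
qed

lemma kpa_ppower_root_vector:
  fixes a b :: "'n::finite"
  assumes ab: "a \<noteq> b"
  defines "x \<equiv> \<lambda>j. (ppower ^^ j) (root_vector a b) :: ('k::{alg_closed_field,field_prime_char}, 'n) wlie"
  shows "x j \<in> sublie (root_group a b) \<and> (\<exists>c. c \<noteq> 0 \<and> G.kpa (x j) = at_level j (mscale c (Eu a b)))"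
proof (induction j)
  case 0
  show ?case using kpa_root_vector[OF ab, where ?'k = 'k] by (auto simp: x_def intro!: exI[of _ 1])
next
  case (Suc j)
  let ?f = "of_nat (fact (CHAR('k) - 1)) :: 'k"
  have x: "x (Suc j) = ppower (x j)" by (simp add: x_def)
  from Suc obtain c where c: "c \<noteq> 0" "G.kpa (x j) = at_level j (mscale c (Eu a b))" and xj: "x j \<in> sublie (root_group a b)" by blast
  note P = kpa_ppower_root[OF ab xj]
  define d where "d = - (?f * c ^ CHAR('k))"
  have "d \<noteq> 0" using c(1) fact_nonzero[where ?'k = 'k] by (simp add: d_def del: of_nat_fact)
  moreover have "G.kpa (x (Suc j)) l = at_level (Suc j) (mscale d (Eu a b)) l" for l
  proof -
    obtain w where w: "G.kpa (x (Suc j)) l = mscale w (Eu a b)"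
      using P(1) unfolding x sublie_root_group_iff[OF ab] by blast
    have "w = G.kpa (x (Suc j)) l $ a $ b" by (simp add: w mscale_def Eu_nth)
    also have "\<dots> = (if l = Suc j then d else 0)"
      unfolding x P(2) by (simp add: c(2) at_level_def mscale_def Eu_nth d_def power_0_left del: of_nat_fact split: nat.split)
    finally show ?thesis by (simp add: w at_level_def)
  qed
  ultimately show ?case using P(1) by (auto simp: x)
qed

section \<open>The subspaces mapping onto \<open>sl\<close>\<close>

text \<open>Brackets only have a coordinate of level \<open>0\<close>, and so have the root vectors; the matrix units off the diagonal and
  their brackets span \<open>sl\<close>.\<close>

lemma g0_eq: "g0 = {x \<in> (wsl :: ('k::{alg_closed_field,field_prime_char}, 'n::finite) wlie set). \<forall>l\<ge>1. G.kpa x l = 0}"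
proof -
  let ?W = "{x \<in> (wsl :: ('k, 'n) wlie set). \<forall>l\<ge>1. G.kpa x l = 0}"
  let ?B = "{bracket (root_vector a b) (root_vector b a) | a b. a \<noteq> b} \<union> {root_vector a b | a b. a \<noteq> b} :: ('k, 'n) wlie set"
  have sub: "wlie.subspace ?W"
    using wlie.subspace_add[OF subspace_wsl] wlie.subspace_scale[OF subspace_wsl]
    by (auto simp: wlie.subspace_def wsl_zero wsl_add wsl_scale)
  have rv: "root_vector a b \<in> ?W" if "a \<noteq> b" for a b
    using kpa_root_vector[OF that, where ?'k = 'k] by (simp add: at_level_def)
  have rb: "bracket (root_vector a b) (root_vector b a) \<in> ?W" if "a \<noteq> b" for a b
    using kpa_root_vector[OF that, where ?'k = 'k] kpa_root_vector[OF that[symmetric], where ?'k = 'k]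
    by (auto simp: wsl_bracket kpa_bracket)
  have "g0 \<subseteq> ?W" unfolding g0_def by (rule wlie.span_minimal[OF _ sub]) (use rv rb in blast)
  moreover have "?W \<subseteq> g0"
  proof
    fix x assume x: "x \<in> ?W"
    let ?T = "{M :: 'k^'n^'n. \<exists>y\<in>wlie.span ?B. y \<in> ?W \<and> G.kpa y 0 = M}"
    have "kmat.subspace ?T"
      unfolding kmat.subspace_def
    proof (intro conjI ballI allI)
      show "0 \<in> ?T" using wlie.span_zero wlie.subspace_0[OF sub] wsl_zero(2) by force
      show "M + N \<in> ?T" if "M \<in> ?T" "N \<in> ?T" for M N
      proof -
        from that obtain y z where "y \<in> wlie.span ?B" "y \<in> ?W" "G.kpa y 0 = M" "z \<in> wlie.span ?B" "z \<in> ?W" "G.kpa z 0 = N" by blast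
        thus ?thesis using wlie.span_add[of y ?B z] wlie.subspace_add[OF sub, of y z]
          by (intro CollectI bexI[of _ "y + z"] conjI) (auto simp: wsl_add)
      qed
      show "mscale c M \<in> ?T" if "M \<in> ?T" for c M
      proof -
        from that obtain y where "y \<in> wlie.span ?B" "y \<in> ?W" "G.kpa y 0 = M" by blast
        thus ?thesis using wlie.span_scale[of y ?B c] wlie.subspace_scale[OF sub, of y c]
          by (intro CollectI bexI[of _ "wscale c y"] conjI) (auto simp: wsl_scale)
      qed
    qed
    moreover have "sl_gens \<subseteq> ?T"
    proof -
      have "Eu a b \<in> ?T" if "a \<noteq> b" for a b
      proof -
        have "root_vector a b \<in> wlie.span ?B" by (rule wlie.span_base) (use that in blast)
        thus ?thesis using rv[OF that] kpa_root_vector(3)[OF that, where ?'k = 'k]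
          by (intro CollectI bexI[of _ "root_vector a b"] conjI) (auto simp: at_level_def)
      qed
      moreover have "Eu a a - Eu b b \<in> ?T" if "a \<noteq> b" for a b
      proof -
        have "bracket (root_vector a b) (root_vector b a) \<in> wlie.span ?B"
          by (rule wlie.span_base) (use that in blast)
        moreover have "G.kpa (bracket (root_vector a b) (root_vector b a)) 0 = (Eu a a - Eu b b :: 'k^'n^'n)"
        proof -
          have "mbracket (Eu a b) (Eu b a) = (Eu a a - Eu b b :: 'k^'n^'n)"
          proof -
            have "Eu a b ** Eu b a = (Eu a a :: 'k^'n^'n)" for a b
            proof -
              have "(\<Sum>k\<in>UNIV. Eu a b $ i $ k * Eu b a $ k $ j) = (\<Sum>k\<in>UNIV. if k = b then Eu a a $ i $ j else 0 :: 'k)" for i j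
                by (intro sum.cong) (auto simp: Eu_nth)
              thus ?thesis by (simp add: vec_eq_iff matrix_matrix_mult_def)
            qed
            thus ?thesis by (simp add: mbracket_def)
          qed
          thus ?thesis
            using kpa_root_vector[OF that, where ?'k = 'k] kpa_root_vector[OF that[symmetric], where ?'k = 'k]
            by (simp add: kpa_bracket at_level_def)
        qed
        ultimately show ?thesis using rb[OF that] by blast
      qed
      ultimately show ?thesis by (auto simp: sl_gens_def)
    qed
    ultimately have "kmat.span sl_gens \<subseteq> ?T" by (intro kmat.span_minimal)
    moreover have "G.kpa x 0 \<in> kmat.span sl_gens" using x wsl_sl sl_span by blast
    ultimately obtain y where y: "y \<in> wlie.span ?B" "y \<in> ?W" "G.kpa y 0 = G.kpa x 0" by blast
    have "y = x"
    proof (rule wsl_eqI)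
      fix l show "G.kpa y l = G.kpa x l" using x y by (cases "l = 0") auto
    qed (use x y in auto)
    thus "x \<in> g0" using y(1) by (simp add: g0_def)
  qed
  ultimately show ?thesis by blast
qed

lemma g0_iso: "repn_iso SLW (wlie_repn (g0 :: ('k::{alg_closed_field,field_prime_char}, 'n::finite) wlie set)) sl_repn lie_red"
proof (rule repn_iso_lie_red)
  show "g0 \<subseteq> (wsl :: ('k, 'n) wlie set)" by (auto simp: g0_eq)
  show "wlie.subspace (g0 :: ('k, 'n) wlie set)" unfolding g0_def by (rule wlie.subspace_span)
  show "Ad g x \<in> g0" if "g \<in> SLW" "x \<in> g0" for g and x :: "('k, 'n) wlie"
    using that by (auto simp: g0_eq kpa_Ad' mult_zero_matrix)
  show "x = 0" if "x \<in> g0" "G.kpa x 0 = 0" for x :: "('k, 'n) wlie"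
  proof (rule wsl_eqI)
    fix l show "G.kpa x l = G.kpa 0 l" using that wsl_zero(2) by (cases "l = 0") (auto simp: g0_eq)
  qed (use that in \<open>auto simp: g0_eq wsl_zero\<close>)
  fix A :: "'k^'n^'n" assume "A \<in> sl"
  hence "at_level 0 A l \<in> sl" for l by (simp add: at_level_def)
  then obtain x where "x \<in> wsl" "G.kpa x = at_level 0 A" using wsl_ex by metis
  thus "\<exists>x\<in>g0. G.kpa x 0 = A" by (intro bexI[of _ x]) (auto simp: g0_eq at_level_def)
qed simp

lemma g0_bracket:
  assumes "x \<in> g0" "y \<in> (g0 :: ('k::{alg_closed_field,field_prime_char}, 'n::finite) wlie set)"
  shows "bracket x y \<in> g0"
  using assms by (auto simp: g0_eq wsl_bracket kpa_bracket)

lemma cartan_wsl: "cartan \<subseteq> (wsl :: ('k::field_prime_char, 'n::finite) wlie set)"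
proof -
  interpret wsub "Tk :: ('k, 'n) wmat set" by (rule wsub_Tk)
  show ?thesis by (auto simp: cartan_def sublie_iff)
qed

lemma cartan_offdiag:
  assumes "x \<in> (cartan :: ('k::field_prime_char, 'n::finite) wlie set)" "i \<noteq> j"
  shows "G.kpa x l $ i $ j = 0"
  by (rule sublie_torus_offdiag[OF wsub_Tk]) (use assms in \<open>auto simp: cartan_def Tk_def\<close>)

lemma cartan_eq_0:
  assumes "x \<in> (cartan :: ('k::field_prime_char, 'n::finite) wlie set)" "G.kpa x 0 = 0"
  shows "x = 0"
proof -
  interpret wsub "Tk :: ('k, 'n) wmat set" by (rule wsub_Tk)
  have "tvec Tk (G.kpa x)" using assms by (simp add: cartan_def sublie_iff)
  from tvec_Tk_zero[OF this] show ?thesis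
    using assms cartan_wsl by (intro wsl_eqI) (auto simp: wsl_zero)
qed

lemma cartan_ex:
  fixes h :: "'k::{alg_closed_field,field_prime_char}^'n::finite^'n"
  assumes "h \<in> sl" "\<And>i j. i \<noteq> j \<Longrightarrow> h $ i $ j = 0"
  shows "\<exists>x\<in>cartan. G.kpa x 0 = h"
proof -
  interpret wsub "Tk :: ('k, 'n) wmat set" by (rule wsub_Tk)
  have "tvec Tk (\<lambda>l. mscale (tcoef l) h)" by (rule tvec_Tk[OF assms])
  from sublie_ex[OF this] obtain x where "x \<in> cartan" "G.kpa x = (\<lambda>l. mscale (tcoef l) h)"
    by (auto simp: cartan_def)
  thus ?thesis by (intro bexI[of _ x]) (simp_all add: tcoef_0)
qed

lemma subspace_cartan: "wlie.subspace (cartan :: ('k::field_prime_char, 'n::finite) wlie set)"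
proof -
  interpret wsub "Tk :: ('k, 'n) wmat set" by (rule wsub_Tk)
  have "G.kpa (x + y) = (\<lambda>l. G.kpa x l + G.kpa y l)" if "x \<in> wsl" "y \<in> wsl" for x y :: "('k, 'n) wlie"
    using that by (simp add: wsl_add fun_eq_iff)
  moreover have "G.kpa (wscale c x) = (\<lambda>l. mscale c (G.kpa x l))" if "x \<in> wsl" for c and x :: "('k, 'n) wlie"
    using that by (simp add: wsl_scale fun_eq_iff)
  moreover have "G.kpa (0 :: ('k, 'n) wlie) = (\<lambda>_. 0)" by (simp add: wsl_zero fun_eq_iff)
  moreover have "tvec Tk (0 :: nat \<Rightarrow> 'k^'n^'n)" using tvec_0[of Tk] by (simp add: zero_fun_def)
  ultimately show ?thesis
    unfolding wlie.subspace_def cartan_def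
    by (auto simp: sublie_iff wsl_add wsl_scale intro: tvec_0 tvec_add tvec_scale)
qed

lemma cartan_weight:
  assumes "x \<in> (cartan :: ('k::field_prime_char, 'n::finite) wlie set)" "x \<noteq> 0"
  shows "weight_vector (\<lambda>_. 1) x"
  by (rule weight_zero) (use assms cartan_wsl cartan_offdiag in auto)

text \<open>The elements of \<open>cartan\<close> have diagonal coordinates and the root vectors off-diagonal ones, so an element with vanishing coordinate of
  level \<open>0\<close> vanishes already in both parts.\<close>

lemma g0_torus_iso:
  "repn_iso Tk (wlie_repn (g0_torus :: ('k::{alg_closed_field,field_prime_char}, 'n::finite) wlie set)) sl_repn lie_red"
proof (rule repn_iso_lie_red)
  let ?B = "cartan \<union> {root_vector a b | a b. a \<noteq> b} :: ('k, 'n) wlie set"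
  have rv: "root_vector a b \<in> (wsl :: ('k, 'n) wlie set)" "root_vector a b \<in> wlie.span ?B" if "a \<noteq> b" for a b
    using kpa_root_vector[OF that, where ?'k = 'k] that by (auto intro!: wlie.span_base)
  have B_sub: "?B \<subseteq> wsl" using cartan_wsl rv by blast
  have span_sub: "wlie.span ?B \<subseteq> wsl" by (rule wlie.span_minimal[OF B_sub subspace_wsl])
  show "g0_torus \<subseteq> (wsl :: ('k, 'n) wlie set)" using span_sub by (simp add: g0_torus_def)
  show "wlie.subspace (g0_torus :: ('k, 'n) wlie set)" unfolding g0_torus_def by (rule wlie.subspace_span)
  show "Tk \<subseteq> (SLW :: ('k, 'n) wmat set)" using Tk_SLW by blast
  show "Ad t x \<in> g0_torus" if t: "t \<in> Tk" and x: "x \<in> g0_torus" for t and x :: "('k, 'n) wlie"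
  proof -
    let ?T = "{x \<in> wsl. Ad t x \<in> wlie.span ?B}"
    have "wlie.subspace ?T"
    proof -
      have "Ad t 0 = wscale 0 (Ad t 0)" using Ad_scale[OF Tk_SLW[OF t] wsl_zero(1), of 0] by simp
      hence "Ad t 0 = 0" by simp
      thus ?thesis
        using wlie.span_add wlie.span_scale wlie.span_zero
        by (auto simp: wlie.subspace_def wsl_zero wsl_add wsl_scale Ad_add Ad_scale Tk_SLW t)
    qed
    moreover have "?B \<subseteq> ?T"
    proof
      fix y assume "y \<in> ?B"
      then consider "y \<in> cartan" | a b where "a \<noteq> b" "y = root_vector a b" by blast
      thus "y \<in> ?T"
      proof cases
        case 1
        have "Ad t y = y"
        proof (cases "y = 0")
          case True
          have "Ad t 0 = wscale 0 (Ad t 0)" using Ad_scale[OF Tk_SLW[OF t] wsl_zero(1), of 0] by simp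
          thus ?thesis using True by simp
        next
          case False
          thus ?thesis using cartan_weight[OF 1] t by (simp add: weight_vector_def)
        qed
        thus ?thesis using 1 cartan_wsl wlie.span_base[of y ?B] by auto
      next
        case (2 a b)
        have "weight_vector (\<lambda>t. root_char a b t ^ CHAR('k) ^ 0) y"
          using kpa_root_vector[OF 2(1), where ?'k = 'k] 2(2) by (intro weight_root[of _ 1]) simp_all
        hence "Ad t y = wscale (root_char a b t) y" using t by (simp add: weight_vector_def)
        thus ?thesis using rv[OF 2(1)] 2(2) wlie.span_scale by auto
      qed
    qed
    ultimately have "wlie.span ?B \<subseteq> ?T" by (intro wlie.span_minimal)
    thus ?thesis using x by (auto simp: g0_torus_def)
  qed
  show "x = 0" if x: "x \<in> g0_torus" and 0: "G.kpa x 0 = 0" for x :: "('k, 'n) wlie"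
  proof -
    let ?Q = "{x \<in> wsl. \<exists>c\<in>cartan. \<exists>N. (\<forall>i. N $ i $ i = 0) \<and> (\<forall>l. G.kpa x l = G.kpa c l + at_level 0 N l)}"
    have "wlie.subspace ?Q"
      unfolding wlie.subspace_def
    proof (intro conjI ballI allI)
      show "0 \<in> ?Q" using wlie.subspace_0[OF subspace_cartan]
        by (auto simp: wsl_zero at_level_def intro!: bexI[of _ 0] exI[of _ 0])
      show "x + y \<in> ?Q" if xy: "x \<in> ?Q" "y \<in> ?Q" for x y
      proof -
        from xy obtain c N d M where c: "c \<in> cartan" "\<forall>i. N $ i $ i = 0" "\<And>l. G.kpa x l = G.kpa c l + at_level 0 N l" "x \<in> wsl"
          and d: "d \<in> cartan" "\<forall>i. M $ i $ i = 0" "\<And>l. G.kpa y l = G.kpa d l + at_level 0 M l" "y \<in> wsl" by blast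
        have "c \<in> wsl" "d \<in> wsl" using c(1) d(1) cartan_wsl by auto
        hence "\<forall>l. G.kpa (x + y) l = G.kpa (c + d) l + at_level 0 (N + M) l"
          using c(3,4) d(3,4) by (simp add: wsl_add at_level_def)
        moreover have "\<forall>i. (N + M) $ i $ i = 0" using c(2) d(2) by simp
        moreover have "x + y \<in> wsl" using c(4) d(4) by (rule wsl_add)
        ultimately show ?thesis using wlie.subspace_add[OF subspace_cartan c(1) d(1)] by blast
      qed
      show "wscale k x \<in> ?Q" if xQ: "x \<in> ?Q" for k x
      proof -
        from xQ obtain c N where c: "c \<in> cartan" "\<forall>i. N $ i $ i = 0" "\<And>l. G.kpa x l = G.kpa c l + at_level 0 N l" "x \<in> wsl" by blast
        have "c \<in> wsl" using c(1) cartan_wsl by auto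
        hence "\<forall>l. G.kpa (wscale k x) l = G.kpa (wscale k c) l + at_level 0 (mscale k N) l"
          using c(3,4) by (simp add: wsl_scale at_level_def kmat.scale_right_distrib)
        moreover have "\<forall>i. (mscale k N) $ i $ i = 0" using c(2) by (simp add: mscale_def)
        moreover have "wscale k x \<in> wsl" using c(4) by (rule wsl_scale)
        ultimately show ?thesis using wlie.subspace_scale[OF subspace_cartan c(1)] by blast
      qed
    qed
    moreover have "?B \<subseteq> ?Q"
    proof
      fix y assume "y \<in> ?B"
      then consider "y \<in> cartan" | a b where "a \<noteq> b" "y = root_vector a b" by blast
      thus "y \<in> ?Q"
      proof cases
        case 1
        thus ?thesis using cartan_wsl by (auto simp: at_level_def intro!: bexI[of _ y] exI[of _ 0])
      next
        case (2 a b)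
        thus ?thesis using kpa_root_vector[OF 2(1), where ?'k = 'k]
          by (auto simp: wlie.subspace_0[OF subspace_cartan] Eu_nth 2 intro!: bexI[of _ 0] exI[of _ "Eu a b"])
      qed
    qed
    ultimately have "wlie.span ?B \<subseteq> ?Q" by (intro wlie.span_minimal)
    then obtain c N where c: "c \<in> cartan" and N: "\<And>i. N $ i $ i = 0"
        and k: "\<And>l. G.kpa x l = G.kpa c l + at_level 0 N l" and xw: "x \<in> wsl"
      using x unfolding g0_torus_def by blast
    have "G.kpa c 0 $ i $ j = 0 \<and> N $ i $ j = 0" for i j
    proof -
      have "G.kpa c 0 $ i $ j + N $ i $ j = 0" using k[of 0] 0 by (simp add: at_level_def vec_eq_iff)
      thus ?thesis using N cartan_offdiag[OF c, of i j 0] by (cases "i = j") auto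
    qed
    hence "G.kpa c 0 = 0" "N = 0" by (simp_all add: vec_eq_iff)
    hence "c = 0" using cartan_eq_0[OF c] by simp
    thus "x = 0" using k \<open>N = 0\<close> xw by (intro wsl_eqI) (auto simp: wsl_zero at_level_def)
  qed
  fix A :: "'k^'n^'n" assume A: "A \<in> sl"
  define h where "h = (\<chi> i j. if i = j then A $ i $ j else 0)"
  have "h \<in> sl" using A by (simp add: sl_def trace_def h_def)
  then obtain c where c: "c \<in> cartan" "G.kpa c 0 = h" using cartan_ex[of h] by (auto simp: h_def)
  let ?I = "{(a, b) | a b :: 'n. a \<noteq> b}"
  let ?s = "\<lambda>I. \<Sum>x\<in>I. wscale (A $ fst x $ snd x) (root_vector (fst x) (snd x)) :: ('k, 'n) wlie"
  have s: "?s I \<in> wlie.span ?B \<and> G.kpa (?s I) 0 = (\<Sum>x\<in>I. mscale (A $ fst x $ snd x) (Eu (fst x) (snd x)))"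
    if "I \<subseteq> ?I" for I
  proof
    have ne: "fst x \<noteq> snd x" if "x \<in> I" for x
      using subsetD[OF \<open>I \<subseteq> ?I\<close> that] by auto
    show "?s I \<in> wlie.span ?B"
      by (intro wlie.span_sum wlie.span_scale rv(2) ne)
    have "G.kpa (?s I) 0 = (\<Sum>x\<in>I. G.kpa (wscale (A $ fst x $ snd x) (root_vector (fst x) (snd x))) 0)"
      by (intro wsl_sum(2) wsl_scale(1) rv(1) ne)
    also have "\<dots> = (\<Sum>x\<in>I. mscale (A $ fst x $ snd x) (Eu (fst x) (snd x)))"
      by (intro sum.cong refl) (simp add: wsl_scale rv(1) ne kpa_root_vector(3) at_level_def)
    finally show "G.kpa (?s I) 0 = (\<Sum>x\<in>I. mscale (A $ fst x $ snd x) (Eu (fst x) (snd x)))" .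
  qed
  have "(\<Sum>x\<in>?I. mscale (A $ fst x $ snd x) (Eu (fst x) (snd x))) $ i $ j = (if i = j then 0 else A $ i $ j)" for i j
  proof -
    have "(\<Sum>x\<in>?I. mscale (A $ fst x $ snd x) (Eu (fst x) (snd x)) $ i $ j) = (\<Sum>x\<in>?I. if x = (i, j) then A $ i $ j else 0)"
      by (intro sum.cong) (auto simp: mscale_def Eu_nth)
    also have "\<dots> = (if (i, j) \<in> ?I then A $ i $ j else 0)" by (rule sum.delta) (rule finite)
    finally show ?thesis by (simp add: sum_component)
  qed
  hence "h + G.kpa (?s ?I) 0 = A" using s[OF order.refl] by (simp add: vec_eq_iff h_def)
  moreover have "c + ?s ?I \<in> g0_torus"
    unfolding g0_torus_def using c(1) by (intro wlie.span_add conjunct1[OF s] order.refl wlie.span_base UnI1)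
  moreover have "G.kpa (c + ?s ?I) 0 = h + G.kpa (?s ?I) 0"
    unfolding c(2)[symmetric]
    by (rule wsl_add(2)) (use c(1) cartan_wsl subsetD[OF span_sub conjunct1[OF s[OF order.refl]]] in blast)+
  ultimately show "\<exists>x\<in>g0_torus. G.kpa x 0 = A" by (intro bexI[of _ "c + ?s ?I"]) simp_all
qed

text \<open>The coordinates are diagonal, so the weight is \<open>0\<close>.  A member of the family is nonzero, since otherwise
  its coefficient in an expansion could be changed.\<close>

lemma torus1_family_weight:
  fixes Y :: "nat \<Rightarrow> nat \<Rightarrow> ('k::{alg_closed_field,field_prime_char}, 'n::finite) wlie"
  assumes Y: "torus1_family Y" and i: "i \<in> {1..CARD('n) - 1}" and j: "j \<ge> 1"
  shows "weight_vector (\<lambda>_. 1) (Y i j)"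
proof (rule weight_zero)
  interpret wsub "torus1 :: ('k, 'n) wmat set" by (rule wsub_torus1)
  have mem: "Y i j \<in> sublie torus1" using Y i j by (auto simp: torus1_family_def)
  thus "Y i j \<in> wsl" by (simp add: sublie_iff)
  show "G.kpa (Y i j) l $ r $ s = 0" if "r \<noteq> s" for l r s
    by (rule sublie_torus_offdiag[OF wsub_torus1 _ mem that]) (auto simp: torus1_def)
  show "Y i j \<noteq> 0"
  proof
    assume 0: "Y i j = 0"
    obtain x where x: "x \<in> sublie torus1" "torus1_expansion Y (\<lambda>_ _. 0) x"
      using Y unfolding torus1_family_def by meson
    then obtain c where c: "torus1_expansion Y c x"
      "\<And>c'. torus1_expansion Y c' x \<Longrightarrow> \<forall>i\<in>{1..CARD('n) - 1}. \<forall>j\<ge>1. c' i j = c i j"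
      using Y unfolding torus1_family_def by meson
    let ?c = "\<lambda>i' j'. if i' = i \<and> j' = j then c i j + 1 else c i' j'"
    have "wscale (?c i' j') (Y i' j') = wscale (c i' j') (Y i' j')" for i' j'
      using 0 by (cases "i' = i \<and> j' = j") auto
    hence "torus1_expansion Y ?c x" using c(1) by (simp only: torus1_expansion_def)
    hence "?c i j = c i j" using c(2) i j by blast
    thus False by simp
  qed
qed

section \<open>The filtration and its topology\<close>

lemma gam_0: "gam 0 = (wsl :: ('k::{alg_closed_field,field_prime_char}, 'n::finite) wlie set)"
  by (auto simp: gam_iff)

lemma gam_antimono:
  "i \<le> j \<Longrightarrow> gam j \<subseteq> (gam i :: ('k::{alg_closed_field,field_prime_char}, 'n::finite) wlie set)"
  by (auto simp: gam_iff)

lemma gam_wsl: "x \<in> gam j \<Longrightarrow> x \<in> (wsl :: ('k::{alg_closed_field,field_prime_char}, 'n::finite) wlie set)"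
  by (simp add: gam_iff)

lemma subspace_gam: "wlie.subspace (gam j :: ('k::{alg_closed_field,field_prime_char}, 'n::finite) wlie set)"
  by (auto simp: wlie.subspace_def gam_iff wsl_add wsl_scale)

text \<open>The bracket only depends on the coordinates of level \<open>0\<close>.  For the \<open>p\<close>-th power, \<open>gam j\<close> is a kernel by \<open>gam_iff_level\<close>.\<close>

lemma restricted_ideal_gam: "restricted_ideal (gam j :: ('k::{alg_closed_field,field_prime_char}, 'n::finite) wlie set)"
  unfolding restricted_ideal_def
proof (intro conjI ballI)
  show "gam j \<subseteq> (wsl :: ('k, 'n) wlie set)" using gam_wsl by blast
  show "wlie.subspace (gam j :: ('k, 'n) wlie set)" by (rule subspace_gam)
  show "bracket x y \<in> gam j" if "x \<in> wsl" "y \<in> gam j" for x y :: "('k, 'n) wlie"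
    using that by (auto simp: gam_iff wsl_bracket kpa_bracket mbracket_0)
  show "ppower y \<in> gam j" if "y \<in> gam j" for y :: "('k, 'n) wlie"
  proof -
    have y: "y \<in> wsl" "y j = 0" using that by (simp_all add: gam_iff_level)
    obtain n where n: "CHAR('k) = Suc n" using not0_implies_Suc[OF CHAR_nonzero[where 'a = 'k]] by (rule exE)
    have "ppower y j = 0" by (rule ext) (simp add: ppower_def y(2) n funpow.simps(2) del: funpow.simps(1))
    thus ?thesis using y G.PL_ppower_mem[of y] by (simp add: gam_iff_level wsl_eq_PL)
  qed
qed

lemma gam_coset_mem:
  assumes "x \<in> wsl"
  shows "y \<in> (+) x ` gam j \<longleftrightarrow> y \<in> (wsl :: ('k::{alg_closed_field,field_prime_char}, 'n::finite) wlie set) \<and> (\<forall>l<j. G.kpa y l = G.kpa x l)"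
proof
  assume "y \<in> (+) x ` gam j"
  thus "y \<in> wsl \<and> (\<forall>l<j. G.kpa y l = G.kpa x l)" using assms by (auto simp: gam_iff wsl_add)
next
  assume y: "y \<in> wsl \<and> (\<forall>l<j. G.kpa y l = G.kpa x l)"
  hence "y - x \<in> gam j" using assms by (simp add: gam_iff wsl_diff)
  moreover have "y = x + (y - x)" by simp
  ultimately show "y \<in> (+) x ` gam j" by blast
qed

lemma openin_wsl:
  "openin wsl_topology U \<longleftrightarrow> U \<subseteq> (wsl :: ('k::{alg_closed_field,field_prime_char}, 'n::finite) wlie set) \<and>
     (\<forall>x\<in>U. \<exists>j. (+) x ` gam j \<subseteq> U)"
proof -
  have "istopology (\<lambda>U. U \<subseteq> (wsl :: ('k, 'n) wlie set) \<and> (\<forall>x\<in>U. \<exists>j. (+) x ` gam j \<subseteq> U))"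
    unfolding istopology_def
  proof (intro conjI allI impI ballI)
    fix U V :: "('k, 'n) wlie set" and x
    assume U: "U \<subseteq> wsl \<and> (\<forall>x\<in>U. \<exists>j. (+) x ` gam j \<subseteq> U)" and V: "V \<subseteq> wsl \<and> (\<forall>x\<in>V. \<exists>j. (+) x ` gam j \<subseteq> V)"
    show "U \<inter> V \<subseteq> wsl" using U by blast
    assume "x \<in> U \<inter> V"
    then obtain i j where "(+) x ` gam i \<subseteq> U" "(+) x ` gam j \<subseteq> V" using U V by blast
    moreover have "(gam (max i j) :: ('k, 'n) wlie set) \<subseteq> gam i" "(gam (max i j) :: ('k, 'n) wlie set) \<subseteq> gam j"
      by (simp_all add: gam_antimono)
    ultimately have "(+) x ` gam (max i j) \<subseteq> U \<inter> V" by blast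
    thus "\<exists>j. (+) x ` gam j \<subseteq> U \<inter> V" by blast
  next
    fix \<K> :: "('k, 'n) wlie set set"
    assume K: "\<forall>K\<in>\<K>. K \<subseteq> wsl \<and> (\<forall>x\<in>K. \<exists>j. (+) x ` gam j \<subseteq> K)"
    show "\<Union>\<K> \<subseteq> wsl" using K by blast
    fix x assume "x \<in> \<Union>\<K>"
    then obtain A where A: "A \<in> \<K>" "x \<in> A" by blast
    then obtain j where "(+) x ` gam j \<subseteq> A" using K by blast
    hence "(+) x ` gam j \<subseteq> \<Union>\<K>" using A(1) by blast
    thus "\<exists>j. (+) x ` gam j \<subseteq> \<Union>\<K>" by blast
  qed
  thus ?thesis unfolding wsl_topology_def by simp
qed

lemma openin_coset:
  assumes x: "x \<in> (wsl :: ('k::{alg_closed_field,field_prime_char}, 'n::finite) wlie set)"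
  shows "openin wsl_topology ((+) x ` gam j)"
  unfolding openin_wsl
proof (intro conjI ballI)
  show "(+) x ` gam j \<subseteq> wsl" using gam_coset_mem[OF x] by blast
  fix y assume y: "y \<in> (+) x ` gam j"
  hence yw: "y \<in> wsl" using gam_coset_mem[OF x] by blast
  have "(+) y ` gam j \<subseteq> (+) x ` gam j"
    using y by (auto simp only: gam_coset_mem[OF x] gam_coset_mem[OF yw] subset_iff simp_thms)
  thus "\<exists>j'. (+) y ` gam j' \<subseteq> (+) x ` gam j" by blast
qed

lemma coset_self: "x \<in> (+) x ` (gam j :: ('k::{alg_closed_field,field_prime_char}, 'n::finite) wlie set)"
  by (rule image_eqI[of _ _ 0]) (simp_all add: gam_iff)

lemma topspace_wsl: "topspace wsl_topology = (wsl :: ('k::{alg_closed_field,field_prime_char}, 'n::finite) wlie set)"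
proof
  show "topspace wsl_topology \<subseteq> (wsl :: ('k, 'n) wlie set)"
    using openin_topspace[of wsl_topology] openin_wsl by blast
  have "(wsl :: ('k, 'n) wlie set) = (+) 0 ` gam 0" by (simp add: gam_0)
  hence "openin wsl_topology (wsl :: ('k, 'n) wlie set)" using openin_coset[of "0 :: ('k, 'n) wlie" 0] by (simp add: gam_0)
  thus "(wsl :: ('k, 'n) wlie set) \<subseteq> topspace wsl_topology" by (rule openin_subset)
qed

lemma continuous_map_wsl:
  fixes f :: "('k::{alg_closed_field,field_prime_char}, 'n::finite) wlie \<Rightarrow> ('k, 'n) wlie"
  assumes "\<And>x. x \<in> wsl \<Longrightarrow> f x \<in> wsl"
    and "\<And>x j. x \<in> wsl \<Longrightarrow> \<exists>i. \<forall>u\<in>(+) x ` gam i. f u \<in> (+) (f x) ` gam j"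
  shows "continuous_map wsl_topology wsl_topology f"
  unfolding continuous_map_def topspace_wsl
proof (intro conjI allI impI)
  show "f \<in> wsl \<rightarrow> wsl" by (rule Pi_I, rule assms(1))
  fix U :: "('k, 'n) wlie set" assume U: "openin wsl_topology U"
  show "openin wsl_topology {x \<in> wsl. f x \<in> U}"
    unfolding openin_wsl
  proof (intro conjI ballI)
    fix x assume "x \<in> {x \<in> wsl. f x \<in> U}"
    hence x: "x \<in> wsl" "f x \<in> U" by auto
    obtain j where j: "(+) (f x) ` gam j \<subseteq> U" using U x unfolding openin_wsl by blast
    obtain i where i: "\<forall>u\<in>(+) x ` gam i. f u \<in> (+) (f x) ` gam j" using assms(2)[OF x(1)] by (rule exE)
    have "(+) x ` gam i \<subseteq> wsl" using gam_coset_mem[OF x(1)] by blast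
    hence "(+) x ` gam i \<subseteq> {x \<in> wsl. f x \<in> U}" using i j by blast
    thus "\<exists>i. (+) x ` gam i \<subseteq> {x \<in> wsl. f x \<in> U}" by blast
  qed blast
qed

lemma continuous_map_wsl2:
  fixes f :: "('k::{alg_closed_field,field_prime_char}, 'n::finite) wlie \<Rightarrow> ('k, 'n) wlie \<Rightarrow> ('k, 'n) wlie"
  assumes "\<And>x y. x \<in> wsl \<Longrightarrow> y \<in> wsl \<Longrightarrow> f x y \<in> wsl"
    and "\<And>x y j. x \<in> wsl \<Longrightarrow> y \<in> wsl \<Longrightarrow> \<exists>i. \<forall>u\<in>(+) x ` gam i. \<forall>v\<in>(+) y ` gam i. f u v \<in> (+) (f x y) ` gam j"
  shows "continuous_map (prod_topology wsl_topology wsl_topology) wsl_topology (\<lambda>(x, y). f x y)"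
  unfolding continuous_map_def topspace_wsl topspace_prod_topology
proof (intro conjI allI impI)
  show "(\<lambda>(x, y). f x y) \<in> wsl \<times> wsl \<rightarrow> wsl"
    by (rule Pi_I) (simp add: assms(1) split_beta mem_Times_iff)
  fix U :: "('k, 'n) wlie set" assume U: "openin wsl_topology U"
  let ?P = "{z \<in> wsl \<times> wsl. (case z of (x, y) \<Rightarrow> f x y) \<in> U}"
  show "openin (prod_topology wsl_topology wsl_topology) ?P"
    unfolding openin_prod_topology_alt
  proof (intro allI impI)
    fix x y assume "(x, y) \<in> ?P"
    hence x: "x \<in> wsl" "y \<in> wsl" "f x y \<in> U" by simp_all
    obtain j where j: "(+) (f x y) ` gam j \<subseteq> U" using U x unfolding openin_wsl by blast
    obtain i where i: "\<forall>u\<in>(+) x ` gam i. \<forall>v\<in>(+) y ` gam i. f u v \<in> (+) (f x y) ` gam j"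
      using assms(2)[OF x(1,2)] by (rule exE)
    have "((+) x ` gam i) \<times> ((+) y ` gam i) \<subseteq> ?P"
    proof
      fix z assume z: "z \<in> ((+) x ` gam i) \<times> ((+) y ` gam i)"
      hence "fst z \<in> wsl" "snd z \<in> wsl"
        by (simp_all only: mem_Times_iff gam_coset_mem[OF x(1)] gam_coset_mem[OF x(2)])
      moreover have "f (fst z) (snd z) \<in> U" using i j z unfolding mem_Times_iff by blast
      ultimately show "z \<in> ?P" by (simp add: mem_Times_iff split_beta)
    qed
    thus "\<exists>V W. openin wsl_topology V \<and> openin wsl_topology W \<and> x \<in> V \<and> y \<in> W \<and> V \<times> W \<subseteq> ?P"
      by (intro exI[of _ "(+) x ` gam i"] exI[of _ "(+) y ` gam i"] conjI openin_coset x coset_self)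
  qed
qed

lemma nbhd_basis_gam: "nbhd_basis_at wsl_topology 0 (gam :: nat \<Rightarrow> ('k::{alg_closed_field,field_prime_char}, 'n::finite) wlie set)"
  unfolding nbhd_basis_at_def
proof (intro conjI allI impI)
  have img: "(+) 0 ` A = A" for A :: "('k, 'n) wlie set" by simp
  fix i
  show "\<exists>U. openin wsl_topology U \<and> 0 \<in> U \<and> U \<subseteq> (gam i :: ('k, 'n) wlie set)"
    using openin_coset[of "0 :: ('k, 'n) wlie" i] unfolding img
    by (intro exI[of _ "gam i"]) (simp add: gam_iff)
next
  fix U :: "('k, 'n) wlie set" assume "openin wsl_topology U \<and> 0 \<in> U"
  then obtain j where "(+) 0 ` gam j \<subseteq> U" unfolding openin_wsl by blast
  thus "\<exists>i. gam i \<subseteq> U" by auto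
qed

lemma Hausdorff_wsl: "Hausdorff_space (wsl_topology :: ('k::{alg_closed_field,field_prime_char}, 'n::finite) wlie topology)"
  unfolding Hausdorff_space_def topspace_wsl
proof (intro allI impI)
  fix x y :: "('k, 'n) wlie" assume xy: "x \<in> wsl \<and> y \<in> wsl \<and> x \<noteq> y"
  then obtain l where l: "G.kpa x l \<noteq> G.kpa y l" using wsl_eqI by blast
  have "disjnt ((+) x ` gam (Suc l)) ((+) y ` gam (Suc l))"
    unfolding disjnt_iff
  proof (intro allI notI)
    fix u assume u: "u \<in> (+) x ` gam (Suc l) \<and> u \<in> (+) y ` gam (Suc l)"
    have 1: "\<forall>i<Suc l. G.kpa u i = G.kpa x i"
      by (rule conjunct2[OF iffD1[OF gam_coset_mem[OF conjunct1[OF xy]] conjunct1[OF u]]])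
    have 2: "\<forall>i<Suc l. G.kpa u i = G.kpa y i"
      by (rule conjunct2[OF iffD1[OF gam_coset_mem[OF conjunct1[OF conjunct2[OF xy]]] conjunct2[OF u]]])
    show False
      by (rule notE[OF l], rule trans[OF 1[rule_format, OF lessI, symmetric] 2[rule_format, OF lessI]])
  qed
  thus "\<exists>U V. openin wsl_topology U \<and> openin wsl_topology V \<and> x \<in> U \<and> y \<in> V \<and> disjnt U V"
    using xy openin_coset[of x "Suc l"] openin_coset[of y "Suc l"] coset_self[of x "Suc l"] coset_self[of y "Suc l"]
    by (intro exI[of _ "(+) x ` gam (Suc l)"] exI[of _ "(+) y ` gam (Suc l)"]) simp
qed

text \<open>Along a Cauchy filter each coordinate is eventually constant, and by \<open>wsl_ex\<close> the sequence of these constants belongs to an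
  element of \<open>wsl\<close>.\<close>

lemma complete_wsl: "complete_additive (wsl_topology :: ('k::{alg_closed_field,field_prime_char}, 'n::finite) wlie topology)"
  unfolding complete_additive_def topspace_wsl
proof (intro allI impI, elim conjE)
  fix F :: "('k, 'n) wlie filter"
  assume F: "F \<noteq> bot" and ev: "\<forall>\<^sub>F x in F. x \<in> wsl"
    and cauchy: "\<forall>U. openin wsl_topology U \<and> 0 \<in> U \<longrightarrow> (\<exists>S. (\<forall>\<^sub>F x in F. x \<in> S) \<and> (\<forall>x\<in>S. \<forall>y\<in>S. x - y \<in> U))"
  have "\<exists>z. z \<in> wsl \<and> (\<forall>\<^sub>F x in F. x \<in> wsl \<and> (\<forall>l<j. G.kpa x l = G.kpa z l))" for j
  proof -
    have "openin wsl_topology (gam j :: ('k, 'n) wlie set)" "0 \<in> (gam j :: ('k, 'n) wlie set)"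
      using openin_coset[of "0 :: ('k, 'n) wlie" j] by (simp_all add: gam_iff)
    hence "\<exists>S. (\<forall>\<^sub>F x in F. x \<in> S) \<and> (\<forall>x\<in>S. \<forall>y\<in>S. x - y \<in> gam j)" by (intro mp[OF spec[OF cauchy]] conjI)
    then obtain S where S0: "(\<forall>\<^sub>F x in F. x \<in> S) \<and> (\<forall>x\<in>S. \<forall>y\<in>S. x - y \<in> gam j)" by (rule exE)
    hence S: "\<forall>\<^sub>F x in F. x \<in> S" "\<forall>x\<in>S. \<forall>y\<in>S. x - y \<in> gam j" by simp_all
    have SW: "\<forall>\<^sub>F x in F. x \<in> S \<and> x \<in> wsl" by (rule eventually_conj[OF S(1) ev])
    obtain z where z0: "z \<in> S \<and> z \<in> wsl" using eventually_happens'[OF F SW] by (rule exE)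
    hence z: "z \<in> S" "z \<in> wsl" by simp_all
    have "\<forall>\<^sub>F x in F. x \<in> wsl \<and> (\<forall>l<j. G.kpa x l = G.kpa z l)"
      using SW
    proof (rule eventually_mono)
      fix x assume x: "x \<in> S \<and> x \<in> wsl"
      hence "x - z \<in> gam j" using S(2) z(1) by blast
      thus "x \<in> wsl \<and> (\<forall>l<j. G.kpa x l = G.kpa z l)" using x z(2) by (simp add: gam_iff wsl_diff)
    qed
    thus ?thesis using z(2) by blast
  qed
  hence "\<exists>z. \<forall>j. z j \<in> wsl \<and> (\<forall>\<^sub>F x in F. x \<in> wsl \<and> (\<forall>l<j. G.kpa x l = G.kpa (z j) l))"
    by (intro choice allI)
  then obtain z where z0: "\<forall>j. z j \<in> wsl \<and> (\<forall>\<^sub>F x in F. x \<in> wsl \<and> (\<forall>l<j. G.kpa x l = G.kpa (z j) l))" by (rule exE)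
  have z: "z j \<in> wsl" "\<forall>\<^sub>F x in F. x \<in> wsl \<and> (\<forall>l<j. G.kpa x l = G.kpa (z j) l)" for j
    by (rule conjunct1[OF spec[OF z0]], rule conjunct2[OF spec[OF z0]])
  have eq: "G.kpa (z (Suc l)) l = G.kpa (z j) l" if "l < j" for l j
  proof -
    obtain x where x: "(x \<in> wsl \<and> (\<forall>i<Suc l. G.kpa x i = G.kpa (z (Suc l)) i)) \<and> x \<in> wsl \<and> (\<forall>i<j. G.kpa x i = G.kpa (z j) i)"
      using eventually_happens'[OF F eventually_conj[OF z(2)[of "Suc l"] z(2)[of j]]] by (rule exE)
    note 1 = conjunct2[OF conjunct1[OF x]] and 2 = conjunct2[OF conjunct2[OF x]]
    show ?thesis by (rule trans[OF 1[rule_format, OF lessI, symmetric] 2[rule_format, OF that]])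
  qed
  obtain w where w: "w \<in> wsl" "G.kpa w = (\<lambda>l. G.kpa (z (Suc l)) l)"
    using wsl_ex[of "\<lambda>l. G.kpa (z (Suc l)) l"] wsl_sl[OF z(1)] by blast
  have "limitin wsl_topology (\<lambda>x. x) w F"
    unfolding limitin_def topspace_wsl
  proof (intro conjI allI impI)
    show "w \<in> wsl" by (rule w(1))
    fix U :: "('k, 'n) wlie set" assume "openin wsl_topology U \<and> w \<in> U"
    then obtain j where j: "(+) w ` gam j \<subseteq> U" unfolding openin_wsl by blast
    show "\<forall>\<^sub>F x in F. x \<in> U"
      using z(2)[of j]
    proof (rule eventually_mono)
      fix x assume "x \<in> wsl \<and> (\<forall>l<j. G.kpa x l = G.kpa (z j) l)"
      hence "x \<in> (+) w ` gam j" unfolding gam_coset_mem[OF w(1)] by (simp add: w(2) eq)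
      thus "x \<in> U" using j by blast
    qed
  qed
  thus "\<exists>l. limitin wsl_topology (\<lambda>x. x) l F" by blast
qed

lemma continuous_diff_wsl:
  "continuous_map (prod_topology wsl_topology wsl_topology) (wsl_topology :: ('k::{alg_closed_field,field_prime_char}, 'n::finite) wlie topology)
     (\<lambda>(x, y). x - y)"
proof (rule continuous_map_wsl2)
  show "\<exists>i. \<forall>u\<in>(+) x ` gam i. \<forall>v\<in>(+) y ` gam i. u - v \<in> (+) (x - y) ` gam j"
    if xy: "x \<in> wsl" "y \<in> wsl" for x y :: "('k, 'n) wlie" and j
    unfolding gam_coset_mem[OF wsl_diff(1)[OF xy]]
  proof (rule exI[of _ j], intro ballI)
    fix u v assume "u \<in> (+) x ` gam j" "v \<in> (+) y ` gam j"
    note u = iffD1[OF gam_coset_mem[OF xy(1)] this(1)] and v = iffD1[OF gam_coset_mem[OF xy(2)] this(2)]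
    show "u - v \<in> wsl \<and> (\<forall>l<j. G.kpa (u - v) l = G.kpa (x - y) l)"
      using xy conjunct1[OF u] conjunct1[OF v] conjunct2[OF u, rule_format] conjunct2[OF v, rule_format]
      by (intro conjI allI impI) (simp_all add: wsl_diff)
  qed
qed (rule wsl_diff)

lemma continuous_scale_wsl:
  "continuous_map wsl_topology (wsl_topology :: ('k::{alg_closed_field,field_prime_char}, 'n::finite) wlie topology) (wscale c)"
proof (rule continuous_map_wsl)
  show "\<exists>i. \<forall>u\<in>(+) x ` gam i. wscale c u \<in> (+) (wscale c x) ` gam j"
    if x: "x \<in> wsl" for x :: "('k, 'n) wlie" and j
    unfolding gam_coset_mem[OF wsl_scale(1)[OF x]]
  proof (rule exI[of _ j], intro ballI)
    fix u assume "u \<in> (+) x ` gam j"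
    note u = iffD1[OF gam_coset_mem[OF x] this]
    show "wscale c u \<in> wsl \<and> (\<forall>l<j. G.kpa (wscale c u) l = G.kpa (wscale c x) l)"
      using x conjunct1[OF u] conjunct2[OF u, rule_format] by (intro conjI allI impI) (simp_all add: wsl_scale)
  qed
qed (rule wsl_scale)

lemma continuous_bracket_wsl:
  "continuous_map (prod_topology wsl_topology wsl_topology) (wsl_topology :: ('k::{alg_closed_field,field_prime_char}, 'n::finite) wlie topology)
     (\<lambda>(x, y). bracket x y)"
proof (rule continuous_map_wsl2)
  show "\<exists>i. \<forall>u\<in>(+) x ` gam i. \<forall>v\<in>(+) y ` gam i. bracket u v \<in> (+) (bracket x y) ` gam j"
    if xy: "x \<in> wsl" "y \<in> wsl" for x y :: "('k, 'n) wlie" and j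
  proof (rule exI[of _ "Suc 0"], intro ballI)
    fix u v assume "u \<in> (+) x ` gam (Suc 0)" "v \<in> (+) y ` gam (Suc 0)"
    hence uv: "u \<in> wsl" "v \<in> wsl" "G.kpa u 0 = G.kpa x 0" "G.kpa v 0 = G.kpa y 0"
      using gam_coset_mem[OF xy(1)] gam_coset_mem[OF xy(2)] by auto
    thus "bracket u v \<in> (+) (bracket x y) ` gam j"
      unfolding gam_coset_mem[OF wsl_bracket[OF xy]] by (simp add: wsl_bracket kpa_bracket xy)
  qed
qed (rule wsl_bracket)

section \<open>Frobenius twists\<close>

lemma frob_add: "(a + b) ^ (CHAR('k) ^ l) = a ^ (CHAR('k) ^ l) + (b :: 'k::field_prime_char) ^ (CHAR('k) ^ l)"
  by (rule freshmans_dream') simp_all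

lemma frob_sum: "(\<Sum>x\<in>A. f x) ^ (CHAR('k) ^ l) = (\<Sum>x\<in>A. (f x :: 'k::field_prime_char) ^ (CHAR('k) ^ l))"
  by (rule freshmans_dream_sum') simp_all

lemma frob_inj: "a ^ (CHAR('k) ^ l) = b ^ (CHAR('k) ^ l) \<Longrightarrow> a = (b :: 'k::field_prime_char)"
proof -
  assume eq: "a ^ (CHAR('k) ^ l) = b ^ (CHAR('k) ^ l)"
  have "((a - b) + b) ^ (CHAR('k) ^ l) = (a - b) ^ (CHAR('k) ^ l) + b ^ (CHAR('k) ^ l)" by (rule frob_add)
  hence "(a - b) ^ (CHAR('k) ^ l) = 0" using eq by simp
  thus "a = b" by simp
qed

lemma frob_surj: obtains c :: "'k::{alg_closed_field,field_prime_char}" where "c ^ (CHAR('k) ^ l) = x"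
  using nth_root_exists[of "CHAR('k) ^ l" x] by auto

lemma mfrob_mult: "mfrob l (A ** B) = mfrob l A ** mfrob l B"
  by (simp add: mfrob_def matrix_matrix_mult_def vec_eq_iff frob_sum power_mult_distrib)

lemma mfrob_mat1: "mfrob l (mat 1) = (mat 1 :: 'k::field_prime_char^'n::finite^'n)"
  by (simp add: mfrob_def mat_def vec_eq_iff power_0_left)

lemma mfrob_add: "mfrob l (A + B) = mfrob l A + mfrob l B"
  by (simp add: mfrob_def vec_eq_iff frob_add)

lemma mfrob_scale: "mfrob l (mscale c A) = mscale (c ^ (CHAR('k) ^ l)) (mfrob l A)" for c :: "'k::field_prime_char"
  by (simp add: mfrob_def mscale_def vec_eq_iff power_mult_distrib)

lemma mfrob_sl: "mfrob l A \<in> sl \<longleftrightarrow> A \<in> (sl :: ('k::field_prime_char^'n::finite^'n) set)"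
  by (simp add: mfrob_def sl_def trace_def frob_sum[symmetric])

lemma mfrob_inj: "mfrob l A = mfrob l B \<Longrightarrow> A = (B :: 'k::field_prime_char^'n::finite^'n)"
  by (auto simp: mfrob_def vec_eq_iff intro: frob_inj)

lemma mfrob_surj: obtains B :: "'k::{alg_closed_field,field_prime_char}^'n::finite^'n" where "mfrob l B = A"
proof -
  have "\<exists>c. c ^ (CHAR('k) ^ l) = A $ i $ j" for i j by (metis frob_surj)
  then obtain c where "\<And>i j. c i j ^ (CHAR('k) ^ l) = A $ i $ j" by metis
  thus ?thesis by (intro that[of "\<chi> i j. c i j"]) (simp add: mfrob_def vec_eq_iff)
qed

lemma sl_act_sl:
  fixes g :: "('k::field_prime_char, 'n::finite) wmat"
  assumes "g \<in> SLW" "A \<in> sl" shows "sl_act g A \<in> sl"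
proof -
  obtain g' where g': "matrix_inv (mred g) = mred g'" "mred g' ** mred g = mat 1" using SLW_inverse[OF assms(1)] by metis
  have "trace (mred g ** A ** mred g') = trace (mred g' ** (mred g ** A))" by (rule trace_mul_sym)
  also have "\<dots> = trace A" by (simp only: matrix_mul_assoc g'(2) matrix_mul_lid)
  finally show ?thesis using assms(2) by (simp add: sl_act_def g'(1) sl_def)
qed

text \<open>The map \<open>F\<close> that raises the coefficients with respect to \<open>B\<close> to the \<open>p\<^sup>l\<close>-th power and the map \<open>mfrob l\<close> are
  both bijective and Frobenius-semilinear, so the composite of \<open>F\<close> with the inverse of \<open>mfrob l\<close> is linear.  The former carries the
  action to the twist with respect to \<open>B\<close>, the latter to conjugation by the Frobenius power of the matrix.\<close>

lemma twist_iso: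
  fixes B :: "('k::{alg_closed_field,field_prime_char}^'n::finite^'n) set"
  assumes B: "\<not> kmat.dependent B" "kmat.span B = sl"
  obtains \<phi> :: "'k^'n^'n \<Rightarrow> 'k^'n^'n" where "bij_betw \<phi> sl sl"
    "\<And>M N. M \<in> sl \<Longrightarrow> N \<in> sl \<Longrightarrow> \<phi> (M + N) = \<phi> M + \<phi> N"
    "\<And>c M. M \<in> sl \<Longrightarrow> \<phi> (mscale c M) = mscale c (\<phi> M)"
    "\<And>g M. g \<in> SLW \<Longrightarrow> M \<in> sl \<Longrightarrow> \<phi> (mfrob l (mred g) ** M ** mfrob l (matrix_inv (mred g))) =
       frobenius_twist mscale B (CHAR('k) ^ l) sl_act g (\<phi> M)"
proof -
  let ?q = "CHAR('k) ^ l"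
  let ?r = "module.representation mscale B"
  have "B \<subseteq> sl" using B(2) kmat.span_superset[of B] by simp
  have "finite (sl_gens :: ('k^'n^'n) set)"
  proof -
    have "sl_gens \<subseteq> (\<lambda>(a, b). Eu a b) ` UNIV \<union> (\<lambda>(a, b). Eu a a - Eu b b :: 'k^'n^'n) ` UNIV"
      by (auto simp: sl_gens_def)
    thus ?thesis by (rule finite_subset) simp
  qed
  from kmat.independent_span_bound[OF this B(1)] have fin: "finite B"
    using \<open>B \<subseteq> sl\<close> sl_span by blast
  have sp: "v \<in> kmat.span B" if "v \<in> sl" for v using that B(2) by simp
  have rep: "(\<Sum>b\<in>B. mscale (?r v b) b) = v" if "v \<in> sl" for v
    by (rule kmat.sum_representation_eq[OF B(1) sp[OF that] fin order.refl])
  have comb_sl: "(\<Sum>b\<in>B. mscale (c b) b) \<in> sl" for c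
    using \<open>B \<subseteq> sl\<close> by (intro kmat.subspace_sum[OF subspace_sl] kmat.subspace_scale[OF subspace_sl]) auto
  have rep_comb: "?r (\<Sum>b\<in>B. mscale (c b) b) b = c b" if b: "b \<in> B" for c b
  proof -
    have "?r (\<Sum>b\<in>B. mscale (c b) b) = (\<lambda>x. \<Sum>b\<in>B. ?r (mscale (c b) b) x)"
      using \<open>B \<subseteq> sl\<close> by (intro kmat.representation_sum[OF B(1)] kmat.span_scale sp) auto
    hence "?r (\<Sum>b\<in>B. mscale (c b) b) b = (\<Sum>b'\<in>B. ?r (mscale (c b') b') b)" by simp
    also have "\<dots> = (\<Sum>b'\<in>B. if b' = b then c b else 0)"
      using \<open>B \<subseteq> sl\<close> by (intro sum.cong refl) (auto simp: kmat.representation_scale[OF B(1) sp] kmat.representation_basis[OF B(1)] subset_iff)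
    also have "\<dots> = c b" using fin b by simp
    finally show ?thesis .
  qed
  define F where "F v = (\<Sum>b\<in>B. mscale (?r v b ^ ?q) b)" for v
  have F_sl: "F v \<in> sl" for v unfolding F_def by (rule comb_sl)
  have F_add: "F (v + w) = F v + F w" if "v \<in> sl" "w \<in> sl" for v w
    unfolding F_def by (simp add: kmat.representation_add[OF B(1) sp sp] that frob_add kmat.scale_left_distrib sum.distrib)
  have F_scale: "F (mscale c v) = mscale (c ^ ?q) (F v)" if "v \<in> sl" for c v
    unfolding F_def by (simp add: kmat.representation_scale[OF B(1) sp] that power_mult_distrib kmat.scale_sum_right)
  have F_inj: "v = w" if vw: "v \<in> sl" "w \<in> sl" "F v = F w" for v w
  proof -
    have "?r v b = ?r w b" if "b \<in> B" for b
    proof (rule frob_inj)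
      show "?r v b ^ ?q = ?r w b ^ ?q"
        using arg_cong[OF vw(3), of "\<lambda>v. ?r v b"] rep_comb[OF that] by (simp add: F_def)
    qed
    hence "(\<Sum>b\<in>B. mscale (?r v b) b) = (\<Sum>b\<in>B. mscale (?r w b) b)" by simp
    thus ?thesis using rep vw by simp
  qed
  have F_surj: "\<exists>v\<in>sl. F v = w" if "w \<in> sl" for w
  proof -
    have "\<exists>c. c ^ ?q = ?r w b" for b by (metis frob_surj)
    then obtain c where c: "\<And>b. c b ^ ?q = ?r w b" by metis
    have "F (\<Sum>b\<in>B. mscale (c b) b) = (\<Sum>b\<in>B. mscale (?r w b) b)"
      unfolding F_def by (intro sum.cong refl) (simp add: rep_comb c)
    thus ?thesis using comb_sl[of c] rep[OF that] by auto
  qed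
  \<comment> \<open>The inverse of \<open>mfrob l\<close>.\<close>
  define \<rho> where "\<rho> M = (SOME N. mfrob l N = M)" for M :: "'k^'n^'n"
  have \<rho>: "mfrob l (\<rho> M) = M" for M unfolding \<rho>_def by (rule someI_ex) (metis mfrob_surj)
  have \<rho>_eq: "\<rho> (mfrob l N) = N" for N by (rule mfrob_inj[of l]) (rule \<rho>)
  have \<rho>_sl: "\<rho> M \<in> sl" if "M \<in> sl" for M using that \<rho>[of M] mfrob_sl[of l "\<rho> M"] by simp
  have act_lin: "sl_act g (v + w) = sl_act g v + sl_act g w" "sl_act g (mscale c v) = mscale c (sl_act g v)"
    for g :: "('k, 'n) wmat" and v w c
    by (simp_all add: sl_act_def matrix_add_ldistrib matrix_add_rdistrib mscale_mult)
  have act_sum: "sl_act g (\<Sum>b\<in>A. mscale (c b) b) = (\<Sum>b\<in>A. mscale (c b) (sl_act g b))" for g :: "('k, 'n) wmat" and c A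
  proof -
    have "sl_act g 0 = 0" using act_lin(2)[of g 0 0] by simp
    thus ?thesis by (induction A rule: infinite_finite_induct) (simp_all add: act_lin)
  qed
  have F_sum: "F (\<Sum>b\<in>A. mscale (c b) (h b)) = (\<Sum>b\<in>A. mscale (c b ^ ?q) (F (h b)))"
    if "finite A" "\<And>b. b \<in> A \<Longrightarrow> h b \<in> sl" for A :: "('k^'n^'n) set" and c h
    using that
  proof (induction A rule: finite_induct)
    case empty
    have "F (mscale 0 0) = mscale (0 ^ ?q) (F 0)" by (rule F_scale) simp
    thus ?case by (simp add: power_0_left)
  next
    case (insert b A)
    have "(\<Sum>b\<in>A. mscale (c b) (h b)) \<in> sl"
      using insert by (intro kmat.subspace_sum[OF subspace_sl] kmat.subspace_scale[OF subspace_sl]) auto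
    thus ?case using insert kmat.subspace_scale[OF subspace_sl, of "h b" "c b"] by (simp add: F_add F_scale)
  qed
  show ?thesis
  proof (rule that[of "\<lambda>M. F (\<rho> M)"])
    show "bij_betw (\<lambda>M. F (\<rho> M)) sl sl"
      unfolding bij_betw_def
    proof
      show "inj_on (\<lambda>M. F (\<rho> M)) sl"
        by (rule inj_onI) (metis F_inj \<rho>_sl \<rho>)
      show "(\<lambda>M. F (\<rho> M)) ` sl = sl"
      proof (intro equalityI subsetI)
        fix w assume "w \<in> (sl :: ('k^'n^'n) set)"
        then obtain v where v: "v \<in> sl" "F v = w" using F_surj by blast
        thus "w \<in> (\<lambda>M. F (\<rho> M)) ` sl" by (intro image_eqI[of _ _ "mfrob l v"]) (simp_all add: \<rho>_eq mfrob_sl)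
      qed (use F_sl in blast)
    qed
    show "F (\<rho> (M + N)) = F (\<rho> M) + F (\<rho> N)" if "M \<in> sl" "N \<in> sl" for M N
    proof -
      have "\<rho> (M + N) = \<rho> M + \<rho> N" using \<rho>_eq[of "\<rho> M + \<rho> N"] by (simp add: mfrob_add \<rho>)
      thus ?thesis by (simp add: F_add \<rho>_sl that)
    qed
    show "F (\<rho> (mscale c M)) = mscale c (F (\<rho> M))" if "M \<in> sl" for c M
    proof -
      obtain d where d: "d ^ ?q = c" using frob_surj by blast
      have "\<rho> (mscale c M) = mscale d (\<rho> M)" using \<rho>_eq[of "mscale d (\<rho> M)"] by (simp add: mfrob_scale \<rho> d)
      thus ?thesis by (simp add: F_scale \<rho>_sl that d)
    qed
    fix g :: "('k, 'n) wmat" and M :: "'k^'n^'n"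
    assume g: "g \<in> SLW" and M: "M \<in> sl"
    let ?v = "\<rho> M"
    have "\<rho> (mfrob l (mred g) ** M ** mfrob l (matrix_inv (mred g))) = sl_act g ?v"
      using \<rho>_eq[of "sl_act g ?v"] by (simp add: sl_act_def mfrob_mult \<rho>)
    hence "F (\<rho> (mfrob l (mred g) ** M ** mfrob l (matrix_inv (mred g)))) = F (sl_act g (\<Sum>b\<in>B. mscale (?r ?v b) b))"
      using rep[OF \<rho>_sl[OF M]] by simp
    also have "\<dots> = (\<Sum>b\<in>B. mscale (?r ?v b ^ ?q) (F (sl_act g b)))"
      unfolding act_sum using \<open>B \<subseteq> sl\<close> by (intro F_sum fin sl_act_sl g) auto
    also have "\<dots> = frobenius_twist mscale B ?q sl_act g (F ?v)"
      unfolding frobenius_twist_def by (intro sum.cong refl) (simp add: F_def rep_comb)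
    finally show "F (\<rho> (mfrob l (mred g) ** M ** mfrob l (matrix_inv (mred g)))) =
       frobenius_twist mscale B ?q sl_act g (F (\<rho> M))" .
  qed
qed

section \<open>The associated graded representation\<close>

definition gcos :: "nat \<Rightarrow> ('k::field_prime_char, 'n::finite) wlie \<Rightarrow> ('k, 'n) wlie set" where
  "gcos j x = (+) x ` gam (Suc j)"

definition ccoord :: "nat \<Rightarrow> ('k::field_prime_char, 'n::finite) wlie set \<Rightarrow> 'k^'n^'n" where
  "ccoord j C = G.kpa (SOME x. x \<in> C) j"

lemma gcos_mem:
  fixes x :: "('k::{alg_closed_field,field_prime_char}, 'n::finite) wlie"
  assumes "x \<in> gam j"
  shows "y \<in> gcos j x \<longleftrightarrow> y \<in> gam j \<and> G.kpa y j = G.kpa x j"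
  using gam_coset_mem[OF gam_wsl[OF assms], of y "Suc j"] assms
  by (auto simp: gcos_def gam_iff less_Suc_eq)

lemma ccoord_gcos:
  fixes x :: "('k::{alg_closed_field,field_prime_char}, 'n::finite) wlie"
  assumes "x \<in> gam j" shows "ccoord j (gcos j x) = G.kpa x j"
proof -
  have "x \<in> gcos j x" using gcos_mem[OF assms] assms by blast
  hence "(SOME y. y \<in> gcos j x) \<in> gcos j x" by (rule someI[of "\<lambda>y. y \<in> gcos j x"])
  thus ?thesis using gcos_mem[OF assms] by (simp add: ccoord_def)
qed

lemma gcos_eq_iff:
  fixes x y :: "('k::{alg_closed_field,field_prime_char}, 'n::finite) wlie"
  assumes "x \<in> gam j" "y \<in> gam j"
  shows "gcos j x = gcos j y \<longleftrightarrow> G.kpa x j = G.kpa y j"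
proof
  assume "gcos j x = gcos j y"
  thus "G.kpa x j = G.kpa y j" using ccoord_gcos assms by metis
qed (auto simp: set_eq_iff gcos_mem assms)

lemma gcos_zero: "gcos j 0 = (gam (Suc j) :: ('k::{alg_closed_field,field_prime_char}, 'n::finite) wlie set)"
  by (simp add: gcos_def)

lemma gam_Ad: "g \<in> SLW \<Longrightarrow> x \<in> gam j \<Longrightarrow> Ad g x \<in> (gam j :: ('k::{alg_closed_field,field_prime_char}, 'n::finite) wlie set)"
  by (auto simp: gam_iff kpa_Ad' mult_zero_matrix)

lemma gcos_add:
  fixes x y :: "('k::{alg_closed_field,field_prime_char}, 'n::finite) wlie"
  assumes "x \<in> gam j" "y \<in> gam j"
  shows "{u + v | u v. u \<in> gcos j x \<and> v \<in> gcos j y} = gcos j (x + y)"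
proof (intro equalityI subsetI)
  have xy: "x + y \<in> gam j" by (rule wlie.subspace_add[OF subspace_gam assms])
  fix z
  {
    assume "z \<in> {u + v | u v. u \<in> gcos j x \<and> v \<in> gcos j y}"
    thus "z \<in> gcos j (x + y)"
      using wlie.subspace_add[OF subspace_gam[of j]] by (auto simp: gcos_mem xy assms wsl_add gam_wsl[where j = j])
  next
    assume "z \<in> gcos j (x + y)"
    hence z: "z \<in> gam j" "G.kpa z j = G.kpa x j + G.kpa y j"
      by (simp_all add: gcos_mem xy wsl_add gam_wsl[where j = j] assms)
    have "z - x \<in> gcos j y"
      using wlie.subspace_diff[OF subspace_gam z(1) assms(1)] z by (simp add: gcos_mem assms wsl_diff gam_wsl[where j = j])
    moreover have "x \<in> gcos j x" using assms by (simp add: gcos_mem)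
    moreover have "z = x + (z - x)" by simp
    ultimately show "z \<in> {u + v | u v. u \<in> gcos j x \<and> v \<in> gcos j y}" by blast
  }
qed

lemma gcos_scale:
  fixes x :: "('k::{alg_closed_field,field_prime_char}, 'n::finite) wlie"
  assumes "x \<in> gam j"
  shows "{wscale c u + v | u v. u \<in> gcos j x \<and> v \<in> gam (Suc j)} = gcos j (wscale c x)"
proof (intro equalityI subsetI)
  have cx: "wscale c x \<in> gam j" by (rule wlie.subspace_scale[OF subspace_gam assms])
  have S: "v \<in> gam j \<and> G.kpa v j = 0" if "v \<in> gam (Suc j)" for v :: "('k, 'n) wlie"
    using that by (simp add: gam_iff)
  fix z
  {
    assume "z \<in> {wscale c u + v | u v. u \<in> gcos j x \<and> v \<in> gam (Suc j)}"
    then obtain u v where uv: "z = wscale c u + v" "u \<in> gam j" "G.kpa u j = G.kpa x j" "v \<in> gam j" "G.kpa v j = 0"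
      using S by (auto simp: gcos_mem assms)
    have cu: "wscale c u \<in> gam j" by (rule wlie.subspace_scale[OF subspace_gam uv(2)])
    show "z \<in> gcos j (wscale c x)"
      using wlie.subspace_add[OF subspace_gam cu uv(4)] uv
      by (simp add: gcos_mem cx wsl_add wsl_scale gam_wsl[where j = j] assms cu)
  next
    assume "z \<in> gcos j (wscale c x)"
    hence "\<exists>v\<in>gam (Suc j). z = wscale c x + v" by (auto simp: gcos_def)
    moreover have "x \<in> gcos j x" using assms by (simp add: gcos_mem)
    ultimately show "z \<in> {wscale c u + v | u v. u \<in> gcos j x \<and> v \<in> gam (Suc j)}" by blast
  }
qed

lemma gcos_Ad:
  fixes x :: "('k::{alg_closed_field,field_prime_char}, 'n::finite) wlie"
  assumes g: "g \<in> SLW" and x: "x \<in> gam j"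
  shows "Ad g ` gcos j x = gcos j (Ad g x)"
proof (intro equalityI subsetI)
  obtain g' where g': "g' \<in> SLW" "matrix_inv (mred g) = mred g'" "mred g ** mred g' = mat 1" "mred g' ** mred g = mat 1"
    using SLW_inverse[OF g] by metis
  have inv': "matrix_inv (mred g') = mred g" by (rule matrix_inv_eqI[OF g'(4,3)])
  have f: "mfrob l (mred g) ** mfrob l (mred g') = mat 1" "mfrob l (mred g') ** mfrob l (mred g) = mat 1" for l
    by (simp_all only: mfrob_mult[symmetric] g' mfrob_mat1)
  have AA: "Ad g (Ad g' z) = z" if z: "z \<in> wsl" for z :: "('k, 'n) wlie"
  proof (rule wsl_eqI)
    fix l
    have "G.kpa (Ad g (Ad g' z)) l = mfrob l (mred g) ** (mfrob l (mred g') ** G.kpa z l ** mfrob l (mred g)) ** mfrob l (mred g')"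
      by (simp add: kpa_Ad' g g' z inv')
    also have "\<dots> = (mfrob l (mred g) ** mfrob l (mred g')) ** G.kpa z l ** (mfrob l (mred g) ** mfrob l (mred g'))"
      by (simp only: matrix_mul_assoc)
    finally show "G.kpa (Ad g (Ad g' z)) l = G.kpa z l" by (simp add: f)
  qed (simp_all add: kpa_Ad' g g' z)
  fix z
  {
    assume "z \<in> Ad g ` gcos j x"
    thus "z \<in> gcos j (Ad g x)" using g x gam_Ad[OF g] by (auto simp: gcos_mem kpa_Ad' gam_wsl[where j = j])
  next
    assume "z \<in> gcos j (Ad g x)"
    hence z: "z \<in> gam j" "G.kpa z j = mfrob j (mred g) ** G.kpa x j ** mfrob j (mred g')"
      using g x gam_Ad[OF g x] by (simp_all add: gcos_mem kpa_Ad' gam_wsl[where j = j] g')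
    have "G.kpa (Ad g' z) j = (mfrob j (mred g') ** mfrob j (mred g)) ** G.kpa x j ** (mfrob j (mred g') ** mfrob j (mred g))"
      by (simp only: kpa_Ad'[OF g'(1) gam_wsl[OF z(1)]] z(2) inv' matrix_mul_assoc)
    hence "Ad g' z \<in> gcos j x" using gam_Ad[OF g'(1) z(1)] by (simp add: gcos_mem x f)
    thus "z \<in> Ad g ` gcos j x" using AA[OF gam_wsl[OF z(1)]] by (metis imageI)
  }
qed

text \<open>The coordinate of level \<open>j\<close> identifies \<open>gam j / gam (j + 1)\<close> with \<open>sl\<close>, on which the group acts through the \<open>j\<close>-th Frobenius
  power; for \<open>j \<ge> 1\<close> compose with \<open>twist_iso\<close>.\<close>

lemma gr_iso:
  fixes B :: "('k::{alg_closed_field,field_prime_char}^'n::finite^'n) set"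
  assumes B: "\<not> kmat.dependent B" "kmat.span B = sl"
  shows "\<exists>psi. repn_iso SLW (gr_repn :: ('k, ('k, 'n) wmat, nat \<Rightarrow> ('k, 'n) wlie set) repn) (sl_twists_repn B) (\<lambda>C j. psi j (C j))"
proof -
  let ?act = "\<lambda>j g v. if j = 0 then sl_act g v else frobenius_twist mscale B (CHAR('k) ^ j) sl_act g v"
  have "\<exists>\<phi> :: 'k^'n^'n \<Rightarrow> 'k^'n^'n. bij_betw \<phi> sl sl \<and>
    (\<forall>M\<in>sl. \<forall>N\<in>sl. \<phi> (M + N) = \<phi> M + \<phi> N) \<and> (\<forall>c. \<forall>M\<in>sl. \<phi> (mscale c M) = mscale c (\<phi> M)) \<and>
    (\<forall>g\<in>SLW. \<forall>M\<in>sl. \<phi> (mfrob j (mred g) ** M ** mfrob j (matrix_inv (mred g))) = ?act j g (\<phi> M))" for j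
  proof (cases "j = 0")
    case True
    thus ?thesis by (intro exI[of _ "\<lambda>x. x"]) (auto simp: bij_betw_def mfrob_0 sl_act_def inj_on_def)
  next
    case False
    obtain \<phi> :: "'k^'n^'n \<Rightarrow> 'k^'n^'n" where "bij_betw \<phi> sl sl"
      "\<And>M N. M \<in> sl \<Longrightarrow> N \<in> sl \<Longrightarrow> \<phi> (M + N) = \<phi> M + \<phi> N"
      "\<And>c M. M \<in> sl \<Longrightarrow> \<phi> (mscale c M) = mscale c (\<phi> M)"
      "\<And>g M. g \<in> SLW \<Longrightarrow> M \<in> sl \<Longrightarrow> \<phi> (mfrob j (mred g) ** M ** mfrob j (matrix_inv (mred g))) =
         frobenius_twist mscale B (CHAR('k) ^ j) sl_act g (\<phi> M)"
      using twist_iso[OF B, of j] by metis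
    thus ?thesis using False by (intro exI[of _ \<phi>]) simp
  qed
  then obtain \<phi> :: "nat \<Rightarrow> 'k^'n^'n \<Rightarrow> 'k^'n^'n" where bij: "\<And>j. bij_betw (\<phi> j) sl sl"
    and add: "\<And>j M N. M \<in> sl \<Longrightarrow> N \<in> sl \<Longrightarrow> \<phi> j (M + N) = \<phi> j M + \<phi> j N"
    and scale: "\<And>j c M. M \<in> sl \<Longrightarrow> \<phi> j (mscale c M) = mscale c (\<phi> j M)"
    and act: "\<And>j g M. g \<in> SLW \<Longrightarrow> M \<in> sl \<Longrightarrow> \<phi> j (mfrob j (mred g) ** M ** mfrob j (matrix_inv (mred g))) = ?act j g (\<phi> j M)"
    by metis
  have \<phi>0: "\<phi> j 0 = 0" for j using scale[of 0 j 0] by simp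
  have \<phi>_inj: "\<phi> j M = \<phi> j N \<Longrightarrow> M = N" if "M \<in> sl" "N \<in> sl" for j M N
    using bij[of j] that by (auto simp: bij_betw_def inj_on_def)
  have \<phi>_sl: "\<phi> j M \<in> sl" if "M \<in> sl" for j M using bij[of j] that by (auto simp: bij_betw_def)
  define psi where "psi j C = \<phi> j (ccoord j C)" for j and C :: "('k, 'n) wlie set"
  define V where "V = {C :: nat \<Rightarrow> ('k, 'n) wlie set. (\<forall>j. C j \<in> gcos j ` gam j) \<and> finite {j. C j \<noteq> gam (Suc j)}}"
  have V: "rspace gr_repn = V"
    by (simp add: V_def gr_repn_def gcos_def[abs_def])
  have rep: "\<exists>x. \<forall>j. x j \<in> gam j \<and> C j = gcos j (x j)" if "C \<in> V" for C
    using that unfolding V_def by (intro choice) blast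
  have psi: "psi j (gcos j x) = \<phi> j (G.kpa x j)" if "x \<in> gam j" for j x
    using that by (simp add: psi_def ccoord_gcos)
  have ksl: "G.kpa x l \<in> sl" if "x \<in> gam j" for x :: "('k, 'n) wlie" and j l using that gam_wsl wsl_sl by blast
  have VI: "(\<lambda>j. gcos j (x j)) \<in> V \<longleftrightarrow> finite {j. G.kpa (x j) j \<noteq> 0}" if "\<And>j. x j \<in> gam j" for x
  proof -
    have "gcos j (x j) \<noteq> gam (Suc j) \<longleftrightarrow> G.kpa (x j) j \<noteq> 0" for j
      unfolding gcos_zero[symmetric] using gcos_eq_iff[OF that, of 0 j] by (simp add: gam_iff)
    thus ?thesis using that by (simp add: V_def)
  qed
  have "repn_iso SLW gr_repn (sl_twists_repn B) (\<lambda>C j. psi j (C j))"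
    unfolding repn_iso_def V
  proof (intro conjI ballI allI)
    show "bij_betw (\<lambda>C j. psi j (C j)) V (rspace (sl_twists_repn B))"
      unfolding bij_betw_def
    proof
      show "inj_on (\<lambda>C j. psi j (C j)) V"
      proof (rule inj_onI)
        fix C D assume C: "C \<in> V" and D: "D \<in> V" and eq: "(\<lambda>j. psi j (C j)) = (\<lambda>j. psi j (D j))"
        obtain x y where x: "\<And>j. x j \<in> gam j \<and> C j = gcos j (x j)" and y: "\<And>j. y j \<in> gam j \<and> D j = gcos j (y j)"
          using rep[OF C] rep[OF D] by blast
        show "C = D"
        proof
          fix j
          have "\<phi> j (G.kpa (x j) j) = \<phi> j (G.kpa (y j) j)"
            using fun_cong[OF eq, of j] x[of j] y[of j] by (simp add: psi)
          hence "G.kpa (x j) j = G.kpa (y j) j" using \<phi>_inj ksl x y by blast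
          hence "gcos j (x j) = gcos j (y j)" by (rule iffD2[OF gcos_eq_iff[OF conjunct1[OF x] conjunct1[OF y]]])
          thus "C j = D j" using x[of j] y[of j] by simp
        qed
      qed
      show "(\<lambda>C j. psi j (C j)) ` V = rspace (sl_twists_repn B)"
      proof (intro equalityI subsetI)
        fix v assume "v \<in> (\<lambda>C j. psi j (C j)) ` V"
        then obtain C where C: "C \<in> V" "v = (\<lambda>j. psi j (C j))" by blast
        obtain x where x: "\<And>j. x j \<in> gam j \<and> C j = gcos j (x j)" using rep[OF C(1)] by blast
        have v: "v = (\<lambda>j. \<phi> j (G.kpa (x j) j))" using x by (simp add: C(2) psi)
        have "C = (\<lambda>j. gcos j (x j))" using x by auto
        hence "finite {j. G.kpa (x j) j \<noteq> 0}" using VI[of x] C(1) x by simp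
        moreover have "{j. v j \<noteq> 0} \<subseteq> {j. G.kpa (x j) j \<noteq> 0}" using \<phi>0 by (auto simp: v)
        ultimately have "finite {j. v j \<noteq> 0}" by (rule rev_finite_subset)
        thus "v \<in> rspace (sl_twists_repn B)" using \<phi>_sl[OF ksl[OF conjunct1[OF x]]] by (simp add: sl_twists_repn_def v)
      next
        fix v assume "v \<in> rspace (sl_twists_repn B)"
        hence v: "\<And>j. v j \<in> sl" "finite {j. v j \<noteq> 0}" by (simp_all add: sl_twists_repn_def)
        have "\<exists>x\<in>gam j. \<phi> j (G.kpa x j) = v j" for j
        proof -
          have "v j \<in> \<phi> j ` sl" using bij[of j] v(1)[of j] by (simp add: bij_betw_def)
          then obtain M where M: "M \<in> sl" "\<phi> j M = v j" by (elim imageE) (rule that, simp_all)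
          have "at_level j M l \<in> sl" for l using M(1) by (simp add: at_level_def)
          then obtain x where "x \<in> wsl" "G.kpa x = at_level j M" using wsl_ex by metis
          thus ?thesis using M by (intro bexI[of _ x]) (simp_all add: gam_iff at_level_def)
        qed
        hence "\<exists>x. \<forall>j. x j \<in> gam j \<and> \<phi> j (G.kpa (x j) j) = v j" by (intro choice allI) blast
        then obtain x where x0: "\<forall>j. x j \<in> gam j \<and> \<phi> j (G.kpa (x j) j) = v j" by (rule exE)
        have x: "x j \<in> gam j" "\<phi> j (G.kpa (x j) j) = v j" for j
          by (rule conjunct1[OF spec[OF x0]], rule conjunct2[OF spec[OF x0]])
        have "{j. G.kpa (x j) j \<noteq> 0} \<subseteq> {j. v j \<noteq> 0}"
        proof (rule Collect_mono, rule impI, rule notI)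
          fix j assume nz: "G.kpa (x j) j \<noteq> 0" and "v j = 0"
          hence "\<phi> j (G.kpa (x j) j) = \<phi> j 0" by (simp only: x(2) \<phi>0)
          hence "G.kpa (x j) j = 0" by (rule \<phi>_inj[OF ksl[OF x(1)] zero_sl])
          thus False using nz by (rule notE[rotated])
        qed
        hence "finite {j. G.kpa (x j) j \<noteq> 0}" using v(2) by (rule finite_subset)
        hence xV: "(\<lambda>j. gcos j (x j)) \<in> V" using VI[of x] x(1) by simp
        have "v j = psi j (gcos j (x j))" for j by (simp only: psi[OF x(1)] x(2))
        hence vx: "v = (\<lambda>j. psi j (gcos j (x j)))" by (rule ext)
        show "v \<in> (\<lambda>C j. psi j (C j)) ` V" by (rule image_eqI[where f = "\<lambda>C j. psi j (C j)", OF vx xV])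
      qed
    qed
    fix C assume C: "C \<in> V"
    obtain x where x: "\<And>j. x j \<in> gam j \<and> C j = gcos j (x j)" using rep[OF C] by blast
    have Cx: "C = (\<lambda>j. gcos j (x j))" using x by auto
    have xg: "x j \<in> gam j" for j using x by blast
    have xf: "finite {j. G.kpa (x j) j \<noteq> 0}" using VI[of x] C xg by (simp add: Cx)
    {
      fix D assume D: "D \<in> V"
      obtain y where y: "\<And>j. y j \<in> gam j \<and> D j = gcos j (y j)" using rep[OF D] by blast
      have Dy: "D = (\<lambda>j. gcos j (y j))" using y by auto
      have yg: "y j \<in> gam j" for j using y by blast
      have yf: "finite {j. G.kpa (y j) j \<noteq> 0}" using VI[of y] D yg by (simp add: Dy)
      have sg: "x j + y j \<in> gam j" for j by (rule wlie.subspace_add[OF subspace_gam xg yg])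
      have s: "radd gr_repn C D = (\<lambda>j. gcos j (x j + y j))"
        by (simp add: gr_repn_def Cx Dy gcos_add xg yg)
      have ks: "G.kpa (x j + y j) j = G.kpa (x j) j + G.kpa (y j) j" for j
        using gam_wsl[OF xg] gam_wsl[OF yg] by (simp add: wsl_add)
      have "finite {j. G.kpa (x j + y j) j \<noteq> 0}"
        by (rule finite_subset[OF _ finite_UnI[OF xf yf]]) (auto simp: ks)
      thus "radd gr_repn C D \<in> V" unfolding s using VI[of "\<lambda>j. x j + y j"] sg by simp
      show "(\<lambda>j. psi j (radd gr_repn C D j)) = radd (sl_twists_repn B) (\<lambda>j. psi j (C j)) (\<lambda>j. psi j (D j))"
        unfolding s by (simp add: psi sg ks add ksl[OF xg] ksl[OF yg] Cx Dy xg yg sl_twists_repn_def)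
    }
    {
      fix c
      have sg: "wscale c (x j) \<in> gam j" for j by (rule wlie.subspace_scale[OF subspace_gam xg])
      have s: "rscale gr_repn c C = (\<lambda>j. gcos j (wscale c (x j)))"
        by (simp add: gr_repn_def Cx gcos_scale xg)
      have ks: "G.kpa (wscale c (x j)) j = mscale c (G.kpa (x j) j)" for j
        using gam_wsl[OF xg] by (simp add: wsl_scale)
      have "finite {j. G.kpa (wscale c (x j)) j \<noteq> 0}"
        by (rule finite_subset[OF _ xf]) (auto simp: ks)
      thus "rscale gr_repn c C \<in> V" unfolding s using VI[of "\<lambda>j. wscale c (x j)"] sg by simp
      show "(\<lambda>j. psi j (rscale gr_repn c C j)) = rscale (sl_twists_repn B) c (\<lambda>j. psi j (C j))"
        unfolding s by (simp add: psi sg ks scale ksl[OF xg] Cx xg sl_twists_repn_def)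
    }
    {
      fix g :: "('k, 'n) wmat" assume g: "g \<in> SLW"
      have sg: "Ad g (x j) \<in> gam j" for j by (rule gam_Ad[OF g xg])
      have s: "ract gr_repn g C = (\<lambda>j. gcos j (Ad g (x j)))"
        by (simp add: gr_repn_def Cx gcos_Ad g xg)
      have ks: "G.kpa (Ad g (x j)) j = mfrob j (mred g) ** G.kpa (x j) j ** mfrob j (matrix_inv (mred g))" for j
        by (rule kpa_Ad'(2)[OF g gam_wsl[OF xg]])
      have "finite {j. G.kpa (Ad g (x j)) j \<noteq> 0}"
        by (rule finite_subset[OF _ xf]) (auto simp: ks mult_zero_matrix)
      thus "ract gr_repn g C \<in> V" unfolding s using VI[of "\<lambda>j. Ad g (x j)"] sg by simp
      show "(\<lambda>j. psi j (ract gr_repn g C j)) = ract (sl_twists_repn B) g (\<lambda>j. psi j (C j))"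
        unfolding s by (simp add: psi sg ks act g ksl[OF xg] Cx xg sl_twists_repn_def fun_eq_iff)
    }
  qed
  thus ?thesis by blast
qed

lemma bracket_gam:
  assumes "j \<ge> 1"
  shows "{bracket x y | x y. x \<in> (wsl :: ('k::{alg_closed_field,field_prime_char}, 'n::finite) wlie set) \<and> y \<in> gam j} = {0}"
proof -
  have br: "bracket x y = 0" if "x \<in> wsl" "y \<in> gam j" for x y :: "('k, 'n) wlie"
  proof (rule wsl_eqI)
    have y: "y \<in> wsl" "G.kpa y 0 = 0" using that(2) assms by (auto simp: gam_iff)
    thus "bracket x y \<in> wsl" by (simp add: wsl_bracket that)
    fix l show "G.kpa (bracket x y) l = G.kpa 0 l" using y that by (simp add: kpa_bracket mbracket_0)
  qed simp
  have 0: "(0 :: ('k, 'n) wlie) \<in> gam j" by (simp add: gam_iff)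
  show ?thesis
  proof (intro equalityI subsetI)
    fix z :: "('k, 'n) wlie" assume "z \<in> {0}"
    hence "z = bracket 0 (0 :: ('k, 'n) wlie)" using br[OF gam_wsl[OF 0] 0] by simp
    thus "z \<in> {bracket x y | x y. x \<in> wsl \<and> y \<in> gam j}" using gam_wsl[OF 0] 0 by blast
  qed (auto simp: br)
qed

theorem theorem8p4:
  assumes p: "CARD('p::prime_card) > 2" and n: "CARD('n::finite) \<ge> 2"
  shows
    "(gam 0 = (wsl :: ('p fpbar, 'n) wlie set)
      \<and> (\<forall>j. gam (Suc j) \<subseteq> (gam j :: ('p fpbar, 'n) wlie set))
      \<and> (\<forall>j. restricted_ideal (gam j :: ('p fpbar, 'n) wlie set)))
     \<and> (let T = (wsl_topology :: ('p fpbar, 'n) wlie topology) in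
        topspace T = wsl
        \<and> nbhd_basis_at T 0 gam
        \<and> continuous_map (prod_topology T T) T (\<lambda>(x, y). x - y)
        \<and> (\<forall>c. continuous_map T T (wscale c))
        \<and> continuous_map (prod_topology T T) T (\<lambda>(x, y). bracket x y)
        \<and> Hausdorff_space T \<and> complete_additive T)
     \<and> (\<forall>B :: ('p fpbar ^ 'n ^ 'n) set. \<not> kmat.dependent B \<and> kmat.span B = sl \<longrightarrow>
        (\<exists>psi. repn_iso SLW gr_repn (sl_twists_repn B) (\<lambda>C j. psi j (C j))))
     \<and> (\<forall>j\<ge>1. {bracket x y | x y. x \<in> (wsl :: ('p fpbar, 'n) wlie set) \<and> y \<in> gam j} = {0})
     \<and> (repn_iso SLW (wlie_repn (g0 :: ('p fpbar, 'n) wlie set)) sl_repn lie_red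
      \<and> (\<forall>x\<in>g0. \<forall>y\<in>(g0 :: ('p fpbar, 'n) wlie set).
           bracket x y \<in> g0 \<and> lie_red (bracket x y) = mbracket (lie_red x) (lie_red y)))
     \<and> (repn_iso Tk (wlie_repn (g0_torus :: ('p fpbar, 'n) wlie set)) sl_repn lie_red
      \<and> (\<forall>x\<in>wsl. \<forall>y\<in>(wsl :: ('p fpbar, 'n) wlie set).
           lie_red (bracket x y) = mbracket (lie_red x) (lie_red y))
      \<and> (\<forall>g\<in>SLW. \<forall>x\<in>(wsl :: ('p fpbar, 'n) wlie set). lie_red (Ad g x) = sl_act g (lie_red x)))
     \<and> ((\<forall>x\<in>(cartan :: ('p fpbar, 'n) wlie set). x \<noteq> 0 \<longrightarrow> weight_vector (\<lambda>_. 1) x)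
      \<and> (\<forall>Y :: nat \<Rightarrow> nat \<Rightarrow> ('p fpbar, 'n) wlie. torus1_family Y \<longrightarrow>
           (\<forall>i\<in>{1..CARD('n) - 1}. \<forall>j\<ge>1. weight_vector (\<lambda>_. 1) (Y i j))))
     \<and> (\<forall>a b j. a \<noteq> b \<longrightarrow>
        weight_vector (\<lambda>t. root_char a b t ^ CARD('p) ^ j)
          ((ppower ^^ j) (root_vector a b) :: ('p fpbar, 'n) wlie))"
proof (intro conjI)
  show "gam 0 = (wsl :: ('p fpbar, 'n) wlie set)" by (rule gam_0)
  show "\<forall>j. gam (Suc j) \<subseteq> (gam j :: ('p fpbar, 'n) wlie set)" by (simp add: gam_antimono)
  show "\<forall>j. restricted_ideal (gam j :: ('p fpbar, 'n) wlie set)" by (simp add: restricted_ideal_gam)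
  show "let T = (wsl_topology :: ('p fpbar, 'n) wlie topology) in
        topspace T = wsl
        \<and> nbhd_basis_at T 0 gam
        \<and> continuous_map (prod_topology T T) T (\<lambda>(x, y). x - y)
        \<and> (\<forall>c. continuous_map T T (wscale c))
        \<and> continuous_map (prod_topology T T) T (\<lambda>(x, y). bracket x y)
        \<and> Hausdorff_space T \<and> complete_additive T"
    unfolding Let_def
    by (intro conjI allI topspace_wsl nbhd_basis_gam continuous_diff_wsl continuous_scale_wsl
        continuous_bracket_wsl Hausdorff_wsl complete_wsl)
  show "\<forall>B :: ('p fpbar ^ 'n ^ 'n) set. \<not> kmat.dependent B \<and> kmat.span B = sl \<longrightarrow>
        (\<exists>psi. repn_iso SLW gr_repn (sl_twists_repn B) (\<lambda>C j. psi j (C j)))"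
    using gr_iso by blast
  show "\<forall>j\<ge>1. {bracket x y | x y. x \<in> (wsl :: ('p fpbar, 'n) wlie set) \<and> y \<in> gam j} = {0}"
    by (intro allI impI bracket_gam)
  show "repn_iso SLW (wlie_repn (g0 :: ('p fpbar, 'n) wlie set)) sl_repn lie_red" by (rule g0_iso)
  have g0w: "x \<in> wsl" if "x \<in> g0" for x :: "('p fpbar, 'n) wlie" using that by (simp add: g0_eq)
  show "\<forall>x\<in>g0. \<forall>y\<in>(g0 :: ('p fpbar, 'n) wlie set).
           bracket x y \<in> g0 \<and> lie_red (bracket x y) = mbracket (lie_red x) (lie_red y)"
    by (simp add: g0_bracket lie_red_bracket g0w)
  show "repn_iso Tk (wlie_repn (g0_torus :: ('p fpbar, 'n) wlie set)) sl_repn lie_red" by (rule g0_torus_iso)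
  show "\<forall>x\<in>wsl. \<forall>y\<in>(wsl :: ('p fpbar, 'n) wlie set).
           lie_red (bracket x y) = mbracket (lie_red x) (lie_red y)" by (simp add: lie_red_bracket)
  show "\<forall>g\<in>SLW. \<forall>x\<in>(wsl :: ('p fpbar, 'n) wlie set). lie_red (Ad g x) = sl_act g (lie_red x)"
    by (simp add: lie_red_Ad)
  show "\<forall>x\<in>(cartan :: ('p fpbar, 'n) wlie set). x \<noteq> 0 \<longrightarrow> weight_vector (\<lambda>_. 1) x"
    by (simp add: cartan_weight)
  show "\<forall>Y :: nat \<Rightarrow> nat \<Rightarrow> ('p fpbar, 'n) wlie. torus1_family Y \<longrightarrow>
           (\<forall>i\<in>{1..CARD('n) - 1}. \<forall>j\<ge>1. weight_vector (\<lambda>_. 1) (Y i j))"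
    by (intro allI impI ballI torus1_family_weight)
  show "\<forall>a b j. a \<noteq> b \<longrightarrow>
        weight_vector (\<lambda>t. root_char a b t ^ CARD('p) ^ j)
          ((ppower ^^ j) (root_vector a b) :: ('p fpbar, 'n) wlie)"
  proof (intro allI impI)
    fix a b :: 'n and j assume ab: "a \<noteq> b"
    let ?x = "(ppower ^^ j) (root_vector a b) :: ('p fpbar, 'n) wlie"
    obtain c where c: "c \<noteq> 0" "G.kpa ?x = at_level j (mscale c (Eu a b))" and x: "?x \<in> sublie (root_group a b)"
      using kpa_ppower_root_vector[OF ab, of j, where ?'k = "'p fpbar"] by blast
    have "?x \<in> wsl" using x by (simp only: sublie_root_group_iff[OF ab])
    from weight_root[OF this c(1)] c(2) show "weight_vector (\<lambda>t. root_char a b t ^ CARD('p) ^ j) ?x"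
      by (simp add: CHAR_fpbar)
  qed
qed

end
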